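(* Let $a\in[-1,1]$ and $\alpha=a\pi/2$. The fractional Fourier transform in superspace has the integral representation $$\mathcal F^{a}_{m|2n}=\left(\pi(1-e^{2i\alpha})\right)^{-M/2}\int_{\mathbb R^m}dV(\underline x)\int_{B,x}\exp\left(\frac{-4e^{i\alpha}\langle x,y\rangle+(1+e^{2i\alpha})(x^2+y^2)}{2-2e^{2i\alpha}}\right),$$ i.e. $\mathcal F^a_{m|2n}(f)(y)$ is obtained by multiplying $f(x)$ on the left by the exponential kernel and integrating over $x$ as indicated.
   Context: There are $m$ commuting real variables $x_1,\dots,x_m$ and $2n$ anti-commuting variables $\grave x_1,\dots,\grave x_{2n}$, with $x_i\grave x_j=\grave x_jx_i$; $M=m-2n$ is the super-dimension. $\Lambda_{2n}$ is the Grassmann algebra generated by the $\grave x_j$. $\mathcal C$ is the algebra generated by $e_1,\dots,e_m,\grave e_1,\dots,\grave e_{2n}$ with relations $e_je_k+e_ke_j=-2\delta_{jk}$, $\grave e_{2j}\grave e_{2k}-\grave e_{2k}\grave e_{2j}=0$, $\grave e_{2j-1}\grave e_{2k-1}-\grave e_{2k-1}\grave e_{2j-1}=0$, $\grave e_{2j-1}\grave e_{2k}-\grave e_{2k}\grave e_{2j-1}=\delta_{jk}$, $e_j\grave e_k+\grave e_ke_j=0$; all generators of $\mathcal C$ commute with all variables. A second set of variables $y_i,\grave y_j$ of the same type is used, and all anti-commuting variables of both sets anti-commute with each other. The function space is $\mathcal S(\mathbb R^m)_{m|2n}=\mathcal S(\mathbb R^m)\otimes\Lambda_{2n}\otimes\mathcal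 C$, complex coefficients being allowed. Notation: $x^2=\sum_{j=1}^n\grave x_{2j-1}\grave x_{2j}-\sum_{j=1}^m x_j^2$ (similarly $y^2$); $\langle x,y\rangle=-\sum_{i=1}^m x_iy_i+\frac12\sum_{j=1}^n(\grave x_{2j-1}\grave y_{2j}-\grave x_{2j}\grave y_{2j-1})$; the super Laplace operator is $\Delta=4\sum_{j=1}^n\partial_{\grave x_{2j-1}}\partial_{\grave x_{2j}}-\sum_{j=1}^m\partial_{x_j}^2$; $dV(\underline x)$ is Lebesgue measure on $\mathbb R^m$; the Berezin integral is $\int_{B,x}=\pi^{-n}\partial_{\grave x_{2n}}\cdots\partial_{\grave x_1}$, with $\partial_{\grave x_j}$ the left derivative. The fractional Fourier transform is defined, for $a\in[-1,1]$, as the operator exponential $$\mathcal F^a_{m|2n}=\exp\left(\frac{ia\pi}{4}(\Delta-x^2-M)\right);$$ in the integral representation the result is written in the variables $y$. *)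

theory Defs
  imports "HOL-Analysis.Analysis" "HOL-Library.Poly_Mapping" "HOL-Library.Type_Length"
begin

text \<open>
  The dimensions are \<open>m = LENGTH('m)\<close> and \<open>n = LENGTH('n)\<close> with types of class \<open>len0\<close>; this class
  contains a type of every length, including length \<open>0\<close>.  All indices are natural numbers
  starting from \<open>1\<close>.
\<close>

section \<open>The Clifford--Weyl algebra\<close>

datatype cw_gen = E nat | Ef nat

text \<open>\<open>E j\<close> stands for $e_j$ and \<open>Ef j\<close> for $\grave e_j$.\<close>

typedef (overloaded) ('m::len0, 'n::len0) cw_word =
  "{w. set w \<subseteq> E ` {1..LENGTH('m)} \<union> Ef ` {1..2 * LENGTH('n)}}"
  morphisms letters mk_word
  by (rule exI[of _ "[]"]) simp

instantiation cw_word :: (len0, len0) monoid_add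
begin

definition "0 = mk_word []"
definition "v + w = mk_word (letters v @ letters w)"

instance
proof
  fix u v w :: "('a, 'b) cw_word"
  have app: "letters (v + w) = letters v @ letters w" for v w :: "('a, 'b) cw_word"
    unfolding plus_cw_word_def using letters[of v] letters[of w]
    by (intro mk_word_inverse) auto
  have zero: "letters (0 :: ('a, 'b) cw_word) = []"
    unfolding zero_cw_word_def by (intro mk_word_inverse) auto
  show "u + v + w = u + (v + w)" "0 + u = u" "u + 0 = u"
    by (simp_all add: letters_inject[symmetric] app zero)
qed

end

text \<open>
  Since \<open>cw_word\<close> is the free monoid (written additively) on the generators, the ring of finitely
  supported functions on it, with convolution as multiplication, is the free algebra.
\<close>

type_synonym ('m, 'n) cw_free = "('m, 'n) cw_word \<Rightarrow>\<^sub>0 complex"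

definition free_scalar :: "complex \<Rightarrow> ('m::len0, 'n::len0) cw_free"
  where "free_scalar c = Poly_Mapping.single 0 c"

definition free_gen :: "cw_gen \<Rightarrow> ('m::len0, 'n::len0) cw_free"
  where "free_gen g = Poly_Mapping.single (mk_word [g]) 1"

abbreviation fe :: "nat \<Rightarrow> ('m::len0, 'n::len0) cw_free" where "fe j \<equiv> free_gen (E j)"
abbreviation ff :: "nat \<Rightarrow> ('m::len0, 'n::len0) cw_free" where "ff j \<equiv> free_gen (Ef j)"

inductive_set cw_ideal :: "('m::len0, 'n::len0) cw_free set" where
  zero: "0 \<in> cw_ideal"
| add: "p \<in> cw_ideal \<Longrightarrow> q \<in> cw_ideal \<Longrightarrow> p + q \<in> cw_ideal"
| mult: "p \<in> cw_ideal \<Longrightarrow> q * p * r \<in> cw_ideal"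
| clifford: "j \<in> {1..LENGTH('m)} \<Longrightarrow> k \<in> {1..LENGTH('m)} \<Longrightarrow>
    fe j * fe k + fe k * fe j - free_scalar (if j = k then - 2 else 0) \<in> cw_ideal"
| weyl_even: "j \<in> {1..LENGTH('n)} \<Longrightarrow> k \<in> {1..LENGTH('n)} \<Longrightarrow>
    ff (2*j) * ff (2*k) - ff (2*k) * ff (2*j) \<in> cw_ideal"
| weyl_odd: "j \<in> {1..LENGTH('n)} \<Longrightarrow> k \<in> {1..LENGTH('n)} \<Longrightarrow>
    ff (2*j-1) * ff (2*k-1) - ff (2*k-1) * ff (2*j-1) \<in> cw_ideal"
| weyl_mixed: "j \<in> {1..LENGTH('n)} \<Longrightarrow> k \<in> {1..LENGTH('n)} \<Longrightarrow>
    ff (2*j-1) * ff (2*k) - ff (2*k) * ff (2*j-1) - free_scalar (if j = k then 1 else 0) \<in> cw_ideal"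
| anti: "j \<in> {1..LENGTH('m)} \<Longrightarrow> k \<in> {1..2 * LENGTH('n)} \<Longrightarrow>
    fe j * ff k + ff k * fe j \<in> cw_ideal"

definition cw_rel :: "('m::len0, 'n::len0) cw_free \<Rightarrow> ('m, 'n) cw_free \<Rightarrow> bool"
  where "cw_rel p q \<longleftrightarrow> p - q \<in> cw_ideal"

lemma cw_ideal_lmult: "p \<in> cw_ideal \<Longrightarrow> q * p \<in> cw_ideal"
  using cw_ideal.mult[of p q 1] by simp

lemma cw_ideal_rmult: "p \<in> cw_ideal \<Longrightarrow> p * q \<in> cw_ideal"
  using cw_ideal.mult[of p 1 q] by simp

lemma cw_ideal_uminus: "p \<in> cw_ideal \<Longrightarrow> - p \<in> cw_ideal"
  using cw_ideal_lmult[of p "- 1"] by simp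

quotient_type (overloaded) ('m, 'n) cw = "('m::len0, 'n::len0) cw_free" / cw_rel
proof (rule equivpI)
  show "reflp (cw_rel :: ('m, 'n) cw_free \<Rightarrow> _)"
    by (simp add: reflp_def cw_rel_def cw_ideal.zero)
  show "symp (cw_rel :: ('m, 'n) cw_free \<Rightarrow> _)"
    unfolding symp_def cw_rel_def using cw_ideal_uminus by fastforce
  show "transp (cw_rel :: ('m, 'n) cw_free \<Rightarrow> _)"
    unfolding transp_def cw_rel_def using cw_ideal.add by fastforce
qed

instantiation cw :: (len0, len0) "{ring, monoid_mult}"
begin

lift_definition zero_cw :: "('a, 'b) cw" is 0 .

lift_definition one_cw :: "('a, 'b) cw" is 1 .

lift_definition plus_cw :: "('a, 'b) cw \<Rightarrow> ('a, 'b) cw \<Rightarrow> ('a, 'b) cw" is "(+)"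
  unfolding cw_rel_def using cw_ideal.add by (metis add_diff_add)

lift_definition uminus_cw :: "('a, 'b) cw \<Rightarrow> ('a, 'b) cw" is uminus
  unfolding cw_rel_def using cw_ideal_uminus by fastforce

lift_definition minus_cw :: "('a, 'b) cw \<Rightarrow> ('a, 'b) cw \<Rightarrow> ('a, 'b) cw" is "(-)"
proof -
  fix p p' q q' :: "('a, 'b) cw_free"
  assume "cw_rel p p'" "cw_rel q q'"
  then have "(p - p') + - (q - q') \<in> cw_ideal"
    unfolding cw_rel_def by (intro cw_ideal.add cw_ideal_uminus)
  then show "cw_rel (p - q) (p' - q')"
    unfolding cw_rel_def by (simp add: algebra_simps)
qed

lift_definition times_cw :: "('a, 'b) cw \<Rightarrow> ('a, 'b) cw \<Rightarrow> ('a, 'b) cw" is "(*)"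
proof -
  fix p p' q q' :: "('a, 'b) cw_free"
  assume "cw_rel p p'" "cw_rel q q'"
  then have "(p - p') * q + p' * (q - q') \<in> cw_ideal"
    unfolding cw_rel_def by (intro cw_ideal.add cw_ideal_lmult cw_ideal_rmult)
  then show "cw_rel (p * q) (p' * q')"
    unfolding cw_rel_def by (simp add: algebra_simps)
qed

instance
  by standard
    (transfer, simp add: cw_rel_def algebra_simps cw_ideal.zero)+

end

lift_definition cscale :: "complex \<Rightarrow> ('m::len0, 'n::len0) cw \<Rightarrow> ('m, 'n) cw"
  is "\<lambda>c p. free_scalar c * p"
  unfolding cw_rel_def using cw_ideal_lmult by (metis right_diff_distrib)

lemma vector_space_cw: "vector_space (cscale :: complex \<Rightarrow> ('m::len0, 'n::len0) cw \<Rightarrow> _)"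
proof
  fix a b :: complex and x y :: "('m, 'n) cw"
  show "cscale a (x + y) = cscale a x + cscale a y"
    by transfer (simp add: cw_rel_def algebra_simps cw_ideal.zero)
  show "cscale (a + b) x = cscale a x + cscale b x"
    by transfer (simp add: cw_rel_def free_scalar_def single_add algebra_simps cw_ideal.zero)
  show "cscale a (cscale b x) = cscale (a * b) x"
    by transfer (simp add: cw_rel_def free_scalar_def mult.assoc[symmetric] mult_single cw_ideal.zero)
  show "cscale 1 x = x"
    by transfer (simp add: cw_rel_def free_scalar_def cw_ideal.zero)
qed

definition cw_functional :: "(('m::len0, 'n::len0) cw \<Rightarrow> complex) \<Rightarrow> bool"
  where "cw_functional \<phi> \<longleftrightarrow> Vector_Spaces.linear cscale (*) \<phi>"

section \<open>Grassmann algebras\<close>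

text \<open>
  An element of the Grassmann algebra on generators $\theta_1,\dots,\theta_N$ with coefficients
  in a ring is the function that maps $A = \{i_1 < \dots < i_k\} \subseteq \{1,\dots,N\}$ to the
  coefficient of $\theta_{i_1}\cdots\theta_{i_k}$, and that vanishes on all other sets.
  The generators commute with the coefficients.
\<close>

definition grassmann :: "nat \<Rightarrow> (nat set \<Rightarrow> complex) set"
  where "grassmann N = {F. \<forall>A. \<not> A \<subseteq> {1..N} \<longrightarrow> F A = 0}"

definition gconst :: "'r \<Rightarrow> nat set \<Rightarrow> 'r::zero"
  where "gconst c A = (if A = {} then c else 0)"

definition gvar :: "nat \<Rightarrow> nat set \<Rightarrow> complex"
  where "gvar j A = (if A = {j} then 1 else 0)"

definition gmult ::
  "(nat set \<Rightarrow> 'r) \<Rightarrow> (nat set \<Rightarrow> 'r) \<Rightarrow> nat set \<Rightarrow> 'r::{ring, monoid_mult}"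
  where "gmult F G A =
    (\<Sum>B\<in>Pow A. (- 1) ^ card {(i, j). i \<in> B \<and> j \<in> A - B \<and> j < i} * F B * G (A - B))"

text \<open>The left derivative with respect to the \<open>j\<close>-th generator.\<close>

definition gderiv :: "nat \<Rightarrow> (nat set \<Rightarrow> 'r) \<Rightarrow> nat set \<Rightarrow> 'r::{ring, monoid_mult}"
  where "gderiv j F A = (if j \<in> A then 0 else (- 1) ^ card {i \<in> A. i < j} * F (insert j A))"

definition gexp :: "(nat set \<Rightarrow> complex) \<Rightarrow> nat set \<Rightarrow> complex"
  where "gexp F A = suminf (\<lambda>k. (gmult F ^^ k) (gconst 1) A / fact k)"

definition gembed :: "(nat set \<Rightarrow> complex) \<Rightarrow> nat set \<Rightarrow> ('m::len0, 'n::len0) cw"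
  where "gembed F A = cscale (F A) 1"

section \<open>Superfunctions\<close>

abbreviation Rm :: "nat \<Rightarrow> (nat \<Rightarrow> real) set"
  where "Rm m \<equiv> {1..m} \<rightarrow>\<^sub>E UNIV"

definition lebesgue_Rm :: "nat \<Rightarrow> (nat \<Rightarrow> real) measure"
  where "lebesgue_Rm m = (\<Pi>\<^sub>M j\<in>{1..m}. lborel)"

definition pd :: "nat \<Rightarrow> ((nat \<Rightarrow> real) \<Rightarrow> complex) \<Rightarrow> (nat \<Rightarrow> real) \<Rightarrow> complex"
  where "pd j f x = vector_derivative (\<lambda>t. f (x(j := t))) (at (x j))"

definition pds :: "nat list \<Rightarrow> ((nat \<Rightarrow> real) \<Rightarrow> complex) \<Rightarrow> (nat \<Rightarrow> real) \<Rightarrow> complex"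
  where "pds js = foldr pd js"

definition monomial :: "nat \<Rightarrow> (nat \<Rightarrow> nat) \<Rightarrow> (nat \<Rightarrow> real) \<Rightarrow> complex"
  where "monomial m \<beta> x = of_real (\<Prod>j\<in>{1..m}. x j ^ \<beta> j)"

text \<open>
  Schwartz functions on $\mathbb R^m$, extended by \<open>0\<close> outside \<open>Rm m\<close>.  As every iterated partial
  derivative exists and is bounded, every iterated partial derivative is Lipschitz, so these
  functions are smooth.
\<close>

definition schwartz :: "nat \<Rightarrow> ((nat \<Rightarrow> real) \<Rightarrow> complex) set"
  where "schwartz m = {f. (\<forall>x. x \<notin> Rm m \<longrightarrow> f x = 0) \<and>
    (\<forall>js. set js \<subseteq> {1..m} \<longrightarrow>
      (\<forall>j\<in>{1..m}. \<forall>x\<in>Rm m. (\<lambda>t. pds js f (x(j := t))) differentiable (at (x j))) \<and>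
      (\<forall>\<beta>. bounded ((\<lambda>x. monomial m \<beta> x * pds js f x) ` Rm m)))}"

type_synonym ('m, 'n) superfun = "(nat \<Rightarrow> real) \<Rightarrow> nat set \<Rightarrow> ('m, 'n) cw"

text \<open>The algebraic tensor product $\mathcal S(\mathbb R^m)\otimes\Lambda_{2n}\otimes\mathcal C$.\<close>

definition super_schwartz :: "('m::len0, 'n::len0) superfun set"
  where "super_schwartz = {F. \<exists>(N::nat) h L c.
    (\<forall>k<N. h k \<in> schwartz LENGTH('m) \<and> L k \<in> grassmann (2 * LENGTH('n))) \<and>
    F = (\<lambda>x A. \<Sum>k<N. cscale (h k x * L k A) (c k))}"

text \<open>
  Convergence in the function space: uniform convergence of all
  $x^\beta\,\partial^{js}$, after taking the coefficient at a Grassmann monomial and applying a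
  linear functional of \<open>cw\<close>.
\<close>

definition super_tendsto ::
  "('i \<Rightarrow> ('m::len0, 'n::len0) superfun) \<Rightarrow> ('m, 'n) superfun \<Rightarrow> 'i filter \<Rightarrow> bool"
  where "super_tendsto U F net \<longleftrightarrow>
    (\<forall>js \<beta> A \<phi>. set js \<subseteq> {1..LENGTH('m)} \<longrightarrow> cw_functional \<phi> \<longrightarrow>
      uniform_limit (Rm LENGTH('m))
        (\<lambda>i x. monomial LENGTH('m) \<beta> x * pds js (\<lambda>x. \<phi> (U i x A)) x)
        (\<lambda>x. monomial LENGTH('m) \<beta> x * pds js (\<lambda>x. \<phi> (F x A)) x) net)"

text \<open>
  Partial derivatives and integrals of functions with values in \<open>cw\<close> are taken weakly.
  Elements of \<open>super_schwartz\<close> take values in a finite-dimensional subspace, where this is the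
  usual notion; the linear functionals separate points, so the value is unique.
\<close>

definition cw_pd :: "nat \<Rightarrow> ('m::len0, 'n::len0) superfun \<Rightarrow> ('m, 'n) superfun"
  where "cw_pd j F x A = (THE c. \<forall>\<phi>. cw_functional \<phi> \<longrightarrow>
    ((\<lambda>t. \<phi> (F (x(j := t)) A)) has_vector_derivative \<phi> c) (at (x j)))"

definition cw_integral :: "((nat \<Rightarrow> real) \<Rightarrow> ('m::len0, 'n::len0) cw) \<Rightarrow> ('m, 'n) cw"
  where "cw_integral g = (THE c. \<forall>\<phi>. cw_functional \<phi> \<longrightarrow>
    has_bochner_integral (lebesgue_Rm LENGTH('m)) (\<lambda>x. \<phi> (g x)) (\<phi> c))"

section \<open>The fractional Fourier transform\<close>

text \<open>
  In the algebra with the two sets of anti-commuting variables, $\grave x_j$ is the generator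
  number \<open>j\<close> and $\grave y_j$ is the generator number \<open>2n + j\<close>, for \<open>1 \<le> j \<le> 2n\<close>.
\<close>

definition xf :: "nat \<Rightarrow> nat set \<Rightarrow> complex"
  where "xf j = gvar j"

definition yf :: "nat \<Rightarrow> nat \<Rightarrow> nat set \<Rightarrow> complex"
  where "yf n j = gvar (2 * n + j)"

definition super_square ::
  "nat \<Rightarrow> nat \<Rightarrow> (nat \<Rightarrow> real) \<Rightarrow> (nat \<Rightarrow> nat set \<Rightarrow> complex) \<Rightarrow> nat set \<Rightarrow> complex"
  where "super_square m n x \<theta> A =
    (\<Sum>j=1..n. gmult (\<theta> (2*j-1)) (\<theta> (2*j)) A) - gconst (of_real (\<Sum>j=1..m. (x j)\<^sup>2)) A"

definition super_inner ::
  "nat \<Rightarrow> nat \<Rightarrow> (nat \<Rightarrow> real) \<Rightarrow> (nat \<Rightarrow> real) \<Rightarrow> nat set \<Rightarrow> complex"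
  where "super_inner m n x y A =
    - gconst (of_real (\<Sum>i=1..m. x i * y i)) A
    + 1/2 * (\<Sum>j=1..n. gmult (xf (2*j-1)) (yf n (2*j)) A - gmult (xf (2*j)) (yf n (2*j-1)) A)"

definition super_laplace :: "('m::len0, 'n::len0) superfun \<Rightarrow> ('m, 'n) superfun"
  where "super_laplace F x A =
    cscale 4 (\<Sum>j=1..LENGTH('n). gderiv (2*j-1) (gderiv (2*j) (F x)) A)
    - (\<Sum>j=1..LENGTH('m). cw_pd j (cw_pd j F) x A)"

definition super_dim :: "'m::len0 itself \<Rightarrow> 'n::len0 itself \<Rightarrow> int"
  where "super_dim _ _ = int LENGTH('m) - 2 * int LENGTH('n)"

definition frac_generator :: "real \<Rightarrow> ('m::len0, 'n::len0) superfun \<Rightarrow> ('m, 'n) superfun"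
  where "frac_generator a F x A = cscale (\<i> * of_real (a * pi / 4))
    (super_laplace F x A
     - gmult (gembed (super_square LENGTH('m) LENGTH('n) x xf)) (F x) A
     - cscale (of_int (super_dim TYPE('m) TYPE('n))) (F x A))"

text \<open>
  The exponential of an (unbounded) operator \<open>T\<close>: \<open>op_exp T f\<close> is the value at time \<open>1\<close> of the
  solution of the Cauchy problem \<open>u' = T u\<close>, \<open>u 0 = f\<close> in the function space.  For the operators
  considered here the power series of the exponential does not converge on the whole function
  space; on an eigenvector with eigenvalue $\lambda$ the solution is $e^{\lambda t} f$.
\<close>

definition super_cauchy_solution ::
  "(('m::len0, 'n::len0) superfun \<Rightarrow> ('m, 'n) superfun) \<Rightarrow> ('m, 'n) superfun \<Rightarrow>
    (real \<Rightarrow> ('m, 'n) superfun) \<Rightarrow> bool"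
  where "super_cauchy_solution T f u \<longleftrightarrow> u 0 = f \<and>
    (\<forall>t\<in>{0..1}. u t \<in> super_schwartz \<and>
      super_tendsto (\<lambda>s x A. cscale (of_real (1 / (s - t))) (u s x A - u t x A)) (T (u t))
        (at t within {0..1}))"

definition op_exp ::
  "(('m::len0, 'n::len0) superfun \<Rightarrow> ('m, 'n) superfun) \<Rightarrow> ('m, 'n) superfun \<Rightarrow> ('m, 'n) superfun"
  where "op_exp T f = (THE g. \<exists>u. super_cauchy_solution T f u \<and> u 1 = g)"

definition frac_fourier :: "real \<Rightarrow> ('m::len0, 'n::len0) superfun \<Rightarrow> ('m, 'n) superfun"
  where "frac_fourier a = op_exp (frac_generator a)"

definition berezin_x :: "(nat set \<Rightarrow> ('m::len0, 'n::len0) cw) \<Rightarrow> nat set \<Rightarrow> ('m, 'n) cw"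
  where "berezin_x G A =
    cscale (of_real (1 / pi ^ LENGTH('n))) (fold gderiv [1..<2 * LENGTH('n) + 1] G A)"

definition super_integral_x ::
  "((nat \<Rightarrow> real) \<Rightarrow> nat set \<Rightarrow> ('m::len0, 'n::len0) cw) \<Rightarrow> nat set \<Rightarrow> ('m, 'n) cw"
  where "super_integral_x G A = cw_integral (\<lambda>x. berezin_x (G x) A)"

definition frac_kernel ::
  "nat \<Rightarrow> nat \<Rightarrow> real \<Rightarrow> (nat \<Rightarrow> real) \<Rightarrow> (nat \<Rightarrow> real) \<Rightarrow> nat set \<Rightarrow> complex"
  where "frac_kernel m n \<alpha> x y = gexp (\<lambda>A.
    (- 4 * exp (\<i> * of_real \<alpha>) * super_inner m n x y A
      + (1 + exp (2 * \<i> * of_real \<alpha>)) * (super_square m n x xf A + super_square m n y (yf n) A))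
    / (2 - 2 * exp (2 * \<i> * of_real \<alpha>)))"

text \<open>
  The power is the principal branch; \<open>1 - exp (2 * \<i> * \<alpha>)\<close> has positive real part for
  \<open>0 < \<bar>\<alpha>\<bar> \<le> pi / 2\<close>.  The integral is an element of the Grassmann algebra in the $\grave y_j$; the
  image \<open>(\<lambda>j. 2n + j) ` A\<close> reads it as an element of $\Lambda_{2n}$.
\<close>

definition frac_integral_transform ::
  "real \<Rightarrow> ('m::len0, 'n::len0) superfun \<Rightarrow> ('m, 'n) superfun"
  where "frac_integral_transform \<alpha> f y A =
    cscale ((of_real pi * (1 - exp (2 * \<i> * of_real \<alpha>)))
              powr (- of_int (super_dim TYPE('m) TYPE('n)) / 2))
      (super_integral_x
        (\<lambda>x. gmult (gembed (frac_kernel LENGTH('m) LENGTH('n) \<alpha> x y)) (f x))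
        ((\<lambda>j. 2 * LENGTH('n) + j) ` A))"

end

theory Submission
  imports Defs "HOL-Probability.Sinc_Integral" "HOL-Probability.Characteristic_Functions" "HOL-Real_Asymp.Real_Asymp"
begin

text \<open>
  Write the generator as \<open>\<i> \<alpha> / 2\<close> times a bosonic part, a sum of Hermite operators
  \<open>x\<^sub>j\<^sup>2 - \<partial>\<^sub>j\<^sup>2 - 1\<close>, plus a fermionic part acting on the finite-dimensional Grassmann algebra.
  The one-dimensional transform with the Mehler kernel intertwines multiplication and differentiation
  by a rotation with angle \<open>\<alpha>\<close>; hence it acts equicontinuously on Schwartz functions for
  \<open>\<bar>\<alpha>\<bar> \<le> \<pi> / 2\<close> and solves the bosonic Cauchy problem, and the kernels of the coordinates multiply up.
  The Berezin integral with the fermionic kernel intertwines each \<open>\<partial>\<^sub>k\<close> with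
  \<open>cos \<alpha> \<partial>\<^sub>k \<plusminus> \<i> / 2 sin \<alpha> x\<^sub>k\<^sub>'\<close>, where \<open>k'\<close> is the partner of \<open>k\<close>; since the Grassmann algebra
  is generated from its top monomial by derivatives, this determines the integral and shows that it solves the fermionic
  Cauchy problem.  For uniqueness, apply the inverse bosonic transform to an arbitrary solution: a linear
  differential equation with constant matrix remains for the finitely many components.
\<close>

text \<open>The obstacle is angle 0. The kernel has modulus 1 and its constant has size |sin
  \<alpha>|^(-1/2), so absolute estimates blow up there, although the evolution starts at this very
  angle. One integration by parts against a complex denominator (\<open>frft_parts\<close>) gains
  the missing factor; with the rotation relations it controls every seminorm uniformly. The angle
  derivative is computed away from 0 only. Continuity at 0 comes from comparison with the Gaussian,
  which the transform fixes; this also settles the branch of the square root. Integrating the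
  derivative across 0 bounds the difference quotients, and interpolation between a small sup norm
  and bounded higher seminorms turns this into differentiability in the Schwartz topology. The
  constant splits because -M/2 = m (-1/2) + n: one inverse square root for each commuting
  coordinate, one factor \<pi> (1 - e^(2 i \<alpha>)) for each pair of anti-commuting variables,
  whose \<pi> cancels against the Berezin integral. Values in the Clifford--Weyl algebra are reduced
  to complex components by linear functionals, which separate points.\<close>

section \<open>Calculus on the real line\<close>

lemma integrable_cauchy: "integrable lborel (\<lambda>s::real. 1 / (1 + s\<^sup>2))"
  and integral_cauchy: "(LINT s|lborel. 1 / (1 + s\<^sup>2)) = pi"
  using integrable_inverse_1_plus_square LBINT_inverse_1_plus_square
  by (simp_all add: set_integrable_def interval_lebesgue_integral_def set_lebesgue_integral_def
      divide_inverse)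

lemma integral_derivative_zero:
  fixes F :: "real \<Rightarrow> complex"
  assumes F: "\<And>s. (F has_vector_derivative f s) (at s)"
    and f: "continuous_on UNIV f" "integrable lborel f"
    and lim: "(F \<longlongrightarrow> 0) at_top" "(F \<longlongrightarrow> 0) at_bot"
  shows "(LINT s|lborel. f s) = 0"
proof -
  have "(LBINT x=-\<infinity>..\<infinity>. f x) = 0 - 0"
    using F f(1) f(2) lim
    by (intro interval_integral_FTC_integrable[where F=F])
      (auto simp: set_integrable_def continuous_on_eq_continuous_at ereal_tendsto_simps)
  then show ?thesis
    by (simp add: interval_lebesgue_integral_def set_lebesgue_integral_def)
qed

lemma has_vector_derivative_iff_quotient:
  fixes f :: "real \<Rightarrow> 'a::real_normed_vector"
  shows "(f has_vector_derivative D) (at t within S) \<longleftrightarrow>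
    ((\<lambda>s. (f s - f t) /\<^sub>R (s - t)) \<longlongrightarrow> D) (at t within S)"
proof -
  have "((\<lambda>s. (1 / norm (s - t)) *\<^sub>R (f s - (f t + (s - t) *\<^sub>R D))) \<longlongrightarrow> 0) (at t within S)
    \<longleftrightarrow> ((\<lambda>s. norm ((f s - f t) /\<^sub>R (s - t) - D)) \<longlongrightarrow> 0) (at t within S)"
    unfolding tendsto_norm_zero_iff[symmetric, of "\<lambda>s. (1 / norm (s - t)) *\<^sub>R (f s - (f t + (s - t) *\<^sub>R D))"]
  proof (rule tendsto_cong)
    have *: "norm ((1 / norm (s - t)) *\<^sub>R (f s - (f t + (s - t) *\<^sub>R D))) = norm ((f s - f t) /\<^sub>R (s - t) - D)"
      if "s \<noteq> t" for s
    proof -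
      have "(s - t) *\<^sub>R ((f s - f t) /\<^sub>R (s - t) - D) = f s - (f t + (s - t) *\<^sub>R D)"
        using that by (simp add: scaleR_diff_right)
      then have "norm (f s - (f t + (s - t) *\<^sub>R D)) = \<bar>s - t\<bar> * norm ((f s - f t) /\<^sub>R (s - t) - D)"
        by (metis norm_scaleR)
      then show ?thesis using that by simp
    qed
    show "\<forall>\<^sub>F s in at t within S. norm ((1 / norm (s - t)) *\<^sub>R (f s - (f t + (s - t) *\<^sub>R D)))
      = norm ((f s - f t) /\<^sub>R (s - t) - D)"
      unfolding eventually_at_filter by (intro always_eventually allI impI *)
  qed
  also have "\<dots> \<longleftrightarrow> ((\<lambda>s. (f s - f t) /\<^sub>R (s - t)) \<longlongrightarrow> D) (at t within S)"
    by (simp only: tendsto_norm_zero_iff LIM_zero_iff)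
  finally show ?thesis
    unfolding has_vector_derivative_def has_derivative_within
    by (simp add: bounded_linear_scaleR_left)
qed

text \<open>The mean value inequality gives the difference quotients the same majorant
  \<open>w\<close> as the derivatives, so dominated convergence applies along every sequence tending
  to \<open>t0\<close>.\<close>

lemma has_vector_derivative_integral_dominated:
  fixes F :: "real \<Rightarrow> 'a \<Rightarrow> complex"
  assumes d: "d > 0"
    and F: "\<And>t s. \<bar>t - t0\<bar> < d \<Longrightarrow> ((\<lambda>t. F t s) has_vector_derivative D t s) (at t)"
    and D: "\<And>t s. \<bar>t - t0\<bar> < d \<Longrightarrow> norm (D t s) \<le> w s"
    and w: "integrable M w"
    and int: "\<And>t. \<bar>t - t0\<bar> < d \<Longrightarrow> integrable M (F t)"
    and meas: "D t0 \<in> borel_measurable M"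
  shows "((\<lambda>t. LINT s|M. F t s) has_vector_derivative (LINT s|M. D t0 s)) (at t0)"
proof -
  define q where "q t s = (F t s - F t0 s) /\<^sub>R (t - t0)" for t s
  have "((\<lambda>t. LINT s|M. q t s) \<longlongrightarrow> (LINT s|M. D t0 s)) (at t0)"
    unfolding tendsto_at_iff_sequentially comp_def
  proof (intro allI impI)
    fix X :: "nat \<Rightarrow> real" assume X: "\<forall>i. X i \<in> UNIV - {t0}" "X \<longlonglongrightarrow> t0"
    \<comment> \<open>The majorant is available only within distance \<open>d\<close> of
      \<open>t0\<close>; the sequence is shifted by \<open>N\<close>, and
      \<open>LIMSEQ_offset\<close> undoes the shift at the end.\<close>
    from X(2) d obtain N where N: "\<And>n. n \<ge> N \<Longrightarrow> \<bar>X n - t0\<bar> < d"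
      by (auto simp: lim_sequentially dist_real_def)
    have "(\<lambda>n. LINT s|M. q (X (n + N)) s) \<longlonglongrightarrow> (LINT s|M. D t0 s)"
    proof (rule integral_dominated_convergence[where w=w])
      show "D t0 \<in> borel_measurable M" by fact
      show "q (X (n + N)) \<in> borel_measurable M" for n
        using int[OF N[of "n + N"]] int[of t0] d unfolding q_def by auto
      show "integrable M w" by fact
      have "(\<lambda>n. q (X n) s) \<longlonglongrightarrow> D t0 s" for s
      proof -
        have "((\<lambda>t. q t s) \<longlongrightarrow> D t0 s) (at t0)"
          using F[of t0 s] d unfolding q_def has_vector_derivative_iff_quotient by simp
        then show ?thesis using X unfolding tendsto_at_iff_sequentially comp_def by blast
      qed
      then show "AE s in M. (\<lambda>n. q (X (n + N)) s) \<longlonglongrightarrow> D t0 s"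
        by (intro AE_I2 LIMSEQ_ignore_initial_segment)
      have "norm (q (X n) s) \<le> w s" if "n \<ge> N" for n s
      proof -
        have "norm (F (X n) s - F t0 s) \<le> w s * norm (X n - t0)"
        proof (rule differentiable_bound[where S="ball t0 d" and f'="\<lambda>t h. h *\<^sub>R D t s"])
          show "((\<lambda>t. F t s) has_derivative (\<lambda>h. h *\<^sub>R D x s)) (at x within ball t0 d)"
            if "x \<in> ball t0 d" for x
            using F[of x s] that
            by (auto simp: dist_real_def has_vector_derivative_def abs_minus_commute intro: has_derivative_at_withinI)
          show "onorm (\<lambda>h. h *\<^sub>R D x s) \<le> w s" if "x \<in> ball t0 d" for x
            using D[of x s] that by (intro onorm_le) (auto simp: dist_real_def abs_minus_commute mult.commute[of "w s"] intro!: mult_left_mono)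
        qed (use N[OF that] d in \<open>auto simp: dist_real_def abs_minus_commute\<close>)
        moreover have "X n \<noteq> t0" using X by auto
        ultimately show ?thesis by (simp add: q_def divide_simps mult.commute)
      qed
      then show "AE s in M. norm (q (X (n + N)) s) \<le> w s" for n by simp
    qed
    then show "(\<lambda>n. LINT s|M. q (X n) s) \<longlonglongrightarrow> (LINT s|M. D t0 s)"
      by (rule LIMSEQ_offset)
  qed
  moreover have "\<forall>\<^sub>F t in at t0. (LINT s|M. q t s) = ((LINT s|M. F t s) - (LINT s|M. F t0 s)) /\<^sub>R (t - t0)"
  proof -
    have "\<forall>\<^sub>F t in at t0. \<bar>t - t0\<bar> < d" using d
      unfolding eventually_at by (auto simp: dist_real_def)
    then show ?thesis
    proof eventually_elim
      case (elim t)
      then show ?case unfolding q_def using int[of t] int[of t0] d by simp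
    qed
  qed
  ultimately have "((\<lambda>t. ((LINT s|M. F t s) - (LINT s|M. F t0 s)) /\<^sub>R (t - t0)) \<longlongrightarrow> (LINT s|M. D t0 s)) (at t0)"
    by (rule Lim_transform_eventually)
  then show ?thesis
    unfolding has_vector_derivative_iff_quotient .
qed

section \<open>The one-dimensional fractional Fourier transform\<close>

text \<open>The Mehler kernel of the harmonic oscillator at imaginary time, without its constant. It
  is unimodular, so convergence of the integrals rests on the decay of the transformed
  function.\<close>

definition frft_kernel :: "real \<Rightarrow> real \<Rightarrow> real \<Rightarrow> complex"
  where "frft_kernel \<alpha> y s = cis (s * y / sin \<alpha> - cos \<alpha> / sin \<alpha> * ((s\<^sup>2 + y\<^sup>2) / 2))"

text \<open>The share of one commuting coordinate in the power with exponent -M/2.\<close>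

definition frft_const :: "real \<Rightarrow> complex"
  where "frft_const \<alpha> = (of_real pi * (1 - exp (2 * \<i> * of_real \<alpha>))) powr (- 1 / 2)"

text \<open>The kernel divides by sin \<alpha>; at angle 0 the identity is put in its place, which
  is the limit by \<open>frft1_tendsto\<close>.\<close>

definition frft1 :: "real \<Rightarrow> (real \<Rightarrow> complex) \<Rightarrow> real \<Rightarrow> complex"
  where "frft1 \<alpha> \<gamma> y =
    (if \<alpha> = 0 then \<gamma> y else frft_const \<alpha> * (LINT s|lborel. frft_kernel \<alpha> y s * \<gamma> s))"

text \<open>Quadratic decay makes the kernel integrals converge absolutely and the boundary terms of
  partial integrations vanish, and it survives multiplication by bounded continuous
  functions.\<close>

definition rapid :: "(real \<Rightarrow> complex) \<Rightarrow> bool"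
  where "rapid \<gamma> \<longleftrightarrow> continuous_on UNIV \<gamma> \<and> (\<exists>K. \<forall>s. (1 + s\<^sup>2) * norm (\<gamma> s) \<le> K)"

lemma norm_frft_kernel [simp]: "norm (frft_kernel \<alpha> y s) = 1"
  by (simp add: frft_kernel_def)

lemma continuous_on_frft_kernel [continuous_intros]: "continuous_on A (frft_kernel \<alpha> y)"
  unfolding frft_kernel_def divide_inverse
  by (intro continuous_on_cis continuous_on_diff continuous_on_mult continuous_on_add
      continuous_on_power continuous_on_const continuous_on_id)

lemma borel_measurable_frft_kernel [measurable]: "frft_kernel \<alpha> y \<in> borel_measurable borel"
  by (intro borel_measurable_continuous_onI continuous_intros)

lemma has_vector_derivative_cis:
  assumes "(g has_real_derivative g') (at t within S)"
  shows "((\<lambda>t. cis (g t)) has_vector_derivative (\<i> * of_real g' * cis (g t))) (at t within S)"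
proof -
  have "((\<lambda>t. \<i> * complex_of_real (g t)) has_vector_derivative (\<i> * of_real g')) (at t within S)"
    using assms by (intro derivative_intros has_vector_derivative_of_real) (simp add: has_real_derivative_iff_has_vector_derivative)
  then have "((exp \<circ> (\<lambda>t. \<i> * complex_of_real (g t))) has_vector_derivative
      (\<i> * of_real g') * exp (\<i> * complex_of_real (g t))) (at t within S)"
    by (rule field_vector_diff_chain_within) (auto intro!: derivative_eq_intros)
  then show ?thesis by (simp add: comp_def cis_conv_exp)
qed

text \<open>From this form one reads off the modulus 2 |sin \<alpha>|, which gives the size of
  \<open>frft_const\<close>, and the real part 2 sin^2 \<alpha>, which keeps the base of the power
  away from the branch cut.\<close>

lemma one_minus_exp: "1 - exp (2 * \<i> * of_real \<alpha>) = - 2 * \<i> * of_real (sin \<alpha>) * cis \<alpha>"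
proof -
  have "exp (2 * \<i> * of_real \<alpha>) = cis (2 * \<alpha>)" by (simp add: cis_conv_exp mult_ac)
  then show ?thesis
    by (simp add: complex_eq_iff sin_double cos_double_sin power2_eq_square)
qed

lemma frft_const_sq:
  assumes "sin \<alpha> \<noteq> 0"
  shows "(norm (frft_const \<alpha>))\<^sup>2 = 1 / (2 * pi * \<bar>sin \<alpha>\<bar>)"
proof -
  have P: "of_real pi * (1 - exp (2 * \<i> * of_real \<alpha>)) \<noteq> 0"
    using assms by (simp add: one_minus_exp)
  then have "(frft_const \<alpha>)\<^sup>2 = 1 / (of_real pi * (1 - exp (2 * \<i> * of_real \<alpha>)))"
    unfolding frft_const_def powr_def
    by (simp add: exp_of_nat_mult[symmetric, where n=2, simplified] flip: exp_double) (simp add: exp_minus divide_inverse)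
  then have "(norm (frft_const \<alpha>))\<^sup>2 = 1 / norm (of_real pi * (1 - exp (2 * \<i> * of_real \<alpha>)))"
    by (metis norm_divide norm_one norm_power)
  then show ?thesis by (simp add: one_minus_exp norm_mult)
qed

text \<open>The constant blows up exactly like |sin \<alpha>|^(-1/2); estimates of the integral must
  therefore gain a factor \<open>sqrt \<bar>sin \<alpha>\<bar>\<close>.\<close>

lemma norm_frft_const:
  assumes "sin \<alpha> \<noteq> 0"
  shows "norm (frft_const \<alpha>) * sqrt \<bar>sin \<alpha>\<bar> = 1 / sqrt (2 * pi)"
proof -
  have "norm (frft_const \<alpha>) = sqrt (1 / (2 * pi * \<bar>sin \<alpha>\<bar>))"
    using frft_const_sq[OF assms] by (metis norm_ge_zero real_sqrt_abs2 real_sqrt_unique power2_eq_square abs_of_nonneg)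
  then show ?thesis using assms by (simp add: real_sqrt_divide real_sqrt_mult)
qed

section \<open>Functions of quadratic decay\<close>

lemma rapidI:
  assumes "continuous_on UNIV \<gamma>" "\<And>s. (1 + s\<^sup>2) * norm (\<gamma> s) \<le> K"
  shows "rapid \<gamma>"
  using assms unfolding rapid_def by blast

lemma rapid_integrable:
  assumes "rapid \<gamma>" shows "integrable lborel \<gamma>"
proof -
  obtain K where K: "\<And>s. (1 + s\<^sup>2) * norm (\<gamma> s) \<le> K" using assms by (auto simp: rapid_def)
  have "integrable lborel (\<lambda>s. K * (1 / (1 + s\<^sup>2)))"
    using integrable_cauchy by (rule integrable_mult_right)
  then show ?thesis
  proof (rule Bochner_Integration.integrable_bound)
    show "\<gamma> \<in> borel_measurable lborel"
      using assms by (auto simp: rapid_def intro: borel_measurable_continuous_onI)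
    have "norm (\<gamma> s) \<le> norm (K * (1 / (1 + s\<^sup>2)))" for s
    proof -
      have "0 < 1 + s\<^sup>2" by (simp add: add_pos_nonneg)
      then have "norm (\<gamma> s) \<le> K * (1 / (1 + s\<^sup>2))"
        using K[of s] by (simp add: divide_simps mult.commute)
      then show ?thesis by (metis abs_ge_self order_trans real_norm_def)
    qed
    then show "AE s in lborel. norm (\<gamma> s) \<le> norm (K * (1 / (1 + s\<^sup>2)))" by simp
  qed
qed

lemma rapid_bounded_mult:
  assumes "rapid \<gamma>" "continuous_on UNIV u" "\<And>s. norm (u s) \<le> B"
  shows "rapid (\<lambda>s. u s * \<gamma> s)"
proof -
  obtain K where K: "\<And>s. (1 + s\<^sup>2) * norm (\<gamma> s) \<le> K" using assms by (auto simp: rapid_def)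
  have B: "B \<ge> 0" using assms(3)[of 0] norm_ge_zero order_trans by blast
  show ?thesis
  proof (rule rapidI)
    show "continuous_on UNIV (\<lambda>s. u s * \<gamma> s)"
      using assms by (auto simp: rapid_def intro: continuous_intros)
    fix s
    have "(1 + s\<^sup>2) * norm (u s * \<gamma> s) = norm (u s) * ((1 + s\<^sup>2) * norm (\<gamma> s))"
      by (simp add: norm_mult)
    also have "\<dots> \<le> B * K" using assms(3) K B by (intro mult_mono) auto
    finally show "(1 + s\<^sup>2) * norm (u s * \<gamma> s) \<le> B * K" .
  qed
qed

lemma rapid_add: "rapid f \<Longrightarrow> rapid g \<Longrightarrow> rapid (\<lambda>s. f s + g s)"
proof -
  assume a: "rapid f" "rapid g"
  then obtain K L where K: "\<And>s. (1 + s\<^sup>2) * norm (f s) \<le> K" and L: "\<And>s. (1 + s\<^sup>2) * norm (g s) \<le> L"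
    by (auto simp: rapid_def)
  show ?thesis
  proof (rule rapidI)
    show "continuous_on UNIV (\<lambda>s. f s + g s)"
      using a by (auto simp: rapid_def intro: continuous_intros)
    fix s
    have "(1 + s\<^sup>2) * norm (f s + g s) \<le> (1 + s\<^sup>2) * (norm (f s) + norm (g s))"
      by (intro mult_left_mono norm_triangle_ineq) simp
    also have "\<dots> \<le> K + L" using K[of s] L[of s] by (simp add: distrib_left)
    finally show "(1 + s\<^sup>2) * norm (f s + g s) \<le> K + L" .
  qed
qed

lemma rapid_cmult: "rapid f \<Longrightarrow> rapid (\<lambda>s. c * f s)"
  by (rule rapid_bounded_mult[where u="\<lambda>_. c" and B="norm c"]) auto

lemma rapid_kernel: "rapid \<gamma> \<Longrightarrow> rapid (\<lambda>s. frft_kernel \<alpha> y s * \<gamma> s)"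
  by (rule rapid_bounded_mult[where B=1]) (auto intro: continuous_intros)

lemma integrable_kernel: "rapid \<gamma> \<Longrightarrow> integrable lborel (\<lambda>s. frft_kernel \<alpha> y s * \<gamma> s)"
  by (intro rapid_integrable rapid_kernel)

lemma rapid_tendsto:
  assumes "rapid \<gamma>" shows "(\<gamma> \<longlongrightarrow> 0) at_top" "(\<gamma> \<longlongrightarrow> 0) at_bot"
proof -
  obtain K where K: "\<And>s. (1 + s\<^sup>2) * norm (\<gamma> s) \<le> K" using assms by (auto simp: rapid_def)
  have *: "norm (\<gamma> s) \<le> K / (1 + s\<^sup>2)" for s
    using K[of s] by (simp add: divide_simps mult.commute add_pos_nonneg)
  have "((\<lambda>s::real. K / (1 + s\<^sup>2)) \<longlongrightarrow> 0) at_top" "((\<lambda>s::real. K / (1 + s\<^sup>2)) \<longlongrightarrow> 0) at_bot"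
    by real_asymp+
  with * show "(\<gamma> \<longlongrightarrow> 0) at_top" "(\<gamma> \<longlongrightarrow> 0) at_bot"
    by (auto intro: Lim_null_comparison[where g="\<lambda>s. K / (1 + s\<^sup>2)"])
qed

lemma frft1_add:
  "rapid f \<Longrightarrow> rapid g \<Longrightarrow> frft1 \<alpha> (\<lambda>s. a * f s + b * g s) y = a * frft1 \<alpha> f y + b * frft1 \<alpha> g y"
proof (cases "\<alpha> = 0")
  case False
  assume f: "rapid f" and g: "rapid g"
  have "(LINT s|lborel. frft_kernel \<alpha> y s * (a * f s + b * g s))
      = (LINT s|lborel. a * (frft_kernel \<alpha> y s * f s) + b * (frft_kernel \<alpha> y s * g s))"
    by (simp add: algebra_simps)
  also have "\<dots> = a * (LINT s|lborel. frft_kernel \<alpha> y s * f s) + b * (LINT s|lborel. frft_kernel \<alpha> y s * g s)"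
    using integrable_kernel[OF f, of \<alpha> y] integrable_kernel[OF g, of \<alpha> y] by simp
  finally show ?thesis using False by (simp add: frft1_def algebra_simps)
qed (simp add: frft1_def)

section \<open>A bound for the kernel integral that is uniform in the angle\<close>

lemma sin_nonzero:
  assumes "\<alpha> \<noteq> 0" "\<bar>\<alpha>\<bar> < pi"
  shows "sin \<alpha> \<noteq> 0"
  using assms sin_gt_zero[of \<alpha>] sin_gt_zero[of "-\<alpha>"] by (cases "\<alpha> > 0") auto

lemma abs_div_sqrt_le_1: "\<bar>r\<bar> / sqrt (1 + r ^ 4) \<le> (1::real)"
proof -
  have "0 \<le> (r\<^sup>2 - 1 / 2)\<^sup>2" by simp
  then have "r\<^sup>2 \<le> 1 + r ^ 4" by (simp add: power2_diff power2_eq_square[of "1 / 2"] flip: power_mult)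
  then have "sqrt (r\<^sup>2) \<le> sqrt (1 + r ^ 4)" by (rule real_sqrt_le_mono)
  moreover have "0 < sqrt (1 + r ^ 4)" by (simp add: add_pos_nonneg)
  ultimately show ?thesis by (simp add: divide_le_eq)
qed

lemma square_div_le_1: "r\<^sup>2 / (1 + r ^ 4) \<le> (1::real)"
proof -
  have "0 \<le> (r\<^sup>2 - 1 / 2)\<^sup>2" by simp
  then have "r\<^sup>2 \<le> 1 + r ^ 4" by (simp add: power2_diff power2_eq_square[of "1 / 2"] flip: power_mult)
  moreover have "0 < 1 + r ^ 4" by (simp add: add_pos_nonneg)
  ultimately show ?thesis by (simp add: divide_le_eq)
qed

text \<open>One integration by parts, with a multiplier adapted to the stationary point
  \<open>cos \<alpha> * s = y\<close> of the phase. In the rescaled distance r = (s cos \<alpha> -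
  y) / sqrt |sin \<alpha>| the first two terms carry a positive power of |sin \<alpha>|, and the
  third is concentrated on an interval of length of order sqrt |sin \<alpha>| / cos \<alpha>. The
  three weights stay explicit because the limit at angle 0 needs more than their sum.\<close>

lemma frft_parts:
  assumes a: "\<alpha> \<noteq> 0" "\<bar>\<alpha>\<bar> \<le> pi / 2"
    and r: "rapid \<gamma>" "rapid \<gamma>'"
    and d: "\<And>s. (\<gamma> has_vector_derivative \<gamma>' s) (at s)"
  shows "norm (LINT s|lborel. frft_kernel \<alpha> y s * \<gamma> s) \<le>
    (LINT s|lborel. \<bar>sin \<alpha>\<bar> * norm (\<gamma> s)
      + sqrt \<bar>sin \<alpha>\<bar> * (\<bar>(cos \<alpha> * s - y) / sqrt \<bar>sin \<alpha>\<bar>\<bar> / sqrt (1 + ((cos \<alpha> * s - y) / sqrt \<bar>sin \<alpha>\<bar>) ^ 4)) * norm (\<gamma>' s)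
      + 2 * cos \<alpha> * ((cos \<alpha> * s - y) / sqrt \<bar>sin \<alpha>\<bar>)\<^sup>2 / (1 + ((cos \<alpha> * s - y) / sqrt \<bar>sin \<alpha>\<bar>) ^ 4) * norm (\<gamma> s))"
    (is "_ \<le> (LINT s|lborel. ?B s)")
proof -
  define S where "S = sin \<alpha>"
  define c where "c = cos \<alpha>"
  define p where "p s = c * s - y" for s
  \<comment> \<open>Division by c - \<i> p^2 / S would fail at \<open>p s = 0\<close> when
    \<open>c\<close> is 0. Adding \<open>\<bar>S\<bar>\<close> makes the real part at least 1,
    because (c + |S|)^2 >= c^2 + S^2 = 1, and costs only a term of size
    \<open>\<bar>S\<bar>\<close>.\<close>
  define w where "w = c + \<bar>S\<bar>"
  define den where "den s = Complex w (- ((p s)\<^sup>2 / S))" for s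
  define r where "r s = p s / sqrt \<bar>S\<bar>" for s
  define k where "k = frft_kernel \<alpha> y"
  have S: "S \<noteq> 0" unfolding S_def using a pi_gt_zero by (intro sin_nonzero) linarith+
  have c: "c \<ge> 0" unfolding c_def using a by (intro cos_ge_zero) auto
  have "1 \<le> w\<^sup>2"
    using sin_cos_squared_add[of \<alpha>] c unfolding w_def S_def c_def
    by (simp add: power2_sum)
  moreover have "w \<ge> 0" using c by (simp add: w_def)
  ultimately have w: "w \<ge> 1" by (metis one_power2 power2_le_imp_le)
  have r2: "(r s)\<^sup>2 = (p s)\<^sup>2 / \<bar>S\<bar>" for s
    by (simp add: r_def power_divide)
  have r4: "(r s)^4 = ((p s)\<^sup>2 / S)\<^sup>2" for s
  proof -
    have "(r s)^4 = ((r s)\<^sup>2)\<^sup>2" by (simp flip: power_mult)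
    then show ?thesis by (simp add: r2 power_divide)
  qed
  have den: "sqrt (1 + (r s)^4) \<le> norm (den s)" for s
    using w by (auto simp: den_def cmod_def r4 intro!: real_sqrt_le_mono add_mono)
  have den1: "1 \<le> norm (den s)" for s
    by (rule order_trans[OF _ den]) simp
  then have den0: "den s \<noteq> 0" for s by (metis norm_zero not_one_le_zero)
  have k': "(k has_vector_derivative (- \<i> * of_real (p s / S) * k s)) (at s)" for s
  proof -
    have "((\<lambda>s. s * y / sin \<alpha> - cos \<alpha> / sin \<alpha> * ((s\<^sup>2 + y\<^sup>2) / 2)) has_real_derivative - (p s / S)) (at s)"
      using S unfolding p_def S_def c_def by (auto intro!: derivative_eq_intros simp: field_simps)
    from has_vector_derivative_cis[OF this] show ?thesis
      unfolding k_def frft_kernel_def[abs_def] by simp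
  qed
  have den': "(den has_vector_derivative (- 2 * \<i> * of_real (p s * c / S))) (at s)" for s
  proof -
    have "den = (\<lambda>s. of_real w - \<i> * of_real ((p s)\<^sup>2 / S))"
      by (auto simp: den_def complex_eq_iff)
    moreover have "((\<lambda>s. (p s)\<^sup>2 / S) has_real_derivative 2 * p s * c / S) (at s)"
      unfolding p_def using S by (auto intro!: derivative_eq_intros)
    then have "((\<lambda>s. of_real w - \<i> * complex_of_real ((p s)\<^sup>2 / S)) has_vector_derivative (0 - \<i> * of_real (2 * p s * c / S))) (at s)"
      by (intro has_vector_derivative_diff has_vector_derivative_const has_vector_derivative_mult_right
          has_vector_derivative_of_real) (simp add: has_real_derivative_iff_has_vector_derivative)
    ultimately show ?thesis by (simp add: mult_ac)
  qed
  \<comment> \<open>Since (p k)' = (c - \<i> p^2 / S) k = (den - |S|) k, the derivative of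
    \<open>F\<close> is k \<gamma> minus a remainder k R. The boundary terms of \<open>F\<close>
    vanish, so the integral of k \<gamma> equals that of k R.\<close>
  define F where "F s = of_real (p s) * k s * \<gamma> s / den s" for s
  define R where "R s = of_real \<bar>S\<bar> * \<gamma> s / den s - of_real (p s) * \<gamma>' s / den s
      - 2 * \<i> * of_real (c * (p s)\<^sup>2 / S) * \<gamma> s / (den s)\<^sup>2" for s
  have F': "(F has_vector_derivative (k s * \<gamma> s - k s * R s)) (at s)" for s
  proof -
    have p': "((\<lambda>s. complex_of_real (p s)) has_vector_derivative of_real c) (at s)"
      unfolding p_def by (auto intro!: derivative_eq_intros has_vector_derivative_of_real)
    have inv: "((\<lambda>s. inverse (den s)) has_vector_derivative (- (inverse (den s) * (- 2 * \<i> * of_real (p s * c / S)) * inverse (den s)))) (at s)"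
      using den0 den'[of s] by (auto simp: has_vector_derivative_def intro!: derivative_eq_intros)
    note D = has_vector_derivative_mult[OF has_vector_derivative_mult[OF has_vector_derivative_mult[OF p' k'] d] inv]
    have *: "of_real (p s) * k s * \<gamma> s * (- (inverse (den s) * (- 2 * \<i> * of_real (p s * c / S)) * inverse (den s)))
       + (of_real (p s) * k s * \<gamma>' s + (of_real (p s) * (- \<i> * of_real (p s / S) * k s) + of_real c * k s) * \<gamma> s) * inverse (den s)
       = k s * \<gamma> s - k s * R s"
    proof -
      have h: "of_real c - \<i> * of_real ((p s)\<^sup>2 / S) = den s - of_real \<bar>S\<bar>"
        by (simp add: den_def w_def complex_eq_iff)
      then have e: "of_real (p s) * (- \<i> * of_real (p s / S) * k s) + of_real c * k s = (den s - of_real \<bar>S\<bar>) * k s"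
        unfolding h[symmetric] by (simp add: power2_eq_square algebra_simps)
      show ?thesis unfolding e R_def using den0[of s]
        by (simp add: divide_simps power2_eq_square) (simp add: algebra_simps)
    qed
    show ?thesis using D unfolding * by (simp add: F_def[abs_def] divide_inverse)
  qed
  have contden: "continuous_on UNIV den" and contk: "continuous_on UNIV k"
    using den' k' by (auto intro!: continuous_at_imp_continuous_on has_vector_derivative_continuous)
  have contp: "continuous_on UNIV (\<lambda>s. complex_of_real (p s))"
    unfolding p_def by (intro continuous_intros)
  have pr: "0 < 1 + (r s)^4" for s by (simp add: add_pos_nonneg)
  have absp: "\<bar>p s\<bar> = sqrt \<bar>S\<bar> * \<bar>r s\<bar>" for s
    using S by (simp add: r_def)
  have pden: "\<bar>p s\<bar> / norm (den s) \<le> sqrt \<bar>S\<bar> * (\<bar>r s\<bar> / sqrt (1 + (r s)^4))" for s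
    unfolding absp times_divide_eq_right using den[of s]
    using pr[of s] den0[of s] by (intro divide_left_mono mult_pos_pos) auto
  have pden1: "\<bar>p s\<bar> / norm (den s) \<le> sqrt \<bar>S\<bar>" for s
    using pden[of s] mult_left_mono[OF abs_div_sqrt_le_1[of "r s"], of "sqrt \<bar>S\<bar>"] by simp
  have dsq: "1 + (r s)^4 \<le> (norm (den s))\<^sup>2" for s
    using power_mono[OF den[of s], of 2] by (simp add: add_nonneg_nonneg)
  have q: "norm (2 * \<i> * of_real (c * (p s)\<^sup>2 / S) / (den s)\<^sup>2) \<le> 2 * c * (r s)\<^sup>2 / (1 + (r s)^4)" for s
  proof -
    have "norm (2 * \<i> * of_real (c * (p s)\<^sup>2 / S) / (den s)\<^sup>2) = 2 * c * (r s)\<^sup>2 / (norm (den s))\<^sup>2"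
      using c by (simp add: norm_mult norm_divide norm_power r2 abs_mult)
    also have "\<dots> \<le> 2 * c * (r s)\<^sup>2 / (1 + (r s)^4)"
      using dsq[of s] c pr[of s] den0[of s] by (intro divide_left_mono mult_pos_pos) auto
    finally show ?thesis .
  qed
  have q1: "2 * c * (r s)\<^sup>2 / (1 + (r s)^4) \<le> 2 * c" for s
    using mult_left_mono[OF square_div_le_1[of "r s"], of "2 * c"] c by simp
  have rF: "rapid F"
  proof -
    have "rapid (\<lambda>s. (of_real (p s) * k s / den s) * \<gamma> s)"
      by (rule rapid_bounded_mult[OF r(1), where B="sqrt \<bar>S\<bar>"])
        (use den0 pden1 in \<open>auto intro!: continuous_intros contden contk contp simp: norm_mult norm_divide k_def\<close>)
    then show ?thesis by (simp add: F_def[abs_def])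
  qed
  have Sden: "norm (of_real \<bar>S\<bar> / den s) \<le> \<bar>S\<bar>" for s
  proof -
    have "\<bar>S\<bar> * 1 \<le> \<bar>S\<bar> * norm (den s)" using den1[of s] by (intro mult_left_mono) auto
    then show ?thesis using den0[of s] by (simp add: norm_divide divide_le_eq)
  qed
  have rR: "rapid R"
  proof -
    have 1: "rapid (\<lambda>s. (of_real \<bar>S\<bar> / den s) * \<gamma> s)"
      by (rule rapid_bounded_mult[OF r(1), where B="\<bar>S\<bar>"])
        (use den0 Sden in \<open>auto intro!: continuous_intros contden\<close>)
    have 2: "rapid (\<lambda>s. (- of_real (p s) / den s) * \<gamma>' s)"
      by (rule rapid_bounded_mult[OF r(2), where B="sqrt \<bar>S\<bar>"])
        (use den0 pden1 in \<open>auto intro!: continuous_intros contden contp simp: norm_mult norm_divide\<close>)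
    have 3: "rapid (\<lambda>s. (- (2 * \<i> * of_real (c * (p s)\<^sup>2 / S) / (den s)\<^sup>2)) * \<gamma> s)"
    proof (rule rapid_bounded_mult[OF r(1), where B="2 * c"])
      show "continuous_on UNIV (\<lambda>s. - (2 * \<i> * of_real (c * (p s)\<^sup>2 / S) / (den s)\<^sup>2))"
        unfolding p_def using den0 S by (auto intro!: continuous_intros contden)
      show "norm (- (2 * \<i> * of_real (c * (p s)\<^sup>2 / S) / (den s)\<^sup>2)) \<le> 2 * c" for s
        using order_trans[OF q q1, of s] by (simp only: norm_minus_cancel)
    qed
    from rapid_add[OF rapid_add[OF 1 2] 3] show ?thesis
      by (rule back_subst[of rapid]) (auto simp: R_def divide_inverse mult_ac)
  qed
  have "(LINT s|lborel. k s * \<gamma> s - k s * R s) = 0"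
  proof (rule integral_derivative_zero[OF F'])
    show "continuous_on UNIV (\<lambda>s. k s * \<gamma> s - k s * R s)"
      using r rR contk by (auto simp: rapid_def intro!: continuous_intros)
    show "integrable lborel (\<lambda>s. k s * \<gamma> s - k s * R s)"
      using integrable_kernel[OF r(1)] integrable_kernel[OF rR] unfolding k_def by auto
  qed (rule rapid_tendsto[OF rF])+
  then have eq: "(LINT s|lborel. k s * \<gamma> s) = (LINT s|lborel. k s * R s)"
    using integrable_kernel[OF r(1), of \<alpha> y] integrable_kernel[OF rR, of \<alpha> y] unfolding k_def by auto
  have "norm (LINT s|lborel. k s * R s) \<le> (LINT s|lborel. ?B s)"
  proof (rule order_trans[OF integral_norm_bound integral_mono])
    show "integrable lborel (\<lambda>s. norm (k s * R s))"
      unfolding k_def by (rule integrable_norm[OF integrable_kernel[OF rR]])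
    show "norm (k s * R s) \<le> ?B s" for s
    proof -
      have "R s = of_real \<bar>S\<bar> / den s * \<gamma> s - of_real (p s) / den s * \<gamma>' s
          - (2 * \<i> * of_real (c * (p s)\<^sup>2 / S) / (den s)\<^sup>2) * \<gamma> s"
        by (simp add: R_def)
      moreover have "norm (k s * R s) = norm (R s)" by (simp add: norm_mult k_def)
      ultimately have "norm (k s * R s) \<le> norm (of_real \<bar>S\<bar> / den s) * norm (\<gamma> s) + norm (of_real (p s) / den s) * norm (\<gamma>' s)
          + norm (2 * \<i> * of_real (c * (p s)\<^sup>2 / S) / (den s)\<^sup>2) * norm (\<gamma> s)"
        by (simp only:) (intro order_trans[OF norm_triangle_ineq4] add_mono norm_mult_ineq)
      also have "\<dots> \<le> \<bar>S\<bar> * norm (\<gamma> s) + (sqrt \<bar>S\<bar> * (\<bar>r s\<bar> / sqrt (1 + (r s)^4))) * norm (\<gamma>' s)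
          + (2 * c * (r s)\<^sup>2 / (1 + (r s)^4)) * norm (\<gamma> s)"
      proof (intro add_mono mult_right_mono q norm_ge_zero)
        show "norm (of_real \<bar>S\<bar> / den s) \<le> \<bar>S\<bar>" by (rule Sden)
        show "norm (of_real (p s) / den s) \<le> sqrt \<bar>S\<bar> * (\<bar>r s\<bar> / sqrt (1 + (r s)^4))"
          using pden[of s] by (simp add: norm_divide)
      qed
      also have "\<dots> = ?B s" by (simp add: S_def c_def r_def p_def)
      finally show ?thesis .
    qed
    have i: "integrable lborel (\<lambda>s. \<bar>S\<bar> * norm (\<gamma> s) + (sqrt \<bar>S\<bar> * (\<bar>r s\<bar> / sqrt (1 + (r s)^4))) * norm (\<gamma>' s)
          + (2 * c * (r s)\<^sup>2 / (1 + (r s)^4)) * norm (\<gamma> s))"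
    proof (intro Bochner_Integration.integrable_add)
      have 1: "integrable lborel (\<lambda>s. norm (\<gamma> s))" "integrable lborel (\<lambda>s. norm (\<gamma>' s))"
        using rapid_integrable r by (auto intro: integrable_norm)
      then show "integrable lborel (\<lambda>s. \<bar>S\<bar> * norm (\<gamma> s))" by simp
      have m: "r \<in> borel_measurable borel" unfolding r_def p_def by measurable
      have [measurable]: "\<gamma> \<in> borel_measurable borel" "\<gamma>' \<in> borel_measurable borel"
        using r by (auto simp: rapid_def intro: borel_measurable_continuous_onI)
      note [measurable] = m
      show "integrable lborel (\<lambda>s. (sqrt \<bar>S\<bar> * (\<bar>r s\<bar> / sqrt (1 + (r s)^4))) * norm (\<gamma>' s))"
      proof (rule Bochner_Integration.integrable_bound[where f="\<lambda>s. sqrt \<bar>S\<bar> * norm (\<gamma>' s)"])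
        show "AE s in lborel. norm ((sqrt \<bar>S\<bar> * (\<bar>r s\<bar> / sqrt (1 + (r s)^4))) * norm (\<gamma>' s)) \<le> norm (sqrt \<bar>S\<bar> * norm (\<gamma>' s))"
        proof (intro AE_I2)
          fix s
          have "norm ((sqrt \<bar>S\<bar> * (\<bar>r s\<bar> / sqrt (1 + (r s)^4))) * norm (\<gamma>' s))
            = sqrt \<bar>S\<bar> * (\<bar>r s\<bar> / sqrt (1 + (r s)^4)) * norm (\<gamma>' s)"
            using pr[of s] by (simp add: abs_mult)
          also have "\<dots> \<le> sqrt \<bar>S\<bar> * 1 * norm (\<gamma>' s)"
            by (intro mult_right_mono mult_left_mono abs_div_sqrt_le_1) auto
          finally show "norm ((sqrt \<bar>S\<bar> * (\<bar>r s\<bar> / sqrt (1 + (r s)^4))) * norm (\<gamma>' s)) \<le> norm (sqrt \<bar>S\<bar> * norm (\<gamma>' s))"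
            by (simp add: abs_mult)
        qed
      qed (use 1 in auto)
      show "integrable lborel (\<lambda>s. (2 * c * (r s)\<^sup>2 / (1 + (r s)^4)) * norm (\<gamma> s))"
      proof (rule Bochner_Integration.integrable_bound[where f="\<lambda>s. 2 * c * norm (\<gamma> s)"])
        show "AE s in lborel. norm ((2 * c * (r s)\<^sup>2 / (1 + (r s)^4)) * norm (\<gamma> s)) \<le> norm (2 * c * norm (\<gamma> s))"
        proof (intro AE_I2)
          fix s
          have "norm ((2 * c * (r s)\<^sup>2 / (1 + (r s)^4)) * norm (\<gamma> s)) = 2 * c * (r s)\<^sup>2 / (1 + (r s)^4) * norm (\<gamma> s)"
            using pr[of s] c by (simp add: abs_mult)
          also have "\<dots> \<le> 2 * c * norm (\<gamma> s)"
            by (intro mult_right_mono q1) auto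
          finally show "norm ((2 * c * (r s)\<^sup>2 / (1 + (r s)^4)) * norm (\<gamma> s)) \<le> norm (2 * c * norm (\<gamma> s))"
            using c by (simp add: abs_mult)
        qed
      qed (use 1 in auto)
    qed
    show "integrable lborel ?B"
      using i unfolding S_def c_def r_def p_def .
  qed
  then show ?thesis unfolding eq[symmetric] unfolding k_def .
qed

lemma integral_cauchy_affine:
  assumes "c > 0" "q > 0"
  shows "has_bochner_integral lborel (\<lambda>s. 1 / (1 + ((c * s - y) / q)\<^sup>2)) (pi * q / c)"
proof -
  have "has_bochner_integral lborel (\<lambda>s::real. 1 / (1 + s\<^sup>2)) pi"
    using integrable_cauchy integral_cauchy by (simp add: has_bochner_integral_iff)
  then have "has_bochner_integral lborel (\<lambda>s. 1 / (1 + (- y / q + (c / q) * s)\<^sup>2)) (pi /\<^sub>R \<bar>c / q\<bar>)"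
    using assms by (subst (asm) lborel_has_bochner_integral_real_affine_iff[where t="- y / q" and c="c / q"]) auto
  moreover have "- y / q + (c / q) * s = (c * s - y) / q" for s by (simp add: diff_divide_distrib)
  moreover have "pi /\<^sub>R \<bar>c / q\<bar> = pi * q / c" using assms by (simp add: field_simps)
  ultimately show ?thesis by simp
qed

text \<open>All three terms of \<open>frft_parts\<close> integrate to a multiple of M sqrt |sin
  \<alpha>|, which the constant of the transform compensates. The price for uniformity in \<alpha>
  is the decay of one derivative of \<gamma>.\<close>

lemma frft1_bound:
  assumes a: "\<bar>\<alpha>\<bar> \<le> pi / 2"
    and r: "rapid \<gamma>" "rapid \<gamma>'"
    and d: "\<And>s. (\<gamma> has_vector_derivative \<gamma>' s) (at s)"
    and M: "\<And>s. (1 + s\<^sup>2) * norm (\<gamma> s) \<le> M" "\<And>s. (1 + s\<^sup>2) * norm (\<gamma>' s) \<le> M"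
  shows "norm (frft1 \<alpha> \<gamma> y) \<le> 6 * pi * M"
proof (cases "\<alpha> = 0")
  case True
  have M0: "M \<ge> 0" using order_trans[OF norm_ge_zero[of "\<gamma> 0"], of M] M(1)[of 0] by simp
  have "norm (\<gamma> y) \<le> (1 + y\<^sup>2) * norm (\<gamma> y)" by (simp add: distrib_right)
  also have "\<dots> \<le> 1 * M" using M by simp
  also have "\<dots> \<le> (6 * pi) * M" using pi_gt3 M0 by (intro mult_right_mono) auto
  finally show ?thesis using True by (simp add: frft1_def)
next
  case False
  define S where "S = sin \<alpha>"
  define c where "c = cos \<alpha>"
  define q where "q = sqrt \<bar>S\<bar>"
  have S: "S \<noteq> 0" unfolding S_def using False a pi_gt_zero by (intro sin_nonzero) linarith+
  have c: "c \<ge> 0" unfolding c_def using a by (intro cos_ge_zero) auto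
  have q: "q > 0" using S by (simp add: q_def)
  have Sq: "\<bar>S\<bar> \<le> q"
  proof -
    have "q * q = \<bar>S\<bar>" by (simp add: q_def)
    moreover have "q \<le> 1" using abs_sin_le_one[of \<alpha>] by (simp add: q_def S_def)
    ultimately show ?thesis using q by (metis less_eq_real_def mult_left_le)
  qed
  have M0: "M \<ge> 0" using order_trans[OF norm_ge_zero[of "\<gamma> 0"], of M] M(1)[of 0] by simp
  have pos: "0 < 1 + s\<^sup>2" for s :: real by (simp add: add_pos_nonneg)
  have b: "norm (\<gamma> s) \<le> M * (1 / (1 + s\<^sup>2))" "norm (\<gamma>' s) \<le> M * (1 / (1 + s\<^sup>2))" for s
    using M[of s] pos[of s] by (simp_all add: pos_le_divide_eq mult.commute)
  have b1: "norm (\<gamma> s) \<le> M" for s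
    using order_trans[OF b(1)[of s], of M] M0 by (simp add: divide_le_eq mult_left_le pos distrib_left)
  \<comment> \<open>The first two terms of \<open>frft_parts\<close> contribute \<open>q\<close>
    each; the third contributes 4 c, from r^2 / (1 + r^4) <= 2 / (1 + r^2). The integrals 2 \<pi> q
    and 4 c (\<pi> q / c) add up to 6 \<pi> q.\<close>
  define T where "T s = M * (2 * q * (1 / (1 + s\<^sup>2)) + 4 * c * (1 / (1 + ((c * s - y) / q)\<^sup>2)))" for s
  have T: "integrable lborel T \<and> (LINT s|lborel. T s) \<le> M * (6 * pi * q)"
  \<comment> \<open>The integral over the rescaled variable is \<pi> q / c, so the factor
    \<open>c\<close> in front cancels and nothing degenerates as \<open>c\<close> tends to 0; at
    \<open>c = 0\<close> itself this term is absent.\<close>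
  proof (cases "c = 0")
    case True
    have "has_bochner_integral lborel (\<lambda>s. M * (2 * q * (1 / (1 + s\<^sup>2)))) (M * (2 * q * pi))"
      using integrable_cauchy integral_cauchy
      by (intro has_bochner_integral_mult_right) (simp_all add: has_bochner_integral_iff)
    moreover have "M * (2 * q * pi) \<le> M * (6 * pi * q)" using M0 q by (intro mult_left_mono) auto
    ultimately show ?thesis unfolding T_def True by (simp add: has_bochner_integral_iff)
  next
    case False
    with c have "c > 0" by simp
    from integral_cauchy_affine[OF this q, of y] integrable_cauchy integral_cauchy
    have "has_bochner_integral lborel T (M * (2 * q * pi + 4 * c * (pi * q / c)))"
      unfolding T_def
      by (intro has_bochner_integral_mult_right has_bochner_integral_add) (simp_all add: has_bochner_integral_iff)
    then show ?thesis using \<open>c > 0\<close> by (simp add: has_bochner_integral_iff algebra_simps)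
  qed
  have "norm (LINT s|lborel. frft_kernel \<alpha> y s * \<gamma> s) \<le> (LINT s|lborel. \<bar>S\<bar> * norm (\<gamma> s)
      + q * (\<bar>(c * s - y) / q\<bar> / sqrt (1 + ((c * s - y) / q) ^ 4)) * norm (\<gamma>' s)
      + 2 * c * ((c * s - y) / q)\<^sup>2 / (1 + ((c * s - y) / q) ^ 4) * norm (\<gamma> s))"
    using frft_parts[OF False a r d, of y] by (simp add: S_def c_def q_def)
  also have "\<dots> \<le> (LINT s|lborel. T s)"
  proof (rule integral_mono')
    show "integrable lborel T" using T by simp
    fix s
    define r where "r = (c * s - y) / q"
    have r1: "0 < 1 + r^2" "0 < 1 + r^4" by (simp_all add: add_pos_nonneg)
    have "r\<^sup>2 * (1 + r\<^sup>2) \<le> 2 * (1 + r^4)"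
    proof -
      have r4: "r ^ 4 = r\<^sup>2 * r\<^sup>2" by (simp flip: power_add)
      have "0 \<le> (r\<^sup>2 - 1)\<^sup>2" "0 \<le> r\<^sup>2 * r\<^sup>2" by simp_all
      then show ?thesis unfolding r4 power2_diff power2_eq_square[of "r\<^sup>2"] distrib_left power_one mult_1_right by linarith
    qed
    then have "r\<^sup>2 / (1 + r^4) \<le> 2 * (1 / (1 + r\<^sup>2))"
      using r1 by (simp add: pos_le_divide_eq divide_simps)
    then have "2 * c * (r\<^sup>2 / (1 + r^4)) \<le> 2 * c * (2 * (1 / (1 + r\<^sup>2)))"
      using c by (intro mult_left_mono) auto
    then have 3: "2 * c * r\<^sup>2 / (1 + r^4) * norm (\<gamma> s) \<le> (2 * c * (2 * (1 / (1 + r\<^sup>2)))) * M"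
      using b1[of s] c r1 by (intro mult_mono) auto
    have 2: "q * (\<bar>r\<bar> / sqrt (1 + r ^ 4)) * norm (\<gamma>' s) \<le> (q * 1) * (M * (1 / (1 + s\<^sup>2)))"
      using b(2)[of s] q abs_div_sqrt_le_1[of r] by (intro mult_mono) auto
    have 1: "\<bar>S\<bar> * norm (\<gamma> s) \<le> q * (M * (1 / (1 + s\<^sup>2)))"
      using b(1)[of s] q Sq by (intro mult_mono) auto
    show "\<bar>S\<bar> * norm (\<gamma> s) + q * (\<bar>(c * s - y) / q\<bar> / sqrt (1 + ((c * s - y) / q) ^ 4)) * norm (\<gamma>' s)
      + 2 * c * ((c * s - y) / q)\<^sup>2 / (1 + ((c * s - y) / q) ^ 4) * norm (\<gamma> s) \<le> T s"
      using add_mono[OF add_mono[OF 1 2] 3] unfolding T_def r_def by (simp add: algebra_simps)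
    show "0 \<le> T s" using M0 q c unfolding T_def by simp
  qed
  also have "\<dots> \<le> M * (6 * pi * q)" using T by simp
  finally have "norm (frft_const \<alpha>) * norm (LINT s|lborel. frft_kernel \<alpha> y s * \<gamma> s)
      \<le> norm (frft_const \<alpha>) * (M * (6 * pi * q))"
    by (rule mult_left_mono) simp
  also have "\<dots> = (norm (frft_const \<alpha>) * q) * (6 * pi * M)" by (simp add: algebra_simps)
  also have "norm (frft_const \<alpha>) * q = 1 / sqrt (2 * pi)"
    using norm_frft_const[of \<alpha>] S by (simp add: S_def q_def)
  also have "1 / sqrt (2 * pi) * (6 * pi * M) \<le> 1 * (6 * pi * M)"
    using M0 pi_gt3 by (intro mult_right_mono) (auto simp: divide_le_eq)
  finally show ?thesis using False by (simp add: frft1_def norm_mult)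
qed

section \<open>Intertwining with multiplication and differentiation\<close>

lemma has_vector_derivative_complex_of_real:
  "(complex_of_real has_vector_derivative 1) (at t within S)"
  by (rule has_vector_derivative_eq_rhs[OF has_vector_derivative_of_real[OF DERIV_ident]]) simp

text \<open>The integral of the total derivative (k \<gamma>)' vanishes, and k' = \<i> (y - s cos
  \<alpha>) / sin \<alpha> * k contains both \<open>y\<close> and \<open>s\<close>; solving for the
  term with \<open>y\<close> gives the relation.\<close>

lemma frft1_mult:
  assumes a: "\<bar>\<alpha>\<bar> \<le> pi / 2"
    and r: "rapid \<gamma>" "rapid \<gamma>'" "rapid (\<lambda>s. of_real s * \<gamma> s)"
    and d: "\<And>s. (\<gamma> has_vector_derivative \<gamma>' s) (at s)"
  shows "of_real y * frft1 \<alpha> \<gamma> y =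
    of_real (cos \<alpha>) * frft1 \<alpha> (\<lambda>s. of_real s * \<gamma> s) y + \<i> * of_real (sin \<alpha>) * frft1 \<alpha> \<gamma>' y"
proof (cases "\<alpha> = 0")
  case False
  define S where "S = sin \<alpha>"
  define c where "c = cos \<alpha>"
  define k where "k = frft_kernel \<alpha> y"
  have S: "S \<noteq> 0" unfolding S_def using False a pi_gt_zero by (intro sin_nonzero) linarith+
  have k': "(k has_vector_derivative (\<i> * of_real ((y - c * s) / S) * k s)) (at s)" for s
  proof -
    have "((\<lambda>s. s * y / sin \<alpha> - cos \<alpha> / sin \<alpha> * ((s\<^sup>2 + y\<^sup>2) / 2)) has_real_derivative ((y - c * s) / S)) (at s)"
      using S unfolding S_def c_def by (auto intro!: derivative_eq_intros simp: field_simps)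
    from has_vector_derivative_cis[OF this] show ?thesis
      unfolding k_def frft_kernel_def[abs_def] by simp
  qed
  define I where "I g = (LINT s|lborel. k s * g s)" for g
  have I: "integrable lborel (\<lambda>s. k s * \<gamma> s)" "integrable lborel (\<lambda>s. k s * \<gamma>' s)"
    "integrable lborel (\<lambda>s. k s * (of_real s * \<gamma> s))"
    using r unfolding k_def by (auto intro: integrable_kernel)
  let ?f = "\<lambda>s. \<i> * of_real y / of_real S * (k s * \<gamma> s) - \<i> * of_real c / of_real S * (k s * (of_real s * \<gamma> s)) + k s * \<gamma>' s"
  have "(LINT s|lborel. ?f s) = 0"
  proof (rule integral_derivative_zero)
    show "((\<lambda>s. k s * \<gamma> s) has_vector_derivative ?f s) (at s)" for s
      by (rule has_vector_derivative_eq_rhs[OF has_vector_derivative_mult[OF k' d]])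
        (use S in \<open>simp add: field_simps\<close>)
    show "continuous_on UNIV ?f"
      using r unfolding rapid_def k_def by (auto intro!: continuous_intros simp: S)
    show "integrable lborel ?f" using I by auto
    have "rapid (\<lambda>s. k s * \<gamma> s)" unfolding k_def by (rule rapid_kernel[OF r(1)])
    then show "((\<lambda>s. k s * \<gamma> s) \<longlongrightarrow> 0) at_top" "((\<lambda>s. k s * \<gamma> s) \<longlongrightarrow> 0) at_bot"
      by (auto dest: rapid_tendsto)
  qed
  then have "\<i> * of_real y / of_real S * I \<gamma> - \<i> * of_real c / of_real S * I (\<lambda>s. of_real s * \<gamma> s) + I \<gamma>' = 0"
    using I by (simp add: I_def)
  then have "0 = - \<i> * of_real S * (\<i> * of_real y / of_real S * I \<gamma> - \<i> * of_real c / of_real S * I (\<lambda>s. of_real s * \<gamma> s) + I \<gamma>')"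
    by simp
  also have "\<dots> = of_real y * I \<gamma> - of_real c * I (\<lambda>s. of_real s * \<gamma> s) - \<i> * of_real S * I \<gamma>'"
    using S by (simp add: algebra_simps)
  finally have "of_real y * I \<gamma> = of_real c * I (\<lambda>s. of_real s * \<gamma> s) + \<i> * of_real S * I \<gamma>'"
    by (simp add: algebra_simps)
  then have "frft_const \<alpha> * (of_real y * I \<gamma>) = frft_const \<alpha> * (of_real c * I (\<lambda>s. of_real s * \<gamma> s) + \<i> * of_real S * I \<gamma>')"
    by simp
  then show ?thesis using False
    by (simp add: frft1_def k_def I_def S_def c_def algebra_simps)
qed (simp add: frft1_def)

text \<open>Differentiation under the integral produces the factor (s - y cos \<alpha>) / sin
  \<alpha>. After the factor \<open>y\<close> is eliminated by \<open>frft1_mult\<close>, the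
  identity 1 - cos^2 = sin^2 removes the division by the sine.\<close>

lemma frft1_deriv:
  assumes a: "\<bar>\<alpha>\<bar> \<le> pi / 2"
    and r: "rapid \<gamma>" "rapid \<gamma>'" "rapid (\<lambda>s. of_real s * \<gamma> s)"
    and d: "\<And>s. (\<gamma> has_vector_derivative \<gamma>' s) (at s)"
  shows "(frft1 \<alpha> \<gamma> has_vector_derivative
    (of_real (cos \<alpha>) * frft1 \<alpha> \<gamma>' y + \<i> * of_real (sin \<alpha>) * frft1 \<alpha> (\<lambda>s. of_real s * \<gamma> s) y)) (at y)"
proof (cases "\<alpha> = 0")
  case True
  then show ?thesis using d by (simp add: frft1_def[abs_def])
next
  case False
  define S where "S = sin \<alpha>"
  define c where "c = cos \<alpha>"
  have S: "S \<noteq> 0" unfolding S_def using False a pi_gt_zero by (intro sin_nonzero) linarith+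
  define I where "I g y = (LINT s|lborel. frft_kernel \<alpha> y s * g s)" for g y
  define D where "D y s = \<i> * of_real ((s - c * y) / S) * frft_kernel \<alpha> y s * \<gamma> s" for y s
  have "((\<lambda>y. LINT s|lborel. frft_kernel \<alpha> y s * \<gamma> s) has_vector_derivative (LINT s|lborel. D y s)) (at y)"
  proof (rule has_vector_derivative_integral_dominated[where d=1])
    fix t s
    have "((\<lambda>y. s * y / sin \<alpha> - cos \<alpha> / sin \<alpha> * ((s\<^sup>2 + y\<^sup>2) / 2)) has_real_derivative ((s - c * t) / S)) (at t)"
      using S unfolding S_def c_def by (auto intro!: derivative_eq_intros simp: field_simps)
    from has_vector_derivative_cis[OF this]
    have "((\<lambda>t. frft_kernel \<alpha> t s) has_vector_derivative (\<i> * of_real ((s - c * t) / S) * frft_kernel \<alpha> t s)) (at t)"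
      unfolding frft_kernel_def .
    from has_vector_derivative_mult[OF this has_vector_derivative_const, of "\<gamma> s"]
    show "((\<lambda>t. frft_kernel \<alpha> t s * \<gamma> s) has_vector_derivative D t s) (at t)"
      by (simp add: D_def)
    assume t: "\<bar>t - y\<bar> < 1"
    have "\<bar>s - c * t\<bar> \<le> \<bar>s\<bar> + \<bar>c\<bar> * \<bar>t\<bar>" by (metis abs_mult abs_triangle_ineq4)
    also have "\<dots> \<le> \<bar>s\<bar> + 1 * (\<bar>y\<bar> + 1)"
      using t unfolding c_def by (intro add_left_mono mult_mono) auto
    finally have "\<bar>s - c * t\<bar> / \<bar>S\<bar> * norm (\<gamma> s) \<le> (\<bar>s\<bar> + (\<bar>y\<bar> + 1)) / \<bar>S\<bar> * norm (\<gamma> s)"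
      by (intro mult_right_mono divide_right_mono) auto
    moreover have "norm (D t s) = \<bar>s - c * t\<bar> / \<bar>S\<bar> * norm (\<gamma> s)"
      by (simp only: D_def norm_mult norm_of_real norm_ii norm_frft_kernel abs_divide mult_1_left mult_1_right)
    ultimately have "norm (D t s) \<le> (\<bar>s\<bar> + (\<bar>y\<bar> + 1)) / \<bar>S\<bar> * norm (\<gamma> s)" by simp
    then show "norm (D t s) \<le> (1 / \<bar>S\<bar>) * norm (of_real s * \<gamma> s) + ((\<bar>y\<bar> + 1) / \<bar>S\<bar>) * norm (\<gamma> s)"
      by (simp add: norm_mult add_divide_distrib distrib_right)
  next
    show "integrable lborel (\<lambda>s. (1 / \<bar>S\<bar>) * norm (of_real s * \<gamma> s) + ((\<bar>y\<bar> + 1) / \<bar>S\<bar>) * norm (\<gamma> s))"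
      by (intro Bochner_Integration.integrable_add integrable_mult_right integrable_norm rapid_integrable r)
    show "integrable lborel (\<lambda>s. frft_kernel \<alpha> t s * \<gamma> s)" for t by (rule integrable_kernel[OF r(1)])
    have [measurable]: "\<gamma> \<in> borel_measurable borel"
      using r by (auto simp: rapid_def intro: borel_measurable_continuous_onI)
    show "D y \<in> borel_measurable lborel" unfolding D_def by measurable
  qed simp
  moreover have "(LINT s|lborel. D y s) = \<i> / of_real S * I (\<lambda>s. of_real s * \<gamma> s) y - \<i> * of_real (c * y) / of_real S * I \<gamma> y"
  proof -
    have "D y s = \<i> / of_real S * (frft_kernel \<alpha> y s * (of_real s * \<gamma> s)) - \<i> * of_real (c * y) / of_real S * (frft_kernel \<alpha> y s * \<gamma> s)" for s
      using S by (simp add: D_def field_simps)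
    then show ?thesis
      using integrable_kernel[OF r(1), of \<alpha> y] integrable_kernel[OF r(3), of \<alpha> y] by (simp add: I_def)
  qed
  ultimately have *: "((\<lambda>y. LINT s|lborel. frft_kernel \<alpha> y s * \<gamma> s) has_vector_derivative
     (\<i> / of_real S * I (\<lambda>s. of_real s * \<gamma> s) y - \<i> * of_real (c * y) / of_real S * I \<gamma> y)) (at y)" by simp
  have "(frft1 \<alpha> \<gamma> has_vector_derivative
     frft_const \<alpha> * (\<i> / of_real S * I (\<lambda>s. of_real s * \<gamma> s) y - \<i> * of_real (c * y) / of_real S * I \<gamma> y)) (at y)"
    using has_vector_derivative_mult_right[OF *, of "frft_const \<alpha>"] False by (simp add: frft1_def[abs_def])
  also have "frft_const \<alpha> * (\<i> / of_real S * I (\<lambda>s. of_real s * \<gamma> s) y - \<i> * of_real (c * y) / of_real S * I \<gamma> y)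
    = \<i> / of_real S * frft1 \<alpha> (\<lambda>s. of_real s * \<gamma> s) y - \<i> * of_real c / of_real S * (of_real y * frft1 \<alpha> \<gamma> y)"
    using False S by (simp add: frft1_def I_def field_simps)
  also have "\<dots> = of_real c * frft1 \<alpha> \<gamma>' y + \<i> * of_real ((1 - c\<^sup>2) / S) * frft1 \<alpha> (\<lambda>s. of_real s * \<gamma> s) y"
    unfolding frft1_mult[OF assms, folded c_def S_def]
    using S by (simp add: field_simps power2_eq_square)
  also have "1 - c\<^sup>2 = S * S"
    using sin_squared_eq[of \<alpha>] by (simp add: S_def c_def power2_eq_square)
  also have "S * S / S = S" using S by simp
  finally show ?thesis by (simp add: S_def c_def)
qed


section \<open>The derivative in the angle\<close>

text \<open>The base of the power has real part 2 \<pi> sin^2 \<alpha> > 0, so the principal branch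
  is differentiable there.\<close>

lemma frft_const_has_vector_derivative:
  assumes "sin \<alpha> \<noteq> 0"
  shows "(frft_const has_vector_derivative (- (cis \<alpha> / (2 * of_real (sin \<alpha>))) * frft_const \<alpha>)) (at \<alpha>)"
proof -
  define P where "P t = of_real pi * (1 - exp (2 * \<i> * complex_of_real t))" for t
  have P: "P \<alpha> = of_real pi * (- 2 * \<i> * of_real (sin \<alpha>) * cis \<alpha>)"
    unfolding P_def one_minus_exp ..
  have P0: "P \<alpha> \<noteq> 0" unfolding P using assms by simp
  have "Re (P \<alpha>) = 2 * pi * (sin \<alpha>)\<^sup>2" unfolding P by (simp add: power2_eq_square)
  then have "Re (P \<alpha>) > 0" using assms by simp
  then have nn: "P \<alpha> \<notin> \<real>\<^sub>\<le>\<^sub>0" by (auto simp: complex_nonpos_Reals_iff)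
  have "((\<lambda>t. 2 * \<i> * complex_of_real t) has_vector_derivative (2 * \<i> * 1)) (at \<alpha>)"
    by (intro has_vector_derivative_mult_right has_vector_derivative_complex_of_real)
  then have "((exp \<circ> (\<lambda>t. 2 * \<i> * complex_of_real t)) has_vector_derivative (2 * \<i> * 1) * exp (2 * \<i> * complex_of_real \<alpha>)) (at \<alpha>)"
    by (rule field_vector_diff_chain_at) (auto intro!: derivative_eq_intros)
  then have "((\<lambda>t. exp (2 * \<i> * complex_of_real t)) has_vector_derivative (2 * \<i> * exp (2 * \<i> * complex_of_real \<alpha>))) (at \<alpha>)"
    by (simp add: comp_def)
  then have P': "(P has_vector_derivative (of_real pi * (0 - 2 * \<i> * exp (2 * \<i> * complex_of_real \<alpha>)))) (at \<alpha>)"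
    unfolding P_def[abs_def] by (intro has_vector_derivative_mult_right has_vector_derivative_diff has_vector_derivative_const)
  have "(((\<lambda>z. z powr (- 1 / 2)) \<circ> P) has_vector_derivative
      (of_real pi * (0 - 2 * \<i> * exp (2 * \<i> * complex_of_real \<alpha>))) * (- 1 / 2 * P \<alpha> powr (- 1 / 2 - 1))) (at \<alpha>)"
    by (rule field_vector_diff_chain_at[OF P' has_field_derivative_powr[OF nn]])
  moreover have "(\<lambda>z. z powr (- 1 / 2)) \<circ> P = frft_const"
    by (auto simp: frft_const_def P_def)
  moreover have "(of_real pi * (0 - 2 * \<i> * exp (2 * \<i> * complex_of_real \<alpha>))) * (- 1 / 2 * P \<alpha> powr (- 1 / 2 - 1))
     = - (cis \<alpha> / (2 * of_real (sin \<alpha>))) * frft_const \<alpha>"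
  proof -
    have e: "exp (2 * \<i> * complex_of_real \<alpha>) = cis \<alpha> * cis \<alpha>"
      by (simp add: cis_conv_exp mult.assoc flip: exp_add)
    have p: "P \<alpha> powr (- 1 / 2 - 1) = frft_const \<alpha> / P \<alpha>"
      using P0 by (simp only: powr_diff powr_to_1 if_False) (simp add: frft_const_def P_def)
    show ?thesis unfolding e p unfolding P using assms by (simp add: field_simps)
  qed
  ultimately show ?thesis by simp
qed

text \<open>The angle derivative of the phase is a quadratic polynomial in \<open>s\<close> and
  \<open>y\<close> over sin^2 \<alpha>. Repeated use of \<open>frft1_mult\<close> turns each
  \<open>y\<close> into operators on \<gamma>, and the derivative of the constant supplies the
  remaining term.\<close>

lemma frft1_time_deriv:
  assumes a: "\<alpha> \<noteq> 0" "\<bar>\<alpha>\<bar> \<le> pi / 2"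
    and r: "rapid \<gamma>" "rapid \<gamma>'" "rapid \<gamma>''" "rapid (\<lambda>s. of_real s * \<gamma> s)"
      "rapid (\<lambda>s. of_real s * (of_real s * \<gamma> s))" "rapid (\<lambda>s. of_real s * \<gamma>' s)"
    and d: "\<And>s. (\<gamma> has_vector_derivative \<gamma>' s) (at s)" "\<And>s. (\<gamma>' has_vector_derivative \<gamma>'' s) (at s)"
  shows "((\<lambda>\<alpha>. frft1 \<alpha> \<gamma> y) has_vector_derivative
    \<i> / 2 * (frft1 \<alpha> (\<lambda>s. of_real s * (of_real s * \<gamma> s)) y - frft1 \<alpha> \<gamma>'' y - frft1 \<alpha> \<gamma> y)) (at \<alpha>)"
proof -
  define S where "S = sin \<alpha>"
  define c where "c = cos \<alpha>"
  have S: "S \<noteq> 0" unfolding S_def using a pi_gt_zero by (intro sin_nonzero) linarith+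
  define I where "I g t = (LINT s|lborel. frft_kernel t y s * g s)" for g t
  define D where "D t s = \<i> * of_real (((s\<^sup>2 + y\<^sup>2) / 2 - s * y * cos t) / (sin t)\<^sup>2) * frft_kernel t y s * \<gamma> s" for t s
  \<comment> \<open>A neighbourhood in which |sin t| >= |sin \<alpha>| / 2 gives a majorant for the
    derivative of the kernel that is independent of \<open>t\<close>.\<close>
  have "isCont sin \<alpha>" by simp
  then obtain d where d0: "d > 0" and sd: "\<And>t. \<bar>t - \<alpha>\<bar> < d \<Longrightarrow> \<bar>sin t - S\<bar> < \<bar>S\<bar> / 2"
    using S unfolding continuous_at_eps_delta dist_real_def S_def[symmetric]
    by (metis zero_less_abs_iff half_gt_zero)
  have I': "((\<lambda>t. LINT s|lborel. frft_kernel t y s * \<gamma> s) has_vector_derivative (LINT s|lborel. D \<alpha> s)) (at \<alpha>)"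
  proof (rule has_vector_derivative_integral_dominated[OF d0])
    fix t s assume t: "\<bar>t - \<alpha>\<bar> < d"
    have st: "\<bar>S\<bar> / 2 \<le> \<bar>sin t\<bar>" using sd[OF t] by arith
    then have s0: "sin t \<noteq> 0" using S by auto
    have "((\<lambda>t. s * y / sin t - cos t / sin t * ((s\<^sup>2 + y\<^sup>2) / 2)) has_real_derivative
        (- (s * y * cos t) / (sin t)\<^sup>2 - (- sin t * sin t - cos t * cos t) / (sin t)\<^sup>2 * ((s\<^sup>2 + y\<^sup>2) / 2))) (at t)"
      using s0 by (auto intro!: derivative_eq_intros simp: power2_eq_square field_simps)
    also have "- sin t * sin t - cos t * cos t = - 1"
      using sin_cos_squared_add[of t] by (simp add: power2_eq_square)
    finally have "((\<lambda>t. s * y / sin t - cos t / sin t * ((s\<^sup>2 + y\<^sup>2) / 2)) has_real_derivative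
        (((s\<^sup>2 + y\<^sup>2) / 2 - s * y * cos t) / (sin t)\<^sup>2)) (at t)"
      by (rule DERIV_cong) (simp add: diff_divide_distrib)
    from has_vector_derivative_mult[OF has_vector_derivative_cis[OF this] has_vector_derivative_const, of "\<gamma> s"]
    show "((\<lambda>t. frft_kernel t y s * \<gamma> s) has_vector_derivative D t s) (at t)"
      unfolding D_def frft_kernel_def by simp
    have "\<bar>s * y * cos t\<bar> \<le> \<bar>s * y\<bar> * 1" unfolding abs_mult by (intro mult_mono) auto
    moreover have "2 * \<bar>s * y\<bar> \<le> s\<^sup>2 + y\<^sup>2"
      using sum_squares_bound[of s y] sum_squares_bound[of "-s" y] by (auto simp: abs_if)
    ultimately have B: "\<bar>s * y * cos t\<bar> \<le> (s\<^sup>2 + y\<^sup>2) / 2" by simp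
    have "\<bar>(s\<^sup>2 + y\<^sup>2) / 2 - s * y * cos t\<bar> \<le> \<bar>(s\<^sup>2 + y\<^sup>2) / 2\<bar> + \<bar>s * y * cos t\<bar>"
      by (rule abs_triangle_ineq4)
    also have "\<dots> \<le> (s\<^sup>2 + y\<^sup>2) / 2 + (s\<^sup>2 + y\<^sup>2) / 2" using B by (intro add_mono) auto
    finally have n: "\<bar>(s\<^sup>2 + y\<^sup>2) / 2 - s * y * cos t\<bar> \<le> s\<^sup>2 + y\<^sup>2" by simp
    have "(\<bar>S\<bar> / 2)\<^sup>2 \<le> \<bar>sin t\<bar>\<^sup>2" by (rule power_mono[OF st]) simp
    then have "S\<^sup>2 / 4 \<le> (sin t)\<^sup>2" by (simp add: power_divide)
    then have "\<bar>(s\<^sup>2 + y\<^sup>2) / 2 - s * y * cos t\<bar> / (sin t)\<^sup>2 \<le> (s\<^sup>2 + y\<^sup>2) / (S\<^sup>2 / 4)"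
      using n S by (intro frac_le) auto
    then have "\<bar>(s\<^sup>2 + y\<^sup>2) / 2 - s * y * cos t\<bar> / (sin t)\<^sup>2 * norm (\<gamma> s) \<le> (s\<^sup>2 + y\<^sup>2) / (S\<^sup>2 / 4) * norm (\<gamma> s)"
      by (rule mult_right_mono) simp
    moreover have "norm (D t s) = \<bar>(s\<^sup>2 + y\<^sup>2) / 2 - s * y * cos t\<bar> / (sin t)\<^sup>2 * norm (\<gamma> s)"
      by (simp only: D_def norm_mult norm_of_real norm_ii norm_frft_kernel abs_divide mult_1_left mult_1_right power2_abs abs_power2)
    moreover have "(s\<^sup>2 + y\<^sup>2) / (S\<^sup>2 / 4) * norm (\<gamma> s)
        = 4 / S\<^sup>2 * norm (of_real s * (of_real s * \<gamma> s)) + 4 * y\<^sup>2 / S\<^sup>2 * norm (\<gamma> s)"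
    proof -
      have nn: "norm (of_real s * (of_real s * \<gamma> s)) = s\<^sup>2 * norm (\<gamma> s)"
        by (simp add: norm_mult power2_eq_square flip: mult.assoc)
      show ?thesis unfolding nn using S by (simp add: field_simps)
    qed
    ultimately show "norm (D t s) \<le> 4 / S\<^sup>2 * norm (of_real s * (of_real s * \<gamma> s)) + 4 * y\<^sup>2 / S\<^sup>2 * norm (\<gamma> s)"
      by simp
  next
    show "integrable lborel (\<lambda>s. 4 / S\<^sup>2 * norm (of_real s * (of_real s * \<gamma> s)) + 4 * y\<^sup>2 / S\<^sup>2 * norm (\<gamma> s))"
      by (intro Bochner_Integration.integrable_add integrable_mult_right integrable_norm rapid_integrable r)
    show "integrable lborel (\<lambda>s. frft_kernel t y s * \<gamma> s)" for t by (rule integrable_kernel[OF r(1)])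
    have [measurable]: "\<gamma> \<in> borel_measurable borel"
      using r by (auto simp: rapid_def intro: borel_measurable_continuous_onI)
    show "D \<alpha> \<in> borel_measurable lborel" unfolding D_def by measurable
  qed
  let ?F = "\<lambda>g. frft1 \<alpha> g y"
  have "(LINT s|lborel. D \<alpha> s) = \<i> / (2 * of_real S ^ 2) * (I (\<lambda>s. of_real s * (of_real s * \<gamma> s)) \<alpha> + of_real y ^ 2 * I \<gamma> \<alpha>)
      - \<i> * of_real c * of_real y / of_real S ^ 2 * I (\<lambda>s. of_real s * \<gamma> s) \<alpha>"
  proof -
    have "D \<alpha> s = \<i> / (2 * of_real S ^ 2) * (frft_kernel \<alpha> y s * (of_real s * (of_real s * \<gamma> s)) + of_real y ^ 2 * (frft_kernel \<alpha> y s * \<gamma> s))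
      - \<i> * of_real c * of_real y / of_real S ^ 2 * (frft_kernel \<alpha> y s * (of_real s * \<gamma> s))" for s
      using S by (simp add: D_def flip: S_def c_def) (simp add: field_simps power2_eq_square)
    then show ?thesis
      using integrable_kernel[OF r(1), of \<alpha> y] integrable_kernel[OF r(4), of \<alpha> y] integrable_kernel[OF r(5), of \<alpha> y]
      by (simp add: I_def)
  qed
  note CI = has_vector_derivative_mult[OF frft_const_has_vector_derivative I', unfolded this]
  have "((\<lambda>t. frft_const t * (LINT s|lborel. frft_kernel t y s * \<gamma> s)) has_vector_derivative
      (- (cis \<alpha> / (2 * of_real S)) * ?F \<gamma> + \<i> / (2 * of_real S ^ 2) * (?F (\<lambda>s. of_real s * (of_real s * \<gamma> s)) + of_real y * (of_real y * ?F \<gamma>))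
      - \<i> * of_real c / of_real S ^ 2 * (of_real y * ?F (\<lambda>s. of_real s * \<gamma> s)))) (at \<alpha>)" (is "(_ has_vector_derivative ?R) _")
    using S a(1) unfolding S_def by (intro has_vector_derivative_eq_rhs[OF CI])
      (simp_all add: frft1_def I_def S_def c_def algebra_simps power2_eq_square)
  moreover have "?R = \<i> / 2 * (?F (\<lambda>s. of_real s * (of_real s * \<gamma> s)) - ?F \<gamma>'' - ?F \<gamma>)"
  proof -
    define X Y Z W where "X = ?F (\<lambda>s. of_real s * (of_real s * \<gamma> s))" and "Y = ?F (\<lambda>s. of_real s * \<gamma>' s)"
      and "Z = ?F \<gamma>''" and "W = ?F \<gamma>"
    have sd: "((\<lambda>s. of_real s * \<gamma> s) has_vector_derivative (1 * \<gamma> s + 1 * (of_real s * \<gamma>' s))) (at s)" for s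
      using has_vector_derivative_mult[OF has_vector_derivative_complex_of_real d(1), of s]
      by (simp add: algebra_simps)
    have U: "of_real y * ?F (\<lambda>s. of_real s * \<gamma> s) = of_real c * X + \<i> * of_real S * (W + Y)"
      using frft1_mult[OF a(2) r(4) _ r(5) sd, of y] frft1_add[OF r(1) r(6), of \<alpha> 1 1 y]
        rapid_add[OF r(1) r(6)] by (simp add: X_def W_def Y_def c_def S_def)
    have V: "of_real y * ?F \<gamma>' = of_real c * Y + \<i> * of_real S * Z"
      using frft1_mult[OF a(2) r(2,3,6) d(2), of y] by (simp add: Y_def Z_def c_def S_def)
    have "of_real y * (of_real y * W) = of_real c * (of_real y * ?F (\<lambda>s. of_real s * \<gamma> s)) + \<i> * of_real S * (of_real y * ?F \<gamma>')"
      using frft1_mult[OF a(2) r(1,2,4) d(1), of y] by (simp add: W_def c_def S_def algebra_simps)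
    then have Q: "of_real y * (of_real y * W) = of_real c * (of_real c * X + \<i> * of_real S * (W + Y)) + \<i> * of_real S * (of_real c * Y + \<i> * of_real S * Z)"
      by (simp only: U V)
    have cs: "complex_of_real c * of_real c = 1 - of_real S * of_real S"
      using sin_cos_squared_add[of \<alpha>] unfolding S_def c_def
      by (metis add_diff_cancel_left' of_real_1 of_real_diff of_real_mult power2_eq_square)
    have ci: "cis \<alpha> = of_real c + \<i> * of_real S" by (simp add: complex_eq_iff c_def S_def)
    \<comment> \<open>With denominators cleared, the mixed terms \<open>Y\<close> cancel. The cosine
      part of \<open>cis \<alpha>\<close> cancels the \<open>W\<close> that stems from the
      commutator of s and d/ds, and its sine part leaves the -1 of the Hermite operator.\<close>
    have "?R * (2 * of_real S ^ 2) = - (of_real c + \<i> * of_real S) * of_real S * W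
       + \<i> * (X + (of_real c * (of_real c * X + \<i> * of_real S * (W + Y)) + \<i> * of_real S * (of_real c * Y + \<i> * of_real S * Z)))
       - 2 * \<i> * of_real c * (of_real c * X + \<i> * of_real S * (W + Y))"
      unfolding X_def[symmetric] W_def[symmetric] Q U ci using S by (simp add: field_simps power2_eq_square)
    also have "\<dots> = \<i> * (X - of_real c * of_real c * X) - \<i> * (of_real S * of_real S) * W - \<i> * (of_real S * of_real S) * Z"
      by (simp add: algebra_simps)
    also have "\<dots> = (\<i> / 2 * (X - Z - W)) * (2 * of_real S ^ 2)"
      unfolding cs by (simp add: algebra_simps power2_eq_square)
    finally show ?thesis using S unfolding X_def Z_def W_def by (simp only: mult_cancel_right) simp
  qed
  ultimately have "((\<lambda>t. frft_const t * (LINT s|lborel. frft_kernel t y s * \<gamma> s)) has_vector_derivative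
      \<i> / 2 * (?F (\<lambda>s. of_real s * (of_real s * \<gamma> s)) - ?F \<gamma>'' - ?F \<gamma>)) (at \<alpha>)"
    by (rule has_vector_derivative_eq_rhs)
  then show ?thesis
    by (rule has_vector_derivative_transform_within_open[where S="- {0}"]) (auto simp: a frft1_def)
qed


section \<open>Invariance of the Gaussian\<close>

lemma rapid_gaussian:
  fixes p :: "real \<Rightarrow> real"
  assumes "continuous_on UNIV p" and p: "\<And>s. \<bar>p s\<bar> \<le> (1 + s\<^sup>2)\<^sup>2"
  shows "rapid (\<lambda>s. of_real (p s * exp (- s\<^sup>2 / 2)))"
proof (rule rapidI)
  show "continuous_on UNIV (\<lambda>s. complex_of_real (p s * exp (- s\<^sup>2 / 2)))"
    using assms(1) by (intro continuous_intros) auto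
  fix s :: real
  \<comment> \<open>Cubing e^x >= 1 + x at x = s^2 / 6 yields the bound, with 216 = 6^3.\<close>
  have "(1 + s\<^sup>2) / 6 \<le> 1 + s\<^sup>2 / 6" by simp
  also have "\<dots> \<le> exp (s\<^sup>2 / 6)" by (rule exp_ge_add_one_self)
  finally have "((1 + s\<^sup>2) / 6) ^ 3 \<le> exp (s\<^sup>2 / 6) ^ 3" by (intro power_mono) auto
  also have "exp (s\<^sup>2 / 6) ^ 3 = exp (s\<^sup>2 / 2)" by (simp flip: exp_of_nat_mult)
  finally have "(1 + s\<^sup>2) ^ 3 \<le> 216 * exp (s\<^sup>2 / 2)" by (simp add: power_divide)
  then have e: "(1 + s\<^sup>2) ^ 3 * exp (- s\<^sup>2 / 2) \<le> 216" by (simp add: exp_minus divide_simps)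
  have "(1 + s\<^sup>2) * norm (complex_of_real (p s * exp (- s\<^sup>2 / 2))) = ((1 + s\<^sup>2) * \<bar>p s\<bar>) * exp (- s\<^sup>2 / 2)"
    by (simp add: abs_mult del: of_real_mult)
  also have "\<dots> \<le> (1 + s\<^sup>2) ^ 3 * exp (- s\<^sup>2 / 2)"
    using mult_left_mono[OF p[of s], of "1 + s\<^sup>2"]
    by (intro mult_right_mono) (auto simp: power3_eq_cube power2_eq_square algebra_simps)
  finally show "(1 + s\<^sup>2) * norm (complex_of_real (p s * exp (- s\<^sup>2 / 2))) \<le> 216"
    using e by simp
qed

lemma integral_gaussian: "(LINT s|lborel. cis (s * y) * of_real (exp (- s\<^sup>2 / 2))) = of_real (sqrt (2 * pi) * exp (- y\<^sup>2 / 2))"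
proof -
  have "char std_normal_distribution y = (LINT s|lborel. std_normal_density s *\<^sub>R iexp (y * s))"
    unfolding char_def by (subst integral_density) (auto simp: normal_density_nonneg)
  also have "\<dots> = (LINT s|lborel. of_real (1 / sqrt (2 * pi)) * (cis (s * y) * of_real (exp (- s\<^sup>2 / 2))))"
    by (rule Bochner_Integration.integral_cong)
      (auto simp: normal_density_def cis_conv_exp scaleR_conv_of_real mult_ac)
  finally have "of_real (1 / sqrt (2 * pi)) * (LINT s|lborel. cis (s * y) * of_real (exp (- s\<^sup>2 / 2)))
      = complex_of_real (exp (- y\<^sup>2 / 2))"
    by (simp add: char_std_normal_distribution del: of_real_divide)
  then show ?thesis by (simp add: field_simps)
qed

text \<open>The Gaussian is annihilated by the Hermite operator, so its transform does not change
  with the angle on either side of 0; the values at the end points \<pi>/2 and -\<pi>/2 come from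
  the characteristic function of the normal distribution. This fixes the normalisation and the
  branch of the constant.\<close>

lemma frft1_gaussian:
  assumes a: "\<bar>\<alpha>\<bar> \<le> pi / 2"
  shows "frft1 \<alpha> (\<lambda>s. of_real (exp (- s\<^sup>2 / 2))) y = of_real (exp (- y\<^sup>2 / 2))"
proof -
  define g :: "real \<Rightarrow> complex" where "g s = of_real (1 * exp (- s\<^sup>2 / 2))" for s
  define g' :: "real \<Rightarrow> complex" where "g' s = of_real (- s * exp (- s\<^sup>2 / 2))" for s
  define g'' :: "real \<Rightarrow> complex" where "g'' s = of_real ((s\<^sup>2 - 1) * exp (- s\<^sup>2 / 2))" for s
  have d: "(g has_vector_derivative g' s) (at s)" "(g' has_vector_derivative g'' s) (at s)" for s
    unfolding g_def[abs_def] g'_def[abs_def] g''_def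
    by (rule has_vector_derivative_of_real; auto intro!: derivative_eq_intros simp: power2_eq_square algebra_simps)+
  have sq: "\<bar>s\<bar> \<le> 1 + s\<^sup>2" for s :: real
    using sum_squares_bound[of "\<bar>s\<bar>" 1] by simp
  have b: "u \<le> (1 + s\<^sup>2)\<^sup>2" if "u \<le> 1 + s\<^sup>2" for u s :: real
  proof -
    have "(1 + s\<^sup>2) * 1 \<le> (1 + s\<^sup>2) * (1 + s\<^sup>2)" by (intro mult_left_mono) auto
    with that show ?thesis by (simp add: power2_eq_square)
  qed
  have sq2: "s * s \<le> (1 + s\<^sup>2)\<^sup>2" for s :: real
    by (rule b) (simp add: power2_eq_square)
  have r1: "rapid g" unfolding g_def[abs_def] by (rule rapid_gaussian) (auto intro!: b)
  have r2: "rapid g'" unfolding g'_def[abs_def] by (rule rapid_gaussian) (auto intro!: b continuous_intros simp: sq)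
  have r3: "rapid g''" unfolding g''_def[abs_def] by (rule rapid_gaussian) (auto intro!: b continuous_intros simp: abs_le_iff)
  have r4: "rapid (\<lambda>s. of_real s * g s)"
    unfolding g_def of_real_mult[symmetric] mult_1_left by (rule rapid_gaussian) (auto intro!: b sq continuous_intros)
  have r5: "rapid (\<lambda>s. of_real s * (of_real s * g s))"
    unfolding g_def of_real_mult[symmetric] mult_1_left mult.assoc[symmetric]
    by (rule rapid_gaussian) (auto intro!: continuous_intros sq2)
  have r6: "rapid (\<lambda>s. of_real s * g' s)"
    unfolding g'_def of_real_mult[symmetric] mult.assoc[symmetric]
    by (rule rapid_gaussian) (auto intro!: continuous_intros sq2 simp: abs_mult)
  have D0: "((\<lambda>\<alpha>. frft1 \<alpha> g y) has_vector_derivative 0) (at t)" if t: "t \<noteq> 0" "\<bar>t\<bar> \<le> pi / 2" for t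
  proof -
    have "(\<lambda>s. 1 * (of_real s * (of_real s * g s)) + (-1) * g'' s) = g"
      by (auto simp: g_def g''_def power2_eq_square algebra_simps)
    with frft1_add[OF r5 r3, of t 1 "-1" y]
    have "frft1 t (\<lambda>s. of_real s * (of_real s * g s)) y - frft1 t g'' y - frft1 t g y = 0" by simp
    with frft1_time_deriv[OF t r1 r2 r3 r4 r5 r6 d, of y] show ?thesis by simp
  qed
  \<comment> \<open>The derivative is known only for nonzero angles, so constancy is claimed on
    intervals that avoid 0; each side is then connected to its own end point.\<close>
  have const: "frft1 s g y = frft1 t g y" if "s \<le> t" "{s..t} \<subseteq> {-pi/2..pi/2} - {0}" for s t
  proof -
    have D: "((\<lambda>\<alpha>. frft1 \<alpha> g y) has_vector_derivative 0) (at x within {s..t})" if x: "x \<in> {s..t}" for x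
    proof -
      have "x \<in> {-pi/2..pi/2} - {0}" using x \<open>{s..t} \<subseteq> _\<close> by blast
      then have "x \<noteq> 0" "\<bar>x\<bar> \<le> pi / 2" by auto
      then show ?thesis by (rule has_vector_derivative_at_within[OF D0])
    qed
    have "\<exists>c. \<forall>x\<in>{s..t}. frft1 x g y = c"
    proof (rule has_vector_derivative_zero_constant[of "{s..t}" "\<lambda>\<alpha>. frft1 \<alpha> g y"])
      fix c assume "\<And>x. x \<in> {s..t} \<Longrightarrow> frft1 x g y = c"
      then show ?thesis by blast
    qed (use D in auto)
    then obtain c where c: "\<And>x. x \<in> {s..t} \<Longrightarrow> frft1 x g y = c" by blast
    show ?thesis using c[of s] c[of t] \<open>s \<le> t\<close> by simp
  qed
  \<comment> \<open>At the end points the cosine vanishes and 1 - e^(2 i t) = 2: the kernel is the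
    plain Fourier kernel, up to the sign of \<open>y\<close>, with constant 1 / sqrt (2
    \<pi>).\<close>
  have half: "frft1 t g y = g y" if "t = pi / 2 \<or> t = - pi / 2" for t
  proof -
    have e: "exp (2 * \<i> * complex_of_real t) = -1"
    proof -
      have "exp (2 * \<i> * complex_of_real t) = cis (2 * t)" by (simp add: cis_conv_exp mult_ac)
      also have "2 * t = pi \<or> 2 * t = - pi" using that by auto
      then have "cis (2 * t) = - 1" by (auto simp: complex_eq_iff)
      finally show ?thesis .
    qed
    have "frft_const t = of_real (2 * pi) powr of_real (- 1 / 2)"
      unfolding frft_const_def e by (simp add: mult_ac)
    also have "\<dots> = of_real (1 / sqrt (2 * pi))"
    proof -
      have "(2 * pi) powr - (1 / 2) = 1 / sqrt (2 * pi)"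
        using powr_half_sqrt[of "2 * pi"] by (simp only: powr_minus_divide) simp
      then show ?thesis by (subst powr_of_real) simp_all
    qed
    finally have c: "frft_const t = of_real (1 / sqrt (2 * pi))" .
    have sc: "(sin t = 1 \<or> sin t = - 1) \<and> cos t = 0"
      using that by (elim disjE; hypsubst; simp)
    have k: "frft_kernel t y s = cis (s * (sin t * y))" for s
      using sc by (auto simp: frft_kernel_def)
    have "(LINT s|lborel. frft_kernel t y s * g s) = of_real (sqrt (2 * pi) * exp (- (sin t * y)\<^sup>2 / 2))"
      unfolding k g_def mult_1_left by (rule integral_gaussian)
    moreover have "(sin t * y)\<^sup>2 = y\<^sup>2" using sc by auto
    moreover have "t \<noteq> 0" using sc by auto
    ultimately show ?thesis by (simp add: frft1_def c g_def)
  qed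
  have "frft1 \<alpha> g y = g y"
  proof -
    consider "\<alpha> = 0" | "\<alpha> > 0" | "\<alpha> < 0" by arith
    then show ?thesis
    proof cases
      case 1 then show ?thesis by (simp add: frft1_def)
    next
      case 2
      have "{\<alpha>..pi / 2} \<subseteq> {-pi/2..pi/2} - {0}" using 2 by (auto intro: order_trans[of _ 0])
      then have "frft1 \<alpha> g y = frft1 (pi / 2) g y" using a by (intro const) auto
      then show ?thesis using half[of "pi / 2"] by simp
    next
      case 3
      have "{- pi / 2..\<alpha>} \<subseteq> {-pi/2..pi/2} - {0}" using 3 by (auto intro: order_trans[of _ 0])
      then have "frft1 (- pi / 2) g y = frft1 \<alpha> g y" using a by (intro const) auto
      then show ?thesis using half[of "- pi / 2"] by simp
    qed
  qed
  then show ?thesis by (simp add: g_def[abs_def])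
qed


section \<open>The limit at angle zero\<close>

text \<open>After division by sqrt |sin \<alpha>| the bound of \<open>frft_parts\<close> has one
  term that still looks singular, the third. Because \<gamma> vanishes at \<open>y\<close>, it is of
  order |s - y| there, which supplies one more factor sqrt |sin \<alpha>| |r|; every term then tends
  to 0 under a fixed integrable majorant.\<close>

lemma frft1_tendsto_zero:
  assumes r: "rapid \<gamma>" "rapid \<gamma>'"
    and d: "\<And>s. (\<gamma> has_vector_derivative \<gamma>' s) (at s)"
    and y: "\<gamma> y = 0"
  shows "((\<lambda>\<alpha>. frft1 \<alpha> \<gamma> y) \<longlongrightarrow> 0) (at 0)"
  unfolding tendsto_at_iff_sequentially comp_def
proof (intro allI impI)
  fix X :: "nat \<Rightarrow> real" assume X: "\<forall>i. X i \<in> UNIV - {0}" "X \<longlonglongrightarrow> 0"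
  obtain K K' where K: "\<And>s. (1 + s\<^sup>2) * norm (\<gamma> s) \<le> K" "\<And>s. (1 + s\<^sup>2) * norm (\<gamma>' s) \<le> K'"
    using r by (auto simp: rapid_def)
  define M where "M = max K K'"
  have M: "(1 + s\<^sup>2) * norm (\<gamma> s) \<le> M" "(1 + s\<^sup>2) * norm (\<gamma>' s) \<le> M" for s
    using K[of s] by (auto simp: M_def)
  have M0: "M \<ge> 0" using order_trans[OF norm_ge_zero[of "\<gamma> 0"], of M] M(1)[of 0] by simp
  have pos: "0 < 1 + s\<^sup>2" for s :: real by (simp add: add_pos_nonneg)
  have g'M: "norm (\<gamma>' s) \<le> M" for s
    using order_trans[OF mult_right_mono[of 1 "1 + s\<^sup>2" "norm (\<gamma>' s)"] M(2)[of s]] by simp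
  have lip: "norm (\<gamma> s) \<le> M * \<bar>s - y\<bar>" for s
  proof -
    have "norm (\<gamma> s - \<gamma> y) \<le> M * norm (s - y)"
      by (rule differentiable_bound[where S=UNIV and f'="\<lambda>t h. h *\<^sub>R \<gamma>' t"])
        (use d g'M in \<open>auto simp: has_vector_derivative_def mult.commute[of M] intro!: onorm_le mult_left_mono\<close>)
    then show ?thesis by (simp add: y)
  qed
  define N where "N = M * (1 + (\<bar>y\<bar> + 1)\<^sup>2)"
  have N0: "N \<ge> 0" using M0 by (simp add: N_def)
  \<comment> \<open>Near \<open>y\<close> this is the Lipschitz bound, at distance more than 1 it is
    the decay of \<gamma>; \<open>N\<close> is chosen large enough for both.\<close>
  have N: "(1 + s\<^sup>2) * norm (\<gamma> s) \<le> N * \<bar>s - y\<bar>" for s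
  proof (cases "\<bar>s - y\<bar> \<le> 1")
    case True
    then have "\<bar>s\<bar> \<le> \<bar>y\<bar> + 1" by arith
    then have "\<bar>s\<bar>\<^sup>2 \<le> (\<bar>y\<bar> + 1)\<^sup>2" by (intro power_mono) auto
    then have "(1 + s\<^sup>2) * norm (\<gamma> s) \<le> (1 + (\<bar>y\<bar> + 1)\<^sup>2) * (M * \<bar>s - y\<bar>)"
      using lip[of s] by (intro mult_mono) auto
    then show ?thesis by (simp add: N_def mult_ac)
  next
    case False
    have "(1 + s\<^sup>2) * norm (\<gamma> s) \<le> M * 1 * 1" using M by simp
    also have "\<dots> \<le> M * (1 + (\<bar>y\<bar> + 1)\<^sup>2) * \<bar>s - y\<bar>"
      using False M0 by (intro mult_mono) auto
    finally show ?thesis by (simp add: N_def)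
  qed
  have b: "norm (\<gamma> s) \<le> M * (1 / (1 + s\<^sup>2))" "norm (\<gamma>' s) \<le> M * (1 / (1 + s\<^sup>2))"
    "norm (\<gamma> s) \<le> N * \<bar>s - y\<bar> * (1 / (1 + s\<^sup>2))" for s
    using M[of s] N[of s] pos[of s] by (simp_all add: pos_le_divide_eq mult.commute)
  define q where "q n = sqrt \<bar>sin (X n)\<bar>" for n
  define r where "r n s = (cos (X n) * s - y) / q n" for n s
  \<comment> \<open>A majorant of the integrand of \<open>frft_parts\<close> divided by
    \<open>q n\<close>, with \<gamma> in the third term estimated by \<open>N\<close> and |s - y|
    expressed through \<open>r n s\<close>; the last summand is the error of that
    substitution.\<close>
  define W where "W n s = (q n * M + M * (\<bar>r n s\<bar> / sqrt (1 + r n s ^ 4)) + 2 * N * (\<bar>r n s\<bar> ^ 3 / (1 + r n s ^ 4))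
      + 2 * N * \<bar>y\<bar> * q n) * (1 / (1 + s\<^sup>2))" for n s
  have q0: "q \<longlonglongrightarrow> 0"
    unfolding q_def using tendsto_real_sqrt[OF tendsto_rabs[OF tendsto_sin[OF X(2)]]] by simp
  have small: "\<forall>\<^sub>F n in sequentially. \<bar>X n\<bar> < 1"
    using X(2) unfolding tendsto_iff by (auto simp: dist_real_def dest: spec[of _ 1])
  have qpos: "q n > 0" if "\<bar>X n\<bar> < 1" for n
    using that X(1) pi_gt3 sin_nonzero[of "X n"] unfolding q_def by auto
  have q1: "q n \<le> 1" for n using abs_sin_le_one[of "X n"] by (simp add: q_def)
  have r3: "\<bar>u\<bar> ^ 3 / (1 + u ^ 4) \<le> 1" for u :: real
  proof -
    have "\<bar>u\<bar> ^ 3 \<le> 1 + u ^ 4"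
    proof (cases "\<bar>u\<bar> \<le> 1")
      case True
      then have "\<bar>u\<bar> ^ 3 \<le> 1" by (intro power_le_one) auto
      then show ?thesis using zero_le_even_power'[of u 2] by (simp add: add_increasing2)
    next
      case False
      then have "\<bar>u\<bar> ^ 3 \<le> \<bar>u\<bar> ^ 4" by (intro power_increasing) auto
      then show ?thesis by simp
    qed
    moreover have "0 < 1 + u ^ 4" by (simp add: add_pos_nonneg)
    ultimately show ?thesis by (simp add: divide_le_eq)
  qed
  have Wdom: "norm (W n s) \<le> (2 * M + 2 * N + 2 * N * \<bar>y\<bar>) * (1 / (1 + s\<^sup>2))" for n s
  proof -
    have qn: "0 \<le> q n" by (simp add: q_def)
    have "q n * M + M * (\<bar>r n s\<bar> / sqrt (1 + r n s ^ 4)) + 2 * N * (\<bar>r n s\<bar> ^ 3 / (1 + r n s ^ 4)) + 2 * N * \<bar>y\<bar> * q n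
      \<le> 1 * M + M * 1 + 2 * N * 1 + 2 * N * \<bar>y\<bar> * 1"
      using q1 qn M0 N0 abs_div_sqrt_le_1 r3 by (intro add_mono mult_mono mult_nonneg_nonneg) auto
    moreover have "0 \<le> q n * M + M * (\<bar>r n s\<bar> / sqrt (1 + r n s ^ 4)) + 2 * N * (\<bar>r n s\<bar> ^ 3 / (1 + r n s ^ 4)) + 2 * N * \<bar>y\<bar> * q n"
      using qn M0 N0 by (intro add_nonneg_nonneg mult_nonneg_nonneg divide_nonneg_nonneg) auto
    ultimately show ?thesis
      unfolding W_def real_norm_def abs_mult using pos[of s] by (intro mult_mono) auto
  qed
  have "(\<lambda>n. LINT s|lborel. W n s) \<longlonglongrightarrow> (LINT s::real|lborel. (0::real))"
  proof (rule integral_dominated_convergence[where w="\<lambda>s. (2 * M + 2 * N + 2 * N * \<bar>y\<bar>) * (1 / (1 + s\<^sup>2))"])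
    show "W n \<in> borel_measurable lborel" for n unfolding W_def r_def by measurable
    show "integrable lborel (\<lambda>s. (2 * M + 2 * N + 2 * N * \<bar>y\<bar>) * (1 / (1 + s\<^sup>2)))"
      using integrable_cauchy by (rule integrable_mult_right)
    show "AE s in lborel. norm (W n s) \<le> (2 * M + 2 * N + 2 * N * \<bar>y\<bar>) * (1 / (1 + s\<^sup>2))" for n
      using Wdom by simp
    \<comment> \<open>For \<open>s\<close> different from \<open>y\<close> the rescaled distance
      \<open>r n s\<close> tends to infinity in modulus; the exceptional point is a null
      set.\<close>
    have "(\<lambda>n. W n s) \<longlonglongrightarrow> 0" if "s \<noteq> y" for s
    proof -
      have c1: "(\<lambda>n. \<bar>cos (X n) * s - y\<bar>) \<longlonglongrightarrow> \<bar>s - y\<bar>"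
        using tendsto_rabs[OF tendsto_diff[OF tendsto_mult_right[OF tendsto_cos[OF X(2)]] tendsto_const[of y]]] by simp
      have "filterlim (\<lambda>n. inverse (q n)) at_top sequentially"
      proof (rule filterlim_inverse_at_top[OF q0])
        show "\<forall>\<^sub>F n in sequentially. 0 < q n" using small by eventually_elim (rule qpos)
      qed
      then have "filterlim (\<lambda>n. \<bar>cos (X n) * s - y\<bar> * inverse (q n)) at_top sequentially"
        using that by (intro filterlim_tendsto_pos_mult_at_top[OF c1]) auto
      then have R: "filterlim (\<lambda>n. \<bar>r n s\<bar>) at_top sequentially"
        by (simp add: r_def abs_mult q_def divide_inverse)
      have "((\<lambda>u::real. u / sqrt (1 + u ^ 4)) \<longlongrightarrow> 0) at_top" "((\<lambda>u::real. u ^ 3 / (1 + u ^ 4)) \<longlongrightarrow> 0) at_top"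
        by real_asymp+
      from this[THEN filterlim_compose, OF R]
      have "(\<lambda>n. \<bar>r n s\<bar> / sqrt (1 + r n s ^ 4)) \<longlonglongrightarrow> 0" "(\<lambda>n. \<bar>r n s\<bar> ^ 3 / (1 + r n s ^ 4)) \<longlonglongrightarrow> 0"
        by simp_all
      then have "(\<lambda>n. W n s) \<longlonglongrightarrow> (0 * M + M * 0 + 2 * N * 0 + 2 * N * \<bar>y\<bar> * 0) * (1 / (1 + s\<^sup>2))"
        unfolding W_def using q0 by (intro tendsto_intros)
      then show ?thesis by simp
    qed
    then show "AE s in lborel. (\<lambda>n. W n s) \<longlonglongrightarrow> 0"
      using AE_lborel_singleton[of y] by (auto elim: eventually_mono)
  qed simp
  then have W0: "(\<lambda>n. LINT s|lborel. W n s) \<longlonglongrightarrow> 0" by simp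
  have "\<forall>\<^sub>F n in sequentially. norm (frft1 (X n) \<gamma> y) \<le> (LINT s|lborel. W n s)"
    using small
  proof eventually_elim
    case (elim n)
    define S where "S = sin (X n)"
    define c where "c = cos (X n)"
    have Xn: "X n \<noteq> 0" "\<bar>X n\<bar> \<le> pi / 2" using X(1) elim pi_gt3 by auto
    have c: "0 \<le> c" "c \<le> 1" using Xn unfolding c_def by (auto intro!: cos_ge_zero)
    have qp: "0 < q n" by (rule qpos[OF elim])
    have qq: "q n * q n = \<bar>S\<bar>" by (simp add: q_def S_def)
    have S0: "S \<noteq> 0" using qq qp by auto
    have c2: "(1 - c) / q n \<le> q n"
    proof -
      have "c * c \<le> c * 1" using c by (intro mult_left_mono) auto
      then have "1 - c \<le> S * S"
        using sin_cos_squared_add[of "X n"] by (simp add: S_def c_def power2_eq_square)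
      also have "S * S = q n * q n * (q n * q n)" by (simp add: qq)
      also have "\<dots> \<le> 1 * 1 * (q n * q n)" using q1[of n] qp by (intro mult_right_mono mult_mono) auto
      finally show ?thesis using qp by (simp add: divide_le_eq)
    qed
    have "norm (LINT s|lborel. frft_kernel (X n) y s * \<gamma> s) \<le> (LINT s|lborel. \<bar>S\<bar> * norm (\<gamma> s)
      + q n * (\<bar>r n s\<bar> / sqrt (1 + r n s ^ 4)) * norm (\<gamma>' s) + 2 * c * (r n s)\<^sup>2 / (1 + r n s ^ 4) * norm (\<gamma> s))"
      using frft_parts[OF Xn r d, of y] by (simp add: S_def c_def q_def r_def)
    also have "\<dots> \<le> (LINT s|lborel. q n * W n s)"
    proof (rule integral_mono')
      have "integrable lborel (W n)"
      proof (rule Bochner_Integration.integrable_bound)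
        show "integrable lborel (\<lambda>s. (2 * M + 2 * N + 2 * N * \<bar>y\<bar>) * (1 / (1 + s\<^sup>2)))"
          using integrable_cauchy by (rule integrable_mult_right)
        show "W n \<in> borel_measurable lborel" unfolding W_def r_def by measurable
        show "AE s in lborel. norm (W n s) \<le> norm ((2 * M + 2 * N + 2 * N * \<bar>y\<bar>) * (1 / (1 + s\<^sup>2)))"
          using order_trans[OF Wdom abs_ge_self] by simp
      qed
      then show "integrable lborel (\<lambda>s. q n * W n s)" by simp
      fix s
      define u where "u = r n s"
      define v where "v = 1 / (1 + s\<^sup>2)"
      have v: "v \<ge> 0" by (simp add: v_def)
      have u4: "0 < 1 + u ^ 4" by (simp add: add_pos_nonneg)
      have 1: "\<bar>S\<bar> * norm (\<gamma> s) \<le> q n * (q n * M) * v"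
        using mult_left_mono[OF b(1)[of s], of "\<bar>S\<bar>"] unfolding qq[symmetric] v_def by (simp add: mult_ac)
      have 2: "q n * (\<bar>u\<bar> / sqrt (1 + u ^ 4)) * norm (\<gamma>' s) \<le> q n * (\<bar>u\<bar> / sqrt (1 + u ^ 4)) * (M * v)"
        using b(2)[of s] qp u4 unfolding v_def by (intro mult_left_mono) auto
      \<comment> \<open>The distance to \<open>y\<close> is traded for the distance to the
        stationary point. The error y (1 - c) is of order (q n)^2, because 1 - c <= 1 - c^2 =
        sin^2.\<close>
      have "c * \<bar>s - y\<bar> = \<bar>(c * s - y) + y * (1 - c)\<bar>"
        using c by (simp add: abs_mult_pos' algebra_simps)
      also have "\<dots> \<le> \<bar>c * s - y\<bar> + \<bar>y\<bar> * (1 - c)"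
        using c by (intro order_trans[OF abs_triangle_ineq]) (simp add: abs_mult)
      also have "\<bar>c * s - y\<bar> = q n * \<bar>u\<bar>" using qp by (simp add: u_def r_def c_def)
      also have "\<bar>y\<bar> * (1 - c) \<le> \<bar>y\<bar> * (q n * q n)"
        using c2 qp by (intro mult_left_mono) (auto simp: divide_le_eq)
      finally have cs: "c * \<bar>s - y\<bar> \<le> q n * (\<bar>u\<bar> + \<bar>y\<bar> * q n)" by (simp add: algebra_simps)
      have "2 * c * u\<^sup>2 / (1 + u ^ 4) * norm (\<gamma> s) \<le> 2 * c * u\<^sup>2 / (1 + u ^ 4) * (N * \<bar>s - y\<bar> * v)"
        using b(3)[of s] c u4 unfolding v_def by (intro mult_left_mono) auto
      also have "\<dots> = 2 * u\<^sup>2 / (1 + u ^ 4) * N * v * (c * \<bar>s - y\<bar>)" by (simp add: mult_ac)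
      also have "\<dots> \<le> 2 * u\<^sup>2 / (1 + u ^ 4) * N * v * (q n * (\<bar>u\<bar> + \<bar>y\<bar> * q n))"
        using cs N0 v u4 by (intro mult_left_mono mult_nonneg_nonneg) auto
      also have "\<dots> = q n * (2 * N * (u\<^sup>2 * \<bar>u\<bar> / (1 + u ^ 4)) + 2 * N * \<bar>y\<bar> * q n * (u\<^sup>2 / (1 + u ^ 4))) * v"
        by (simp add: algebra_simps add_divide_distrib)
      also have "u\<^sup>2 * \<bar>u\<bar> = \<bar>u\<bar> ^ 3" by (simp add: power3_eq_cube power2_eq_square)
      also have "q n * (2 * N * (\<bar>u\<bar> ^ 3 / (1 + u ^ 4)) + 2 * N * \<bar>y\<bar> * q n * (u\<^sup>2 / (1 + u ^ 4))) * v
          \<le> q n * (2 * N * (\<bar>u\<bar> ^ 3 / (1 + u ^ 4)) + 2 * N * \<bar>y\<bar> * q n * 1) * v"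
        using qp N0 v square_div_le_1[of u] by (intro mult_right_mono mult_left_mono add_left_mono mult_nonneg_nonneg) auto
      finally have 3: "2 * c * u\<^sup>2 / (1 + u ^ 4) * norm (\<gamma> s)
          \<le> q n * (2 * N * (\<bar>u\<bar> ^ 3 / (1 + u ^ 4)) + 2 * N * \<bar>y\<bar> * q n * 1) * v" .
      have e: "q n * W n s = q n * (q n * M) * v + q n * (\<bar>u\<bar> / sqrt (1 + u ^ 4)) * (M * v)
          + q n * (2 * N * (\<bar>u\<bar> ^ 3 / (1 + u ^ 4)) + 2 * N * \<bar>y\<bar> * q n * 1) * v"
        unfolding W_def u_def v_def by (simp only: algebra_simps)
      show "\<bar>S\<bar> * norm (\<gamma> s) + q n * (\<bar>r n s\<bar> / sqrt (1 + r n s ^ 4)) * norm (\<gamma>' s)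
        + 2 * c * (r n s)\<^sup>2 / (1 + r n s ^ 4) * norm (\<gamma> s) \<le> q n * W n s"
        unfolding e using add_mono[OF add_mono[OF 1 2] 3] unfolding u_def .
      show "0 \<le> q n * W n s"
        unfolding e using qp M0 N0 v u4 by (intro add_nonneg_nonneg mult_nonneg_nonneg) auto
    qed
    finally have "norm (frft_const (X n)) * norm (LINT s|lborel. frft_kernel (X n) y s * \<gamma> s)
        \<le> norm (frft_const (X n)) * (q n * (LINT s|lborel. W n s))"
      by (intro mult_left_mono) auto
    also have "\<dots> = 1 / sqrt (2 * pi) * (LINT s|lborel. W n s)"
      using norm_frft_const[of "X n"] S0 by (simp add: S_def q_def flip: mult.assoc)
    also have "\<dots> \<le> 1 * (LINT s|lborel. W n s)"
    proof (rule mult_right_mono)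
      show "1 / sqrt (2 * pi) \<le> 1" using pi_gt3 by (simp add: divide_le_eq)
      show "0 \<le> (LINT s|lborel. W n s)"
        using M0 N0 qp unfolding W_def
        by (intro integral_nonneg_AE AE_I2 mult_nonneg_nonneg add_nonneg_nonneg) auto
    qed
    finally show ?case using Xn by (simp add: frft1_def norm_mult)
  qed
  then show "(\<lambda>n. frft1 (X n) \<gamma> y) \<longlonglongrightarrow> 0"
    by (rule Lim_null_comparison) (rule W0)
qed

text \<open>A multiple of the Gaussian is subtracted so that the difference vanishes at
  \<open>y\<close>; the Gaussian itself is reproduced at every angle near 0.\<close>

lemma frft1_tendsto:
  assumes r: "rapid \<gamma>" "rapid \<gamma>'"
    and d: "\<And>s. (\<gamma> has_vector_derivative \<gamma>' s) (at s)"
  shows "((\<lambda>\<alpha>. frft1 \<alpha> \<gamma> y) \<longlongrightarrow> \<gamma> y) (at 0)"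
proof -
  define g :: "real \<Rightarrow> complex" where "g s = of_real (exp (- s\<^sup>2 / 2))" for s
  define g' :: "real \<Rightarrow> complex" where "g' s = of_real (- s * exp (- s\<^sup>2 / 2))" for s
  have dg: "(g has_vector_derivative g' s) (at s)" for s
    unfolding g_def[abs_def] g'_def[abs_def]
    by (rule has_vector_derivative_of_real) (auto intro!: derivative_eq_intros simp: power2_eq_square algebra_simps)
  have b: "u \<le> (1 + s\<^sup>2)\<^sup>2" if "u \<le> 1 + s\<^sup>2" for u s :: real
  proof -
    have "(1 + s\<^sup>2) * 1 \<le> (1 + s\<^sup>2) * (1 + s\<^sup>2)" by (intro mult_left_mono) auto
    with that show ?thesis by (simp add: power2_eq_square)
  qed
  have sq: "\<bar>s\<bar> \<le> 1 + s\<^sup>2" for s :: real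
    using sum_squares_bound[of "\<bar>s\<bar>" 1] by simp
  have r1: "rapid g" using rapid_gaussian[of "\<lambda>_. 1"] b by (simp add: g_def[abs_def])
  have r2: "rapid g'" unfolding g'_def[abs_def] by (rule rapid_gaussian) (auto intro!: b continuous_intros simp: sq)
  define k where "k = - (\<gamma> y / g y)"
  let ?h = "\<lambda>s. 1 * \<gamma> s + k * g s"
  have h0: "?h y = 0" by (simp add: k_def g_def)
  have "((\<lambda>\<alpha>. frft1 \<alpha> ?h y) \<longlongrightarrow> 0) (at 0)"
  proof (rule frft1_tendsto_zero[where \<gamma>'="\<lambda>s. 1 * \<gamma>' s + k * g' s"])
    show "1 * \<gamma> y + k * g y = 0" by (rule h0)
    show "rapid ?h" by (intro rapid_add rapid_cmult r r1)
    show "rapid (\<lambda>s. 1 * \<gamma>' s + k * g' s)" by (intro rapid_add rapid_cmult r r2)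
    show "(?h has_vector_derivative 1 * \<gamma>' s + k * g' s) (at s)" for s
      by (intro has_vector_derivative_add has_vector_derivative_mult_right d dg)
  qed
  then have "((\<lambda>\<alpha>. frft1 \<alpha> ?h y - k * g y) \<longlongrightarrow> 0 - k * g y) (at 0)" by (intro tendsto_intros)
  then have "((\<lambda>\<alpha>. frft1 \<alpha> ?h y - k * g y) \<longlongrightarrow> \<gamma> y) (at 0)" by (simp add: k_def g_def)
  moreover have "\<forall>\<^sub>F \<alpha> in at 0. frft1 \<alpha> ?h y - k * g y = frft1 \<alpha> \<gamma> y"
  proof -
    have "\<forall>\<^sub>F \<alpha> in at 0. \<bar>\<alpha>\<bar> < pi / 2"
      using pi_gt_zero by (auto simp: eventually_at dist_real_def intro!: exI[of _ "pi / 2"])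
    then show ?thesis
    proof eventually_elim
      case (elim \<alpha>)
      then have "frft1 \<alpha> g y = g y" unfolding g_def by (intro frft1_gaussian) simp
      then show ?case using frft1_add[OF r(1) r1, of \<alpha> 1 k y] by simp
    qed
  qed
  ultimately show ?thesis by (rule Lim_transform_eventually)
qed

section \<open>Equicontinuous operators on Schwartz functions\<close>

declare One_nat_def [simp del]

section \<open>Partial derivatives and Schwartz space\<close>

definition mx :: "nat \<Rightarrow> ((nat \<Rightarrow> real) \<Rightarrow> complex) \<Rightarrow> (nat \<Rightarrow> real) \<Rightarrow> complex"
  where "mx i f x = of_real (x i) * f x"

lemma Rm_upd [simp]: "j \<in> {1..m} \<Longrightarrow> x(j := t) \<in> Rm m \<longleftrightarrow> x \<in> Rm m"
  by (auto simp: PiE_iff extensional_def)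

lemma monomial_0 [simp]: "monomial m (\<lambda>_. 0) x = 1"
  by (simp add: monomial_def)

lemma monomial_Suc:
  assumes "j \<in> {1..m}"
  shows "monomial m (\<beta>(j := Suc (\<beta> j))) x = of_real (x j) * monomial m \<beta> x"
proof -
  have "(\<Prod>i\<in>{1..m}. x i ^ (\<beta>(j := Suc (\<beta> j))) i) = x j ^ Suc (\<beta> j) * (\<Prod>i\<in>{1..m} - {j}. x i ^ \<beta> i)"
    using assms by (subst prod.remove[of _ j]) auto
  also have "\<dots> = x j * (\<Prod>i\<in>{1..m}. x i ^ \<beta> i)"
    using assms by (subst (2) prod.remove[of _ j]) auto
  finally show ?thesis unfolding monomial_def by simp
qed

lemma monomial_double: "monomial m (\<lambda>i. 2 * \<beta> i) x = (monomial m \<beta> x)\<^sup>2"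
  by (simp add: monomial_def power_mult power_commutes prod_power_distrib flip: of_real_power)
     (simp add: power2_eq_square power_mult_distrib flip: power_mult prod.distrib power_add mult_2)

text \<open>The part of membership in \<open>schwartz\<close> that makes \<open>pd\<close> linear.
  The vanishing outside \<open>Rm m\<close> turns identities between operators into equalities of
  functions.\<close>

definition adm :: "nat \<Rightarrow> ((nat \<Rightarrow> real) \<Rightarrow> complex) \<Rightarrow> bool"
  where "adm m f \<longleftrightarrow> (\<forall>x. x \<notin> Rm m \<longrightarrow> f x = 0) \<and>
    (\<forall>j\<in>{1..m}. \<forall>x\<in>Rm m. (\<lambda>t. f (x(j := t))) differentiable (at (x j)))"

lemma adm_deriv:
  assumes "adm m f" "j \<in> {1..m}" "x \<in> Rm m"
  shows "((\<lambda>t. f (x(j := t))) has_vector_derivative pd j f (x(j := t0))) (at t0)"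
proof -
  have "x(j := t0) \<in> Rm m" using assms by simp
  then have "(\<lambda>t. f ((x(j := t0))(j := t))) differentiable (at ((x(j := t0)) j))"
    using assms(1,2) unfolding adm_def by blast
  then show ?thesis unfolding vector_derivative_works pd_def by simp
qed

lemma pdI:
  assumes "((\<lambda>t. f (x(j := t))) has_vector_derivative D) (at (x j))"
  shows "pd j f x = D"
  unfolding pd_def by (rule vector_derivative_at[OF assms])

lemma pd_outside:
  assumes "\<And>x. x \<notin> Rm m \<Longrightarrow> f x = 0" "j \<in> {1..m}" "x \<notin> Rm m"
  shows "pd j f x = 0"
  by (rule pdI) (use assms in simp)

lemma admI:
  assumes "\<And>x. x \<notin> Rm m \<Longrightarrow> f x = 0"
    and "\<And>j x. j \<in> {1..m} \<Longrightarrow> x \<in> Rm m \<Longrightarrow> ((\<lambda>t. f (x(j := t))) has_vector_derivative D j x) (at (x j))"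
  shows "adm m f"
  using assms unfolding adm_def by (blast intro: differentiableI_vector)

lemma adm_lincomb:
  assumes "adm m f" "adm m g"
  shows "adm m (\<lambda>x. a * f x + b * g x)"
    and "j \<in> {1..m} \<Longrightarrow> pd j (\<lambda>x. a * f x + b * g x) = (\<lambda>x. a * pd j f x + b * pd j g x)"
proof -
  have d: "((\<lambda>t. a * f (x(j := t)) + b * g (x(j := t))) has_vector_derivative a * pd j f x + b * pd j g x) (at (x j))"
    if "j \<in> {1..m}" "x \<in> Rm m" for j x
    using adm_deriv[OF assms(1) that, of "x j"] adm_deriv[OF assms(2) that, of "x j"]
    by (intro has_vector_derivative_add has_vector_derivative_mult_right) simp_all
  show "adm m (\<lambda>x. a * f x + b * g x)"
    by (rule admI[where D="\<lambda>j x. a * pd j f x + b * pd j g x"]) (use d assms in \<open>auto simp: adm_def\<close>)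
  assume j: "j \<in> {1..m}"
  show "pd j (\<lambda>x. a * f x + b * g x) = (\<lambda>x. a * pd j f x + b * pd j g x)"
  proof
    fix x
    show "pd j (\<lambda>x. a * f x + b * g x) x = a * pd j f x + b * pd j g x"
    proof (cases "x \<in> Rm m")
      case True then show ?thesis by (intro pdI d j)
    next
      case False
      then show ?thesis using assms j pd_outside[of m _ j x] unfolding adm_def by simp
    qed
  qed
qed

lemma pds_Nil [simp]: "pds [] f = f" and pds_Cons [simp]: "pds (j # js) f = pd j (pds js f)"
  and pds_append: "pds (js @ ks) f = pds js (pds ks f)"
  by (simp_all add: pds_def)

lemma schwartz_iff:
  "f \<in> schwartz m \<longleftrightarrow> (\<forall>js. set js \<subseteq> {1..m} \<longrightarrow> adm m (pds js f) \<and>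
     (\<forall>\<beta>. \<exists>c. \<forall>x\<in>Rm m. norm (monomial m \<beta> x * pds js f x) \<le> c))" (is "_ \<longleftrightarrow> ?R")
proof
  assume f: "f \<in> schwartz m"
  have o: "x \<notin> Rm m \<Longrightarrow> pds js f x = 0" if "set js \<subseteq> {1..m}" for js x
    using that
  proof (induction js arbitrary: x)
    case Nil then show ?case using f by (simp add: schwartz_def)
  next
    case (Cons j js)
    show ?case unfolding pds_Cons by (rule pd_outside[where m=m]) (use Cons in auto)
  qed
  show ?R using f o unfolding schwartz_def adm_def bounded_iff by auto
next
  assume R: ?R
  have "\<forall>x. x \<notin> Rm m \<longrightarrow> f x = 0" using R[rule_format, of "[]"] by (simp add: adm_def)
  then show "f \<in> schwartz m" using R unfolding schwartz_def adm_def bounded_iff by auto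
qed

lemma schwartz_adm: "f \<in> schwartz m \<Longrightarrow> adm m f"
  using schwartz_iff[of f m] by (metis empty_iff empty_set pds_Nil subsetI)

lemma schwartz_outside: "f \<in> schwartz m \<Longrightarrow> x \<notin> Rm m \<Longrightarrow> f x = 0"
  using schwartz_adm[of f m] by (simp add: adm_def)

lemma pds_schwartz: "f \<in> schwartz m \<Longrightarrow> set js \<subseteq> {1..m} \<Longrightarrow> pds js f \<in> schwartz m"
  unfolding schwartz_iff by (metis le_sup_iff pds_append set_append)

lemma pd_schwartz: "f \<in> schwartz m \<Longrightarrow> j \<in> {1..m} \<Longrightarrow> pd j f \<in> schwartz m"
  using pds_schwartz[of f m "[j]"] by simp

lemma schwartz_deriv:
  "f \<in> schwartz m \<Longrightarrow> j \<in> {1..m} \<Longrightarrow> x \<in> Rm m \<Longrightarrow>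
    ((\<lambda>t. f (x(j := t))) has_vector_derivative pd j f (x(j := t0))) (at t0)"
  by (intro adm_deriv schwartz_adm)

lemma pds_lincomb:
  assumes "f \<in> schwartz m" "g \<in> schwartz m" "set js \<subseteq> {1..m}"
  shows "pds js (\<lambda>x. a * f x + b * g x) = (\<lambda>x. a * pds js f x + b * pds js g x)"
  using assms(3)
proof (induction js)
  case (Cons j js)
  then show ?case
    using adm_lincomb(2)[OF schwartz_adm[OF pds_schwartz[OF assms(1)]] schwartz_adm[OF pds_schwartz[OF assms(2)]], of js js j a b]
    by simp
qed simp

section \<open>Seminorms\<close>

text \<open>Seminorm bounds are expressed as a relation, so that no supremum has to be formed or
  shown to be finite.\<close>

definition sn_le :: "nat \<Rightarrow> (nat list \<times> (nat \<Rightarrow> nat)) set \<Rightarrow> ((nat \<Rightarrow> real) \<Rightarrow> complex) \<Rightarrow> real \<Rightarrow> bool"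
  where "sn_le m \<Theta> f c \<longleftrightarrow> (\<forall>(js, \<beta>)\<in>\<Theta>. \<forall>x\<in>Rm m. norm (monomial m \<beta> x * pds js f x) \<le> c)"

definition index :: "nat \<Rightarrow> (nat list \<times> (nat \<Rightarrow> nat)) set \<Rightarrow> bool"
  where "index m \<Theta> \<longleftrightarrow> finite \<Theta> \<and> (\<forall>(js, \<beta>)\<in>\<Theta>. set js \<subseteq> {1..m})"

lemma index_simps [simp]:
  "index m {}" "index m (insert p \<Theta>) \<longleftrightarrow> set (fst p) \<subseteq> {1..m} \<and> index m \<Theta>"
  "index m (A \<union> B) \<longleftrightarrow> index m A \<and> index m B"
  by (auto simp: index_def split: prod.splits)

lemma sn_leD: "sn_le m \<Theta> f c \<Longrightarrow> (js, \<beta>) \<in> \<Theta> \<Longrightarrow> x \<in> Rm m \<Longrightarrow> norm (monomial m \<beta> x * pds js f x) \<le> c"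
  by (auto simp: sn_le_def)

lemma sn_le_mono: "sn_le m \<Theta> f c \<Longrightarrow> c \<le> c' \<Longrightarrow> \<Theta>' \<subseteq> \<Theta> \<Longrightarrow> sn_le m \<Theta>' f c'"
  by (force simp: sn_le_def)

lemma sn_le_insert: "sn_le m (insert p \<Theta>) f c \<longleftrightarrow>
    (\<forall>x\<in>Rm m. norm (monomial m (snd p) x * pds (fst p) f x) \<le> c) \<and> sn_le m \<Theta> f c"
  by (simp add: sn_le_def case_prod_unfold)

lemma schwartz_sn_le:
  assumes "f \<in> schwartz m" "index m \<Theta>"
  obtains c where "c \<ge> 0" "sn_le m \<Theta> f c"
proof -
  have "finite \<Theta>" using assms by (simp add: index_def)
  then have "index m \<Theta> \<Longrightarrow> \<exists>c\<ge>0. sn_le m \<Theta> f c"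
  proof (induction \<Theta>)
    case empty then show ?case by (auto simp: sn_le_def)
  next
    case (insert p \<Theta>)
    then obtain c where c: "c \<ge> 0" "sn_le m \<Theta> f c" by auto
    obtain d where "\<forall>x\<in>Rm m. norm (monomial m (snd p) x * pds (fst p) f x) \<le> d"
      using assms(1) insert.prems unfolding schwartz_iff index_simps by blast
    with c have "sn_le m (insert p \<Theta>) f (max c d)" unfolding sn_le_def by (force split: prod.splits)
    with c show ?case by (auto intro!: exI[of _ "max c d"])
  qed
  with assms that show ?thesis by blast
qed

section \<open>Equicontinuous families of operators\<close>

type_synonym cop = "((nat \<Rightarrow> real) \<Rightarrow> complex) \<Rightarrow> (nat \<Rightarrow> real) \<Rightarrow> complex"

text \<open>Equicontinuity into the bounded functions with the sup norm: the constant and the finite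
  set of seminorms are shared by the whole family.\<close>

definition bdd_ops :: "nat \<Rightarrow> cop set \<Rightarrow> bool"
  where "bdd_ops m \<U> \<longleftrightarrow> (\<exists>K\<ge>0. \<exists>\<Theta>. index m \<Theta> \<and> (\<forall>U\<in>\<U>. \<forall>f\<in>schwartz m. \<forall>c\<ge>0. sn_le m \<Theta> f c \<longrightarrow>
    (\<forall>x\<in>Rm m. norm (U f x) \<le> K * c)))"

definition equi :: "nat \<Rightarrow> cop set \<Rightarrow> bool"
  where "equi m \<U> \<longleftrightarrow> (\<forall>U\<in>\<U>. \<forall>f\<in>schwartz m. U f \<in> schwartz m) \<and>
    (\<forall>js \<beta>. set js \<subseteq> {1..m} \<longrightarrow> bdd_ops m ((\<lambda>U f x. monomial m \<beta> x * pds js (U f) x) ` \<U>))"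

lemma bdd_ops_imageE:
  assumes "bdd_ops m (F ` \<U>)"
  obtains K \<Theta> where "K \<ge> 0" "index m \<Theta>" "\<And>U f c x. U \<in> \<U> \<Longrightarrow> f \<in> schwartz m \<Longrightarrow> c \<ge> 0 \<Longrightarrow>
    sn_le m \<Theta> f c \<Longrightarrow> x \<in> Rm m \<Longrightarrow> norm (F U f x) \<le> K * c"
  using assms unfolding bdd_ops_def ball_simps by metis

lemma equi_index:
  assumes "equi m \<U>" "index m \<Theta>"
  obtains K \<Theta>' where "K \<ge> 0" "index m \<Theta>'"
    "\<And>U f c. U \<in> \<U> \<Longrightarrow> f \<in> schwartz m \<Longrightarrow> c \<ge> 0 \<Longrightarrow> sn_le m \<Theta>' f c \<Longrightarrow> sn_le m \<Theta> (U f) (K * c)"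
proof -
  have "finite \<Theta>" using assms by (simp add: index_def)
  then have "index m \<Theta> \<Longrightarrow> \<exists>K\<ge>0. \<exists>\<Theta>'. index m \<Theta>' \<and> (\<forall>U\<in>\<U>. \<forall>f\<in>schwartz m. \<forall>c\<ge>0. sn_le m \<Theta>' f c \<longrightarrow> sn_le m \<Theta> (U f) (K * c))"
  proof (induction \<Theta>)
    case empty then show ?case by (auto simp: sn_le_def intro!: exI[of _ 0] exI[of _ "{}"])
  next
    case (insert p \<Theta>)
    then obtain K \<Theta>' where K: "K \<ge> 0" "index m \<Theta>'"
      "\<And>U f c. U \<in> \<U> \<Longrightarrow> f \<in> schwartz m \<Longrightarrow> c \<ge> 0 \<Longrightarrow> sn_le m \<Theta>' f c \<Longrightarrow> sn_le m \<Theta> (U f) (K * c)"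
      by auto
    obtain L \<Psi> where L: "L \<ge> 0" "index m \<Psi>" "\<And>U f c x. U \<in> \<U> \<Longrightarrow> f \<in> schwartz m \<Longrightarrow> c \<ge> 0 \<Longrightarrow> sn_le m \<Psi> f c \<Longrightarrow>
        x \<in> Rm m \<Longrightarrow> norm (monomial m (snd p) x * pds (fst p) (U f) x) \<le> L * c"
    proof -
      have "bdd_ops m ((\<lambda>U f x. monomial m (snd p) x * pds (fst p) (U f) x) ` \<U>)"
        using assms(1) insert.prems by (simp add: equi_def)
      then show ?thesis by (rule bdd_ops_imageE) (rule that; assumption)
    qed
    have "sn_le m (insert p \<Theta>) (U f) (max K L * c)"
      if "U \<in> \<U>" "f \<in> schwartz m" "c \<ge> 0" "sn_le m (\<Theta>' \<union> \<Psi>) f c" for U f c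
    proof -
      have "sn_le m \<Theta>' f c" "sn_le m \<Psi> f c" using that(4) by (auto intro: sn_le_mono)
      with K(3)[OF that(1-3)] L(3)[OF that(1-3)]
      have 1: "sn_le m \<Theta> (U f) (K * c)" "\<forall>x\<in>Rm m. norm (monomial m (snd p) x * pds (fst p) (U f) x) \<le> L * c"
        by auto
      have "K * c \<le> max K L * c" "L * c \<le> max K L * c" using that(3) by (auto intro: mult_right_mono)
      with 1 show ?thesis
        using sn_le_mono[OF 1(1), of "max K L * c" \<Theta>] order_trans[of _ "L * c" "max K L * c"]
        unfolding sn_le_insert by blast
    qed
    then show ?case using K(1,2) L(1,2) by (intro exI[of _ "max K L"] conjI exI[of _ "\<Theta>' \<union> \<Psi>"]) auto
  qed
  with assms that show ?thesis by blast
qed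

lemma bdd_ops_subset: "bdd_ops m \<V> \<Longrightarrow> (\<And>U. U \<in> \<U> \<Longrightarrow> \<exists>V\<in>\<V>. \<forall>f\<in>schwartz m. U f = V f) \<Longrightarrow> bdd_ops m \<U>"
  unfolding bdd_ops_def by metis

lemma bdd_ops_comp:
  assumes "bdd_ops m \<U>" "equi m \<P>"
  shows "bdd_ops m {\<lambda>f. U (P f) |U P. U \<in> \<U> \<and> P \<in> \<P>}"
proof -
  obtain K \<Theta> where K: "K \<ge> 0" "index m \<Theta>"
    "\<And>U f c x. U \<in> \<U> \<Longrightarrow> f \<in> schwartz m \<Longrightarrow> c \<ge> 0 \<Longrightarrow> sn_le m \<Theta> f c \<Longrightarrow> x \<in> Rm m \<Longrightarrow> norm (U f x) \<le> K * c"
    using assms(1) unfolding bdd_ops_def by blast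
  obtain L \<Psi> where L: "L \<ge> 0" "index m \<Psi>"
    "\<And>P f c. P \<in> \<P> \<Longrightarrow> f \<in> schwartz m \<Longrightarrow> c \<ge> 0 \<Longrightarrow> sn_le m \<Psi> f c \<Longrightarrow> sn_le m \<Theta> (P f) (L * c)"
    using equi_index[OF assms(2) K(2)] by metis
  have "norm (U (P f) x) \<le> (K * L) * c" if "U \<in> \<U>" "P \<in> \<P>" "f \<in> schwartz m" "c \<ge> 0" "sn_le m \<Psi> f c" "x \<in> Rm m" for U P f c x
    using K(3)[OF that(1) _ _ L(3)[OF that(2-5)] that(6)] assms(2) that L(1) by (auto simp: equi_def mult.assoc)
  then show ?thesis unfolding bdd_ops_def using K(1) L(1,2)
    by (intro exI[of _ "K * L"] conjI exI[of _ \<Psi>]) auto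
qed

lemma bdd_ops_sum:
  assumes "bdd_ops m \<U>" "bdd_ops m \<V>"
  shows "bdd_ops m {\<lambda>f x. a * U f x + b * V f x |a b U V. norm a \<le> A \<and> norm b \<le> A \<and> U \<in> \<U> \<and> V \<in> \<V>}"
proof -
  obtain K \<Theta> where K: "K \<ge> 0" "index m \<Theta>"
    "\<And>U f c x. U \<in> \<U> \<Longrightarrow> f \<in> schwartz m \<Longrightarrow> c \<ge> 0 \<Longrightarrow> sn_le m \<Theta> f c \<Longrightarrow> x \<in> Rm m \<Longrightarrow> norm (U f x) \<le> K * c"
    using assms(1) unfolding bdd_ops_def by blast
  obtain L \<Psi> where L: "L \<ge> 0" "index m \<Psi>"
    "\<And>U f c x. U \<in> \<V> \<Longrightarrow> f \<in> schwartz m \<Longrightarrow> c \<ge> 0 \<Longrightarrow> sn_le m \<Psi> f c \<Longrightarrow> x \<in> Rm m \<Longrightarrow> norm (U f x) \<le> L * c"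
    using assms(2) unfolding bdd_ops_def by blast
  have "norm (a * U f x + b * V f x) \<le> (\<bar>A\<bar> * (K + L)) * c"
    if "norm a \<le> A" "norm b \<le> A" "U \<in> \<U>" "V \<in> \<V>" "f \<in> schwartz m" "c \<ge> 0" "sn_le m (\<Theta> \<union> \<Psi>) f c" "x \<in> Rm m" for a b U V f c x
  proof -
    have s: "sn_le m \<Theta> f c" "sn_le m \<Psi> f c" using that(7) by (auto intro: sn_le_mono)
    have "norm (U f x) \<le> K * c" "norm (V f x) \<le> L * c"
      by (rule K(3)[OF that(3,5,6) s(1) that(8)], rule L(3)[OF that(4,5,6) s(2) that(8)])
    then have "norm (a * U f x) + norm (b * V f x) \<le> \<bar>A\<bar> * (K * c) + \<bar>A\<bar> * (L * c)"
      using that(1,2) unfolding norm_mult by (intro add_mono mult_mono) auto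
    then show ?thesis using norm_triangle_ineq[of "a * U f x" "b * V f x"] by (simp add: algebra_simps)
  qed
  then show ?thesis unfolding bdd_ops_def using K(1,2) L(1,2)
    by (intro exI[of _ "\<bar>A\<bar> * (K + L)"] conjI exI[of _ "\<Theta> \<union> \<Psi>"]) auto
qed

lemma bdd_ops_single:
  "set js \<subseteq> {1..m} \<Longrightarrow> bdd_ops m {\<lambda>f x. monomial m \<beta> x * pds js f x}"
  unfolding bdd_ops_def
  by (intro exI[of _ 1] conjI exI[of _ "{(js, \<beta>)}"]) (auto simp: sn_le_def)

lemma schwartzI:
  assumes "\<And>js. set js \<subseteq> {1..m} \<Longrightarrow> adm m (pds js f)"
    and "\<And>js \<beta>. set js \<subseteq> {1..m} \<Longrightarrow> \<exists>c. \<forall>x\<in>Rm m. norm (monomial m \<beta> x * pds js f x) \<le> c"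
  shows "f \<in> schwartz m"
  using assms unfolding schwartz_iff by blast

lemma schwartz_lincomb:
  assumes "f \<in> schwartz m" "g \<in> schwartz m"
  shows "(\<lambda>x. a * f x + b * g x) \<in> schwartz m"
proof (rule schwartzI)
  fix js assume js: "set js \<subseteq> {1..m}"
  show "adm m (pds js (\<lambda>x. a * f x + b * g x))"
    unfolding pds_lincomb[OF assms js] by (intro adm_lincomb schwartz_adm pds_schwartz assms js)
  fix \<beta>
  obtain c d where c: "\<forall>x\<in>Rm m. norm (monomial m \<beta> x * pds js f x) \<le> c"
    and d: "\<forall>x\<in>Rm m. norm (monomial m \<beta> x * pds js g x) \<le> d"
    using assms js unfolding schwartz_iff by blast
  have "norm (monomial m \<beta> x * (a * pds js f x + b * pds js g x)) \<le> norm a * c + norm b * d" if "x \<in> Rm m" for x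
  proof -
    have "monomial m \<beta> x * (a * pds js f x + b * pds js g x)
      = a * (monomial m \<beta> x * pds js f x) + b * (monomial m \<beta> x * pds js g x)"
      by (simp add: algebra_simps)
    also have "norm \<dots> \<le> norm a * c + norm b * d"
      using c d that by (intro order_trans[OF norm_triangle_ineq] add_mono) (auto simp only: norm_mult[of a] norm_mult[of b] intro!: mult_left_mono norm_ge_zero)
    finally show ?thesis .
  qed
  then show "\<exists>c. \<forall>x\<in>Rm m. norm (monomial m \<beta> x * pds js (\<lambda>x. a * f x + b * g x) x) \<le> c"
    unfolding pds_lincomb[OF assms js] by blast
qed

lemma schwartz_zero: "(\<lambda>_. 0) \<in> schwartz m"
proof -
  have z: "pds js (\<lambda>_. 0) = (\<lambda>_. 0)" for js
  proof (induction js)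
    case (Cons j js)
    show ?case unfolding pds_Cons Cons by (intro ext pdI) simp
  qed simp
  show ?thesis by (rule schwartzI) (auto simp: z adm_def)
qed

lemma schwartz_cmult: "f \<in> schwartz m \<Longrightarrow> (\<lambda>x. a * f x) \<in> schwartz m"
  using schwartz_lincomb[of f m f a 0] by simp

lemma schwartz_add: "f \<in> schwartz m \<Longrightarrow> g \<in> schwartz m \<Longrightarrow> (\<lambda>x. f x + g x) \<in> schwartz m"
  using schwartz_lincomb[of f m g 1 1] by simp

lemma schwartz_diff: "f \<in> schwartz m \<Longrightarrow> g \<in> schwartz m \<Longrightarrow> (\<lambda>x. f x - g x) \<in> schwartz m"
  using schwartz_lincomb[of f m g 1 "-1"] by simp

lemma schwartz_sum: "(\<And>i. i \<in> I \<Longrightarrow> f i \<in> schwartz m) \<Longrightarrow> (\<lambda>x. \<Sum>i\<in>I. f i x) \<in> schwartz m"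
  by (induction I rule: infinite_finite_induct) (auto intro: schwartz_zero schwartz_add)

lemma equi_subset:
  assumes "equi m \<V>" "\<And>U. U \<in> \<U> \<Longrightarrow> \<exists>V\<in>\<V>. \<forall>f\<in>schwartz m. U f = V f"
  shows "equi m \<U>"
  unfolding equi_def
proof (intro conjI allI impI ballI)
  fix U f assume "U \<in> \<U>" "f \<in> schwartz m"
  then show "U f \<in> schwartz m" using assms unfolding equi_def by metis
next
  fix js :: "nat list" and \<beta> assume "set js \<subseteq> {1..m}"
  then have "bdd_ops m ((\<lambda>U f x. monomial m \<beta> x * pds js (U f) x) ` \<V>)" using assms by (auto simp: equi_def)
  then show "bdd_ops m ((\<lambda>U f x. monomial m \<beta> x * pds js (U f) x) ` \<U>)"
  proof (rule bdd_ops_subset)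
    fix W assume "W \<in> (\<lambda>U f x. monomial m \<beta> x * pds js (U f) x) ` \<U>"
    then obtain U where U: "U \<in> \<U>" "W = (\<lambda>f x. monomial m \<beta> x * pds js (U f) x)" by blast
    from assms(2)[OF U(1)] obtain V where "V \<in> \<V>" "\<forall>f\<in>schwartz m. U f = V f" by blast
    then show "\<exists>V\<in>(\<lambda>U f x. monomial m \<beta> x * pds js (U f) x) ` \<V>. \<forall>f\<in>schwartz m. W f = V f"
      using U by (intro bexI[of _ "\<lambda>f x. monomial m \<beta> x * pds js (V f) x"]) auto
  qed
qed

lemma equi_comp:
  assumes "equi m \<U>" "equi m \<P>"
  shows "equi m {\<lambda>f. U (P f) |U P. U \<in> \<U> \<and> P \<in> \<P>}"
  unfolding equi_def
proof (intro conjI allI impI ballI)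
  fix js :: "nat list" and \<beta> assume "set js \<subseteq> {1..m}"
  then have "bdd_ops m ((\<lambda>U f x. monomial m \<beta> x * pds js (U f) x) ` \<U>)" using assms by (auto simp: equi_def)
  from bdd_ops_comp[OF this assms(2)]
  show "bdd_ops m ((\<lambda>U f x. monomial m \<beta> x * pds js (U f) x) ` {\<lambda>f. U (P f) |U P. U \<in> \<U> \<and> P \<in> \<P>})"
  proof (rule bdd_ops_subset)
    fix X assume "X \<in> (\<lambda>U f x. monomial m \<beta> x * pds js (U f) x) ` {\<lambda>f. U (P f) |U P. U \<in> \<U> \<and> P \<in> \<P>}"
    then obtain U P where "U \<in> \<U>" "P \<in> \<P>" "X = (\<lambda>f x. monomial m \<beta> x * pds js (U (P f)) x)" by blast
    then show "\<exists>Y\<in>{\<lambda>f. U (P f) |U P. U \<in> (\<lambda>U f x. monomial m \<beta> x * pds js (U f) x) ` \<U> \<and> P \<in> \<P>}.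
        \<forall>f\<in>schwartz m. X f = Y f"
      by (intro bexI[of _ X] CollectI exI[of _ "\<lambda>f x. monomial m \<beta> x * pds js (U f) x"] exI[of _ P]) simp_all
  qed
qed (use assms in \<open>auto simp: equi_def\<close>)

lemma equi_sum:
  assumes "equi m \<U>" "equi m \<V>"
  shows "equi m {\<lambda>f x. a * U f x + b * V f x |a b U V. norm a \<le> A \<and> norm b \<le> A \<and> U \<in> \<U> \<and> V \<in> \<V>}" (is "equi m ?W")
  unfolding equi_def
proof (intro conjI allI impI ballI)
  fix js :: "nat list" and \<beta> assume js: "set js \<subseteq> {1..m}"
  then have 1: "bdd_ops m ((\<lambda>U f x. monomial m \<beta> x * pds js (U f) x) ` \<U>)"
    "bdd_ops m ((\<lambda>U f x. monomial m \<beta> x * pds js (U f) x) ` \<V>)" using assms by (auto simp: equi_def)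
  show "bdd_ops m ((\<lambda>U f x. monomial m \<beta> x * pds js (U f) x) ` ?W)"
  proof (rule bdd_ops_subset[OF bdd_ops_sum[OF 1, of A]])
    fix X assume "X \<in> (\<lambda>U f x. monomial m \<beta> x * pds js (U f) x) ` ?W"
    then obtain a b U V where X: "X = (\<lambda>f x. monomial m \<beta> x * pds js (\<lambda>x. a * U f x + b * V f x) x)"
      "norm a \<le> A" "norm b \<le> A" "U \<in> \<U>" "V \<in> \<V>" by blast
    have "X f = (\<lambda>x. a * (monomial m \<beta> x * pds js (U f) x) + b * (monomial m \<beta> x * pds js (V f) x))"
      if "f \<in> schwartz m" for f
    proof -
      have "U f \<in> schwartz m" "V f \<in> schwartz m" using assms X that by (simp_all add: equi_def)
      then show ?thesis unfolding X(1) by (simp only: pds_lincomb[OF _ _ js]) (simp add: algebra_simps)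
    qed
    then show "\<exists>Y\<in>{\<lambda>f x. a * U f x + b * V f x |a b U V. norm a \<le> A \<and> norm b \<le> A
       \<and> U \<in> (\<lambda>U f x. monomial m \<beta> x * pds js (U f) x) ` \<U> \<and> V \<in> (\<lambda>U f x. monomial m \<beta> x * pds js (U f) x) ` \<V>}. \<forall>f\<in>schwartz m. X f = Y f"
      using X(2-5)
      by (intro bexI[of _ "\<lambda>f x. a * (monomial m \<beta> x * pds js (U f) x) + b * (monomial m \<beta> x * pds js (V f) x)"]
          CollectI exI[of _ a] exI[of _ b] exI[of _ "\<lambda>f x. monomial m \<beta> x * pds js (U f) x"]
          exI[of _ "\<lambda>f x. monomial m \<beta> x * pds js (V f) x"]) simp_all
  qed
qed (use assms in \<open>auto simp: equi_def intro: schwartz_lincomb\<close>)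

lemma equi_pds: "set ks \<subseteq> {1..m} \<Longrightarrow> equi m {pds ks}"
  unfolding equi_def using bdd_ops_single[of "_ @ ks" m]
  by (auto simp: pds_schwartz pds_append[symmetric])

lemma equi_pd: "j \<in> {1..m} \<Longrightarrow> equi m {pd j}"
  using equi_pds[of "[j]" m] by (auto intro: equi_subset)

lemma equi_id: "equi m {\<lambda>f. f}"
  using equi_pds[of "[]" m] by (auto intro: equi_subset)

lemma equi_comp1: "equi m {U} \<Longrightarrow> equi m {V} \<Longrightarrow> equi m {\<lambda>f. U (V f)}"
  by (rule equi_subset[OF equi_comp[of m "{U}" "{V}"]]) auto

lemma equi_lincomb1: "equi m {U} \<Longrightarrow> equi m {V} \<Longrightarrow> equi m {\<lambda>f x. a * U f x + b * V f x}"
proof (rule equi_subset[OF equi_sum[of m "{U}" "{V}" "max (norm a) (norm b)"]])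
  show "\<exists>W\<in>{\<lambda>f x. c * S f x + d * T f x |c d S T. norm c \<le> max (norm a) (norm b) \<and> norm d \<le> max (norm a) (norm b) \<and>
      S \<in> {U} \<and> T \<in> {V}}. \<forall>f\<in>schwartz m. X f = W f"
    if "X \<in> {\<lambda>f x. a * U f x + b * V f x}" for X
    using that by (intro bexI[of _ X] CollectI) (simp, rule exI[of _ a], rule exI[of _ b], simp)
qed

text \<open>The commutator of \<open>pds js\<close> with multiplication by coordinate
  \<open>i\<close>, see \<open>pds_mx\<close>. The factors 0 and 1 give every clause the shape of a
  linear combination, to which \<open>equi_lincomb1\<close> applies.\<close>

primrec leibniz :: "nat \<Rightarrow> nat list \<Rightarrow> cop" where
  "leibniz i [] = (\<lambda>f x. 0 * f x + 0 * f x)"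
| "leibniz i (j # js) = (\<lambda>f x. (if i = j then 1 else 0) * pds js f x + 1 * pd j (leibniz i js f) x)"

lemma equi_leibniz: "set js \<subseteq> {1..m} \<Longrightarrow> equi m {leibniz i js}"
proof (induction js)
  case Nil then show ?case unfolding leibniz.simps by (intro equi_lincomb1 equi_id)
next
  case (Cons j js)
  then show ?case unfolding leibniz.simps
    by (intro equi_lincomb1 equi_pds equi_comp1[of m "pd j" "leibniz i js"] equi_pd) auto
qed

lemma adm_mx:
  assumes "adm m f" "i \<in> {1..m}"
  shows "adm m (mx i f)" "j \<in> {1..m} \<Longrightarrow> pd j (mx i f) = (\<lambda>x. (if i = j then 1 else 0) * f x + 1 * mx i (pd j f) x)"
proof -
  have d: "((\<lambda>t. mx i f (x(j := t))) has_vector_derivative (if i = j then 1 else 0) * f x + 1 * mx i (pd j f) x) (at (x j))"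
    if j: "j \<in> {1..m}" and x: "x \<in> Rm m" for j x
  proof -
    have 1: "((\<lambda>t. complex_of_real ((x(j := t)) i)) has_vector_derivative (if i = j then 1 else 0)) (at (x j))"
      by (auto simp: has_vector_derivative_complex_of_real)
    from has_vector_derivative_mult[OF 1 adm_deriv[OF assms(1) j x, of "x j"]]
    show ?thesis unfolding mx_def by (simp add: add.commute)
  qed
  show "adm m (mx i f)"
    by (rule admI[where D="\<lambda>j x. (if i = j then 1 else 0) * f x + 1 * mx i (pd j f) x"]) (use d assms in \<open>auto simp: adm_def mx_def\<close>)
  assume j: "j \<in> {1..m}"
  show "pd j (mx i f) = (\<lambda>x. (if i = j then 1 else 0) * f x + 1 * mx i (pd j f) x)"
  proof
    fix x
    show "pd j (mx i f) x = (if i = j then 1 else 0) * f x + 1 * mx i (pd j f) x"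
    proof (cases "x \<in> Rm m")
      case True then show ?thesis by (intro pdI d j)
    next
      case False
      then show ?thesis using assms j pd_outside[of m _ j x] unfolding adm_def mx_def by simp
    qed
  qed
qed

lemma pds_mx:
  assumes f: "f \<in> schwartz m" and i: "i \<in> {1..m}" and js: "set js \<subseteq> {1..m}"
  shows "pds js (mx i f) = (\<lambda>x. 1 * mx i (pds js f) x + 1 * leibniz i js f x)"
  using js
proof (induction js)
  case (Cons j js)
  then have j: "j \<in> {1..m}" "set js \<subseteq> {1..m}" by auto
  have l: "adm m (leibniz i js f)" using equi_leibniz[OF j(2)] f by (auto simp: equi_def intro: schwartz_adm)
  have a: "adm m (pds js f)" by (intro schwartz_adm pds_schwartz f j)
  show ?case
    unfolding pds_Cons Cons.IH[OF j(2)] adm_lincomb(2)[OF adm_mx(1)[OF a i] l j(1)] adm_mx(2)[OF a i j(1)]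
    by (auto simp: algebra_simps)
qed simp

lemma equi_mx:
  assumes i: "i \<in> {1..m}"
  shows "equi m {mx i}"
proof -
  have b: "bdd_ops m {\<lambda>f x. monomial m \<beta> x * pds js (mx i f) x}" if js: "set js \<subseteq> {1..m}" for js \<beta>
  proof -
    have 1: "bdd_ops m {\<lambda>f x. monomial m \<beta> x * pds [] (leibniz i js f) x}"
      using equi_leibniz[OF js, of i, unfolded equi_def, THEN conjunct2, rule_format, of "[]" \<beta>] by simp
    show ?thesis
    proof (rule bdd_ops_subset[OF bdd_ops_sum[OF bdd_ops_single[OF js, of "\<beta>(i := Suc (\<beta> i))"] 1, of 1]])
      fix X assume "X \<in> {\<lambda>f x. monomial m \<beta> x * pds js (mx i f) x}"
      then have "\<forall>f\<in>schwartz m. X f = (\<lambda>x. 1 * (monomial m (\<beta>(i := Suc (\<beta> i))) x * pds js f x)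
          + 1 * (monomial m \<beta> x * pds [] (leibniz i js f) x))"
        by (auto simp: pds_mx[OF _ i js] monomial_Suc[OF i] mx_def algebra_simps)
      then show "\<exists>V\<in>{\<lambda>f x. a * U f x + b * V f x |a b U V. norm a \<le> 1 \<and> norm b \<le> 1 \<and>
            U \<in> {\<lambda>f x. monomial m (\<beta>(i := Suc (\<beta> i))) x * pds js f x} \<and>
            V \<in> {\<lambda>f x. monomial m \<beta> x * pds [] (leibniz i js f) x}}. \<forall>f\<in>schwartz m. X f = V f"
        by (intro bexI[of _ "\<lambda>f x. 1 * (monomial m (\<beta>(i := Suc (\<beta> i))) x * pds js f x)
              + 1 * (monomial m \<beta> x * pds [] (leibniz i js f) x)"] CollectI exI[of _ 1]
            exI[of _ "\<lambda>f x. monomial m (\<beta>(i := Suc (\<beta> i))) x * pds js f x"]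
            exI[of _ "\<lambda>f x. monomial m \<beta> x * pds [] (leibniz i js f) x"]) simp_all
    qed
  qed
  have "mx i f \<in> schwartz m" if f: "f \<in> schwartz m" for f
  proof (rule schwartzI)
    fix js assume js: "set js \<subseteq> {1..m}"
    have "adm m (leibniz i js f)" using equi_leibniz[OF js] f by (auto simp: equi_def intro: schwartz_adm)
    then show "adm m (pds js (mx i f))"
      unfolding pds_mx[OF f i js]
      by (intro adm_lincomb(1) adm_mx(1) schwartz_adm[OF pds_schwartz[OF f js]] i)
    fix \<beta>
    obtain K \<Theta> where K: "index m \<Theta>" "\<And>f c x. f \<in> schwartz m \<Longrightarrow> c \<ge> 0 \<Longrightarrow> sn_le m \<Theta> f c \<Longrightarrow> x \<in> Rm m \<Longrightarrow>
      norm (monomial m \<beta> x * pds js (mx i f) x) \<le> K * c"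
      using b[OF js, of \<beta>] unfolding bdd_ops_def ball_simps by metis
    obtain c where "c \<ge> 0" "sn_le m \<Theta> f c" by (rule schwartz_sn_le[OF f K(1)])
    with K(2)[OF f] show "\<exists>c. \<forall>x\<in>Rm m. norm (monomial m \<beta> x * pds js (mx i f) x) \<le> c" by blast
  qed
  with b show ?thesis unfolding equi_def by auto
qed

lemma mx_schwartz: "f \<in> schwartz m \<Longrightarrow> i \<in> {1..m} \<Longrightarrow> mx i f \<in> schwartz m"
  using equi_mx[of i m] by (simp add: equi_def)

section \<open>Families stable under coordinates and derivatives\<close>

text \<open>The sup norm bound must persist after up to \<open>k\<close> further applications of
  \<open>pd i\<close> and \<open>mx i\<close> in any order. Every Schwartz seminorm of
  \<open>U f\<close> is the sup norm of such a word applied to \<open>U f\<close>, hence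
  \<open>stable_equi\<close>. Intertwining relations treat one letter at a time, which fits the
  recursion.\<close>

primrec stable :: "nat \<Rightarrow> nat \<Rightarrow> cop set \<Rightarrow> bool" where
  "stable m 0 \<U> \<longleftrightarrow> bdd_ops m \<U> \<and> (\<forall>U\<in>\<U>. \<forall>f\<in>schwartz m. adm m (U f))"
| "stable m (Suc k) \<U> \<longleftrightarrow> bdd_ops m \<U> \<and> (\<forall>U\<in>\<U>. \<forall>f\<in>schwartz m. adm m (U f)) \<and>
    (\<forall>i\<in>{1..m}. stable m k ((\<lambda>U f. pd i (U f)) ` \<U>) \<and> stable m k ((\<lambda>U f. mx i (U f)) ` \<U>))"

lemma stable_0: "stable m k \<U> \<Longrightarrow> stable m 0 \<U>"
  by (cases k) simp_all

lemma stable_SucD: "stable m (Suc k) \<U> \<Longrightarrow> stable m k \<U>"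
proof (induction k arbitrary: \<U>)
  case (Suc k)
  have "stable m k ((\<lambda>U f. pd i (U f)) ` \<U>)" "stable m k ((\<lambda>U f. mx i (U f)) ` \<U>)" if "i \<in> {1..m}" for i
    by (rule Suc.IH, use Suc.prems[unfolded stable.simps(2)[of m "Suc k"]] that in blast)+
  then show ?case
    using stable_0[OF Suc.prems] unfolding stable.simps(2)[of m k] stable.simps(1) by (simp only:) simp
qed simp

lemma stable_subset:
  "stable m k \<V> \<Longrightarrow> (\<And>U. U \<in> \<U> \<Longrightarrow> \<exists>V\<in>\<V>. \<forall>f\<in>schwartz m. U f = V f) \<Longrightarrow> stable m k \<U>"
proof (induction k arbitrary: \<U> \<V>)
  case 0
  have "bdd_ops m \<U>" by (rule bdd_ops_subset[OF _ 0(2)]) (use 0(1) in simp)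
  moreover have "adm m (U f)" if UU: "U \<in> \<U>" and ff: "f \<in> schwartz m" for U f
  proof -
    obtain V where "V \<in> \<V>" "U f = V f" using 0(2)[OF UU] ff by metis
    then show ?thesis using 0(1) ff by simp
  qed
  ultimately show ?case by simp
next
  case (Suc k)
  have z: "stable m 0 \<U>"
    by (rule stable_0[OF Suc.IH[OF stable_SucD[OF Suc.prems(1)] Suc.prems(2)]])
  have "stable m k ((\<lambda>U f. pd i (U f)) ` \<U>)" "stable m k ((\<lambda>U f. mx i (U f)) ` \<U>)" if i: "i \<in> {1..m}" for i
  proof -
    have 1: "stable m k ((\<lambda>U f. pd i (U f)) ` \<V>)" "stable m k ((\<lambda>U f. mx i (U f)) ` \<V>)"
      using Suc.prems(1) i by simp_all
    have *: "\<exists>V\<in>(\<lambda>U f. F (U f)) ` \<V>. \<forall>f\<in>schwartz m. W f = V f"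
      if "W \<in> (\<lambda>U f. F (U f)) ` \<U>" for W and F :: cop
    proof -
      from that obtain U where U: "U \<in> \<U>" "W = (\<lambda>f. F (U f))" by blast
      from Suc.prems(2)[OF U(1)] obtain V where "V \<in> \<V>" "\<forall>f\<in>schwartz m. U f = V f" by blast
      with U show ?thesis by (intro bexI[of _ "\<lambda>f. F (V f)"]) auto
    qed
    show "stable m k ((\<lambda>U f. pd i (U f)) ` \<U>)" by (rule Suc.IH[OF 1(1)]) (rule *)
    show "stable m k ((\<lambda>U f. mx i (U f)) ` \<U>)" by (rule Suc.IH[OF 1(2)]) (rule *)
  qed
  with z show ?case by simp
qed

lemma stable_comp:
  assumes "equi m \<P>"
  shows "stable m k \<U> \<Longrightarrow> stable m k {\<lambda>f. U (P f) |U P. U \<in> \<U> \<and> P \<in> \<P>}"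
proof (induction k arbitrary: \<U>)
  case 0
  then show ?case using bdd_ops_comp[OF _ assms, of \<U>] assms by (auto simp: equi_def)
next
  case (Suc k)
  have z: "stable m 0 {\<lambda>f. U (P f) |U P. U \<in> \<U> \<and> P \<in> \<P>}"
    using Suc.IH[OF stable_SucD[OF Suc.prems]] by (rule stable_0)
  have *: "\<exists>V\<in>{\<lambda>f. U (P f) |U P. U \<in> (\<lambda>U f. F (U f)) ` \<U> \<and> P \<in> \<P>}. \<forall>f\<in>schwartz m. W f = V f"
    if "W \<in> (\<lambda>U f. F (U f)) ` {\<lambda>f. U (P f) |U P. U \<in> \<U> \<and> P \<in> \<P>}" for W and F :: cop
  proof -
    from that obtain U P where "U \<in> \<U>" "P \<in> \<P>" "W = (\<lambda>f. F (U (P f)))" by blast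
    then show ?thesis by (intro bexI[of _ W] CollectI exI[of _ "\<lambda>f. F (U f)"] exI[of _ P]) auto
  qed
  have "stable m k ((\<lambda>U f. pd i (U f)) ` {\<lambda>f. U (P f) |U P. U \<in> \<U> \<and> P \<in> \<P>})"
    "stable m k ((\<lambda>U f. mx i (U f)) ` {\<lambda>f. U (P f) |U P. U \<in> \<U> \<and> P \<in> \<P>})" if "i \<in> {1..m}" for i
    by (rule stable_subset[OF Suc.IH *]; use Suc.prems that in simp)+
  with z show ?case by simp
qed

lemma stable_sum:
  "stable m k \<U> \<Longrightarrow> stable m k \<V> \<Longrightarrow>
    stable m k {\<lambda>f x. a * U f x + b * V f x |a b U V. norm a \<le> A \<and> norm b \<le> A \<and> U \<in> \<U> \<and> V \<in> \<V>}"
proof (induction k arbitrary: \<U> \<V>)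
  case 0
  then show ?case using bdd_ops_sum[of m \<U> \<V> A] by (auto intro: adm_lincomb(1))
next
  case (Suc k)
  let ?S = "\<lambda>\<U> \<V>. {\<lambda>f x. a * U f x + b * V f x |a b U V. norm a \<le> A \<and> norm b \<le> A \<and> U \<in> \<U> \<and> V \<in> \<V>}"
  have z: "stable m 0 (?S \<U> \<V>)"
    using Suc.IH[OF Suc.prems[THEN stable_SucD]] by (rule stable_0)
  have ad: "\<forall>U\<in>\<U>. \<forall>f\<in>schwartz m. adm m (U f)" "\<forall>V\<in>\<V>. \<forall>f\<in>schwartz m. adm m (V f)"
    using Suc.prems[THEN stable_0] by simp_all
  have *: "\<exists>V\<in>?S ((\<lambda>U f. F (U f)) ` \<U>) ((\<lambda>U f. F (U f)) ` \<V>). \<forall>f\<in>schwartz m. W f = V f"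
    if W: "W \<in> (\<lambda>U f. F (U f)) ` ?S \<U> \<V>"
      and F: "\<And>f g a b. adm m f \<Longrightarrow> adm m g \<Longrightarrow> F (\<lambda>x. a * f x + b * g x) = (\<lambda>x. a * F f x + b * F g x)" for W and F :: cop
  proof -
    from W obtain a b U V where X: "norm a \<le> A" "norm b \<le> A" "U \<in> \<U>" "V \<in> \<V>" "W = (\<lambda>f. F (\<lambda>x. a * U f x + b * V f x))" by blast
    have "W f = (\<lambda>x. a * F (U f) x + b * F (V f) x)" if "f \<in> schwartz m" for f
      unfolding X(5) using ad X(3,4) that by (intro F) auto
    then show ?thesis using X
      by (intro bexI[of _ "\<lambda>f x. a * F (U f) x + b * F (V f) x"] CollectI exI[of _ a] exI[of _ b]
          exI[of _ "\<lambda>f. F (U f)"] exI[of _ "\<lambda>f. F (V f)"]) auto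
  qed
  have "stable m k ((\<lambda>U f. pd i (U f)) ` ?S \<U> \<V>)" if i: "i \<in> {1..m}" for i
  proof -
    have p: "stable m k ((\<lambda>U f. pd i (U f)) ` \<U>)" "stable m k ((\<lambda>U f. pd i (U f)) ` \<V>)"
      using Suc.prems i by simp_all
    show ?thesis
    proof (rule stable_subset[OF Suc.IH[OF p]])
      fix W assume "W \<in> (\<lambda>U f. pd i (U f)) ` ?S \<U> \<V>"
      then show "\<exists>V\<in>?S ((\<lambda>U f. pd i (U f)) ` \<U>) ((\<lambda>U f. pd i (U f)) ` \<V>). \<forall>f\<in>schwartz m. W f = V f"
        by (rule *) (rule adm_lincomb(2)[OF _ _ i])
    qed
  qed
  moreover have "stable m k ((\<lambda>U f. mx i (U f)) ` ?S \<U> \<V>)" if i: "i \<in> {1..m}" for i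
  proof -
    have p: "stable m k ((\<lambda>U f. mx i (U f)) ` \<U>)" "stable m k ((\<lambda>U f. mx i (U f)) ` \<V>)"
      using Suc.prems i by simp_all
    show ?thesis
    proof (rule stable_subset[OF Suc.IH[OF p]])
      fix W assume "W \<in> (\<lambda>U f. mx i (U f)) ` ?S \<U> \<V>"
      then show "\<exists>V\<in>?S ((\<lambda>U f. mx i (U f)) ` \<U>) ((\<lambda>U f. mx i (U f)) ` \<V>). \<forall>f\<in>schwartz m. W f = V f"
        by (rule *) (simp add: mx_def algebra_simps)
    qed
  qed
  ultimately show ?case using z by simp
qed

lemma stable_pds:
  "(\<And>k. stable m k \<U>) \<Longrightarrow> set js \<subseteq> {1..m} \<Longrightarrow> stable m k ((\<lambda>U f. pds js (U f)) ` \<U>)"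
proof (induction js arbitrary: k)
  case (Cons j js)
  then have "stable m (Suc k) ((\<lambda>U f. pds js (U f)) ` \<U>)" by (intro Cons.IH) simp_all
  then have "stable m k ((\<lambda>U f. pd j (U f)) ` (\<lambda>U f. pds js (U f)) ` \<U>)" using Cons.prems by simp
  then show ?case by (simp add: image_image)
qed simp

text \<open>Induction on the total degree: one coordinate factor at a time is absorbed into the
  family as \<open>mx i\<close>.\<close>

lemma stable_monomial:
  assumes "\<And>k. stable m k \<U>"
  shows "bdd_ops m ((\<lambda>U f x. monomial m \<beta> x * U f x) ` \<U>)"
proof -
  have "bdd_ops m ((\<lambda>U f x. monomial m \<beta> x * U f x) ` \<U>)" if "\<And>k. stable m k \<U>" "(\<Sum>i\<in>{1..m}. \<beta> i) = N" for N \<beta> \<U>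
    using that
  proof (induction N arbitrary: \<beta> \<U>)
    case 0
    then have "monomial m \<beta> = (\<lambda>_. 1)" by (simp add: monomial_def fun_eq_iff)
    then show ?case using 0(1)[of 0] by simp
  next
    case (Suc N)
    then obtain i where i: "i \<in> {1..m}" "\<beta> i > 0" by (metis Suc_neq_Zero gr0I sum.neutral)
    define \<gamma> where "\<gamma> = \<beta>(i := \<beta> i - 1)"
    have b: "\<beta> = \<gamma>(i := Suc (\<gamma> i))" using i by (auto simp: \<gamma>_def)
    have "(\<Sum>j\<in>{1..m}. \<beta> j) = \<beta> i + (\<Sum>j\<in>{1..m} - {i}. \<beta> j)" "(\<Sum>j\<in>{1..m}. \<gamma> j) = \<gamma> i + (\<Sum>j\<in>{1..m} - {i}. \<gamma> j)"
      using i by (auto intro: sum.remove)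
    moreover have "(\<Sum>j\<in>{1..m} - {i}. \<gamma> j) = (\<Sum>j\<in>{1..m} - {i}. \<beta> j)" by (auto simp: \<gamma>_def)
    ultimately have "(\<Sum>j\<in>{1..m}. \<gamma> j) = N" using Suc.prems(2) i by (simp add: \<gamma>_def)
    moreover have "stable m k ((\<lambda>U f. mx i (U f)) ` \<U>)" for k using Suc.prems(1)[of "Suc k"] i by simp
    ultimately have "bdd_ops m ((\<lambda>U f x. monomial m \<gamma> x * U f x) ` (\<lambda>U f. mx i (U f)) ` \<U>)" by (intro Suc.IH)
    moreover have "monomial m \<beta> x = of_real (x i) * monomial m \<gamma> x" for x
      by (subst b) (rule monomial_Suc[OF i(1)])
    ultimately show ?case by (simp add: image_image mx_def mult_ac)
  qed
  with assms show ?thesis by blast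
qed

lemma stable_equi:
  assumes "\<And>k. stable m k \<U>"
  shows "equi m \<U>"
proof -
  have b: "bdd_ops m ((\<lambda>U f x. monomial m \<beta> x * pds js (U f) x) ` \<U>)" if "set js \<subseteq> {1..m}" for js \<beta>
    using stable_monomial[OF stable_pds[OF assms that], of \<beta>] by (simp add: image_image)
  have "U f \<in> schwartz m" if U: "U \<in> \<U>" and f: "f \<in> schwartz m" for U f
  proof (rule schwartzI)
    fix js assume js: "set js \<subseteq> {1..m}"
    show "adm m (pds js (U f))" using stable_pds[OF assms js, of 0] U f by simp
    fix \<beta>
    obtain K \<Theta> where K: "index m \<Theta>" "\<And>U f c x. U \<in> \<U> \<Longrightarrow> f \<in> schwartz m \<Longrightarrow> c \<ge> 0 \<Longrightarrow> sn_le m \<Theta> f c \<Longrightarrow>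
      x \<in> Rm m \<Longrightarrow> norm (monomial m \<beta> x * pds js (U f) x) \<le> K * c"
      using bdd_ops_imageE[OF b[OF js, of \<beta>]] by metis
    obtain c where "c \<ge> 0" "sn_le m \<Theta> f c" by (rule schwartz_sn_le[OF f K(1)])
    with K(2)[OF U f] show "\<exists>c. \<forall>x\<in>Rm m. norm (monomial m \<beta> x * pds js (U f) x) \<le> c" by blast
  qed
  with b show ?thesis unfolding equi_def by blast
qed

section \<open>Null families and differentiability in the Schwartz space\<close>

text \<open>Convergence to 0 in the Schwartz topology. Membership is required eventually only, since
  curves are controlled for parameters in their interval alone.\<close>

definition snull :: "nat \<Rightarrow> ('i \<Rightarrow> (nat \<Rightarrow> real) \<Rightarrow> complex) \<Rightarrow> 'i filter \<Rightarrow> bool"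
  where "snull m p F \<longleftrightarrow> (\<forall>\<^sub>F s in F. p s \<in> schwartz m) \<and>
    (\<forall>js \<beta>. set js \<subseteq> {1..m} \<longrightarrow> (\<forall>e>0. \<forall>\<^sub>F s in F. sn_le m {(js, \<beta>)} (p s) e))"

lemma snullD:
  assumes "snull m p F" "index m \<Theta>" "e > 0"
  shows "\<forall>\<^sub>F s in F. p s \<in> schwartz m \<and> sn_le m \<Theta> (p s) e"
proof -
  have "finite \<Theta>" using assms by (simp add: index_def)
  then have "index m \<Theta> \<Longrightarrow> \<forall>\<^sub>F s in F. sn_le m \<Theta> (p s) e"
  proof (induction \<Theta>)
    case empty then show ?case by (simp add: sn_le_def)
  next
    case (insert q \<Theta>)
    have "\<forall>\<^sub>F s in F. sn_le m {(fst q, snd q)} (p s) e"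
      using assms insert.prems unfolding snull_def index_simps by blast
    moreover have "\<forall>\<^sub>F s in F. sn_le m \<Theta> (p s) e" using insert by simp
    ultimately show ?case by eventually_elim (simp add: sn_le_insert)
  qed
  with assms show ?thesis unfolding snull_def by (simp add: eventually_conj)
qed

lemma snullI:
  assumes "\<forall>\<^sub>F s in F. p s \<in> schwartz m"
    and "\<And>js \<beta> e. set js \<subseteq> {1..m} \<Longrightarrow> e > 0 \<Longrightarrow> \<forall>\<^sub>F s in F. sn_le m {(js, \<beta>)} (p s) e"
  shows "snull m p F"
  using assms unfolding snull_def by blast

text \<open>The operators may vary together with the argument, since equicontinuity supplies one
  constant for all of them; the product rule \<open>sderiv_chain\<close> relies on this.\<close>

lemma snull_equi:
  assumes p: "snull m p F" and U: "equi m \<U>" and W: "\<forall>\<^sub>F s in F. W s \<in> \<U>"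
  shows "snull m (\<lambda>s. W s (p s)) F"
proof (rule snullI)
  have "\<forall>\<^sub>F s in F. p s \<in> schwartz m" using p by (simp add: snull_def)
  with W show "\<forall>\<^sub>F s in F. W s (p s) \<in> schwartz m"
    by eventually_elim (use U in \<open>auto simp: equi_def\<close>)
  fix js \<beta> and e :: real assume js: "set js \<subseteq> {1..m}" and e: "e > 0"
  obtain K \<Theta> where K: "K \<ge> 0" "index m \<Theta>" "\<And>U f c. U \<in> \<U> \<Longrightarrow> f \<in> schwartz m \<Longrightarrow> c \<ge> 0 \<Longrightarrow>
      sn_le m \<Theta> f c \<Longrightarrow> sn_le m {(js, \<beta>)} (U f) (K * c)"
    using equi_index[OF U, of "{(js, \<beta>)}"] js by auto
  have "e / (K + 1) > 0" using e K by (intro divide_pos_pos) auto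
  from snullD[OF p K(2) this] W show "\<forall>\<^sub>F s in F. sn_le m {(js, \<beta>)} (W s (p s)) e"
  proof eventually_elim
    case (elim s)
    then have "sn_le m {(js, \<beta>)} (W s (p s)) (K * (e / (K + 1)))" using K e by (intro K(3)) auto
    moreover have "K * (e / (K + 1)) \<le> e" using K e by (simp add: field_simps)
    ultimately show ?case by (rule sn_le_mono) auto
  qed
qed

lemma snull_add:
  assumes "snull m p F" "snull m q F"
  shows "snull m (\<lambda>s x. p s x + q s x) F"
proof (rule snullI)
  have S: "\<forall>\<^sub>F s in F. p s \<in> schwartz m" "\<forall>\<^sub>F s in F. q s \<in> schwartz m" using assms by (auto simp: snull_def)
  then show "\<forall>\<^sub>F s in F. (\<lambda>x. p s x + q s x) \<in> schwartz m" by eventually_elim (rule schwartz_add)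
  fix js \<beta> and e :: real assume js: "set js \<subseteq> {1..m}" and e: "e > 0"
  then have i: "index m {(js, \<beta>)}" "e / 2 > 0" by auto
  from snullD[OF assms(1) i] snullD[OF assms(2) i]
  show "\<forall>\<^sub>F s in F. sn_le m {(js, \<beta>)} (\<lambda>x. p s x + q s x) e"
  proof eventually_elim
    case (elim s)
    then have ps: "pds js (\<lambda>x. p s x + q s x) = (\<lambda>x. pds js (p s) x + pds js (q s) x)"
      using pds_lincomb[of "p s" m "q s" js 1 1] js by simp
    have "norm (monomial m \<beta> x * (pds js (p s) x + pds js (q s) x)) \<le> e" if "x \<in> Rm m" for x
    proof -
      have "norm (monomial m \<beta> x * pds js (p s) x) \<le> e / 2" "norm (monomial m \<beta> x * pds js (q s) x) \<le> e / 2"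
        using elim that by (auto simp: sn_le_def)
      then show ?thesis
        using norm_triangle_ineq[of "monomial m \<beta> x * pds js (p s) x" "monomial m \<beta> x * pds js (q s) x"]
        by (simp add: distrib_left)
    qed
    then show ?case by (simp add: sn_le_def ps)
  qed
qed

lemma equi_scale: "equi m {\<lambda>f x. a * f x |a. norm a \<le> A}"
proof (rule equi_subset[OF equi_sum[OF equi_id equi_id, of m A]])
  fix U :: cop assume "U \<in> {\<lambda>f x. a * f x |a. norm a \<le> A}"
  then obtain a where a: "norm a \<le> A" "U = (\<lambda>f x. a * f x)" by blast
  then have "U = (\<lambda>f x. a * f x + 0 * f x)" "0 \<le> A" using norm_ge_zero[of a] by (auto simp: order_trans[OF norm_ge_zero])
  then show "\<exists>V\<in>{\<lambda>f x. a * U f x + b * V f x |a b U V. norm a \<le> A \<and> norm b \<le> A \<and> U \<in> {\<lambda>f. f} \<and> V \<in> {\<lambda>f. f}}.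
       \<forall>f\<in>schwartz m. U f = V f"
    using a(1) by (intro bexI[of _ U] CollectI exI[of _ a] exI[of _ 0]) auto
qed

lemma snull_scale:
  assumes "snull m p F" "\<forall>\<^sub>F s in F. norm (c s) \<le> A"
  shows "snull m (\<lambda>s x. c s * p s x) F"
  by (rule snull_equi[OF assms(1) equi_scale[of m A], of "\<lambda>s f x. c s * f x"])
     (use assms(2) in \<open>auto elim: eventually_mono\<close>)

lemma snull_scale_zero:
  assumes "f \<in> schwartz m" "(c \<longlongrightarrow> 0) F"
  shows "snull m (\<lambda>s x. c s * f x) F"
proof (rule snullI)
  show "\<forall>\<^sub>F s in F. (\<lambda>x. c s * f x) \<in> schwartz m" using assms by (simp add: schwartz_cmult)
  fix js \<beta> and e :: real assume js: "set js \<subseteq> {1..m}" and e: "e > 0"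
  then have i: "index m {(js, \<beta>)}" by auto
  obtain d where d: "d \<ge> 0" "sn_le m {(js, \<beta>)} f d" by (rule schwartz_sn_le[OF assms(1) i])
  have "e / (d + 1) > 0" using d e by auto
  then have "\<forall>\<^sub>F s in F. norm (c s) < e / (d + 1)" using assms(2) by (simp add: tendsto_iff)
  then show "\<forall>\<^sub>F s in F. sn_le m {(js, \<beta>)} (\<lambda>x. c s * f x) e"
  proof eventually_elim
    case (elim s)
    have ps: "pds js (\<lambda>x. c s * f x) = (\<lambda>x. c s * pds js f x)"
      using pds_lincomb[of f m f js "c s" 0] assms js by simp
    have "norm (monomial m \<beta> x * (c s * pds js f x)) \<le> e" if "x \<in> Rm m" for x
    proof -
      have "norm (monomial m \<beta> x * (c s * pds js f x)) = norm (c s) * norm (monomial m \<beta> x * pds js f x)"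
        by (simp add: norm_mult)
      also have "\<dots> \<le> e / (d + 1) * d" using elim d that e by (intro mult_mono) (auto simp: sn_le_def)
      also have "\<dots> \<le> e" using d e by (simp add: field_simps)
      finally show ?thesis .
    qed
    then show ?case by (simp add: sn_le_def ps)
  qed
qed

lemma snull_cong: "snull m p F \<Longrightarrow> \<forall>\<^sub>F s in F. p s = q s \<Longrightarrow> snull m q F"
proof (rule snullI)
  assume a: "snull m p F" "\<forall>\<^sub>F s in F. p s = q s"
  then have "\<forall>\<^sub>F s in F. p s \<in> schwartz m" by (simp add: snull_def)
  with a(2) show "\<forall>\<^sub>F s in F. q s \<in> schwartz m" by eventually_elim simp
  fix js \<beta> and e :: real assume "set js \<subseteq> {1..m}" "e > 0"
  then have "\<forall>\<^sub>F s in F. sn_le m {(js, \<beta>)} (p s) e" using a by (simp add: snull_def)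
  with a(2) show "\<forall>\<^sub>F s in F. sn_le m {(js, \<beta>)} (q s) e" by eventually_elim simp
qed

definition sderiv :: "nat \<Rightarrow> (real \<Rightarrow> (nat \<Rightarrow> real) \<Rightarrow> complex) \<Rightarrow> ((nat \<Rightarrow> real) \<Rightarrow> complex) \<Rightarrow> real \<Rightarrow> real set \<Rightarrow> bool"
  where "sderiv m v v' t I \<longleftrightarrow> (\<forall>s\<in>I. v s \<in> schwartz m) \<and> v' \<in> schwartz m \<and>
    snull m (\<lambda>s x. (v s x - v t x) / of_real (s - t) - v' x) (at t within I)"

lemma eventually_at_within_mem: "\<forall>\<^sub>F s in at t within I. s \<in> I \<and> s \<noteq> (t :: real)"
  by (simp add: eventually_at_filter)

lemma tendsto_of_real_diff_zero: "((\<lambda>s. complex_of_real (s - t)) \<longlongrightarrow> 0) (at t within I)"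
  by (auto intro!: tendsto_eq_intros)

lemma sderiv_snull:
  assumes "sderiv m v v' t I" "t \<in> I"
  shows "snull m (\<lambda>s x. v s x - v t x) (at t within I)"
proof -
  have "\<forall>\<^sub>F s in at t within I. norm (complex_of_real (s - t)) < 1"
    using tendsto_of_real_diff_zero[of t I] by (simp add: tendsto_iff del: of_real_diff)
  then have "\<forall>\<^sub>F s in at t within I. norm (complex_of_real (s - t)) \<le> 1"
    by eventually_elim simp
  with assms have 1: "snull m (\<lambda>s x. of_real (s - t) * ((v s x - v t x) / of_real (s - t) - v' x)) (at t within I)"
    by (intro snull_scale) (auto simp: sderiv_def)
  have 2: "snull m (\<lambda>s x. of_real (s - t) * v' x) (at t within I)"
    using assms by (intro snull_scale_zero tendsto_of_real_diff_zero) (auto simp: sderiv_def)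
  show ?thesis
    by (rule snull_cong[OF snull_add[OF 1 2] eventually_mono[OF eventually_at_within_mem]])
       (auto simp: field_simps)
qed

text \<open>Product rule for an operator curve applied to a function curve. The error splits into W
  s applied to the error of \<open>v\<close>, the increment of \<open>W\<close> at the fixed
  function \<open>v'\<close>, and the error of \<open>W\<close> at the fixed function
  \<open>v t\<close>; only the first involves moving operators on a moving function.\<close>

lemma sderiv_chain:
  assumes v: "sderiv m v v' t I" and t: "t \<in> I"
    and lin: "\<And>s a b f g. s \<in> I \<Longrightarrow> f \<in> schwartz m \<Longrightarrow> g \<in> schwartz m \<Longrightarrow>
      W s (\<lambda>x. a * f x + b * g x) = (\<lambda>x. a * W s f x + b * W s g x)"
    and equi: "equi m (W ` I)"
    and W: "\<And>f. f \<in> schwartz m \<Longrightarrow> sderiv m (\<lambda>s. W s f) (W' f) t I"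
  shows "sderiv m (\<lambda>s. W s (v s)) (\<lambda>x. W t v' x + W' (v t) x) t I"
proof -
  have S: "\<And>s. s \<in> I \<Longrightarrow> v s \<in> schwartz m" "v' \<in> schwartz m" using v by (auto simp: sderiv_def)
  have WS: "W s f \<in> schwartz m" if "s \<in> I" "f \<in> schwartz m" for s f
    using equi that by (auto simp: equi_def)
  let ?F = "at t within I"
  have q: "snull m (\<lambda>s x. (v s x - v t x) / of_real (s - t) - v' x) ?F" using v unfolding sderiv_def by blast
  have "\<forall>\<^sub>F s in ?F. W s \<in> W ` I"
    by (rule eventually_mono[OF eventually_at_within_mem]) simp
  from snull_equi[OF q equi this]
  have 1: "snull m (\<lambda>s. W s (\<lambda>x. (v s x - v t x) / of_real (s - t) - v' x)) ?F" .
  have 2: "snull m (\<lambda>s x. W s v' x - W t v' x) ?F" by (rule sderiv_snull[OF W[OF S(2)] t])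
  have 3: "snull m (\<lambda>s x. (W s (v t) x - W t (v t) x) / of_real (s - t) - W' (v t) x) ?F"
    using W[OF S(1)[OF t]] unfolding sderiv_def by blast
  have "snull m (\<lambda>s x. (W s (v s) x - W t (v t) x) / of_real (s - t) - (W t v' x + W' (v t) x)) ?F"
  proof (rule snull_cong[OF snull_add[OF snull_add[OF 1 2] 3] eventually_mono[OF eventually_at_within_mem]])
    fix s assume s: "s \<in> I \<and> s \<noteq> t"
    define k where "k = 1 / complex_of_real (s - t)"
    have "(\<lambda>x. (v s x - v t x) / of_real (s - t) - v' x) = (\<lambda>x. 1 * (\<lambda>x. k * v s x + (- k) * v t x) x + (-1) * v' x)"
      by (simp add: k_def diff_divide_distrib)
    then have "W s (\<lambda>x. (v s x - v t x) / of_real (s - t) - v' x) = (\<lambda>x. k * W s (v s) x - k * W s (v t) x - W s v' x)"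
      using s S t by (simp only: lin schwartz_lincomb) simp
    then show "(\<lambda>x. W s (\<lambda>x. (v s x - v t x) / of_real (s - t) - v' x) x + (W s v' x - W t v' x) +
          ((W s (v t) x - W t (v t) x) / of_real (s - t) - W' (v t) x)) =
        (\<lambda>x. (W s (v s) x - W t (v t) x) / of_real (s - t) - (W t v' x + W' (v t) x))"
      by (auto simp: k_def diff_divide_distrib)
  qed
  moreover have "W' (v t) \<in> schwartz m" using W[OF S(1)[OF t]] by (simp add: sderiv_def)
  ultimately show ?thesis unfolding sderiv_def using S t WS by (auto intro: schwartz_add)
qed

text \<open>The point 0 stands for the angle at which only continuity is known; the fundamental
  theorem of calculus tolerates such an exception inside the interval.\<close>

lemma increment_bound_le:
  fixes f :: "real \<Rightarrow> complex"
  assumes ab: "a \<le> b" and B: "B \<ge> 0"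
    and f: "continuous_on {a..b} f"
    and f': "\<And>r. r \<in> {a<..<b} - {0} \<Longrightarrow> (f has_vector_derivative f' r) (at r)"
    and D: "\<And>r. r \<in> {a..b} \<Longrightarrow> norm (f' r - D) \<le> B"
  shows "norm (f b - f a - of_real (b - a) * D) \<le> B * (b - a)"
proof -
  have "((\<lambda>r. f' r - D) has_integral ((f b - of_real b * D) - (f a - of_real a * D))) {a..b}"
  proof (rule fundamental_theorem_of_calculus_interior_strong[where S="{0}"])
    show "((\<lambda>r. f r - of_real r * D) has_vector_derivative f' r - D) (at r)" if "r \<in> {a<..<b} - {0}" for r
      using has_vector_derivative_diff[OF f'[OF that]
          has_vector_derivative_mult[OF has_vector_derivative_complex_of_real has_vector_derivative_const]]
      by simp
    show "continuous_on {a..b} (\<lambda>r. f r - of_real r * D)" by (intro continuous_intros f)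
  qed (use ab in auto)
  from has_integral_bound[OF B this[unfolded interval_cbox], unfolded interval_cbox[symmetric]] D
  have "norm ((f b - of_real b * D) - (f a - of_real a * D)) \<le> B * measure lborel {a..b}" by simp
  then show ?thesis using ab by (simp add: algebra_simps)
qed

lemma increment_bound:
  fixes f :: "real \<Rightarrow> complex"
  assumes B: "B \<ge> 0"
    and f: "continuous_on J f" and J: "{min a b..max a b} \<subseteq> J"
    and f': "\<And>r. r \<in> J - {0} \<Longrightarrow> (f has_vector_derivative f' r) (at r)"
    and D: "\<And>r. r \<in> {min a b..max a b} \<Longrightarrow> norm (f' r - D) \<le> B"
  shows "norm (f b - f a - of_real (b - a) * D) \<le> B * \<bar>b - a\<bar>"
proof (cases "a \<le> b")
  case True
  then show ?thesis
    using increment_bound_le[OF True B continuous_on_subset[OF f], of f' D] f' D J by (auto simp: subset_eq)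
next
  case False
  then have ba: "b \<le> a" by simp
  have "norm (f a - f b - of_real (a - b) * D) \<le> B * (a - b)"
    using increment_bound_le[OF ba B continuous_on_subset[OF f], of f' D] f' D J False by (auto simp: subset_eq)
  moreover have "f b - f a - of_real (b - a) * D = - (f a - f b - of_real (a - b) * D)" by (simp add: algebra_simps)
  ultimately show ?thesis using False by (simp only: norm_minus_cancel) simp
qed

lemma sn_le_lincomb:
  assumes "f \<in> schwartz m" "g \<in> schwartz m" "index m \<Theta>" "sn_le m \<Theta> f c" "sn_le m \<Theta> g d"
  shows "sn_le m \<Theta> (\<lambda>x. a * f x + b * g x) (norm a * c + norm b * d)"
proof -
  have "norm (monomial m \<beta> x * pds js (\<lambda>x. a * f x + b * g x) x) \<le> norm a * c + norm b * d"
    if p: "(js, \<beta>) \<in> \<Theta>" and x: "x \<in> Rm m" for js \<beta> x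
  proof -
  have js: "set js \<subseteq> {1..m}" using assms(3) p by (auto simp: index_def)
  have 1: "norm (monomial m \<beta> x * pds js f x) \<le> c" "norm (monomial m \<beta> x * pds js g x) \<le> d"
    using sn_leD[OF assms(4) p x] sn_leD[OF assms(5) p x] by simp_all
  have "monomial m \<beta> x * pds js (\<lambda>x. a * f x + b * g x) x
    = a * (monomial m \<beta> x * pds js f x) + b * (monomial m \<beta> x * pds js g x)"
    by (simp add: pds_lincomb[OF assms(1,2) js] algebra_simps)
  also have "norm \<dots> \<le> norm a * c + norm b * d"
    unfolding norm_mult[of a] norm_mult[of b] using 1
    by (intro order_trans[OF norm_triangle_ineq] add_mono) (simp_all only: norm_mult[of a] norm_mult[of b] mult_left_mono norm_ge_zero)
  finally show ?thesis .
  qed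
  then show ?thesis unfolding sn_le_def by blast
qed

section \<open>Interpolation\<close>

text \<open>First order Taylor expansion with step \<open>d\<close>: Landau's inequality between a
  function and its second derivative, before the step is optimised.\<close>

lemma pd_interpolate:
  assumes f: "f \<in> schwartz m" and j: "j \<in> {1..m}" and x: "x \<in> Rm m" and d: "d > 0"
    and e: "\<And>x. x \<in> Rm m \<Longrightarrow> norm (f x) \<le> e"
    and K: "\<And>x. x \<in> Rm m \<Longrightarrow> norm (pd j (pd j f) x) \<le> K"
  shows "norm (pd j f x) \<le> 2 * e / d + K * d"
proof -
  define \<phi> where "\<phi> t = f (x(j := t))" for t
  define \<phi>' where "\<phi>' t = pd j f (x(j := t))" for t
  have xt: "x(j := t) \<in> Rm m" for t using x j by simp
  have d1: "(\<phi> has_vector_derivative \<phi>' t) (at t)" for t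
    unfolding \<phi>_def[abs_def] \<phi>'_def by (rule schwartz_deriv[OF f j x])
  have d2: "(\<phi>' has_vector_derivative pd j (pd j f) (x(j := t))) (at t)" for t
    unfolding \<phi>'_def[abs_def] by (rule schwartz_deriv[OF pd_schwartz[OF f j] j x])
  have c: "continuous_on A \<phi>" "continuous_on A \<phi>'" for A
    using d1 d2 by (auto intro!: continuous_at_imp_continuous_on has_vector_derivative_continuous)
  have K0: "K \<ge> 0" using K[OF x] norm_ge_zero order_trans by blast
  have b: "norm (\<phi>' r - \<phi>' (x j)) \<le> K * d" if "r \<in> {x j..x j + d}" for r
  proof -
    have "norm (\<phi>' r - \<phi>' (x j) - of_real (r - x j) * 0) \<le> K * (r - x j)"
      by (rule increment_bound_le[where f'="\<lambda>t. pd j (pd j f) (x(j := t))"])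
        (use that K0 c d2 K[OF xt] in auto)
    also have "\<dots> \<le> K * d" using that K0 by (intro mult_left_mono) auto
    finally show ?thesis by simp
  qed
  have "norm (\<phi> (x j + d) - \<phi> (x j) - of_real (x j + d - x j) * \<phi>' (x j)) \<le> (K * d) * (x j + d - x j)"
    by (rule increment_bound_le[where f'=\<phi>']) (use d K0 c d1 b in auto)
  then have "norm (\<phi> (x j + d) - \<phi> (x j) - of_real d * \<phi>' (x j)) \<le> K * d * d" by simp
  moreover have "of_real d * \<phi>' (x j) = (\<phi> (x j + d) - \<phi> (x j)) - (\<phi> (x j + d) - \<phi> (x j) - of_real d * \<phi>' (x j))" by simp
  then have "norm (of_real d * \<phi>' (x j)) \<le> norm (\<phi> (x j + d) - \<phi> (x j)) + norm (\<phi> (x j + d) - \<phi> (x j) - of_real d * \<phi>' (x j))"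
    by (metis norm_triangle_ineq4)
  moreover have "norm (\<phi> (x j + d) - \<phi> (x j)) \<le> e + e"
    unfolding \<phi>_def by (intro order_trans[OF norm_triangle_ineq4] add_mono e xt)
  ultimately have "norm (of_real d * \<phi>' (x j)) \<le> 2 * e + K * d * d" by simp
  then have "d * norm (\<phi>' (x j)) \<le> 2 * e + K * d * d" using d by (simp add: norm_mult)
  then have "norm (\<phi>' (x j)) \<le> (2 * e + K * d * d) / d" using d by (simp add: pos_le_divide_eq mult.commute)
  also have "\<dots> = 2 * e / d + K * d" using d by (simp add: field_simps)
  finally show ?thesis by (simp add: \<phi>'_def)
qed

text \<open>Bounded seminorms and a vanishing sup norm suffice. Derivatives are reached one at a
  time by \<open>pd_interpolate\<close>; polynomial weights follow because the square of a weighted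
  value is the unweighted value times the doubly weighted one.\<close>

lemma snull_interpolate:
  assumes S: "\<forall>\<^sub>F s in F. p s \<in> schwartz m"
    and bd: "\<And>\<Theta>. index m \<Theta> \<Longrightarrow> \<exists>c\<ge>0. \<forall>\<^sub>F s in F. sn_le m \<Theta> (p s) c"
    and z: "\<And>e. e > 0 \<Longrightarrow> \<forall>\<^sub>F s in F. \<forall>x\<in>Rm m. norm (p s x) \<le> e"
  shows "snull m p F"
proof (rule snullI[OF S])
  have 0: "\<forall>\<^sub>F s in F. \<forall>x\<in>Rm m. norm (pds js (p s) x) \<le> e" if "set js \<subseteq> {1..m}" "e > 0" for js e
    using that
  proof (induction js arbitrary: e)
    case Nil then show ?case using z by simp
  next
    case (Cons j js)
    then have i: "index m {(j # j # js, \<lambda>_. 0)}" and j: "j \<in> {1..m}" "set js \<subseteq> {1..m}" by auto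
    obtain c where c: "c \<ge> 0" "\<forall>\<^sub>F s in F. sn_le m {(j # j # js, \<lambda>_. 0)} (p s) c" using bd[OF i] by blast
    \<comment> \<open>With the previous derivative at most e d / 4, the two terms 2 (e d / 4) / d
      and c d of the interpolation are each at most e / 2.\<close>
    define d where "d = e / (2 * (c + 1))"
    have d: "d > 0" using c Cons.prems by (simp add: d_def)
    have "e * d / 4 > 0" using d Cons.prems by simp
    from Cons.IH[OF j(2) this] c(2) S show ?case
    proof eventually_elim
      case (elim s)
      show ?case
      proof
        fix x assume x: "x \<in> Rm m"
        have "norm (pd j (pds js (p s)) x) \<le> 2 * (e * d / 4) / d + c * d"
          using elim by (intro pd_interpolate[OF pds_schwartz[OF elim(3) j(2)] j(1) x d]) (auto simp: sn_le_def)
        also have "2 * (e * d / 4) / d = e / 2" using d by simp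
        also have "c * d \<le> e / 2" using c Cons.prems by (simp add: d_def field_simps)
        finally show "norm (pds (j # js) (p s) x) \<le> e" by simp
      qed
    qed
  qed
  fix js \<beta> and e :: real assume js: "set js \<subseteq> {1..m}" and e: "e > 0"
  then have i: "index m {(js, \<lambda>i. 2 * \<beta> i)}" by auto
  obtain c where c: "c \<ge> 0" "\<forall>\<^sub>F s in F. sn_le m {(js, \<lambda>i. 2 * \<beta> i)} (p s) c" using bd[OF i] by blast
  have "e\<^sup>2 / (c + 1) > 0" using e c by simp
  from 0[OF js this] c(2) show "\<forall>\<^sub>F s in F. sn_le m {(js, \<beta>)} (p s) e"
  proof eventually_elim
    case (elim s)
    have "norm (monomial m \<beta> x * pds js (p s) x) \<le> e" if x: "x \<in> Rm m" for x
    proof -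
      \<comment> \<open>One factor is small and carries no weight; the other carries the weight
        twice and is merely bounded.\<close>
      have "(norm (monomial m \<beta> x * pds js (p s) x))\<^sup>2 = norm (pds js (p s) x) * norm (monomial m (\<lambda>i. 2 * \<beta> i) x * pds js (p s) x)"
        by (simp add: monomial_double norm_mult norm_power power2_eq_square)
      also have "\<dots> \<le> e\<^sup>2 / (c + 1) * c"
        using elim x e c by (intro mult_mono) (auto simp: sn_le_def)
      also have "\<dots> \<le> e\<^sup>2" using e c by (simp add: field_simps)
      finally show ?thesis by (rule power2_le_imp_le[OF _ less_imp_le[OF e]])
    qed
    then show ?case by (simp add: sn_le_def)
  qed
qed

section \<open>The fractional Fourier transform in one coordinate\<close>

definition frft :: "nat \<Rightarrow> nat \<Rightarrow> real \<Rightarrow> cop"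
  where "frft m j \<alpha> f x = (if x \<in> Rm m then frft1 \<alpha> (\<lambda>s. f (x(j := s))) (x j) else 0)"

text \<open>The operator x_j^2 - d_j^2 - 1, nested as linear combinations of two terms so that the
  \<open>lincomb\<close> lemmas rewrite it directly.\<close>

definition hermite :: "nat \<Rightarrow> cop"
  where "hermite j f x = 1 * (1 * mx j (mx j f) x + (-1) * pd j (pd j f) x) + (-1) * f x"

text \<open>The seminorms of f and of x_j^2 f, whose sum bounds (1 + x_j^2) |f|; the double
  successor matches two uses of \<open>monomial_Suc\<close>.\<close>

definition decay_index :: "nat \<Rightarrow> (nat list \<times> (nat \<Rightarrow> nat)) set"
  where "decay_index j = {([], \<lambda>_. 0), ([], (\<lambda>_. 0)(j := Suc (Suc 0)))}"

lemma index_decay [simp]: "index m (decay_index j)"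
  by (simp add: decay_index_def)

lemma decay_bound:
  assumes j: "j \<in> {1..m}" and x: "x \<in> Rm m" and c: "sn_le m (decay_index j) f c"
  shows "(1 + s\<^sup>2) * norm (f (x(j := s))) \<le> 2 * c"
proof -
  have xs: "x(j := s) \<in> Rm m" using x j by simp
  have "monomial m ((\<lambda>_. 0)(j := Suc (Suc 0))) (x(j := s)) = of_real (s * s)"
    using monomial_Suc[OF j, of "(\<lambda>_. 0)(j := Suc 0)" "x(j := s)"] monomial_Suc[OF j, of "\<lambda>_. 0" "x(j := s)"]
    by simp
  then have "norm (f (x(j := s))) \<le> c" "norm (complex_of_real (s * s) * f (x(j := s))) \<le> c"
    using c xs unfolding decay_index_def sn_le_def by auto
  then show ?thesis by (simp add: distrib_right norm_mult power2_eq_square abs_mult)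
qed

lemma section_rapid:
  assumes "f \<in> schwartz m" "j \<in> {1..m}" "x \<in> Rm m"
  shows "rapid (\<lambda>s. f (x(j := s)))"
proof -
  obtain c where "c \<ge> 0" "sn_le m (decay_index j) f c" by (rule schwartz_sn_le[OF assms(1) index_decay])
  show ?thesis
  proof (rule rapidI)
    show "continuous_on UNIV (\<lambda>s. f (x(j := s)))"
      using schwartz_deriv[OF assms]
      by (auto intro!: continuous_at_imp_continuous_on has_vector_derivative_continuous)
    show "(1 + s\<^sup>2) * norm (f (x(j := s))) \<le> 2 * c" for s
      by (rule decay_bound) fact+
  qed
qed

lemma mx_section: "(\<lambda>s. of_real s * f (x(j := s))) = (\<lambda>s. mx j f (x(j := s)))"
  by (simp add: mx_def)

lemma frft_0:
  assumes "f \<in> schwartz m" shows "frft m j 0 f = f"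
  using schwartz_outside[OF assms] by (auto simp: frft_def frft1_def)

context
  fixes m j :: nat
  assumes j: "j \<in> {1..m}"
begin

lemma frft_lincomb:
  assumes "f \<in> schwartz m" "g \<in> schwartz m"
  shows "frft m j \<alpha> (\<lambda>x. a * f x + b * g x) = (\<lambda>x. a * frft m j \<alpha> f x + b * frft m j \<alpha> g x)"
  by (auto simp: frft_def frft1_add section_rapid[OF _ j] assms)

lemma frft_cmult: "f \<in> schwartz m \<Longrightarrow> frft m j \<alpha> (\<lambda>x. a * f x) = (\<lambda>x. a * frft m j \<alpha> f x)"
  using frft_lincomb[of f f \<alpha> a 0] by simp

lemma frft_mx_same:
  assumes f: "f \<in> schwartz m" and \<alpha>: "\<bar>\<alpha>\<bar> \<le> pi / 2"
  shows "mx j (frft m j \<alpha> f) = (\<lambda>x. of_real (cos \<alpha>) * frft m j \<alpha> (mx j f) x + \<i> * of_real (sin \<alpha>) * frft m j \<alpha> (pd j f) x)"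
proof
  fix x
  show "mx j (frft m j \<alpha> f) x = of_real (cos \<alpha>) * frft m j \<alpha> (mx j f) x + \<i> * of_real (sin \<alpha>) * frft m j \<alpha> (pd j f) x"
  proof (cases "x \<in> Rm m")
    case True
    have r: "rapid (\<lambda>s. mx j f (x(j := s)))" by (rule section_rapid[OF mx_schwartz[OF f j] j True])
    show ?thesis
      using frft1_mult[OF \<alpha> section_rapid[OF f j True] section_rapid[OF pd_schwartz[OF f j] j True]
          r[folded mx_section] schwartz_deriv[OF f j True], of "x j"] True
      unfolding mx_section by (simp add: frft_def mx_def)
  qed (simp add: mx_def frft_def)
qed

lemma frft_mx_other:
  assumes f: "f \<in> schwartz m" and i: "i \<in> {1..m}" "i \<noteq> j"
  shows "mx i (frft m j \<alpha> f) = frft m j \<alpha> (mx i f)"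
proof
  fix x
  show "mx i (frft m j \<alpha> f) x = frft m j \<alpha> (mx i f) x"
  proof (cases "x \<in> Rm m")
    case True
    have "frft1 \<alpha> (\<lambda>s. of_real (x i) * f (x(j := s)) + 0 * f (x(j := s))) (x j) = of_real (x i) * frft1 \<alpha> (\<lambda>s. f (x(j := s))) (x j)"
      using frft1_add[OF section_rapid[OF f j True] section_rapid[OF f j True], of \<alpha> "of_real (x i)" 0 "x j"] by simp
    then show ?thesis using True i by (simp add: mx_def frft_def)
  qed (simp add: mx_def frft_def)
qed

lemma frft_deriv_same:
  assumes f: "f \<in> schwartz m" and \<alpha>: "\<bar>\<alpha>\<bar> \<le> pi / 2" and x: "x \<in> Rm m"
  shows "((\<lambda>t. frft m j \<alpha> f (x(j := t))) has_vector_derivative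
    (of_real (cos \<alpha>) * frft m j \<alpha> (pd j f) x + \<i> * of_real (sin \<alpha>) * frft m j \<alpha> (mx j f) x)) (at (x j))"
proof -
  have r: "rapid (\<lambda>s. mx j f (x(j := s)))" by (rule section_rapid[OF mx_schwartz[OF f j] j x])
  have "(frft1 \<alpha> (\<lambda>s. f (x(j := s))) has_vector_derivative
    (of_real (cos \<alpha>) * frft m j \<alpha> (pd j f) x + \<i> * of_real (sin \<alpha>) * frft m j \<alpha> (mx j f) x)) (at (x j))"
    using frft1_deriv[OF \<alpha> section_rapid[OF f j x] section_rapid[OF pd_schwartz[OF f j] j x]
          r[folded mx_section] schwartz_deriv[OF f j x], of "x j"] x
    unfolding mx_section by (simp add: frft_def)
  moreover have "(\<lambda>t. frft m j \<alpha> f (x(j := t))) = frft1 \<alpha> (\<lambda>s. f (x(j := s)))"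
    using x j by (simp add: frft_def fun_eq_iff)
  ultimately show ?thesis by simp
qed

lemma frft_deriv_other:
  assumes f: "f \<in> schwartz m" and i: "i \<in> {1..m}" "i \<noteq> j" and x: "x \<in> Rm m"
  shows "((\<lambda>t. frft m j \<alpha> f (x(i := t))) has_vector_derivative frft m j \<alpha> (pd i f) x) (at (x i))"
proof (cases "\<alpha> = 0")
  case True
  then show ?thesis
    using schwartz_deriv[OF f i(1) x, of "x i"] frft_0[OF f] frft_0[OF pd_schwartz[OF f i(1)]] by simp
next
  case False
  obtain c where c: "c \<ge> 0" "sn_le m (decay_index j) (pd i f) c"
    by (rule schwartz_sn_le[OF pd_schwartz[OF f i(1)] index_decay])
  have xs: "x(j := s) \<in> Rm m" "x(i := s) \<in> Rm m" for s using x j i by simp_all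
  have "((\<lambda>t. LINT s|lborel. frft_kernel \<alpha> (x j) s * f (x(i := t, j := s))) has_vector_derivative
      (LINT s|lborel. frft_kernel \<alpha> (x j) s * pd i f (x(i := x i, j := s)))) (at (x i))"
  proof (rule has_vector_derivative_integral_dominated[where d=1 and w="\<lambda>s. 2 * c * (1 / (1 + s\<^sup>2))"])
    show "((\<lambda>t. frft_kernel \<alpha> (x j) s * f (x(i := t, j := s))) has_vector_derivative
        frft_kernel \<alpha> (x j) s * pd i f (x(i := t, j := s))) (at t)" for t s
      unfolding fun_upd_twist[OF i(2)]
      by (intro has_vector_derivative_mult_right schwartz_deriv[OF f i(1)] xs)
    show "norm (frft_kernel \<alpha> (x j) s * pd i f (x(i := t, j := s))) \<le> 2 * c * (1 / (1 + s\<^sup>2))" for t s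
    proof -
      have "0 < 1 + s\<^sup>2" by (simp add: add_pos_nonneg)
      then show ?thesis
        using decay_bound[OF j xs(2) c(2), of s t] by (simp add: norm_mult pos_le_divide_eq mult.commute)
    qed
    show "integrable lborel (\<lambda>s. 2 * c * (1 / (1 + s\<^sup>2)))"
      using integrable_cauchy by (rule integrable_mult_right)
    show "integrable lborel (\<lambda>s. frft_kernel \<alpha> (x j) s * f (x(i := t, j := s)))" for t
      by (rule integrable_kernel[OF section_rapid[OF f j xs(2)]])
    show "(\<lambda>s. frft_kernel \<alpha> (x j) s * pd i f (x(i := x i, j := s))) \<in> borel_measurable lborel"
      using integrable_kernel[OF section_rapid[OF pd_schwartz[OF f i(1)] j xs(2)[of "x i"]], of \<alpha> "x j"] by simp
  qed simp
  from has_vector_derivative_mult_right[OF this, of "frft_const \<alpha>"]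
  show ?thesis using False x xs i by (simp add: frft_def frft1_def)
qed

lemma adm_frft:
  assumes f: "f \<in> schwartz m" and \<alpha>: "\<bar>\<alpha>\<bar> \<le> pi / 2"
  shows "adm m (frft m j \<alpha> f)"
proof (rule admI[where D="\<lambda>i x. if i = j then of_real (cos \<alpha>) * frft m j \<alpha> (pd j f) x + \<i> * of_real (sin \<alpha>) * frft m j \<alpha> (mx j f) x
    else frft m j \<alpha> (pd i f) x"])
  show "((\<lambda>t. frft m j \<alpha> f (x(i := t))) has_vector_derivative
    (if i = j then of_real (cos \<alpha>) * frft m j \<alpha> (pd j f) x + \<i> * of_real (sin \<alpha>) * frft m j \<alpha> (mx j f) x
    else frft m j \<alpha> (pd i f) x)) (at (x i))" if "i \<in> {1..m}" "x \<in> Rm m" for i x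
    using frft_deriv_same[OF f \<alpha> that(2)] frft_deriv_other[OF f that(1) _ that(2)] by (cases "i = j") auto
qed (simp add: frft_def)

lemma frft_pd_same:
  assumes f: "f \<in> schwartz m" and \<alpha>: "\<bar>\<alpha>\<bar> \<le> pi / 2"
  shows "pd j (frft m j \<alpha> f) = (\<lambda>x. of_real (cos \<alpha>) * frft m j \<alpha> (pd j f) x + \<i> * of_real (sin \<alpha>) * frft m j \<alpha> (mx j f) x)"
proof
  fix x
  show "pd j (frft m j \<alpha> f) x = of_real (cos \<alpha>) * frft m j \<alpha> (pd j f) x + \<i> * of_real (sin \<alpha>) * frft m j \<alpha> (mx j f) x"
  proof (cases "x \<in> Rm m")
    case True then show ?thesis by (intro pdI frft_deriv_same f \<alpha>)
  next
    case False
    have "pd j (frft m j \<alpha> f) x = 0" by (rule pd_outside[OF _ j False]) (simp add: frft_def)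
    then show ?thesis using False by (simp add: frft_def)
  qed
qed

lemma frft_pd_other:
  assumes f: "f \<in> schwartz m" and i: "i \<in> {1..m}" "i \<noteq> j"
  shows "pd i (frft m j \<alpha> f) = frft m j \<alpha> (pd i f)"
proof
  fix x
  show "pd i (frft m j \<alpha> f) x = frft m j \<alpha> (pd i f) x"
  proof (cases "x \<in> Rm m")
    case True then show ?thesis by (intro pdI frft_deriv_other f i)
  next
    case False
    have "pd i (frft m j \<alpha> f) x = 0" by (rule pd_outside[OF _ i(1) False]) (simp add: frft_def)
    then show ?thesis using False by (simp add: frft_def)
  qed
qed

end

section \<open>Equicontinuity in the angle\<close>

lemma bdd_opsE:
  assumes "bdd_ops m \<U>"
  obtains K \<Theta> where "K \<ge> 0" "index m \<Theta>" "\<And>U f c x. U \<in> \<U> \<Longrightarrow> f \<in> schwartz m \<Longrightarrow> c \<ge> 0 \<Longrightarrow>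
    sn_le m \<Theta> f c \<Longrightarrow> x \<in> Rm m \<Longrightarrow> norm (U f x) \<le> K * c"
  by (rule bdd_ops_imageE[of m "\<lambda>U. U" \<U>]) (use assms in \<open>simp_all add: image_ident\<close>)

text \<open>The shape of an intertwining relation: a letter to the left of an operator is exchanged
  for fixed operators \<open>P\<close> and \<open>Q\<close> to its right, with coefficients of
  modulus at most 1. The families to the left are then those of an induction hypothesis.\<close>

lemma stable_combine:
  assumes P: "equi m {P}" and Q: "equi m {Q}" and U: "stable m k \<U>" and V: "stable m k \<V>"
    and X: "\<And>X. X \<in> \<X> \<Longrightarrow> \<exists>a b c d U V U' V'. norm a \<le> 1 \<and> norm b \<le> 1 \<and> norm c \<le> 1 \<and> norm d \<le> 1 \<and>
      U \<in> \<U> \<and> V \<in> \<V> \<and> U' \<in> \<U> \<and> V' \<in> \<V> \<and>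
      (\<forall>f\<in>schwartz m. X f = (\<lambda>x. 1 * (a * U (P f) x + b * V (P f) x) + 1 * (c * U' (Q f) x + d * V' (Q f) x)))"
  shows "stable m k \<X>"
proof -
  let ?C = "\<lambda>\<U> P. {\<lambda>f. U (P' f) |U P'. U \<in> \<U> \<and> P' \<in> {P}}"
  let ?S = "\<lambda>\<U> \<V>. {\<lambda>f x. a * U f x + b * V f x |a b U V. norm a \<le> 1 \<and> norm b \<le> 1 \<and> U \<in> \<U> \<and> V \<in> \<V>}"
  have "stable m k (?S (?S (?C \<U> P) (?C \<V> P)) (?S (?C \<U> Q) (?C \<V> Q)))"
    by (intro stable_sum stable_comp P Q U V)
  then show ?thesis
  proof (rule stable_subset)
    fix X assume "X \<in> \<X>"
    from assms(5)[OF this] obtain a b c d U V U' V' where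
      n: "norm a \<le> 1" "norm b \<le> 1" "norm c \<le> 1" "norm d \<le> 1" and
      M: "U \<in> \<U>" "V \<in> \<V>" "U' \<in> \<U>" "V' \<in> \<V>" and
      E: "\<forall>f\<in>schwartz m. X f = (\<lambda>x. 1 * (a * U (P f) x + b * V (P f) x) + 1 * (c * U' (Q f) x + d * V' (Q f) x))"
      by blast
    define R where "R = (\<lambda>f x. a * U (P f) x + b * V (P f) x)"
    define T where "T = (\<lambda>f x. c * U' (Q f) x + d * V' (Q f) x)"
    have sumI: "(\<lambda>f x. a * U f x + b * V f x) \<in> ?S \<A> \<B>"
      if "norm a \<le> 1" "norm b \<le> 1" "U \<in> \<A>" "V \<in> \<B>" for a b :: complex and U V :: cop and \<A> \<B>
      using that by - (rule CollectI, rule exI[of _ a], rule exI[of _ b], rule exI[of _ U], rule exI[of _ V], simp)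
    have compI: "(\<lambda>f. U (P f)) \<in> ?C \<A> P" if "U \<in> \<A>" for U P :: cop and \<A>
      using that by - (rule CollectI, rule exI[of _ U], rule exI[of _ P], simp)
    have R: "R \<in> ?S (?C \<U> P) (?C \<V> P)"
      unfolding R_def by (rule sumI[OF n(1,2) compI[OF M(1)] compI[OF M(2)]])
    have T: "T \<in> ?S (?C \<U> Q) (?C \<V> Q)"
      unfolding T_def by (rule sumI[OF n(3,4) compI[OF M(3)] compI[OF M(4)]])
    have "(\<lambda>f x. 1 * R f x + 1 * T f x) \<in> ?S (?S (?C \<U> P) (?C \<V> P)) (?S (?C \<U> Q) (?C \<V> Q))"
      by (rule sumI[OF _ _ R T]) simp_all
    then show "\<exists>V\<in>?S (?S (?C \<U> P) (?C \<V> P)) (?S (?C \<U> Q) (?C \<V> Q)). \<forall>f\<in>schwartz m. X f = V f"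
      by (rule bexI[rotated]) (use E in \<open>simp add: R_def T_def\<close>)
  qed
qed

definition angles :: "real set" where "angles = {- (pi / 2)..pi / 2}"

lemma anglesD: "\<alpha> \<in> angles \<Longrightarrow> \<bar>\<alpha>\<bar> \<le> pi / 2"
  by (auto simp: angles_def)

lemma zero_angles [simp]: "0 \<in> angles" by (simp add: angles_def)

lemma interval_angles: "s \<in> angles \<Longrightarrow> t \<in> angles \<Longrightarrow> {min s t..max s t} \<subseteq> angles"
  by (auto simp: angles_def)

lemma equi_hermite: "j \<in> {1..m} \<Longrightarrow> equi m {hermite j}"
  unfolding hermite_def[abs_def] by (intro equi_lincomb1 equi_comp1[of m "mx j" "mx j"] equi_comp1[of m "pd j" "pd j"] equi_mx equi_pd equi_id)

lemma hermite_schwartz: "f \<in> schwartz m \<Longrightarrow> j \<in> {1..m} \<Longrightarrow> hermite j f \<in> schwartz m"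
  using equi_hermite[of j m] by (simp add: equi_def)

context
  fixes m j :: nat
  assumes j: "j \<in> {1..m}"
begin

lemma bdd_frft: "bdd_ops m (frft m j ` angles)"
proof -
  have i: "index m {([j], \<lambda>_. 0), ([j], (\<lambda>_. 0)(j := Suc (Suc 0)))}" using j by simp
  have "norm (frft m j \<alpha> f x) \<le> 12 * pi * c"
    if a: "\<alpha> \<in> angles" and f: "f \<in> schwartz m" and c: "c \<ge> 0"
      "sn_le m (decay_index j \<union> {([j], \<lambda>_. 0), ([j], (\<lambda>_. 0)(j := Suc (Suc 0)))}) f c" and x: "x \<in> Rm m" for \<alpha> f c x
  proof -
    have 1: "sn_le m (decay_index j) f c" using c(2) by (rule sn_le_mono) auto
    have 2: "sn_le m (decay_index j) (pd j f) c"
      using c(2) unfolding sn_le_def decay_index_def by auto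
    have "norm (frft1 \<alpha> (\<lambda>s. f (x(j := s))) (x j)) \<le> 6 * pi * (2 * c)"
      by (rule frft1_bound[OF anglesD[OF a] section_rapid[OF f j x] section_rapid[OF pd_schwartz[OF f j] j x]
            schwartz_deriv[OF f j x] decay_bound[OF j x 1] decay_bound[OF j x 2]])
    then show ?thesis using x by (simp add: frft_def)
  qed
  then show ?thesis
    unfolding bdd_ops_def ball_simps using i index_decay
    by (intro exI[of _ "12 * pi"] conjI exI[of _ "decay_index j \<union> {([j], \<lambda>_. 0), ([j], (\<lambda>_. 0)(j := Suc (Suc 0)))}"]) auto
qed

text \<open>The rotation relations express a derivative or coordinate of the transform through
  transforms of derivatives and coordinates, with sines and cosines as coefficients; the sup norm
  bound for all angles is thus inherited at each level.\<close>

lemma stable_frft: "stable m k (frft m j ` angles)"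
proof (induction k)
  case 0
  show ?case using bdd_frft adm_frft[OF j _ anglesD] by auto
next
  case (Suc k)
  have "stable m k ((\<lambda>U f. pd i (U f)) ` frft m j ` angles)" if i: "i \<in> {1..m}" for i
  proof (rule stable_combine[OF equi_pd[OF i] equi_mx[OF j] Suc.IH Suc.IH])
    fix X assume "X \<in> (\<lambda>U f. pd i (U f)) ` frft m j ` angles"
    then obtain \<alpha> where a: "\<alpha> \<in> angles" and X: "X = (\<lambda>f. pd i (frft m j \<alpha> f))" by blast
    define p where "p = (if i = j then complex_of_real (cos \<alpha>) else 1)"
    define q where "q = (if i = j then \<i> * complex_of_real (sin \<alpha>) else 0)"
    have "norm p \<le> 1" "norm q \<le> 1" by (auto simp: p_def q_def norm_mult)
    moreover have "X f = (\<lambda>x. 1 * (p * frft m j \<alpha> (pd i f) x + 0 * frft m j \<alpha> (pd i f) x)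
        + 1 * (q * frft m j \<alpha> (mx j f) x + 0 * frft m j \<alpha> (mx j f) x))" if f: "f \<in> schwartz m" for f
      using frft_pd_same[OF j f anglesD[OF a]] frft_pd_other[OF j f i, of \<alpha>] by (auto simp: X p_def q_def)
    ultimately show "\<exists>a b c d U V U' V'. norm a \<le> 1 \<and> norm b \<le> 1 \<and> norm c \<le> 1 \<and> norm d \<le> 1 \<and>
      U \<in> frft m j ` angles \<and> V \<in> frft m j ` angles \<and> U' \<in> frft m j ` angles \<and> V' \<in> frft m j ` angles \<and>
      (\<forall>f\<in>schwartz m. X f = (\<lambda>x. 1 * (a * U (pd i f) x + b * V (pd i f) x) + 1 * (c * U' (mx j f) x + d * V' (mx j f) x)))"
      using a by (intro exI[of _ p] exI[of _ 0] exI[of _ q] exI[of _ "frft m j \<alpha>"] conjI) auto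
  qed
  moreover have "stable m k ((\<lambda>U f. mx i (U f)) ` frft m j ` angles)" if i: "i \<in> {1..m}" for i
  proof (rule stable_combine[OF equi_mx[OF i] equi_pd[OF j] Suc.IH Suc.IH])
    fix X assume "X \<in> (\<lambda>U f. mx i (U f)) ` frft m j ` angles"
    then obtain \<alpha> where a: "\<alpha> \<in> angles" and X: "X = (\<lambda>f. mx i (frft m j \<alpha> f))" by blast
    define p where "p = (if i = j then complex_of_real (cos \<alpha>) else 1)"
    define q where "q = (if i = j then \<i> * complex_of_real (sin \<alpha>) else 0)"
    have "norm p \<le> 1" "norm q \<le> 1" by (auto simp: p_def q_def norm_mult)
    moreover have "X f = (\<lambda>x. 1 * (p * frft m j \<alpha> (mx i f) x + 0 * frft m j \<alpha> (mx i f) x)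
        + 1 * (q * frft m j \<alpha> (pd j f) x + 0 * frft m j \<alpha> (pd j f) x))" if f: "f \<in> schwartz m" for f
      using frft_mx_same[OF j f anglesD[OF a]] frft_mx_other[OF j f i, of \<alpha>] by (auto simp: X p_def q_def)
    ultimately show "\<exists>a b c d U V U' V'. norm a \<le> 1 \<and> norm b \<le> 1 \<and> norm c \<le> 1 \<and> norm d \<le> 1 \<and>
      U \<in> frft m j ` angles \<and> V \<in> frft m j ` angles \<and> U' \<in> frft m j ` angles \<and> V' \<in> frft m j ` angles \<and>
      (\<forall>f\<in>schwartz m. X f = (\<lambda>x. 1 * (a * U (mx i f) x + b * V (mx i f) x) + 1 * (c * U' (pd j f) x + d * V' (pd j f) x)))"
      using a by (intro exI[of _ p] exI[of _ 0] exI[of _ q] exI[of _ "frft m j \<alpha>"] conjI) auto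
  qed
  ultimately show ?case using stable_0[OF Suc.IH] by simp
qed

lemma equi_frft: "equi m (frft m j ` angles)"
  by (rule stable_equi[OF stable_frft])

lemma frft_schwartz: "f \<in> schwartz m \<Longrightarrow> \<alpha> \<in> angles \<Longrightarrow> frft m j \<alpha> f \<in> schwartz m"
  using equi_frft by (auto simp: equi_def)

lemma frft_time_deriv:
  assumes f: "f \<in> schwartz m" and x: "x \<in> Rm m" and a: "\<alpha> \<in> angles - {0}"
  shows "((\<lambda>\<alpha>. frft m j \<alpha> f x) has_vector_derivative \<i> / 2 * frft m j \<alpha> (hermite j f) x) (at \<alpha>)"
proof -
  have a': "\<alpha> \<noteq> 0" "\<bar>\<alpha>\<bar> \<le> pi / 2" using a anglesD by auto
  note S = f pd_schwartz[OF f j] pd_schwartz[OF pd_schwartz[OF f j] j] mx_schwartz[OF f j]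
    mx_schwartz[OF mx_schwartz[OF f j] j] mx_schwartz[OF pd_schwartz[OF f j] j]
  note R = section_rapid[OF S(1) j x] section_rapid[OF S(2) j x] section_rapid[OF S(3) j x]
    section_rapid[OF S(4) j x, folded mx_section]
    section_rapid[OF S(6) j x, folded mx_section]
  have R5: "rapid (\<lambda>s. of_real s * (of_real s * f (x(j := s))))"
    using section_rapid[OF S(5) j x] by (simp add: mx_def)
  have "((\<lambda>\<alpha>. frft1 \<alpha> (\<lambda>s. f (x(j := s))) (x j)) has_vector_derivative
    \<i> / 2 * (frft m j \<alpha> (mx j (mx j f)) x - frft m j \<alpha> (pd j (pd j f)) x - frft m j \<alpha> f x)) (at \<alpha>)"
    using frft1_time_deriv[OF a' R(1,2,3,4) R5 R(5) schwartz_deriv[OF S(1) j x] schwartz_deriv[OF S(2) j x], of "x j"] x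
    by (simp add: mx_def frft_def)
  moreover have "frft m j \<alpha> (hermite j f) = (\<lambda>x. frft m j \<alpha> (mx j (mx j f)) x - frft m j \<alpha> (pd j (pd j f)) x - frft m j \<alpha> f x)"
    unfolding hermite_def[abs_def]
    by (simp only: frft_lincomb[OF j] schwartz_lincomb S) simp
  ultimately show ?thesis using x by (simp add: frft_def[of m j _ f x])
qed

text \<open>This is where the limit at angle 0 enters; at the other angles continuity follows from
  differentiability.\<close>

lemma frft_continuous:
  assumes f: "f \<in> schwartz m" and x: "x \<in> Rm m"
  shows "continuous_on angles (\<lambda>\<alpha>. frft m j \<alpha> f x)"
proof (rule continuous_at_imp_continuous_on, rule ballI)
  fix \<alpha> assume a: "\<alpha> \<in> angles"
  show "isCont (\<lambda>\<alpha>. frft m j \<alpha> f x) \<alpha>"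
  proof (cases "\<alpha> = 0")
    case True
    have "((\<lambda>\<alpha>. frft m j \<alpha> f x) \<longlongrightarrow> frft m j 0 f x) (at 0)"
      using frft1_tendsto[OF section_rapid[OF f j x] section_rapid[OF pd_schwartz[OF f j] j x] schwartz_deriv[OF f j x], of "x j"] x
      by (simp add: frft_0[OF f]) (simp add: frft_def)
    then show ?thesis using True by (simp add: isCont_def)
  next
    case False
    then show ?thesis using frft_time_deriv[OF f x, of \<alpha>] a has_vector_derivative_continuous by blast
  qed
qed

lemma frft_increment:
  assumes f: "f \<in> schwartz m" and x: "x \<in> Rm m" and st: "s \<in> angles" "t \<in> angles" and B: "B \<ge> 0"
    and D: "\<And>r. r \<in> {min t s..max t s} \<Longrightarrow> norm (\<i> / 2 * frft m j r (hermite j f) x - D) \<le> B"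
  shows "norm (frft m j s f x - frft m j t f x - of_real (s - t) * D) \<le> B * \<bar>s - t\<bar>"
  by (rule increment_bound[OF B frft_continuous[OF f x] interval_angles[OF st(2,1)] frft_time_deriv[OF f x] D])

section \<open>Difference quotients in the angle\<close>

text \<open>All pairs of distinct angles at once, including pairs with 0 between them or at an end.
  \<open>frft_increment\<close> with \<open>D = 0\<close> bounds the quotients by the transform of
  \<open>hermite j f\<close>, however close the two angles are.\<close>

definition frft_quot :: "cop set"
  where "frft_quot = {\<lambda>f x. (frft m j s f x - frft m j t f x) / of_real (s - t) |s t. s \<in> angles \<and> t \<in> angles \<and> s \<noteq> t}"

lemma bdd_frft_quot: "bdd_ops m frft_quot"
proof -
  obtain K \<Theta> where K: "K \<ge> 0" "index m \<Theta>"
    "\<And>U f c x. U \<in> {\<lambda>f. U (P f) |U P. U \<in> frft m j ` angles \<and> P \<in> {hermite j}} \<Longrightarrow> f \<in> schwartz m \<Longrightarrow> c \<ge> 0 \<Longrightarrow>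
      sn_le m \<Theta> f c \<Longrightarrow> x \<in> Rm m \<Longrightarrow> norm (U f x) \<le> K * c"
    by (rule bdd_opsE[OF bdd_ops_comp[OF bdd_frft equi_hermite[OF j]]]) (rule that; assumption)
  have K3: "norm (frft m j r (hermite j f) x) \<le> K * c"
    if "r \<in> angles" "f \<in> schwartz m" "c \<ge> 0" "sn_le m \<Theta> f c" "x \<in> Rm m" for r f c x
    by (rule K(3)[OF _ that(2-5)], rule CollectI, rule exI[of _ "frft m j r"], rule exI[of _ "hermite j"]) (use that(1) in simp)
  have "norm ((frft m j s f x - frft m j t f x) / of_real (s - t)) \<le> K * c"
    if st: "s \<in> angles" "t \<in> angles" "s \<noteq> t" and f: "f \<in> schwartz m" and c: "c \<ge> 0" "sn_le m \<Theta> f c" and x: "x \<in> Rm m" for s t f c x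
  proof -
    have "norm (frft m j s f x - frft m j t f x - of_real (s - t) * 0) \<le> K * c * \<bar>s - t\<bar>"
    proof (rule frft_increment[OF f x st(1,2)])
      show "0 \<le> K * c" using K c by simp
      fix r assume "r \<in> {min t s..max t s}"
      then have "r \<in> angles" using interval_angles[OF st(2,1)] by blast
      from K3[OF this f c x] show "norm (\<i> / 2 * frft m j r (hermite j f) x - 0) \<le> K * c"
        by (simp add: norm_mult) (use norm_ge_zero[of "frft m j r (hermite j f) x"] in linarith)
    qed
    then show ?thesis using st(3) by (simp add: norm_divide divide_le_eq del: of_real_diff)
  qed
  then show ?thesis unfolding bdd_ops_def frft_quot_def using K(1,2)
    by (intro exI[of _ K] conjI exI[of _ \<Theta>]) auto
qed

lemma cos_sin_quot:
  assumes "s \<noteq> t"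
  shows "norm ((complex_of_real (cos s) - of_real (cos t)) / of_real (s - t)) \<le> 1"
    "norm ((complex_of_real (sin s) - of_real (sin t)) / of_real (s - t)) \<le> 1"
proof -
  have "norm (cos s - cos t) \<le> 1 * norm (s - t)"
    by (rule field_differentiable_bound[where S=UNIV and f'="\<lambda>x. - sin x"]) (auto intro!: derivative_eq_intros)
  moreover have "norm (sin s - sin t) \<le> 1 * norm (s - t)"
    by (rule field_differentiable_bound[where S=UNIV and f'=cos]) (auto intro!: derivative_eq_intros)
  ultimately show "norm ((complex_of_real (cos s) - of_real (cos t)) / of_real (s - t)) \<le> 1"
    "norm ((complex_of_real (sin s) - of_real (sin t)) / of_real (s - t)) \<le> 1"
    using assms by (simp_all add: norm_divide divide_le_eq flip: of_real_diff)
qed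

text \<open>Discrete product rule: cs A - ct C = cs (A - C) + (cs - ct) C, and likewise for the sine
  part.\<close>

lemma rotate_quot:
  assumes "s \<noteq> (t :: real)"
  shows "((cs * A + ii * ss * B) - (ct * C + ii * st * D)) / of_real (s - t)
    = 1 * (cs * ((A - C) / of_real (s - t)) + (cs - ct) / of_real (s - t) * C)
      + 1 * (ii * ss * ((B - D) / of_real (s - t)) + ii * ((ss - st) / of_real (s - t)) * (D :: complex))"
  using assms by (simp add: divide_simps del: of_real_diff) (simp add: algebra_simps)

text \<open>By the rotation relations and the discrete product rule, a derivative or coordinate of a
  quotient is a combination of quotients and of plain transforms; the quotients of cosine and sine
  that appear as coefficients are bounded by 1.\<close>

lemma stable_frft_quot: "stable m k frft_quot"
proof (induction k)
  case 0
  have "adm m (\<lambda>x. (frft m j s f x - frft m j t f x) / of_real (s - t))"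
    if "s \<in> angles" "t \<in> angles" "f \<in> schwartz m" for s t f
  proof -
    have "(\<lambda>x. (frft m j s f x - frft m j t f x) / of_real (s - t))
      = (\<lambda>x. (1 / of_real (s - t)) * frft m j s f x + (- 1 / of_real (s - t)) * frft m j t f x)"
      by (simp add: diff_divide_distrib)
    then show ?thesis using that by (simp only: adm_lincomb(1) adm_frft[OF j _ anglesD])
  qed
  then show ?case using bdd_frft_quot by (auto simp: frft_quot_def)
next
  case (Suc k)
  \<comment> \<open>One argument serves \<open>pd i\<close> and \<open>mx i\<close>:
    \<open>P\<close> is the same operation, \<open>Q\<close> the conjugate operation in coordinate
    \<open>j\<close>, and \<open>same\<close> records whether coordinate \<open>i\<close> is the
    rotated one.\<close>
  have step: "stable m k ((\<lambda>U f. F (U f)) ` frft_quot)"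
    if P: "equi m {P}" and Q: "equi m {Q}"
      and lin: "\<And>f g a b. adm m f \<Longrightarrow> adm m g \<Longrightarrow> F (\<lambda>x. a * f x + b * g x) = (\<lambda>x. a * F f x + b * F g x)"
      and rot: "\<And>f \<alpha>. f \<in> schwartz m \<Longrightarrow> \<alpha> \<in> angles \<Longrightarrow> F (frft m j \<alpha> f) =
        (\<lambda>x. (if same then of_real (cos \<alpha>) else 1) * frft m j \<alpha> (P f) x + e * (if same then of_real (sin \<alpha>) else 0) * frft m j \<alpha> (Q f) x)"
      and e: "norm e = 1" for F P Q :: cop and same e
  proof (rule stable_combine[OF P Q Suc.IH stable_frft])
    fix X assume "X \<in> (\<lambda>U f. F (U f)) ` frft_quot"
    then obtain s t where st: "s \<in> angles" "t \<in> angles" "s \<noteq> t"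
      and X: "X = (\<lambda>f. F (\<lambda>x. (frft m j s f x - frft m j t f x) / of_real (s - t)))" unfolding frft_quot_def by blast
    define c :: "real \<Rightarrow> complex" where "c \<alpha> = (if same then of_real (cos \<alpha>) else 1)" for \<alpha>
    define d :: "real \<Rightarrow> complex" where "d \<alpha> = (if same then of_real (sin \<alpha>) else 0)" for \<alpha>
    define L where "L = (\<lambda>f x. (frft m j s f x - frft m j t f x) / complex_of_real (s - t))"
    have L: "L \<in> frft_quot" unfolding L_def frft_quot_def using st by blast
    have n1: "norm (c s) \<le> 1" by (simp add: c_def)
    have n2: "norm ((c s - c t) / of_real (s - t)) \<le> 1"
      by (cases same) (use cos_sin_quot(1)[OF st(3)] in \<open>simp_all add: c_def del: of_real_diff\<close>)
    have n3: "norm (e * d s) \<le> 1" by (simp add: d_def norm_mult e)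
    have n4: "norm (e * ((d s - d t) / of_real (s - t))) \<le> 1"
      unfolding norm_mult e mult_1_left
      by (cases same) (use cos_sin_quot(2)[OF st(3)] in \<open>simp_all add: d_def del: of_real_diff\<close>)
    note n = n1 n2 n3 n4
    have E: "X f = (\<lambda>x. 1 * (c s * L (P f) x + (c s - c t) / of_real (s - t) * frft m j t (P f) x)
        + 1 * (e * d s * L (Q f) x + e * ((d s - d t) / of_real (s - t)) * frft m j t (Q f) x))" if f: "f \<in> schwartz m" for f
    proof -
      have "(\<lambda>x. (frft m j s f x - frft m j t f x) / complex_of_real (s - t))
        = (\<lambda>x. (1 / of_real (s - t)) * frft m j s f x + (- 1 / of_real (s - t)) * frft m j t f x)"
        by (simp add: diff_divide_distrib)
      then have "X f = (\<lambda>x. (1 / of_real (s - t)) * F (frft m j s f) x + (- 1 / of_real (s - t)) * F (frft m j t f) x)"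
        unfolding X by (simp only: lin adm_frft[OF j f anglesD] st)
      also have "\<dots> = (\<lambda>x. ((c s * frft m j s (P f) x + e * d s * frft m j s (Q f) x) - (c t * frft m j t (P f) x + e * d t * frft m j t (Q f) x)) / of_real (s - t))"
        unfolding rot[OF f st(1)] rot[OF f st(2)] c_def d_def by (simp add: diff_divide_distrib)
      finally show ?thesis unfolding rotate_quot[OF st(3)] L_def .
    qed
    show "\<exists>a b c d U V U' V'. norm a \<le> 1 \<and> norm b \<le> 1 \<and> norm c \<le> 1 \<and> norm d \<le> 1 \<and>
      U \<in> frft_quot \<and> V \<in> frft m j ` angles \<and> U' \<in> frft_quot \<and> V' \<in> frft m j ` angles \<and>
      (\<forall>f\<in>schwartz m. X f = (\<lambda>x. 1 * (a * U (P f) x + b * V (P f) x) + 1 * (c * U' (Q f) x + d * V' (Q f) x)))"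
      by (rule exI[of _ "c s"], rule exI[of _ "(c s - c t) / of_real (s - t)"], rule exI[of _ "e * d s"],
          rule exI[of _ "e * ((d s - d t) / of_real (s - t))"], rule exI[of _ L], rule exI[of _ "frft m j t"],
          rule exI[of _ L], rule exI[of _ "frft m j t"]) (intro conjI n L ballI E imageI st)
  qed
  have "stable m k ((\<lambda>U f. pd i (U f)) ` frft_quot)" if i: "i \<in> {1..m}" for i
    by (rule step[where P="pd i" and Q="mx j" and same="i = j" and e="\<i>", OF equi_pd[OF i] equi_mx[OF j] adm_lincomb(2)[OF _ _ i]])
       (use frft_pd_same[OF j _ anglesD] frft_pd_other[OF j _ i] in auto)
  moreover have "stable m k ((\<lambda>U f. mx i (U f)) ` frft_quot)" if i: "i \<in> {1..m}" for i
  proof -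
    have lin: "mx i (\<lambda>x. a * f x + b * g x) = (\<lambda>x. a * mx i f x + b * mx i g x)" for f g a b
      by (simp add: fun_eq_iff mx_def algebra_simps)
    show ?thesis
      by (rule step[where P="mx i" and Q="pd j" and same="i = j" and e="\<i>", OF equi_mx[OF i] equi_pd[OF j] lin])
         (use frft_mx_same[OF j _ anglesD] frft_mx_other[OF j _ i] in auto)
  qed
  ultimately show ?case using stable_0[OF Suc.IH] by simp
qed

lemma equi_frft_quot: "equi m frft_quot"
  by (rule stable_equi[OF stable_frft_quot])

text \<open>The sup norm of the error is of order |s - t|, and all its seminorms stay bounded
  because the quotients form an equicontinuous family; interpolation does the rest.\<close>

lemma sderiv_frft:
  assumes f: "f \<in> schwartz m" and t: "t \<in> angles"
  shows "sderiv m (\<lambda>\<alpha>. frft m j \<alpha> f) (\<lambda>x. \<i> / 2 * frft m j t (hermite j f) x) t angles"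
proof -
  have Hf: "hermite j f \<in> schwartz m" by (rule hermite_schwartz[OF f j])
  have D: "(\<lambda>x. \<i> / 2 * frft m j t (hermite j f) x) \<in> schwartz m"
    by (intro schwartz_cmult frft_schwartz Hf t)
  define L where "L s = (\<lambda>f x. (frft m j s f x - frft m j t f x) / complex_of_real (s - t))" for s
  have L: "L s \<in> frft_quot" if "s \<in> angles" "s \<noteq> t" for s
    unfolding L_def frft_quot_def using that t by blast
  have ev: "\<forall>\<^sub>F s in at t within angles. L s \<in> frft_quot \<and> s \<in> angles \<and> s \<noteq> t"
    by (rule eventually_mono[OF eventually_at_within_mem]) (use L in blast)
  have LS: "L s f \<in> schwartz m" if "L s \<in> frft_quot" for s
    using that equi_frft_quot f by (auto simp: equi_def)
  have q: "(\<lambda>x. (frft m j s f x - frft m j t f x) / of_real (s - t) - \<i> / 2 * frft m j t (hermite j f) x)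
    = (\<lambda>x. 1 * L s f x + (-1) * (\<i> / 2 * frft m j t (hermite j f) x))" for s
    by (simp add: L_def)
  have "snull m (\<lambda>s x. (frft m j s f x - frft m j t f x) / of_real (s - t) - \<i> / 2 * frft m j t (hermite j f) x) (at t within angles)"
    unfolding q
  proof (rule snull_interpolate)
    show "\<forall>\<^sub>F s in at t within angles. (\<lambda>x. 1 * L s f x + (-1) * (\<i> / 2 * frft m j t (hermite j f) x)) \<in> schwartz m"
      using ev by eventually_elim (intro schwartz_lincomb D LS; simp)
  next
    fix \<Theta> assume i: "index m \<Theta>"
    obtain K \<Psi> where K: "K \<ge> 0" "index m \<Psi>"
      "\<And>U f c. U \<in> frft_quot \<Longrightarrow> f \<in> schwartz m \<Longrightarrow> c \<ge> 0 \<Longrightarrow> sn_le m \<Psi> f c \<Longrightarrow> sn_le m \<Theta> (U f) (K * c)"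
      by (rule equi_index[OF equi_frft_quot i]) (rule that; assumption)
    obtain c where c: "c \<ge> 0" "sn_le m \<Psi> f c" by (rule schwartz_sn_le[OF f K(2)])
    obtain d where d: "d \<ge> 0" "sn_le m \<Theta> (\<lambda>x. \<i> / 2 * frft m j t (hermite j f) x) d" by (rule schwartz_sn_le[OF D i])
    have "\<forall>\<^sub>F s in at t within angles. sn_le m \<Theta> (\<lambda>x. 1 * L s f x + (-1) * (\<i> / 2 * frft m j t (hermite j f) x)) (K * c + d)"
      using ev
    proof eventually_elim
      case (elim s)
      then have l: "L s \<in> frft_quot" by simp
      from sn_le_lincomb[OF LS[OF l] D i K(3)[OF l f c] d(2), of 1 "-1"] show ?case by simp
    qed
    then show "\<exists>c\<ge>0. \<forall>\<^sub>F s in at t within angles. sn_le m \<Theta> (\<lambda>x. 1 * L s f x + (-1) * (\<i> / 2 * frft m j t (hermite j f) x)) c"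
      using K(1) c d by (intro exI[of _ "K * c + d"]) auto
  next
    fix e :: real assume e: "e > 0"
    obtain K \<Psi> where K: "K \<ge> 0" "index m \<Psi>"
      "\<And>U f c x. U \<in> frft_quot \<Longrightarrow> f \<in> schwartz m \<Longrightarrow> c \<ge> 0 \<Longrightarrow> sn_le m \<Psi> f c \<Longrightarrow> x \<in> Rm m \<Longrightarrow> norm (U f x) \<le> K * c"
      by (rule bdd_opsE[OF bdd_frft_quot]) (rule that; assumption)
    obtain c where c: "c \<ge> 0" "sn_le m \<Psi> (hermite j f) c" by (rule schwartz_sn_le[OF Hf K(2)])
    \<comment> \<open>The quotient bound, applied to \<open>hermite j f\<close>, makes the
      derivative Lipschitz in the angle; hence the first order remainder is quadratic in s -
      t.\<close>
    have lip: "norm (frft m j r (hermite j f) x - frft m j t (hermite j f) x) \<le> K * c * \<bar>r - t\<bar>"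
      if "r \<in> angles" "x \<in> Rm m" for r x
    proof (cases "r = t")
      case False
      from K(3)[OF L[OF that(1) False] Hf c that(2)] have "norm ((frft m j r (hermite j f) x - frft m j t (hermite j f) x) / of_real (r - t)) \<le> K * c"
        by (simp add: L_def)
      then show ?thesis using False by (simp add: norm_divide divide_le_eq del: of_real_diff)
    qed simp
    have b: "norm (1 * L s f x + (-1) * (\<i> / 2 * frft m j t (hermite j f) x)) \<le> K * c * \<bar>s - t\<bar>"
      if s: "s \<in> angles" "s \<noteq> t" and x: "x \<in> Rm m" for s x
    proof -
      have "norm (frft m j s f x - frft m j t f x - of_real (s - t) * (\<i> / 2 * frft m j t (hermite j f) x)) \<le> (K * c * \<bar>s - t\<bar>) * \<bar>s - t\<bar>"
      proof (rule frft_increment[OF f x s(1) t])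
        show "0 \<le> K * c * \<bar>s - t\<bar>" using K c by simp
        fix r assume r: "r \<in> {min t s..max t s}"
        then have ra: "r \<in> angles" using interval_angles[OF t s(1)] by blast
        have "\<i> / 2 * frft m j r (hermite j f) x - \<i> / 2 * frft m j t (hermite j f) x
          = \<i> / 2 * (frft m j r (hermite j f) x - frft m j t (hermite j f) x)" by (simp add: algebra_simps)
        also have "norm \<dots> = 1 / 2 * norm (frft m j r (hermite j f) x - frft m j t (hermite j f) x)" by (simp add: norm_mult)
        also have "\<dots> \<le> 1 * (K * c * \<bar>r - t\<bar>)" using lip[OF ra x] K c by (intro mult_mono) auto
        also have "\<dots> \<le> K * c * \<bar>s - t\<bar>" using r K c unfolding mult_1_left by (intro mult_left_mono) auto
        finally show "norm (\<i> / 2 * frft m j r (hermite j f) x - \<i> / 2 * frft m j t (hermite j f) x) \<le> K * c * \<bar>s - t\<bar>" .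
      qed
      moreover have "1 * L s f x + (-1) * (\<i> / 2 * frft m j t (hermite j f) x)
        = (frft m j s f x - frft m j t f x - of_real (s - t) * (\<i> / 2 * frft m j t (hermite j f) x)) / of_real (s - t)"
        using s by (simp add: L_def diff_divide_distrib del: of_real_diff)
      ultimately show ?thesis using s by (simp add: norm_divide divide_le_eq del: of_real_diff)
    qed
    have "\<forall>\<^sub>F s in at t within angles. \<bar>s - t\<bar> < e / (K * c + 1)"
    proof -
      have "0 < e / (K * c + 1)" using e K c by (intro divide_pos_pos add_nonneg_pos) auto
      then show ?thesis unfolding eventually_at by (intro exI[of _ "e / (K * c + 1)"]) (auto simp: dist_real_def)
    qed
    with ev show "\<forall>\<^sub>F s in at t within angles. \<forall>x\<in>Rm m. norm (1 * L s f x + (-1) * (\<i> / 2 * frft m j t (hermite j f) x)) \<le> e"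
    proof eventually_elim
      case (elim s)
      have "0 < K * c + 1" using K c by (simp add: add_nonneg_pos)
      then have "K * c * \<bar>s - t\<bar> \<le> (K * c + 1) * (e / (K * c + 1))" using elim K c by (intro mult_mono) auto
      also have "\<dots> = e" using \<open>0 < K * c + 1\<close> by simp
      finally show ?case using b elim order_trans by blast
    qed
  qed
  then show ?thesis unfolding sderiv_def using D frft_schwartz[OF f] by simp
qed

text \<open>The quadratic form x^2 - d^2 is invariant under the rotation of x and d effected by the
  transform in the same coordinate. In another coordinate everything commutes.\<close>

lemma hermite_frft:
  assumes f: "f \<in> schwartz m" and a: "\<alpha> \<in> angles" and i: "i \<in> {1..m}"
  shows "hermite i (frft m j \<alpha> f) = frft m j \<alpha> (hermite i f)"
proof -
  have a': "\<bar>\<alpha>\<bar> \<le> pi / 2" by (rule anglesD[OF a])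
  note S = f pd_schwartz[OF f i] pd_schwartz[OF pd_schwartz[OF f i] i] mx_schwartz[OF f i]
    mx_schwartz[OF mx_schwartz[OF f i] i] mx_schwartz[OF pd_schwartz[OF f i] i] pd_schwartz[OF mx_schwartz[OF f i] i]
  have R: "frft m j \<alpha> (hermite i f) = (\<lambda>x. frft m j \<alpha> (mx i (mx i f)) x - frft m j \<alpha> (pd i (pd i f)) x - frft m j \<alpha> f x)"
    unfolding hermite_def[abs_def]
    by (simp only: frft_lincomb[OF j] schwartz_lincomb S) simp
  show ?thesis
  proof (cases "i = j")
    case False
    show ?thesis unfolding R
      using False by (simp add: hermite_def[abs_def] frft_mx_other[OF j _ i False] frft_pd_other[OF j _ i False] S)
  next
    case True
    define c where "c = complex_of_real (cos \<alpha>)"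
    define d where "d = complex_of_real (sin \<alpha>)"
    note S' = S[unfolded True]
    have Tm: "mx j (frft m j \<alpha> g) = (\<lambda>x. c * frft m j \<alpha> (mx j g) x + (\<i> * d) * frft m j \<alpha> (pd j g) x)"
      and Tp: "pd j (frft m j \<alpha> g) = (\<lambda>x. c * frft m j \<alpha> (pd j g) x + (\<i> * d) * frft m j \<alpha> (mx j g) x)"
      if "g \<in> schwartz m" for g
      using frft_mx_same[OF j that a'] frft_pd_same[OF j that a'] by (simp_all add: c_def d_def)
    have ad: "adm m (frft m j \<alpha> g)" if "g \<in> schwartz m" for g by (rule adm_frft[OF j that a'])
    have mm: "mx j (mx j (frft m j \<alpha> f)) = (\<lambda>x. c * mx j (frft m j \<alpha> (mx j f)) x + (\<i> * d) * mx j (frft m j \<alpha> (pd j f)) x)"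
      unfolding Tm[OF f] by (simp add: mx_def[abs_def] algebra_simps)
    have pp: "pd j (pd j (frft m j \<alpha> f)) = (\<lambda>x. c * pd j (frft m j \<alpha> (pd j f)) x + (\<i> * d) * pd j (frft m j \<alpha> (mx j f)) x)"
      unfolding Tp[OF f] by (rule adm_lincomb(2)[OF ad[OF S'(2)] ad[OF S'(4)] j])
    have cd: "c * c = 1 - d * d"
      using sin_cos_squared_add[of \<alpha>] unfolding c_def d_def
      by (metis add_diff_cancel_left' of_real_1 of_real_diff of_real_mult power2_eq_square)
    \<comment> \<open>\<open>A\<close> and \<open>D\<close> stand for the pure second order terms,
      \<open>B\<close> and \<open>C\<close> for the mixed ones in both orders; the mixed ones
      cancel, and c^2 + d^2 = 1 remains in front of A - D.\<close>
    have key: "c * (c * A + (\<i> * d) * B) + (\<i> * d) * (c * C + (\<i> * d) * D)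
        - (c * (c * D + (\<i> * d) * C) + (\<i> * d) * (c * B + (\<i> * d) * A)) = A - D" for A B C D :: complex
    proof -
      have "c * (c * A + (\<i> * d) * B) + (\<i> * d) * (c * C + (\<i> * d) * D)
        - (c * (c * D + (\<i> * d) * C) + (\<i> * d) * (c * B + (\<i> * d) * A)) = (c * c) * (A - D) + d * d * (A - D)"
        by (simp add: algebra_simps)
      then show ?thesis unfolding cd by (simp add: algebra_simps)
    qed
    show ?thesis
      unfolding True R[unfolded True] unfolding hermite_def[abs_def] mm pp
      unfolding Tm[OF S'(4)] Tm[OF S'(2)] Tp[OF S'(4)] Tp[OF S'(2)]
      by (rule ext) (simp only: mult_1_left mult_minus_left add_uminus_conv_diff key)
  qed
qed

end

section \<open>The transform in all coordinates\<close>

definition frfts :: "nat \<Rightarrow> nat list \<Rightarrow> real \<Rightarrow> cop"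
  where "frfts m js \<alpha> f = foldr (\<lambda>j. frft m j \<alpha>) js f"

definition hermites :: "nat list \<Rightarrow> cop"
  where "hermites js f x = (\<Sum>j\<leftarrow>js. hermite j f x)"

lemma frfts_Nil [simp]: "frfts m [] \<alpha> f = f" and frfts_Cons: "frfts m (j # js) \<alpha> f = frft m j \<alpha> (frfts m js \<alpha> f)"
  and frfts_snoc: "frfts m (js @ [j]) \<alpha> f = frfts m js \<alpha> (frft m j \<alpha> f)"
  by (simp_all add: frfts_def)

lemma frfts_schwartz: "set js \<subseteq> {1..m} \<Longrightarrow> f \<in> schwartz m \<Longrightarrow> \<alpha> \<in> angles \<Longrightarrow> frfts m js \<alpha> f \<in> schwartz m"
  by (induction js) (auto simp: frfts_Cons intro: frft_schwartz)

lemma frfts_0: "f \<in> schwartz m \<Longrightarrow> frfts m js 0 f = f"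
  by (induction js) (simp_all add: frfts_Cons frft_0)

lemma frfts_lincomb:
  assumes "set js \<subseteq> {1..m}" "f \<in> schwartz m" "g \<in> schwartz m" "\<alpha> \<in> angles"
  shows "frfts m js \<alpha> (\<lambda>x. a * f x + b * g x) = (\<lambda>x. a * frfts m js \<alpha> f x + b * frfts m js \<alpha> g x)"
  using assms(1)
proof (induction js)
  case (Cons j js)
  then show ?case
    using frft_lincomb[of j m "frfts m js \<alpha> f" "frfts m js \<alpha> g" \<alpha> a b] assms(2-4)
    by (simp add: frfts_Cons frfts_schwartz)
qed simp

lemma equi_frfts: "set js \<subseteq> {1..m} \<Longrightarrow> equi m (frfts m js ` angles)"
proof (induction js)
  case Nil
  show ?case
  proof (rule equi_subset[OF equi_id[of m]])
    fix X assume "X \<in> frfts m [] ` angles"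
    then obtain \<alpha> where "X = frfts m [] \<alpha>" by (rule imageE)
    then have "\<forall>f\<in>schwartz m. X f = f" by simp
    then show "\<exists>V\<in>{\<lambda>f. f}. \<forall>f\<in>schwartz m. X f = V f" by - (rule bexI[of _ "\<lambda>f. f"], assumption, rule singletonI)
  qed
next
  case (Cons j js)
  then have j: "j \<in> {1..m}" "set js \<subseteq> {1..m}" by auto
  show ?case
  proof (rule equi_subset[OF equi_comp[OF equi_frft[OF j(1)] Cons.IH[OF j(2)]]])
    fix X assume "X \<in> frfts m (j # js) ` angles"
    then obtain \<alpha> where a: "X = frfts m (j # js) \<alpha>" "\<alpha> \<in> angles" by (rule imageE)
    have X: "X = (\<lambda>f. frft m j \<alpha> (frfts m js \<alpha> f))" unfolding a(1) by (rule ext) (rule frfts_Cons)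
    have "\<exists>U P. X = (\<lambda>f. U (P f)) \<and> U \<in> frft m j ` angles \<and> P \<in> frfts m js ` angles"
      by (rule exI[of _ "frft m j \<alpha>"], rule exI[of _ "frfts m js \<alpha>"]) (intro conjI X imageI a(2))
    then show "\<exists>V\<in>{\<lambda>f. U (P f) |U P. U \<in> frft m j ` angles \<and> P \<in> frfts m js ` angles}. \<forall>f\<in>schwartz m. X f = V f"
      by (intro bexI[of _ X] CollectI) (rule ballI, rule refl)
  qed
qed

lemma hermites_Cons: "hermites (j # js) f = (\<lambda>x. 1 * hermite j f x + 1 * hermites js f x)"
  by (simp add: hermites_def fun_eq_iff)

lemma hermites_schwartz: "set js \<subseteq> {1..m} \<Longrightarrow> f \<in> schwartz m \<Longrightarrow> hermites js f \<in> schwartz m"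
proof (induction js)
  case Nil then show ?case using schwartz_zero by (simp add: hermites_def[abs_def])
next
  case (Cons j js)
  then show ?case unfolding hermites_Cons by (intro schwartz_lincomb hermite_schwartz) auto
qed

lemma hermites_frft:
  assumes f: "f \<in> schwartz m" and j: "j \<in> {1..m}" and a: "\<alpha> \<in> angles"
  shows "set js \<subseteq> {1..m} \<Longrightarrow> hermites js (frft m j \<alpha> f) = frft m j \<alpha> (hermites js f)"
proof (induction js)
  case Nil
  have "frft m j \<alpha> (\<lambda>_. 0) = (\<lambda>_. 0)" using frft_cmult[OF j f, of \<alpha> 0] by simp
  then show ?case by (simp add: hermites_def[abs_def])
next
  case (Cons i ks)
  then have i: "i \<in> {1..m}" "set ks \<subseteq> {1..m}" by auto
  show ?case
    unfolding hermites_Cons hermite_frft[OF j f a i(1)] Cons.IH[OF i(2)]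
      frft_lincomb[OF j hermite_schwartz[OF f i(1)] hermites_schwartz[OF i(2) f], of \<alpha> 1 1] ..
qed

lemma hermites_frfts:
  assumes "f \<in> schwartz m" "set ks \<subseteq> {1..m}" "\<alpha> \<in> angles"
  shows "set js \<subseteq> {1..m} \<Longrightarrow> hermites ks (frfts m js \<alpha> f) = frfts m js \<alpha> (hermites ks f)"
proof (induction js)
  case (Cons j js)
  then show ?case using hermites_frft[OF frfts_schwartz[OF _ assms(1,3)], of js j \<alpha> ks] assms by (simp add: frfts_Cons)
qed simp

lemma sderiv_const: "f \<in> schwartz m \<Longrightarrow> sderiv m (\<lambda>_. f) (\<lambda>_. 0) t I"
  using snull_scale_zero[of f m "\<lambda>_. 0" "at t within I"] schwartz_zero
  by (simp add: sderiv_def)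

lemma sderiv_frfts:
  assumes f: "f \<in> schwartz m" and t: "t \<in> angles"
  shows "set js \<subseteq> {1..m} \<Longrightarrow>
    sderiv m (\<lambda>\<alpha>. frfts m js \<alpha> f) (\<lambda>x. \<i> / 2 * hermites js (frfts m js t f) x) t angles"
proof (induction js)
  case Nil
  then show ?case using sderiv_const[OF f] by (simp add: hermites_def)
next
  case (Cons j js)
  then have j: "j \<in> {1..m}" "set js \<subseteq> {1..m}" by auto
  let ?v = "frfts m js t f"
  have v: "?v \<in> schwartz m" by (rule frfts_schwartz[OF j(2) f t])
  have "sderiv m (\<lambda>s. frft m j s (frfts m js s f))
     (\<lambda>x. frft m j t (\<lambda>x. \<i> / 2 * hermites js ?v x) x + \<i> / 2 * frft m j t (hermite j ?v) x) t angles"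
    by (rule sderiv_chain[where W'="\<lambda>g x. \<i> / 2 * frft m j t (hermite j g) x", OF Cons.IH[OF j(2)] t frft_lincomb[OF j(1)] equi_frft[OF j(1)] sderiv_frft[OF j(1) _ t]])
  moreover have "(\<lambda>x. frft m j t (\<lambda>x. \<i> / 2 * hermites js ?v x) x + \<i> / 2 * frft m j t (hermite j ?v) x)
     = (\<lambda>x. \<i> / 2 * hermites (j # js) (frfts m (j # js) t f) x)"
    unfolding frfts_Cons hermites_Cons frft_cmult[OF j(1) hermites_schwartz[OF j(2) v]]
      hermites_frft[OF v j(1) t j(2)] hermite_frft[OF j(1) v t j(1)]
    by (simp add: algebra_simps)
  ultimately show ?case by (simp add: frfts_Cons)
qed

lemma snull_compose:
  assumes "snull m p F" "filterlim h F G"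
  shows "snull m (\<lambda>s. p (h s)) G"
proof (rule snullI)
  show "\<forall>\<^sub>F s in G. p (h s) \<in> schwartz m"
    using assms(1) by (auto simp: snull_def intro: eventually_compose_filterlim[OF _ assms(2)])
  fix js \<beta> and e :: real assume "set js \<subseteq> {1..m}" "e > 0"
  then have "\<forall>\<^sub>F s in F. sn_le m {(js, \<beta>)} (p s) e" using assms(1) by (simp add: snull_def)
  then show "\<forall>\<^sub>F s in G. sn_le m {(js, \<beta>)} (p (h s)) e" by (rule eventually_compose_filterlim[OF _ assms(2)])
qed

lemma sderiv_reparam:
  assumes v: "sderiv m v v' (\<kappa> * t) J" and I: "\<And>s. s \<in> I \<Longrightarrow> \<kappa> * s \<in> J" and t: "t \<in> I"
  shows "sderiv m (\<lambda>s. v (\<kappa> * s)) (\<lambda>x. of_real \<kappa> * v' x) t I"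
\<comment> \<open>Scaling by \<kappa> maps punctured neighbourhoods to punctured neighbourhoods only
  if \<kappa> is nonzero; otherwise the curve is constant.\<close>
proof (cases "\<kappa> = 0")
  case True
  have "v 0 \<in> schwartz m" using v I[OF t] True by (auto simp: sderiv_def)
  then show ?thesis using sderiv_const[of "v 0" m t I] True by simp
next
  case False
  have S: "\<And>s. s \<in> I \<Longrightarrow> v (\<kappa> * s) \<in> schwartz m" "(\<lambda>x. of_real \<kappa> * v' x) \<in> schwartz m"
    using v I by (auto simp: sderiv_def intro: schwartz_cmult)
  have lim: "((\<lambda>s. \<kappa> * s) \<longlongrightarrow> \<kappa> * t) (at t within I)"
    by (intro tendsto_intros)
  have "\<forall>\<^sub>F s in at t within I. \<kappa> * s \<in> J \<and> \<kappa> * s \<noteq> \<kappa> * t"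
    using eventually_at_within_mem[of I t] by eventually_elim (use I False in simp)
  with lim have flim: "filterlim (\<lambda>s. \<kappa> * s) (at (\<kappa> * t) within J) (at t within I)"
    unfolding filterlim_at by blast
  have N: "snull m (\<lambda>r x. (v r x - v (\<kappa> * t) x) / of_real (r - \<kappa> * t) - v' x) (at (\<kappa> * t) within J)"
    using v unfolding sderiv_def by blast
  have "\<forall>\<^sub>F s in at t within I. norm (complex_of_real \<kappa>) \<le> \<bar>\<kappa>\<bar>" by simp
  from snull_scale[OF snull_compose[OF N flim] this]
  have "snull m (\<lambda>s x. of_real \<kappa> * ((v (\<kappa> * s) x - v (\<kappa> * t) x) / of_real (\<kappa> * s - \<kappa> * t) - v' x)) (at t within I)" .
  moreover have "of_real \<kappa> * (z / of_real (\<kappa> * s - \<kappa> * t) - w) = z / of_real (s - t) - of_real \<kappa> * w" for z w :: complex and s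
  proof -
    have "complex_of_real (\<kappa> * s - \<kappa> * t) = of_real \<kappa> * of_real (s - t)" by (simp add: algebra_simps)
    then show ?thesis using False by (simp add: right_diff_distrib del: of_real_diff)
  qed
  ultimately have "snull m (\<lambda>s x. (v (\<kappa> * s) x - v (\<kappa> * t) x) / of_real (s - t) - of_real \<kappa> * v' x) (at t within I)"
    by (simp only:)
  with S show ?thesis unfolding sderiv_def by blast
qed

lemma sderiv_pointwise:
  assumes v: "sderiv m v v' t I" and x: "x \<in> Rm m"
  shows "((\<lambda>s. v s x) has_vector_derivative v' x) (at t within I)"
  unfolding has_vector_derivative_iff_quotient
proof (rule LIM_zero_cancel, rule tendstoI)
  fix e :: real assume e: "e > 0"
  have eq: "z /\<^sub>R r = z / of_real r" for z :: complex and r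
    by (simp add: divide_inverse scaleR_conv_of_real mult.commute)
  have "\<forall>\<^sub>F s in at t within I. sn_le m {([], \<lambda>_. 0)} (\<lambda>x. (v s x - v t x) / of_real (s - t) - v' x) (e / 2)"
    using v e unfolding sderiv_def snull_def by auto
  then show "\<forall>\<^sub>F s in at t within I. dist ((v s x - v t x) /\<^sub>R (s - t) - v' x) 0 < e"
  proof eventually_elim
    case (elim s)
    then have "norm ((v s x - v t x) / of_real (s - t) - v' x) \<le> e / 2"
      using x by (simp add: sn_le_def del: of_real_diff)
    then show ?case unfolding eq dist_norm diff_zero using e by linarith
  qed
qed

text \<open>The curve s to W(s) W(-s) f has derivative 0, because the two contributions of
  \<open>hermites\<close>, which commutes with the transforms, cancel. It stays within the symmetric
  interval of angles and equals \<open>f\<close> at 0.\<close>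

lemma frfts_inverse:
  assumes js: "set js \<subseteq> {1..m}" and f: "f \<in> schwartz m" and t: "t \<in> angles"
  shows "frfts m js t (frfts m js (- t) f) = f"
proof
  fix x
  have neg: "s \<in> angles \<Longrightarrow> - s \<in> angles" for s by (auto simp: angles_def)
  show "frfts m js t (frfts m js (- t) f) x = f x"
  proof (cases "x \<in> Rm m")
    case x: True
    define p where "p s = frfts m js s (frfts m js (- s) f) x" for s
    have "(p has_vector_derivative 0) (at s within angles)" if s: "s \<in> angles" for s
    proof -
      have v: "sderiv m (\<lambda>s. frfts m js (- 1 * s) f) (\<lambda>x. of_real (- 1) * (\<i> / 2 * hermites js (frfts m js (- 1 * s) f) x)) s angles"
        by (rule sderiv_reparam) (use sderiv_frfts[OF f _ js, of "- s"] s neg in auto)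
      let ?w = "frfts m js (- 1 * s) f"
      have w: "?w \<in> schwartz m" using s neg by (intro frfts_schwartz js f) simp
      have "sderiv m (\<lambda>s. frfts m js s (frfts m js (- 1 * s) f))
        (\<lambda>x. frfts m js s (\<lambda>x. of_real (- 1) * (\<i> / 2 * hermites js ?w x)) x + \<i> / 2 * hermites js (frfts m js s ?w) x) s angles"
        by (rule sderiv_chain[where W'="\<lambda>g x. \<i> / 2 * hermites js (frfts m js s g) x", OF v s frfts_lincomb[OF js] equi_frfts[OF js] sderiv_frfts[OF _ s js]])
      from sderiv_pointwise[OF this x]
      have "(p has_vector_derivative (frfts m js s (\<lambda>x. of_real (- 1) * (\<i> / 2 * hermites js ?w x)) x + \<i> / 2 * hermites js (frfts m js s ?w) x)) (at s within angles)"
        by (simp add: p_def[abs_def])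
      moreover have "frfts m js s (\<lambda>x. of_real (- 1) * (\<i> / 2 * hermites js ?w x)) = (\<lambda>x. - (\<i> / 2) * frfts m js s (hermites js ?w) x)"
        using frfts_lincomb[OF js hermites_schwartz[OF js w] hermites_schwartz[OF js w] s, of "- (\<i> / 2)" 0] by simp
      ultimately show ?thesis using hermites_frfts[OF w js s js] by simp
    qed
    moreover have "convex angles" by (simp add: angles_def)
    ultimately have "\<exists>c. \<forall>s\<in>angles. p s = c"
      using has_vector_derivative_zero_constant[of angles p] by metis
    then have "p t = p 0" using t by auto
    then show ?thesis using frfts_0 f by (simp add: p_def)
  next
    case False
    have "frfts m js t (frfts m js (- t) f) \<in> schwartz m" by (intro frfts_schwartz js f t neg[OF t])
    from schwartz_outside[OF this False] schwartz_outside[OF f False] show ?thesis by simp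
  qed
qed

section \<open>Fubini\<close>

text \<open>The coordinates are changed one at a time, each change being controlled by the bound of
  one partial derivative.\<close>

lemma schwartz_lipschitz:
  assumes f: "f \<in> schwartz m"
  shows "\<exists>K\<ge>0. \<forall>x\<in>Rm m. \<forall>x'\<in>Rm m. norm (f x - f x') \<le> K * (\<Sum>i=1..m. \<bar>x i - x' i\<bar>)"
proof -
  let ?\<Theta> = "(\<lambda>j. ([j], \<lambda>_. 0)) ` {1..m}"
  have "index m ?\<Theta>" by (auto simp: index_def)
  then obtain K where K: "K \<ge> 0" "sn_le m ?\<Theta> f K" by (rule schwartz_sn_le[OF f])
  have pdK: "norm (pd j f x) \<le> K" if "j \<in> {1..m}" "x \<in> Rm m" for j x
    using K(2) that by (auto simp: sn_le_def)
  have "norm (f x - f x') \<le> K * (\<Sum>i\<in>J. \<bar>x i - x' i\<bar>)"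
    if "finite J" "J \<subseteq> {1..m}" "x \<in> Rm m" "x' \<in> Rm m" "\<And>i. i \<notin> J \<Longrightarrow> x i = x' i" for J x x'
    using that
  proof (induction J arbitrary: x)
    case empty
    then have "x = x'" by auto
    then show ?case by simp
  next
    case (insert j J)
    define x'' where "x'' = x(j := x' j)"
    have j: "j \<in> {1..m}" using insert.prems by auto
    have c: "continuous_on UNIV (\<lambda>t. f (x(j := t)))"
      using schwartz_deriv[OF f j insert.prems(2)] by (auto intro!: continuous_at_imp_continuous_on has_vector_derivative_continuous)
    have "norm (f (x(j := x j)) - f (x(j := x' j)) - of_real (x j - x' j) * 0) \<le> K * \<bar>x j - x' j\<bar>"
      by (rule increment_bound[OF K(1) c _ schwartz_deriv[OF f j insert.prems(2)]])
         (use pdK[OF j] insert.prems(2) j in auto)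
    moreover have "norm (f x'' - f x') \<le> K * (\<Sum>i\<in>J. \<bar>x'' i - x' i\<bar>)"
      by (rule insert.IH) (use insert.prems j in \<open>auto simp: x''_def\<close>)
    moreover have "(\<Sum>i\<in>J. \<bar>x'' i - x' i\<bar>) = (\<Sum>i\<in>J. \<bar>x i - x' i\<bar>)"
      using insert.hyps by (intro sum.cong) (auto simp: x''_def)
    ultimately show ?case
      using norm_triangle_ineq[of "f x - f x''" "f x'' - f x'"] insert.hyps by (simp add: x''_def distrib_left)
  qed
  from this[of "{1..m}"] have "norm (f x - f x') \<le> K * (\<Sum>i=1..m. \<bar>x i - x' i\<bar>)" if "x \<in> Rm m" "x' \<in> Rm m" for x x'
    using that by (auto simp: PiE_iff extensional_def)
  then show ?thesis by (intro exI[of _ K] conjI ballI K(1))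
qed

lemma override_Rm: "y \<in> Rm m \<Longrightarrow> I \<subseteq> {1..m} \<Longrightarrow> (\<lambda>i. if i \<in> I then z i else y i) \<in> Rm m"
  by (auto simp: PiE_iff extensional_def)

text \<open>Overriding the coordinates in \<open>I\<close> makes the function Lipschitz on all
  sequences, hence continuous for the product topology and Borel. The Borel sets agree with those of
  the full product, and extension by 0 outside \<open>I\<close> pulls the function back to the
  finite product.\<close>

lemma schwartz_measurable:
  assumes f: "f \<in> schwartz m" and I: "I \<subseteq> {1..m}" and y: "y \<in> Rm m"
  shows "(\<lambda>z. f (\<lambda>i. if i \<in> I then z i else y i)) \<in> borel_measurable (\<Pi>\<^sub>M i\<in>I. lborel)"
proof -
  define h where "h z = f (\<lambda>i. if i \<in> I then z i else y i)" for z :: "nat \<Rightarrow> real"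
  obtain K where K: "K \<ge> 0" "\<And>x x'. x \<in> Rm m \<Longrightarrow> x' \<in> Rm m \<Longrightarrow> norm (f x - f x') \<le> K * (\<Sum>i=1..m. \<bar>x i - x' i\<bar>)"
    using schwartz_lipschitz[OF f] by blast
  have lip: "norm (h w - h z) \<le> K * (\<Sum>i=1..m. \<bar>w i - z i\<bar>)" for w z
    unfolding h_def
    by (rule order_trans[OF K(2)[OF override_Rm[OF y I] override_Rm[OF y I]]])
       (intro mult_left_mono sum_mono K; simp)
  have "isCont h z" for z
  proof -
    have c: "((\<lambda>w. w i) \<longlongrightarrow> z i) (at z)" for i :: nat
    proof -
      have "continuous_on UNIV (\<lambda>w :: nat \<Rightarrow> real. w i)" by (rule continuous_on_product_coordinates)
      then show ?thesis by (simp add: continuous_on_def)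
    qed
    have "((\<lambda>w. K * (\<Sum>i=1..m. \<bar>w i - z i\<bar>)) \<longlongrightarrow> K * (\<Sum>i=1..m. \<bar>z i - z i\<bar>)) (at z)"
      by (intro tendsto_intros c)
    then have "((\<lambda>w. K * (\<Sum>i=1..m. \<bar>w i - z i\<bar>)) \<longlongrightarrow> 0) (at z)" by simp
    then have "((\<lambda>w. h w - h z) \<longlongrightarrow> 0) (at z)"
      by (rule Lim_null_comparison[rotated]) (use lip in simp)
    then show ?thesis by (simp add: isCont_def LIM_zero_iff)
  qed
  then have "h \<in> borel_measurable borel"
    by (intro borel_measurable_continuous_onI) (simp add: continuous_on_eq_continuous_at)
  then have h: "h \<in> borel_measurable (\<Pi>\<^sub>M i\<in>UNIV. borel)"
    using measurable_cong_sets[OF sets_PiM_equal_borel refl] by blast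
  have e: "(\<lambda>z i. if i \<in> I then z i else 0) \<in> (\<Pi>\<^sub>M i\<in>I. lborel) \<rightarrow>\<^sub>M (\<Pi>\<^sub>M i\<in>(UNIV::nat set). (borel :: real measure))"
  proof (rule measurable_PiM_single')
    fix i :: nat
    show "(\<lambda>z. if i \<in> I then z i else 0) \<in> borel_measurable (\<Pi>\<^sub>M i\<in>I. (lborel :: real measure))"
    proof (cases "i \<in> I")
      case True
      then have "(\<lambda>z. z i) \<in> (\<Pi>\<^sub>M i\<in>I. (lborel :: real measure)) \<rightarrow>\<^sub>M lborel" by (rule measurable_component_singleton)
      then show ?thesis using True by simp
    qed simp
  qed auto
  have "h (\<lambda>i. if i \<in> I then z i else 0) = f (\<lambda>i. if i \<in> I then z i else y i)" for z
    unfolding h_def by (rule arg_cong[of _ _ f]) auto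
  with measurable_compose[OF e h] show ?thesis by simp
qed

text \<open>Induction on \<open>I\<close>, applied to f + x_i^2 f, gains one factor 1 / (1 + x_i^2)
  per coordinate.\<close>

lemma schwartz_product_bound:
  assumes "finite I" "I \<subseteq> {1..m}" "f \<in> schwartz m"
  shows "\<exists>K\<ge>0. \<forall>x\<in>Rm m. norm (f x) \<le> K * (\<Prod>i\<in>I. 1 / (1 + (x i)\<^sup>2))"
  using assms
proof (induction I arbitrary: f)
  case empty
  obtain c where "c \<ge> 0" "sn_le m {([], \<lambda>_. 0)} f c" by (rule schwartz_sn_le[OF empty.prems(2), of "{([], \<lambda>_. 0)}"]) (simp add: index_def)?
  then show ?case by (auto simp: sn_le_def)
next
  case (insert i I)
  define g where "g = (\<lambda>x. 1 * f x + 1 * mx i (mx i f) x)"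
  have i: "i \<in> {1..m}" using insert.prems by simp
  have "g \<in> schwartz m" unfolding g_def by (intro schwartz_lincomb mx_schwartz insert.prems i)
  then obtain K where K: "K \<ge> 0" "\<And>x. x \<in> Rm m \<Longrightarrow> norm (g x) \<le> K * (\<Prod>i\<in>I. 1 / (1 + (x i)\<^sup>2))"
    using insert.IH[of g] insert.prems by auto
  have "norm (f x) \<le> K * (\<Prod>i\<in>insert i I. 1 / (1 + (x i)\<^sup>2))" if x: "x \<in> Rm m" for x
  proof -
    have p: "0 < 1 + (x i)\<^sup>2" by (simp add: add_pos_nonneg)
    have "g x = of_real (1 + (x i)\<^sup>2) * f x" by (simp add: g_def mx_def power2_eq_square algebra_simps)
    then have "norm (g x) = (1 + (x i)\<^sup>2) * norm (f x)" using p by (simp only: norm_mult norm_of_real abs_of_pos)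
    with K(2)[OF x] p have "norm (f x) \<le> K * (\<Prod>i\<in>I. 1 / (1 + (x i)\<^sup>2)) / (1 + (x i)\<^sup>2)"
      by (simp add: pos_le_divide_eq mult.commute)
    then show ?thesis using insert.hyps by (simp add: mult_ac)
  qed
  with K(1) show ?case by blast
qed

lemma kernel_integrable:
  assumes f: "f \<in> schwartz m" and I: "I \<subseteq> {1..m}" and y: "y \<in> Rm m"
  shows "integrable (\<Pi>\<^sub>M i\<in>I. lborel) (\<lambda>x. (\<Prod>i\<in>I. frft_kernel \<alpha> (y i) (x i)) * f (\<lambda>i. if i \<in> I then x i else y i))"
proof -
  have fin: "finite I" using I finite_subset by blast
  interpret product_sigma_finite "\<lambda>_::nat. lborel :: real measure" ..
  obtain K where K: "K \<ge> 0" "\<And>x. x \<in> Rm m \<Longrightarrow> norm (f x) \<le> K * (\<Prod>i\<in>I. 1 / (1 + (x i)\<^sup>2))"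
    using schwartz_product_bound[OF fin I f] by blast
  show ?thesis
  proof (rule Bochner_Integration.integrable_bound)
    show "integrable (\<Pi>\<^sub>M i\<in>I. lborel) (\<lambda>x. K * (\<Prod>i\<in>I. 1 / (1 + (x i)\<^sup>2)))"
      by (intro integrable_mult_right product_integrable_prod fin integrable_cauchy)
    have "(\<lambda>x. frft_kernel \<alpha> (y i) (x i)) \<in> borel_measurable (\<Pi>\<^sub>M i\<in>I. (lborel :: real measure))" if "i \<in> I" for i
      using measurable_compose[OF measurable_component_singleton[OF that, of "\<lambda>_. lborel :: real measure"], of "frft_kernel \<alpha> (y i)" borel] by simp
    then show "(\<lambda>x. (\<Prod>i\<in>I. frft_kernel \<alpha> (y i) (x i)) * f (\<lambda>i. if i \<in> I then x i else y i)) \<in> borel_measurable (\<Pi>\<^sub>M i\<in>I. lborel)"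
      by (intro borel_measurable_times borel_measurable_prod schwartz_measurable[OF f I y])
    have "norm ((\<Prod>i\<in>I. frft_kernel \<alpha> (y i) (x i)) * f (\<lambda>i. if i \<in> I then x i else y i)) \<le> K * (\<Prod>i\<in>I. 1 / (1 + (x i)\<^sup>2))" for x
    proof -
      have "norm (f (\<lambda>i. if i \<in> I then x i else y i)) \<le> K * (\<Prod>i\<in>I. 1 / (1 + (x i)\<^sup>2))"
        using K(2)[OF override_Rm[OF y I, of x]] by simp
      then show ?thesis by (simp add: norm_mult prod_norm[symmetric])
    qed
    then show "AE x in \<Pi>\<^sub>M i\<in>I. lborel. norm ((\<Prod>i\<in>I. frft_kernel \<alpha> (y i) (x i)) * f (\<lambda>i. if i \<in> I then x i else y i))
        \<le> norm (K * (\<Prod>i\<in>I. 1 / (1 + (x i)\<^sup>2)))"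
      by (intro AE_I2) (simp only: real_norm_def, rule order_trans[OF _ abs_ge_self])
  qed
qed

text \<open>Induction at the right end of the list, because the last coordinate is transformed first
  and is the innermost integral; coordinates not in the list stay at their values in
  \<open>y\<close>.\<close>

lemma frfts_integral:
  assumes y: "y \<in> Rm m" and a: "\<alpha> \<in> angles" "\<alpha> \<noteq> 0"
  shows "f \<in> schwartz m \<Longrightarrow> distinct js \<Longrightarrow> set js \<subseteq> {1..m} \<Longrightarrow>
    frfts m js \<alpha> f y = frft_const \<alpha> ^ length js * (LINT x|(\<Pi>\<^sub>M i\<in>set js. lborel).
      (\<Prod>i\<in>set js. frft_kernel \<alpha> (y i) (x i)) * f (\<lambda>i. if i \<in> set js then x i else y i))"
proof (induction js arbitrary: f rule: rev_induct)
  case Nil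
  show ?case by (simp add: PiM_empty lebesgue_integral_count_space_finite)
next
  case (snoc j js)
  interpret product_sigma_finite "\<lambda>_::nat. lborel :: real measure" ..
  let ?I = "set js"
  have j: "j \<in> {1..m}" "j \<notin> ?I" "?I \<subseteq> {1..m}" "distinct js" using snoc.prems by auto
  let ?F = "\<lambda>x. (\<Prod>i\<in>insert j ?I. frft_kernel \<alpha> (y i) (x i)) * f (\<lambda>i. if i \<in> insert j ?I then x i else y i)"
  have "(LINT x|(\<Pi>\<^sub>M i\<in>insert j ?I. lborel). ?F x) = (LINT x|(\<Pi>\<^sub>M i\<in>?I. lborel). (LINT s|lborel. ?F (x(j := s))))"
    by (rule product_integral_insert) (use j kernel_integrable[OF snoc.prems(1) _ y, of "insert j ?I"] in auto)
  also have "frft_const \<alpha> * \<dots> = (LINT x|(\<Pi>\<^sub>M i\<in>?I. lborel). frft_const \<alpha> * (LINT s|lborel. ?F (x(j := s))))"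
    by simp
  also have "\<dots> = (LINT x|(\<Pi>\<^sub>M i\<in>?I. lborel). (\<Prod>i\<in>?I. frft_kernel \<alpha> (y i) (x i)) * frft m j \<alpha> f (\<lambda>i. if i \<in> ?I then x i else y i))"
  proof (rule Bochner_Integration.integral_cong[OF refl])
    fix x
    let ?z = "\<lambda>i. if i \<in> ?I then x i else y i"
    have F: "?F (x(j := s)) = (\<Prod>i\<in>?I. frft_kernel \<alpha> (y i) (x i)) * (frft_kernel \<alpha> (y j) s * f (?z(j := s)))" for s
    proof -
      have "(\<Prod>i\<in>insert j ?I. frft_kernel \<alpha> (y i) ((x(j := s)) i)) = frft_kernel \<alpha> (y j) s * (\<Prod>i\<in>?I. frft_kernel \<alpha> (y i) ((x(j := s)) i))"
        using j(2) by simp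
      also have "(\<Prod>i\<in>?I. frft_kernel \<alpha> (y i) ((x(j := s)) i)) = (\<Prod>i\<in>?I. frft_kernel \<alpha> (y i) (x i))"
        using j(2) by (intro prod.cong) auto
      finally have "(\<Prod>i\<in>insert j ?I. frft_kernel \<alpha> (y i) ((x(j := s)) i)) = frft_kernel \<alpha> (y j) s * (\<Prod>i\<in>?I. frft_kernel \<alpha> (y i) (x i))" .
      moreover have "(\<lambda>i. if i \<in> insert j ?I then (x(j := s)) i else y i) = ?z(j := s)" by auto
      ultimately show ?thesis by (simp only:) (simp add: mult_ac)
    qed
    have z: "?z \<in> Rm m" by (rule override_Rm[OF y j(3)])
    have "frft m j \<alpha> f ?z = frft_const \<alpha> * (LINT s|lborel. frft_kernel \<alpha> (y j) s * f (?z(j := s)))"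
      using z a(2) j(2) by (simp add: frft_def frft1_def)
    then show "frft_const \<alpha> * (LINT s|lborel. ?F (x(j := s))) = (\<Prod>i\<in>?I. frft_kernel \<alpha> (y i) (x i)) * frft m j \<alpha> f ?z"
      unfolding F by simp
  qed
  finally have E: "frft_const \<alpha> * (LINT x|(\<Pi>\<^sub>M i\<in>insert j ?I. lborel). ?F x)
    = (LINT x|(\<Pi>\<^sub>M i\<in>?I. lborel). (\<Prod>i\<in>?I. frft_kernel \<alpha> (y i) (x i)) * frft m j \<alpha> f (\<lambda>i. if i \<in> ?I then x i else y i))" .
  have "frfts m (js @ [j]) \<alpha> f y = frft_const \<alpha> ^ length js * (frft_const \<alpha> * (LINT x|(\<Pi>\<^sub>M i\<in>insert j ?I. lborel). ?F x))"
    unfolding E frfts_snoc by (rule snoc.IH[OF frft_schwartz[OF j(1) snoc.prems(1) a(1)] j(4,3)])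
  then show ?case by (simp add: mult_ac)
qed

section \<open>Creation and annihilation operators on Grassmann algebras\<close>

type_synonym gr = "nat set \<Rightarrow> complex"

definition sg :: "nat \<Rightarrow> nat set \<Rightarrow> complex"
  where "sg j A = (- 1) ^ card {i \<in> A. i < j}"

text \<open>Left multiplication by the \<open>j\<close>-th generator, see \<open>gmult_gvar\<close>.
  Unlike \<open>gmult\<close>, which is 0 at infinite index sets, it satisfies the anticommutation
  relations without any finiteness condition.\<close>

definition mop :: "nat \<Rightarrow> gr \<Rightarrow> gr"
  where "mop j F A = (if j \<in> A then sg j A * F (A - {j}) else 0)"

lemma dop_eq: "gderiv j F A = (if j \<in> A then 0 else sg j A * F (insert j A))" for F :: gr
  by (simp add: gderiv_def sg_def)

lemma finite_less: "finite {i \<in> A. i < (j::nat)}"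
  by (rule finite_subset[of _ "{..<j}"]) auto

lemma sg_sq [simp]: "sg j A * sg j A = 1"
  by (simp add: sg_def flip: power_add power_mult mult_2)

lemma sg_sq' [simp]: "sg j A * (sg j A * z) = z"
  by (simp flip: mult.assoc)

lemma sg_insert: "i \<notin> A \<Longrightarrow> sg j (insert i A) = (if i < j then - sg j A else sg j A)"
proof -
  assume "i \<notin> A"
  have "{k \<in> insert i A. k < j} = (if i < j then insert i {k \<in> A. k < j} else {k \<in> A. k < j})" by auto
  then show ?thesis using \<open>i \<notin> A\<close> finite_less[of A j] by (simp add: sg_def)
qed

lemma sg_remove: "i \<in> A \<Longrightarrow> sg j (A - {i}) = (if i < j then - sg j A else sg j A)"
  using sg_insert[of i "A - {i}" j] by (auto simp: insert_absorb)

lemma mop_lin: "mop j (\<lambda>A. a * F A + b * G A) = (\<lambda>A. a * mop j F A + b * mop j G A)"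
  by (auto simp: mop_def algebra_simps)

lemma dop_lin: "gderiv j (\<lambda>A. a * F A + b * G A) = (\<lambda>A. a * gderiv j F A + b * gderiv j G A :: complex)"
  by (auto simp: dop_eq algebra_simps)

lemma mop_mop: "mop i (mop j F) = (\<lambda>A. - mop j (mop i F) A)"
proof
  fix A
  show "mop i (mop j F) A = - mop j (mop i F) A"
  proof (cases "i = j")
    case False
    then show ?thesis
      by (cases "i \<in> A"; cases "j \<in> A") (auto simp: mop_def sg_remove insert_commute Diff_insert2[symmetric] Diff_insert[symmetric])
  qed (simp add: mop_def)
qed

lemma mop_self [simp]: "mop j (mop j F) = (\<lambda>A. 0)"
  by (auto simp: mop_def)

lemma dop_dop: "gderiv i (gderiv j F) = (\<lambda>A. - gderiv j (gderiv i F) A :: complex)"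
proof
  fix A
  show "gderiv i (gderiv j F) A = - gderiv j (gderiv i F) A"
    by (cases "i = j"; cases "i \<in> A"; cases "j \<in> A") (auto simp: dop_eq sg_insert insert_commute)
qed

lemma dop_self [simp]: "gderiv j (gderiv j F) = (\<lambda>A. 0 :: complex)"
  by (auto simp: dop_eq)

text \<open>With \<open>mop_mop\<close> and \<open>dop_dop\<close> this completes the canonical
  anticommutation relations, on which the calculus of the quadratic elements below is built.\<close>

lemma dop_mop: "gderiv i (mop j F) = (\<lambda>A. (if i = j then F A else 0) - mop j (gderiv i F) A)"
proof
  fix A
  show "gderiv i (mop j F) A = (if i = j then F A else 0) - mop j (gderiv i F) A"
  proof (cases "i = j")
    case True
    then show ?thesis by (cases "i \<in> A") (auto simp: dop_eq mop_def sg_remove sg_insert insert_absorb)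
  next
    case False
    then show ?thesis
      by (cases "i \<in> A"; cases "j \<in> A") (auto simp: dop_eq mop_def sg_remove sg_insert insert_commute insert_Diff_if)
  qed
qed

lemma gmult_infinite: "infinite A \<Longrightarrow> gmult F G A = 0"
  unfolding gmult_def using finite_Pow_iff[of A] by (simp del: finite_Pow_iff)

lemma gmult_gconst:
  fixes c :: complex
  assumes "finite A" shows "gmult (gconst c) G A = c * G A"
proof -
  have "gmult (gconst c) G A = (\<Sum>B\<in>Pow A. if B = {} then c * G A else 0)"
    unfolding gmult_def gconst_def by (rule sum.cong) auto
  then show ?thesis using assms by simp
qed

lemma gmult_gvar:
  assumes "finite A" shows "gmult (gvar j) G A = mop j G A"
proof -
  have "gmult (gvar j) G A = (\<Sum>B\<in>Pow A. if B = {j} then (- 1) ^ card {(i, k). i \<in> {j} \<and> k \<in> A - {j} \<and> k < i} * G (A - {j}) else 0)"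
    unfolding gmult_def gvar_def by (rule sum.cong) auto
  also have "\<dots> = (if j \<in> A then (- 1) ^ card {(i, k). i \<in> {j} \<and> k \<in> A - {j} \<and> k < i} * G (A - {j}) else 0)"
    using assms by (simp add: sum.delta')
  also have "{(i, k). i \<in> {j} \<and> k \<in> A - {j} \<and> k < i} = Pair j ` {k \<in> A. k < j}" by auto
  also have "card \<dots> = card {k \<in> A. k < j}" by (rule card_image) (simp add: inj_on_def)
  finally show ?thesis by (simp add: mop_def sg_def)
qed

lemma gmult_add: "gmult (\<lambda>A. a * F A + b * F' A) G = (\<lambda>A. a * gmult F G A + b * gmult F' G A)" for G :: gr
  by (auto simp: gmult_def sum.distrib sum_distrib_left algebra_simps)

lemma gmult_cmult: "gmult (\<lambda>A. a * F A) G = (\<lambda>A. a * gmult F G A)" for G :: gr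
  using gmult_add[of a F 0 F G] by simp

lemma gmult_sum: "gmult (\<lambda>A. \<Sum>j\<in>J. F j A) G = (\<lambda>A. \<Sum>j\<in>J. gmult (F j) G A)" for G :: gr
  by (auto simp: gmult_def sum_distrib_left sum_distrib_right sum.swap[of _ J])

text \<open>Moving \<open>i\<close> to the front of
  \<open>B \<union> (A - B)\<close> costs the inversions with \<open>B\<close> and those with \<open>A - B\<close>.\<close>

lemma gmult_mop: "gmult (mop i F) G = mop i (gmult F G)" for F G :: gr
proof
  fix A
  show "gmult (mop i F) G A = mop i (gmult F G) A"
  proof (cases "finite A")
    case False
    then show ?thesis by (simp add: gmult_infinite mop_def)
  next
    case A: True
    show ?thesis
    proof (cases "i \<in> A")
      case False
      then have "gmult (mop i F) G A = 0"
        unfolding gmult_def mop_def by (intro sum.neutral) auto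
      then show ?thesis using False by (simp add: mop_def)
    next
      case i: True
      let ?inv = "\<lambda>B C. {(k, l). k \<in> B \<and> l \<in> C \<and> l < (k::nat)}"
      have "gmult (mop i F) G A = (\<Sum>B\<in>{B\<in>Pow A. i \<in> B}. (- 1) ^ card (?inv B (A - B)) * (sg i B * F (B - {i})) * G (A - B))"
        unfolding gmult_def mop_def using A by (intro sum.mono_neutral_cong_right) auto
      also have "\<dots> = (\<Sum>B\<in>Pow (A - {i}). sg i A * ((- 1) ^ card (?inv B (A - {i} - B)) * F B * G (A - {i} - B)))"
      proof (rule sum.reindex_bij_witness[where i="insert i" and j="\<lambda>B. B - {i}"])
        fix B assume B: "B \<in> {B \<in> Pow A. i \<in> B}"
        define C where "C = B - {i}"
        have BC: "B = insert i C" "i \<notin> C" "A - B = A - {i} - C" "C \<subseteq> A" using B by (auto simp: C_def)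
        have fin: "finite B" "finite C" using B A by (auto simp: C_def intro: finite_subset)
        have "?inv B (A - B) = ?inv C (A - B) \<union> Pair i ` {l \<in> A - B. l < i}" unfolding BC(1) by auto
        moreover have "?inv C (A - B) \<inter> Pair i ` {l \<in> A - B. l < i} = {}" using BC(2) by auto
        moreover have "finite (?inv C (A - B))" by (rule finite_subset[of _ "C \<times> A"]) (use fin A in auto)
        ultimately have "card (?inv B (A - B)) = card (?inv C (A - B)) + card {l \<in> A - B. l < i}"
          using A by (simp add: card_Un_disjoint card_image inj_on_def)
        moreover have "card {l \<in> A. l < i} = card {l \<in> B. l < i} + card {l \<in> A - B. l < i}"
        proof -
          have "{l \<in> A. l < i} = {l \<in> B. l < i} \<union> {l \<in> A - B. l < i}" using B by auto
          then show ?thesis using A fin by (simp add: card_Un_disjoint disjoint_iff)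
        qed
        moreover have "(- 1 :: complex) ^ card {l \<in> B. l < i} * (- 1) ^ card {l \<in> B. l < i} = 1"
          by (simp flip: power_add mult_2)
        ultimately have s: "(- 1) ^ card (?inv B (A - B)) * sg i B = sg i A * (- 1 :: complex) ^ card (?inv C (A - {i} - C))"
          unfolding sg_def BC(3) by (simp add: power_add)
        show "sg i A * ((- 1) ^ card (?inv (B - {i}) (A - {i} - (B - {i}))) * F (B - {i}) * G (A - {i} - (B - {i}))) =
            (- 1) ^ card (?inv B (A - B)) * (sg i B * F (B - {i})) * G (A - B)"
          unfolding C_def[symmetric] BC(3)[symmetric] using s unfolding BC(3)[symmetric] by (simp add: mult.assoc[symmetric])
      qed (use i in auto)
      also have "\<dots> = mop i (gmult F G) A" using i by (simp add: mop_def gmult_def sum_distrib_left)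
      finally show ?thesis .
    qed
  qed
qed

section \<open>Exponentials of quadratic elements\<close>

type_synonym quad = "(complex \<times> nat \<times> nat) list"

fun qop :: "quad \<Rightarrow> gr \<Rightarrow> gr" where
  "qop [] F = (\<lambda>A. 0)"
| "qop ((a, i, j) # ts) F = (\<lambda>A. a * mop i (mop j F) A + qop ts F A)"

text \<open>A product of generators \<theta>_i \<theta>_j squares to 0 and commutes with everything,
  so the exponential of a quadratic element is a finite product of factors 1 + a \<theta>_i
  \<theta>_j; \<open>pquad_exp_sums\<close> identifies it with the power series.\<close>

fun qexp :: "quad \<Rightarrow> gr \<Rightarrow> gr" where
  "qexp [] F = F"
| "qexp ((a, i, j) # ts) F = qexp ts (\<lambda>A. 1 * F A + a * mop i (mop j F) A)"

lemma mm_comm: "mop i (mop j (mop k F)) = mop k (mop i (mop j F))"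
proof -
  have neg: "mop j (\<lambda>A. - F A) = (\<lambda>A. - mop j F A)" for j F using mop_lin[of j "-1" F 0 F] by simp
  show ?thesis by (simp add: mop_mop[of j k] mop_mop[of i k "mop j F"] neg)
qed

lemma qop_lin: "qop ts (\<lambda>A. a * F A + b * G A) = (\<lambda>A. a * qop ts F A + b * qop ts G A)"
proof (induction ts)
  case (Cons t ts)
  then show ?case by (cases t) (simp add: mop_lin algebra_simps)
qed simp

lemma qop_mop: "qop ts (mop k F) = mop k (qop ts F)"
proof (induction ts)
  case Nil then show ?case by (simp add: mop_def fun_eq_iff)
next
  case (Cons t ts)
  obtain a i j where t: "t = (a, i, j)" by (cases t)
  have "mop k (\<lambda>A. a * mop i (mop j F) A + 1 * qop ts F A) = (\<lambda>A. a * mop k (mop i (mop j F)) A + 1 * mop k (qop ts F) A)"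
    by (rule mop_lin)
  then show ?case using Cons by (simp add: t mm_comm[of i j k])
qed

lemma qexp_lin: "qexp ts (\<lambda>A. a * F A + b * G A) = (\<lambda>A. a * qexp ts F A + b * qexp ts G A)"
proof (induction ts arbitrary: F G)
  case (Cons t ts)
  obtain c i j where t: "t = (c, i, j)" by (cases t)
  have "(\<lambda>A. 1 * (a * F A + b * G A) + c * mop i (mop j (\<lambda>A. a * F A + b * G A)) A)
    = (\<lambda>A. a * (1 * F A + c * mop i (mop j F) A) + b * (1 * G A + c * mop i (mop j G) A))"
    by (simp add: mop_lin algebra_simps)
  then show ?case unfolding t qexp.simps by (simp only: Cons)
qed simp

lemma qexp_mop: "qexp ts (mop k F) = mop k (qexp ts F)"
proof (induction ts arbitrary: F)
  case (Cons t ts)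
  obtain c i j where t: "t = (c, i, j)" by (cases t)
  have "(\<lambda>A. 1 * mop k F A + c * mop i (mop j (mop k F)) A) = mop k (\<lambda>A. 1 * F A + c * mop i (mop j F) A)"
    unfolding mop_lin mm_comm[of i j k] ..
  then show ?case unfolding t qexp.simps by (simp only: Cons)
qed simp

definition pquad :: "complex \<Rightarrow> quad \<Rightarrow> gr \<Rightarrow> gr"
  where "pquad c ts F = (\<lambda>A. c * F A + qop ts F A)"

lemma pquad_lin: "pquad c ts (\<lambda>A. a * F A + b * G A) = (\<lambda>A. a * pquad c ts F A + b * pquad c ts G A)"
  by (simp add: pquad_def qop_lin algebra_simps)

lemma pquad_mop: "pquad c ts (mop k F) = mop k (pquad c ts F)"
  using mop_lin[of k c F 1 "qop ts F"] by (simp add: pquad_def qop_mop)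

lemma pquad_pow_mop: "(pquad c ts ^^ k) (mop i F) = mop i ((pquad c ts ^^ k) F)"
  by (induction k) (simp_all add: pquad_mop)

lemma mm_nilpotent: "mop i (mop j (mop i (mop j F))) = (\<lambda>A. 0)"
proof -
  show ?thesis unfolding mm_comm[of i j i] by (simp add: mop_def fun_eq_iff)
qed

lemma pquad_Cons: "pquad c ((a, i, j) # ts) F = (\<lambda>A. 1 * pquad c ts F A + a * mop i (mop j F) A)"
  by (simp add: pquad_def algebra_simps)

text \<open>The binomial expansion stops after the linear term, because the added quadratic term is
  central and squares to 0.\<close>

lemma pquad_Cons_pow:
  "(pquad c ((a, i, j) # ts) ^^ k) F = (\<lambda>A. 1 * (pquad c ts ^^ k) F A + (of_nat k * a) * (pquad c ts ^^ (k - 1)) (mop i (mop j F)) A)"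
proof (induction k)
  case (Suc k)
  let ?X = "(pquad c ts ^^ k) F" and ?Y = "(pquad c ts ^^ (k - 1)) (mop i (mop j F))"
  have X: "mop i (mop j ?X) = (pquad c ts ^^ k) (mop i (mop j F))"
    by (simp only: pquad_pow_mop)
  have Y: "mop i (mop j ?Y) = (\<lambda>A. 0)"
    by (simp only: pquad_pow_mop mm_nilpotent) (simp add: mop_def fun_eq_iff mm_nilpotent[unfolded fun_eq_iff mop_def])?
  \<comment> \<open>At \<open>k = 0\<close> the truncated exponent \<open>k - 1\<close> gives a
    wrong power, but the factor \<open>of_nat k\<close> vanishes there.\<close>
  have Y': "of_nat k * pquad c ts ?Y A = of_nat k * (pquad c ts ^^ k) (mop i (mop j F)) A" for A
    by (cases k) simp_all
  have "(pquad c ((a, i, j) # ts) ^^ Suc k) F = pquad c ((a, i, j) # ts) (\<lambda>A. 1 * ?X A + (of_nat k * a) * ?Y A)"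
    by (simp only: funpow.simps o_apply Suc)
  also have "\<dots> = (\<lambda>A. 1 * (1 * pquad c ts ?X A + a * mop i (mop j ?X) A)
      + (of_nat k * a) * (1 * pquad c ts ?Y A + a * mop i (mop j ?Y) A))"
    by (simp only: pquad_lin pquad_Cons)
  also have "\<dots> = (\<lambda>A. 1 * (pquad c ts ^^ Suc k) F A + (of_nat (Suc k) * a) * (pquad c ts ^^ (Suc k - 1)) (mop i (mop j F)) A)"
  proof
    fix A
    have "a * (of_nat k * pquad c ts ?Y A) = a * (of_nat k * (pquad c ts ^^ k) (mop i (mop j F)) A)"
      by (simp only: Y')
    then show "1 * (1 * pquad c ts ?X A + a * mop i (mop j ?X) A)
      + (of_nat k * a) * (1 * pquad c ts ?Y A + a * mop i (mop j ?Y) A)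
      = 1 * (pquad c ts ^^ Suc k) F A + (of_nat (Suc k) * a) * (pquad c ts ^^ (Suc k - 1)) (mop i (mop j F)) A"
      unfolding X Y by (simp add: algebra_simps)
  qed
  finally show ?case .
qed simp

lemma pquad_exp_sums: "(\<lambda>k. (pquad c ts ^^ k) F A / fact k) sums (exp c * qexp ts F A)"
proof (induction ts arbitrary: F)
  case Nil
  have "(pquad c [] ^^ k) F A = c ^ k * F A" for k
    by (induction k) (simp_all add: pquad_def)
  moreover have "(\<lambda>k. c ^ k /\<^sub>R fact k * F A) sums (exp c * F A)"
    by (intro sums_mult2 exp_converges)
  ultimately show ?case by (simp add: scaleR_conv_of_real divide_inverse mult_ac)
next
  case (Cons t ts)
  obtain a i j where t: "t = (a, i, j)" by (cases t)
  let ?f = "\<lambda>k. (pquad c ts ^^ k) F A / fact k"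
  let ?g = "\<lambda>k. (of_nat k * a) * (pquad c ts ^^ (k - 1)) (mop i (mop j F)) A / fact k"
  have 1: "?f sums (exp c * qexp ts F A)" by (rule Cons)
  have "(\<lambda>k. ?g (Suc k)) = (\<lambda>k. a * ((pquad c ts ^^ k) (mop i (mop j F)) A / fact k))"
    by (simp add: fun_eq_iff field_simps del: of_nat_Suc)
  then have "(\<lambda>k. ?g (Suc k)) sums (a * (exp c * qexp ts (mop i (mop j F)) A))"
    by (simp only:) (intro sums_mult Cons)
  then have 2: "?g sums (a * (exp c * qexp ts (mop i (mop j F)) A))"
    by (subst (asm) sums_Suc_iff) simp
  have "(pquad c (t # ts) ^^ k) F A / fact k = ?f k + ?g k" for k
    unfolding t pquad_Cons_pow by (simp add: add_divide_distrib)
  with sums_add[OF 1 2]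
  have "(\<lambda>k. (pquad c (t # ts) ^^ k) F A / fact k) sums (exp c * qexp ts F A + a * (exp c * qexp ts (mop i (mop j F)) A))"
    by simp
  moreover have "qexp (t # ts) F = (\<lambda>A. 1 * qexp ts F A + a * qexp ts (mop i (mop j F)) A)"
    unfolding t qexp.simps by (rule qexp_lin)
  ultimately show ?case by (simp add: algebra_simps)
qed

lemma gexp_eq:
  assumes P: "\<And>F A. finite A \<Longrightarrow> gmult P F A = pquad c ts F A" and A: "finite A"
  shows "gexp P A = exp c * qexp ts (gconst 1) A"
proof -
  have q: "qop ts F A = qop ts G A" if "\<And>A. finite A \<Longrightarrow> F A = G A" "finite A" for F G A ts
    using that
  proof (induction ts)
    case (Cons t ts)
    then show ?case by (cases t) (simp add: mop_def)
  qed simp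
  have "(gmult P ^^ k) (gconst 1) A = (pquad c ts ^^ k) (gconst 1) A" if "finite A" for k A
    using that
  proof (induction k arbitrary: A)
    case (Suc k)
    have "pquad c ts ((gmult P ^^ k) (gconst 1)) A = pquad c ts ((pquad c ts ^^ k) (gconst 1)) A"
      using q[of "(gmult P ^^ k) (gconst 1)" "(pquad c ts ^^ k) (gconst 1)" A ts] Suc
      unfolding pquad_def[of c ts "(gmult P ^^ k) (gconst 1)"] pquad_def[of c ts "(pquad c ts ^^ k) (gconst 1)"] by simp
    then show ?case using Suc.prems by (simp add: P)
  qed simp
  with A have "gexp P A = suminf (\<lambda>k. (pquad c ts ^^ k) (gconst 1) A / fact k)" by (simp add: gexp_def)
  then show ?thesis using sums_unique[OF pquad_exp_sums[of c ts "gconst 1" A]] by simp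
qed

lemma gmult_qexp: "gmult (qexp ts F) G = qexp ts (gmult F G)"
proof (induction ts arbitrary: F)
  case (Cons t ts)
  obtain c i j where t: "t = (c, i, j)" by (cases t)
  show ?case unfolding t qexp.simps Cons gmult_add gmult_mop ..
qed simp

lemma qexp_cong_finite:
  assumes "\<And>A. finite A \<Longrightarrow> F A = G A" "finite A" shows "qexp ts F A = qexp ts G A"
  using assms
proof (induction ts arbitrary: F G A)
  case (Cons t ts)
  obtain c i j where t: "t = (c, i, j)" by (cases t)
  show ?case unfolding t qexp.simps
    by (rule Cons.IH[OF _ Cons.prems(2)]) (simp add: mop_def Cons.prems(1))
qed simp

lemma gmult_gexp:
  assumes P: "\<And>F A. finite A \<Longrightarrow> gmult P F A = pquad c ts F A" and A: "finite A"
  shows "gmult (gexp P) G A = exp c * qexp ts G A"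
proof -
  have "gmult (gexp P) G A = gmult (\<lambda>A. exp c * qexp ts (gconst 1) A) G A"
    unfolding gmult_def using A by (intro sum.cong) (auto simp: gexp_eq[OF P] dest: finite_subset)
  also have "\<dots> = exp c * qexp ts (gmult (gconst 1) G) A" by (simp add: gmult_cmult gmult_qexp)
  also have "qexp ts (gmult (gconst 1) G) A = qexp ts G A"
    by (rule qexp_cong_finite[OF _ A]) (simp add: gmult_gconst)
  finally show ?thesis .
qed

text \<open>The commutator of an annihilation operator with the exponential is the derivative of the exponent.\<close>

fun qder :: "nat \<Rightarrow> quad \<Rightarrow> gr \<Rightarrow> gr" where
  "qder k [] F = (\<lambda>A. 0)"
| "qder k ((a, i, j) # ts) F = (\<lambda>A. (if k = i then a * mop j F A else 0) - (if k = j then a * mop i F A else 0) + qder k ts F A)"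

text \<open>Each factor of the product is differentiated in turn. Passing an annihilation operator
  through 1 + a \<theta>_i \<theta>_j leaves a linear term, and this term commutes with the other
  factors, which are even.\<close>

lemma gderiv_qexp: "gderiv k (qexp ts F) = (\<lambda>A. 1 * qexp ts (gderiv k F) A + 1 * qder k ts (qexp ts F) A)"
proof (induction ts arbitrary: F)
  case (Cons t ts)
  obtain a i j where t: "t = (a, i, j)" by (cases t)
  define R where "R F = (\<lambda>A. 1 * F A + a * mop i (mop j F) A)" for F
  define d where "d F = (\<lambda>A. (if k = i then a * mop j F A else 0) - (if k = j then a * mop i F A else 0))" for F
  have q: "qexp (t # ts) F = qexp ts (R F)" for F by (simp add: t R_def)
  have neg: "mop j (\<lambda>A. - F A) = (\<lambda>A. - mop j F A)" for j F using mop_lin[of j "-1" F 0 F] by simp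
  have m: "mop i (\<lambda>A. (if k = j then F A else 0) - mop j (gderiv k F) A)
      = (\<lambda>A. (if k = j then mop i F A else 0) - mop i (mop j (gderiv k F)) A)"
    by (auto simp: mop_def algebra_simps)
  have "gderiv k (R F) = (\<lambda>A. 1 * gderiv k F A + a * gderiv k (mop i (mop j F)) A)"
    unfolding R_def by (rule dop_lin)
  also have "\<dots> = (\<lambda>A. 1 * R (gderiv k F) A + 1 * d F A)"
    by (auto simp: R_def d_def dop_mop m algebra_simps)
  \<comment> \<open>The linear term contains \<theta>_i or \<theta>_j and therefore kills the
    quadratic part of the same factor; so it may act on the complete factor, and the result refers
    to \<open>qexp ts F\<close> as a whole.\<close>
  also have "d F = d (R F)"
  proof -
    have z: "mop i (mop i (mop j F)) = (\<lambda>A. 0)" "mop j (mop i (mop j F)) = (\<lambda>A. 0)"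
      by simp (simp add: mop_mop[of i j F] mop_lin[of j "-1" "mop j (mop i F)" 0 F, simplified])
    have m: "mop i (R F) = mop i F" "mop j (R F) = mop j F"
      unfolding R_def mop_lin z by simp_all
    show ?thesis unfolding d_def m ..
  qed
  finally have "qexp ts (gderiv k (R F)) = (\<lambda>A. 1 * qexp ts (R (gderiv k F)) A + 1 * qexp ts (d (R F)) A)"
    by (simp only: qexp_lin)
  moreover have "qexp ts (d G) = d (qexp ts G)" for G
  proof -
    have "d G = (\<lambda>A. (if k = i then a else 0) * mop j G A + (- (if k = j then a else 0)) * mop i G A)" for G
      by (auto simp: d_def)
    then show ?thesis by (simp only: qexp_lin qexp_mop)
  qed
  moreover have "qder k (t # ts) G = (\<lambda>A. d G A + qder k ts G A)" for G by (simp add: t d_def)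
  ultimately show ?case unfolding q Cons by (simp add: algebra_simps)
qed simp

section \<open>The fermionic transform\<close>


text \<open>The summand 2n together with the -1 in each of the m Hermite operators makes up -M = 2n
  - m.\<close>

definition fermi :: "nat \<Rightarrow> gr \<Rightarrow> gr"
  where "fermi n F A = 4 * (\<Sum>j=1..n. gderiv (2*j-1) (gderiv (2*j) F) A)
    - (\<Sum>j=1..n. mop (2*j-1) (mop (2*j) F) A) + 2 * of_nat n * F A"

lemma mop_neg: "mop i (\<lambda>A. - F A) = (\<lambda>A. - mop i F A)"
  using mop_lin[of i "-1" F 0 F] by simp

lemma dop_neg: "gderiv i (\<lambda>A. - F A) = (\<lambda>A. - gderiv i F A :: complex)"
  using dop_lin[of i "-1" F 0 F] by simp

lemma mop_zero [simp]: "mop i (\<lambda>A. 0) = (\<lambda>A. 0)" by (simp add: mop_def fun_eq_iff)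
lemma dop_zero [simp]: "gderiv i (\<lambda>A. 0) = (\<lambda>A. 0 :: complex)" by (simp add: dop_eq fun_eq_iff)

lemma mop_diff: "mop i (\<lambda>A. F A - G A) = (\<lambda>A. mop i F A - mop i G A)"
  using mop_lin[of i 1 F "-1" G] by simp

lemma dop_diff: "gderiv i (\<lambda>A. F A - G A) = (\<lambda>A. gderiv i F A - gderiv i G A :: complex)"
  using dop_lin[of i 1 F "-1" G] by simp

lemma mop_cmult: "mop i (\<lambda>A. a * F A) = (\<lambda>A. a * mop i F A)"
  using mop_lin[of i a F 0 F] by simp

lemma dop_cmult: "gderiv i (\<lambda>A. a * F A) = (\<lambda>A. a * gderiv i F A :: complex)"
  using dop_lin[of i a F 0 F] by simp

lemma mop_add: "mop i (\<lambda>A. F A + G A) = (\<lambda>A. mop i F A + mop i G A)"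
  using mop_lin[of i 1 F 1 G] by simp

lemma dop_add: "gderiv i (\<lambda>A. F A + G A) = (\<lambda>A. gderiv i F A + gderiv i G A :: complex)"
  using dop_lin[of i 1 F 1 G] by simp

lemma mop_if: "mop i (\<lambda>A. if P then F A else 0) = (\<lambda>A. if P then mop i F A else 0)"
  by (cases P) simp_all

lemma dop_if: "gderiv i (\<lambda>A. if P then F A else (0::complex)) = (\<lambda>A. if P then gderiv i F A else 0)"
  by (cases P) simp_all

lemma dd_dop: "gderiv p (gderiv q (gderiv k F)) = (gderiv k (gderiv p (gderiv q F)) :: gr)"
  by (simp add: dop_dop[of q k] dop_dop[of p k "gderiv q F"] dop_neg)

lemma dd_mop: "gderiv p (gderiv q (mop k F)) = (\<lambda>A. (if q = k then gderiv p F A else 0) - (if p = k then gderiv q F A else 0)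
    + mop k (gderiv p (gderiv q F)) A)"
  by (auto simp: dop_mop dop_diff dop_if fun_eq_iff)

lemma mm_dop: "mop p (mop q (gderiv k F)) = (\<lambda>A. gderiv k (mop p (mop q F)) A - (if k = p then mop q F A else 0) + (if k = q then mop p F A else 0))"
  by (auto simp: dop_mop mop_diff mop_if fun_eq_iff)

lemma fermi_lin: "fermi n (\<lambda>A. a * F A + b * G A) = (\<lambda>A. a * fermi n F A + b * fermi n G A)"
  by (simp add: fermi_def fun_eq_iff mop_lin dop_lin sum.distrib sum_distrib_left algebra_simps)

definition partner :: "nat \<Rightarrow> nat" where "partner k = (if odd k then k + 1 else k - 1)"

definition sgn_of :: "nat \<Rightarrow> complex" where "sgn_of k = (if odd k then 1 else - 1)"

lemma pair_cases:
  assumes "k \<in> {1..2 * n}"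
  obtains j where "j \<in> {1..n}" "k = 2 * j - 1" "partner k = 2 * j" "sgn_of k = 1"
    | j where "j \<in> {1..n}" "k = 2 * j" "partner k = 2 * j - 1" "sgn_of k = - 1"
proof (cases "odd k")
  case True
  then obtain i where "k = 2 * i + 1" by (auto elim: oddE)
  then show ?thesis using assms by (intro that(1)[of "i + 1"]) (auto simp: partner_def sgn_of_def)
next
  case False
  then obtain i where "k = 2 * i" by (auto elim: evenE)
  then show ?thesis using assms by (intro that(2)[of i]) (auto simp: partner_def sgn_of_def)
qed

lemma pair_eq:
  assumes "i \<in> {1..n}" "j \<in> {1..(n::nat)}"
  shows "2 * i - 1 \<noteq> 2 * j" "2 * i \<noteq> 2 * j - 1" "(2 * i - 1 = 2 * j - 1) = (i = j)" "(2 * i = 2 * j) = (i = j)"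
  using assms by (auto; presburger)+

lemma sum_mop: "mop k (\<lambda>A. \<Sum>j\<in>J. F j A) = (\<lambda>A. \<Sum>j\<in>J. mop k (F j) A)"
  by (auto simp: mop_def sum_distrib_left)

lemma sum_dop: "gderiv k (\<lambda>A. \<Sum>j\<in>J. F j A) = (\<lambda>A. \<Sum>j\<in>J. gderiv k (F j) A :: complex)"
  by (auto simp: dop_eq sum_distrib_left)

text \<open>Together with \<open>fermi_mop_partner\<close>: the commutator with \<open>fermi\<close>
  maps \<open>gderiv k\<close> to \<open>sgn_of k\<close> times \<open>mop (partner k)\<close>, and
  the latter operator to \<open>4 * sgn_of k\<close> times \<open>gderiv k\<close>. Its square on
  this plane is 4, so under the factor \<i> / 2 the generated flow is a rotation with cosine and
  sine of the angle.\<close>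

lemma fermi_dop:
  assumes k: "k \<in> {1..2 * n}"
  shows "fermi n (gderiv k F) A = gderiv k (fermi n F) A + sgn_of k * mop (partner k) F A"
proof -
  have 1: "gderiv k (fermi n F) A = 4 * (\<Sum>j=1..n. gderiv k (gderiv (2*j-1) (gderiv (2*j) F)) A)
      - (\<Sum>j=1..n. gderiv k (mop (2*j-1) (mop (2*j) F)) A) + 2 * of_nat n * gderiv k F A"
    unfolding fermi_def[abs_def] dop_add dop_diff dop_cmult sum_dop ..
  have 2: "(\<Sum>j=1..n. mop (2*j-1) (mop (2*j) (gderiv k F)) A)
    = (\<Sum>j=1..n. gderiv k (mop (2*j-1) (mop (2*j) F)) A) - sgn_of k * mop (partner k) F A"
    using k
  proof (cases rule: pair_cases)
    case (1 i)
    have "(\<Sum>j=1..n. (if k = 2*j-1 then mop (2*j) F A else 0)) = (\<Sum>j=1..n. (if j = i then mop (2*i) F A else 0))"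
      using 1 by (intro sum.cong) (auto simp: pair_eq[OF _ 1(1)])
    moreover have "(\<Sum>j=1..n. (if k = 2*j then mop (2*j-1) F A else 0)) = 0"
      using 1 by (intro sum.neutral ballI) (simp add: pair_eq[OF 1(1)])
    ultimately show ?thesis using 1 by (simp add: mm_dop sum.distrib sum_subtractf)
  next
    case (2 i)
    have "(\<Sum>j=1..n. (if k = 2*j then mop (2*j-1) F A else 0)) = (\<Sum>j=1..n. (if j = i then mop (2*i-1) F A else 0))"
      using 2 by (intro sum.cong) auto
    moreover have "(\<Sum>j=1..n. (if k = 2*j-1 then mop (2*j) F A else 0)) = 0"
      using 2 by (intro sum.neutral ballI) (simp add: pair_eq[OF 2(1)])
    ultimately show ?thesis using 2 by (simp add: mm_dop sum.distrib sum_subtractf)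
  qed
  show ?thesis unfolding 1 unfolding fermi_def 2 dd_dop by simp
qed

lemma fermi_mop_partner:
  assumes k: "k \<in> {1..2 * n}"
  shows "fermi n (mop (partner k) F) A = mop (partner k) (fermi n F) A + 4 * sgn_of k * gderiv k F A"
proof -
  let ?p = "partner k"
  have 1: "mop ?p (fermi n F) A = 4 * (\<Sum>j=1..n. mop ?p (gderiv (2*j-1) (gderiv (2*j) F)) A)
      - (\<Sum>j=1..n. mop ?p (mop (2*j-1) (mop (2*j) F)) A) + 2 * of_nat n * mop ?p F A"
    unfolding fermi_def[abs_def] mop_add mop_diff mop_cmult sum_mop ..
  have 2: "(\<Sum>j=1..n. gderiv (2*j-1) (gderiv (2*j) (mop ?p F)) A)
    = (\<Sum>j=1..n. mop ?p (gderiv (2*j-1) (gderiv (2*j) F)) A) + sgn_of k * gderiv k F A"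
    using k
  proof (cases rule: pair_cases)
    case (1 i)
    have "(\<Sum>j=1..n. (if 2*j = ?p then gderiv (2*j-1) F A else 0)) = (\<Sum>j=1..n. (if j = i then gderiv (2*i-1) F A else 0))"
      using 1 by (intro sum.cong) auto
    moreover have "(\<Sum>j=1..n. (if 2*j-1 = ?p then gderiv (2*j) F A else 0)) = 0"
      using 1 by (intro sum.neutral ballI) (simp add: pair_eq[OF _ 1(1)])
    ultimately show ?thesis using 1 by (simp add: dd_mop sum.distrib sum_subtractf)
  next
    case (2 i)
    have "(\<Sum>j=1..n. (if 2*j-1 = ?p then gderiv (2*j) F A else 0)) = (\<Sum>j=1..n. (if j = i then gderiv (2*i) F A else 0))"
      using 2 by (intro sum.cong) (auto simp: pair_eq[OF _ 2(1)])
    moreover have "(\<Sum>j=1..n. (if 2*j = ?p then gderiv (2*j-1) F A else 0)) = 0"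
      using 2 by (intro sum.neutral ballI) (simp add: pair_eq[OF _ 2(1)])
    ultimately show ?thesis using 2 by (simp add: dd_mop sum.distrib sum_subtractf)
  qed
  have 3: "mop (2*j-1) (mop (2*j) (mop ?p F)) = mop ?p (mop (2*j-1) (mop (2*j) F))" for j by (rule mm_comm)
  show ?thesis unfolding 1 unfolding fermi_def 2 3 by (simp add: algebra_simps)
qed

text \<open>Berezin integration over the first \<open>2n\<close> generators, the remaining ones being renumbered.\<close>

definition berezin :: "nat \<Rightarrow> gr \<Rightarrow> gr"
  where "berezin n F A = fold gderiv [1..<2 * n + 1] F ((\<lambda>j. 2 * n + j) ` A)"

lemma fold_dop_zero: "fold gderiv xs (\<lambda>A. 0) = (\<lambda>A. 0 :: complex)"
  by (induction xs) simp_all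

lemma fold_dop_lin: "fold gderiv xs (\<lambda>A. a * F A + b * G A) = (\<lambda>A. a * fold gderiv xs F A + b * fold gderiv xs G A :: complex)"
  by (induction xs arbitrary: F G) (simp_all add: dop_lin)

lemma fold_dop_dop: "fold gderiv xs (gderiv i F) = (\<lambda>A. (- 1) ^ length xs * gderiv i (fold gderiv xs F) A :: complex)"
proof (induction xs arbitrary: F)
  case (Cons x xs)
  have "fold gderiv (x # xs) (gderiv i F) = fold gderiv xs (\<lambda>A. (-1) * gderiv i (gderiv x F) A + 0 * F A)"
    by (simp add: dop_dop[of x i])
  then show ?case unfolding fold_dop_lin by (simp add: Cons)
qed simp

lemma fold_dop_mem: "i \<in> set xs \<Longrightarrow> fold gderiv xs (gderiv i F) = (\<lambda>A. 0 :: complex)"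
proof (induction xs arbitrary: F)
  case (Cons x xs)
  show ?case
  proof (cases "x = i")
    case True then show ?thesis by (simp add: fold_dop_zero)
  next
    case False
    have "fold gderiv (x # xs) (gderiv i F) = fold gderiv xs (\<lambda>A. (-1) * gderiv i (gderiv x F) A + 0 * F A)"
      by (simp add: dop_dop[of x i])
    then show ?thesis unfolding fold_dop_lin using False Cons by simp
  qed
qed simp

lemma fold_dop_mop: "i \<notin> set xs \<Longrightarrow> fold gderiv xs (mop i F) = (\<lambda>A. (- 1) ^ length xs * mop i (fold gderiv xs F) A)"
proof (induction xs arbitrary: F)
  case (Cons x xs)
  have "fold gderiv (x # xs) (mop i F) = fold gderiv xs (\<lambda>A. (-1) * mop i (gderiv x F) A + 0 * F A)"
    using Cons.prems by (simp add: dop_mop)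
  then show ?case unfolding fold_dop_lin using Cons by simp
qed simp

lemma shift_simps:
  "2 * n + k \<in> (\<lambda>j. 2 * n + j) ` A \<longleftrightarrow> k \<in> A"
  "(\<lambda>j. 2 * n + j) ` A - {2 * n + k} = (\<lambda>j. 2 * n + j) ` (A - {k})"
  "insert (2 * n + k) ((\<lambda>j. 2 * n + j) ` A) = (\<lambda>j. 2 * n + j) ` insert k A"
  "sg (2 * n + k) ((\<lambda>j. 2 * n + j) ` A) = sg k A"
proof -
  have "{i \<in> (\<lambda>j. 2 * n + j) ` A. i < 2 * n + k} = (\<lambda>j. 2 * n + j) ` {i \<in> A. i < k}" by auto
  then show "sg (2 * n + k) ((\<lambda>j. 2 * n + j) ` A) = sg k A"
    by (simp add: sg_def card_image)
qed auto

text \<open>A generator with index above 2n passes an even number of derivatives, so no sign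
  appears, and the renumbering preserves the order of indices.\<close>

lemma berezin_mop:
  assumes "k \<ge> 1" shows "berezin n (mop (2 * n + k) F) = mop k (berezin n F)"
proof
  fix A
  have "fold gderiv [1..<2 * n + 1] (mop (2 * n + k) F) = (\<lambda>A. (- 1) ^ length [1..<2 * n + 1] * mop (2 * n + k) (fold gderiv [1..<2 * n + 1] F) A)"
    using assms by (intro fold_dop_mop) auto
  then show "berezin n (mop (2 * n + k) F) A = mop k (berezin n F) A"
    by (simp add: berezin_def) (simp add: mop_def shift_simps berezin_def)
qed

lemma berezin_dop: "berezin n (gderiv (2 * n + k) F) = gderiv k (berezin n F)"
proof
  fix A
  define G where "G = fold gderiv [1..<2 * n + 1] F"
  have h: "fold gderiv [1..<2 * n + 1] (gderiv (2 * n + k) F) = (\<lambda>A. (- 1) ^ length [1..<2 * n + 1] * gderiv (2 * n + k) G A)"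
    unfolding G_def by (rule fold_dop_dop)
  have e1: "berezin n (gderiv (2 * n + k) F) A = gderiv (2 * n + k) G ((\<lambda>j. 2 * n + j) ` A)"
    unfolding berezin_def h by simp
  have bF: "berezin n F = (\<lambda>A. G ((\<lambda>j. 2 * n + j) ` A))"
    by (rule ext) (simp only: berezin_def G_def)
  show "berezin n (gderiv (2 * n + k) F) A = gderiv k (berezin n F) A"
    unfolding e1 bF dop_eq shift_simps ..
qed

lemma berezin_dop_zero: "k \<in> {1..2 * n} \<Longrightarrow> berezin n (gderiv k F) = (\<lambda>A. 0)"
  by (rule ext) (simp only: berezin_def fold_dop_mem[of k "[1..<2 * n + 1]"] set_upt atLeastLessThan_iff, auto simp: fold_dop_mem)

lemma berezin_lin: "berezin n (\<lambda>A. a * F A + b * G A) = (\<lambda>A. a * berezin n F A + b * berezin n G A)"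
  unfolding berezin_def fold_dop_lin ..

section \<open>The quadratic exponent of the kernel\<close>

text \<open>The contribution of the \<open>j\<close>-th pair to the exponent of the kernel: the two
  terms with \<open>f\<close> come from the inner product, the two with \<open>e\<close> from x^2
  and y^2. Indices above 2n belong to the y variables.\<close>

definition tpair :: "complex \<Rightarrow> complex \<Rightarrow> nat \<Rightarrow> nat \<Rightarrow> quad"
  where "tpair e f n j = [(f, 2*j-1, 2*n+2*j), (-f, 2*j, 2*n+(2*j-1)), (e, 2*j-1, 2*j), (e, 2*n+(2*j-1), 2*n+2*j)]"

definition tlist :: "complex \<Rightarrow> complex \<Rightarrow> nat \<Rightarrow> quad"
  where "tlist e f n = concat (map (tpair e f n) [1..<n+1])"

lemma qder_append: "qder k (xs @ ys) F = (\<lambda>A. qder k xs F A + qder k ys F A)"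
proof (induction xs)
  case (Cons t xs) then show ?case by (cases t) (simp add: algebra_simps)
qed simp

lemma qder_tlist:
  assumes j: "j \<in> {1..n}" and z: "\<And>i. i \<in> {1..n} \<Longrightarrow> i \<noteq> j \<Longrightarrow> qder k (tpair e f n i) F = (\<lambda>A. 0)"
  shows "qder k (tlist e f n) F = qder k (tpair e f n j) F"
proof -
  have main: "qder k (concat (map (tpair e f n) xs)) F = (if j \<in> set xs then qder k (tpair e f n j) F else (\<lambda>A. 0))"
    if "distinct xs" "set xs \<subseteq> {1..n}" for xs
    using that
  proof (induction xs)
    case (Cons x xs)
    then show ?case using z[of x] by (cases "x = j") (auto simp: qder_append)
  qed simp
  have "qder k (concat (map (tpair e f n) [1..<n+1])) F = (if j \<in> set [1..<n+1] then qder k (tpair e f n j) F else (\<lambda>A. 0))"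
    by (rule main) auto
  moreover have "j \<in> set [1..<n+1]" using j by auto
  ultimately show ?thesis unfolding tlist_def by (simp only: if_True)
qed

lemma idx:
  assumes "j \<in> {1..n}" "i \<in> {1..(n::nat)}"
  shows "(2*j-1 = 2*i) = False" "(2*j = 2*i-1) = False" "(2*j-1 = 2*i-1) = (i = j)" "(2*j = 2*i) = (i = j)"
    "(2*j-1 = 2*n+2*i) = False" "(2*j-1 = 2*n+(2*i-1)) = False" "(2*j = 2*n+2*i) = False" "(2*j = 2*n+(2*i-1)) = False"
    "(2*n+2*i = 2*j-1) = False" "(2*n+(2*i-1) = 2*j-1) = False" "(2*n+2*i = 2*j) = False" "(2*n+(2*i-1) = 2*j) = False"
    "(2*n+2*j = 2*n+2*i) = (i = j)" "(2*n+(2*j-1) = 2*n+(2*i-1)) = (i = j)"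
    "(2*n+2*j = 2*n+(2*i-1)) = False" "(2*n+(2*j-1) = 2*n+2*i) = False"
    "(2*n+2*j = 2*i) = False" "(2*n+2*j = 2*i-1) = False" "(2*n+(2*j-1) = 2*i) = False" "(2*n+(2*j-1) = 2*i-1) = False"
  using assms unfolding atLeastAtMost_iff by presburger+

lemma qder_tlist_pair:
  assumes j: "j \<in> {1..n}"
  shows "qder (2*j-1) (tlist e f n) F = (\<lambda>A. f * mop (2*n+2*j) F A + e * mop (2*j) F A)"
    "qder (2*j) (tlist e f n) F = (\<lambda>A. - f * mop (2*n+(2*j-1)) F A - e * mop (2*j-1) F A)"
    "qder (2*n+(2*j-1)) (tlist e f n) F = (\<lambda>A. f * mop (2*j) F A + e * mop (2*n+2*j) F A)"
    "qder (2*n+2*j) (tlist e f n) F = (\<lambda>A. - f * mop (2*j-1) F A - e * mop (2*n+(2*j-1)) F A)"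
proof -
  have 1: "qder (2*j-1) (tpair e f n i) F = (\<lambda>A. if i = j then f * mop (2*n+2*i) F A + e * mop (2*i) F A else 0)"
    and 2: "qder (2*j) (tpair e f n i) F = (\<lambda>A. if i = j then - f * mop (2*n+(2*i-1)) F A - e * mop (2*i-1) F A else 0)"
    and 3: "qder (2*n+(2*j-1)) (tpair e f n i) F = (\<lambda>A. if i = j then f * mop (2*i) F A + e * mop (2*n+2*i) F A else 0)"
    and 4: "qder (2*n+2*j) (tpair e f n i) F = (\<lambda>A. if i = j then - f * mop (2*i-1) F A - e * mop (2*n+(2*i-1)) F A else 0)"
    if i: "i \<in> {1..n}" for i
    unfolding tpair_def qder.simps idx[OF j i] by (cases "i = j"; simp)+
  show "qder (2*j-1) (tlist e f n) F = (\<lambda>A. f * mop (2*n+2*j) F A + e * mop (2*j) F A)"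
    by (subst qder_tlist[OF j]) (simp_all only: 1 j if_False if_True simp_thms)
  show "qder (2*j) (tlist e f n) F = (\<lambda>A. - f * mop (2*n+(2*j-1)) F A - e * mop (2*j-1) F A)"
    by (subst qder_tlist[OF j]) (simp_all only: 2 j if_False if_True simp_thms)
  show "qder (2*n+(2*j-1)) (tlist e f n) F = (\<lambda>A. f * mop (2*j) F A + e * mop (2*n+2*j) F A)"
    by (subst qder_tlist[OF j]) (simp_all only: 3 j if_False if_True simp_thms)
  show "qder (2*n+2*j) (tlist e f n) F = (\<lambda>A. - f * mop (2*j-1) F A - e * mop (2*n+(2*j-1)) F A)"
    by (subst qder_tlist[OF j]) (simp_all only: 4 j if_False if_True simp_thms)
qed

definition gsing :: "nat set \<Rightarrow> gr" where "gsing S A = (if A = S then 1 else 0)"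

lemma mop_gsing_mem: "i \<in> S \<Longrightarrow> mop i (gsing S) = (\<lambda>A. 0)"
  by (auto simp: mop_def gsing_def fun_eq_iff)

lemma sg_none: "(\<And>i. i \<in> A \<Longrightarrow> j \<le> i) \<Longrightarrow> sg j A = 1"
proof -
  assume a: "\<And>i. i \<in> A \<Longrightarrow> j \<le> i"
  have "{i \<in> A. i < j} = {}" using a by force
  then show ?thesis unfolding sg_def by (simp only: card.empty power_0)
qed

lemma dop_gsing: "k \<in> S \<Longrightarrow> gderiv k (gsing S) = (\<lambda>A. sg k S * gsing (S - {k}) A)"
  by (auto simp: dop_eq gsing_def fun_eq_iff sg_remove sg_insert)

lemma mop_gsing: "k \<notin> S \<Longrightarrow> mop k (gsing S) = (\<lambda>A. sg k S * gsing (insert k S) A)"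
  by (auto simp: mop_def gsing_def fun_eq_iff sg_remove sg_insert)

lemma fold_dop_gsing: "k \<le> N + 1 \<Longrightarrow> fold gderiv [k..<N+1] (gsing {k..N}) = gsing {}"
proof (induction "N + 1 - k" arbitrary: k)
  case 0
  then show ?case by simp
next
  case (Suc d)
  then have k: "k < N + 1" by simp
  have "gderiv k (gsing {k..N}) = gsing ({k..N} - {k})"
  proof -
    have "sg k {k..N} = 1" by (rule sg_none) simp
    then show ?thesis using k by (simp add: dop_gsing)
  qed
  also have "{k..N} - {k} = {Suc k..N}" by auto
  finally show ?case using Suc.hyps(1)[of "Suc k"] Suc.hyps(2) k by (simp only: upt_conv_Cons[OF k] fold_simps)
qed

lemma berezin_top: "berezin n (gsing {1..2*n}) = gconst 1"
  using fold_dop_gsing[of 1 "2 * n"] by (auto simp: berezin_def gsing_def gconst_def fun_eq_iff)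

text \<open>The product of the factors a + b \<theta>_(2j-1) \<theta>_(2j) over the listed pairs.
  The shift \<open>sh\<close> is \<open>2 * n\<close> before the Berezin integration and 0 after the
  renumbering.\<close>

definition yprod :: "nat \<Rightarrow> complex \<Rightarrow> complex \<Rightarrow> nat list \<Rightarrow> gr \<Rightarrow> gr"
  where "yprod sh a b js F = foldr (\<lambda>j F A. a * F A + b * mop (sh + (2*j-1)) (mop (sh + 2*j) F) A) js F"

lemma qexp_append: "qexp (xs @ ys) F = qexp ys (qexp xs F)"
proof (induction xs arbitrary: F)
  case (Cons t xs) then show ?case by (cases t) simp
qed simp

text \<open>Every term of the exponent with an x generator annihilates an element that all x
  generators annihilate; only the y^2 terms survive.\<close>

lemma qexp_top:
  assumes "\<And>i. i \<in> {1..2*n} \<Longrightarrow> mop i F = (\<lambda>A. 0)" "set js \<subseteq> {1..n}"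
  shows "qexp (concat (map (tpair e f n) js)) F = yprod (2*n) 1 e js F"
proof -
  have pair: "qexp (tpair e f n j) G = (\<lambda>A. 1 * G A + e * mop (2*n+(2*j-1)) (mop (2*n+2*j) G) A)"
    if j: "j \<in> {1..n}" and G: "\<And>i. i \<in> {1..2*n} \<Longrightarrow> mop i G = (\<lambda>A. 0)" for G j
  proof -
    have jj: "2*j-1 \<in> {1..2*n}" "2*j \<in> {1..2*n}" using j by auto
    have z: "mop (2*j-1) (mop i G) = (\<lambda>A. 0)" "mop (2*j) (mop i G) = (\<lambda>A. 0)" for i
      by (simp_all add: mop_mop[of "2*j-1" i] mop_mop[of "2*j" i] G[OF jj(1)] G[OF jj(2)])
    show ?thesis by (simp add: tpair_def z)
  qed
  have keep: "mop i (yprod (2*n) 1 e js F) = (\<lambda>A. 0)" if "i \<in> {1..2*n}" for i js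
  proof (induction js)
    case Nil then show ?case using assms(1) that by (simp add: yprod_def)
  next
    case (Cons j js)
    have "yprod (2*n) 1 e (j # js) F = (\<lambda>A. 1 * yprod (2*n) 1 e js F A + e * mop (2*n+(2*j-1)) (mop (2*n+2*j) (yprod (2*n) 1 e js F)) A)"
      by (simp add: yprod_def)
    moreover have "mop i (mop (2*n+(2*j-1)) (mop (2*n+2*j) (yprod (2*n) 1 e js F))) = (\<lambda>A. 0)"
      unfolding mm_comm[of "2*n+(2*j-1)" "2*n+2*j" i, symmetric] Cons mop_zero ..
    ultimately show ?case by (simp only: mop_lin Cons) simp
  qed
  show ?thesis using assms(2)
  proof (induction js)
    case Nil then show ?case by (simp add: yprod_def)
  next
    case (Cons j js)
    let ?p = "2*n+(2*j-1)" and ?q = "2*n+2*j" and ?T = "concat (map (tpair e f n) js)"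
    have "qexp (concat (map (tpair e f n) (j # js))) F = qexp ?T (qexp (tpair e f n j) F)"
      by (simp add: qexp_append)
    also have "qexp (tpair e f n j) F = (\<lambda>A. 1 * F A + e * mop ?p (mop ?q F) A)"
      by (rule pair) (use assms(1) Cons.prems in auto)
    also have "qexp ?T (\<lambda>A. 1 * F A + e * mop ?p (mop ?q F) A) = (\<lambda>A. 1 * qexp ?T F A + e * mop ?p (mop ?q (qexp ?T F)) A)"
      unfolding qexp_lin qexp_mop ..
    also have "qexp ?T F = yprod (2*n) 1 e js F" using Cons by simp
    finally show ?case by (simp add: yprod_def)
  qed
qed

text \<open>One factor \<open>c\<close> is given to each pair. With
  \<open>c = 1 - kq \<alpha>\<close> this cancels the pole of the coefficient
  \<open>ke \<alpha>\<close>, so that the result extends to angle 0.\<close>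

lemma berezin_yprod:
  assumes "set js \<subseteq> {1..n}"
  shows "(\<lambda>A. c ^ length js * berezin n (yprod (2*n) 1 e js F) A) = yprod 0 c (c * e) js (berezin n F)"
  using assms
proof (induction js)
  case Nil then show ?case by (simp add: yprod_def)
next
  case (Cons j js)
  let ?Y = "yprod (2*n) 1 e js F"
  have j1: "2*j-1 \<ge> 1" "2*j \<ge> 1" using Cons.prems by auto
  have "berezin n (yprod (2*n) 1 e (j # js) F) = (\<lambda>A. 1 * berezin n ?Y A + e * mop (2*j-1) (mop (2*j) (berezin n ?Y)) A)"
    using berezin_lin[of n 1 ?Y e] by (simp add: yprod_def berezin_mop[OF j1(1)] berezin_mop[OF j1(2)])
  moreover have "yprod 0 c (c * e) (j # js) (berezin n F)
     = (\<lambda>A. c * yprod 0 c (c * e) js (berezin n F) A + (c * e) * mop (2*j-1) (mop (2*j) (yprod 0 c (c * e) js (berezin n F))) A)"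
    by (simp add: yprod_def)
  moreover have "yprod 0 c (c * e) js (berezin n F) = (\<lambda>A. c ^ length js * berezin n ?Y A)" using Cons by simp
  ultimately show ?case by (simp add: mop_cmult algebra_simps)
qed

lemma grassmann_dop: "F \<in> grassmann N \<Longrightarrow> gderiv k F \<in> grassmann N"
  by (auto simp: grassmann_def dop_eq)

lemma grassmann_mop: "F \<in> grassmann N \<Longrightarrow> k \<in> {1..N} \<Longrightarrow> mop k F \<in> grassmann N"
proof -
  assume F: "F \<in> grassmann N" and k: "k \<in> {1..N}"
  have "\<not> A - {k} \<subseteq> {1..N}" if "\<not> A \<subseteq> {1..N}" for A using that k by blast
  then show ?thesis using F by (simp add: grassmann_def mop_def)
qed

lemma grassmann_lincomb: "F \<in> grassmann N \<Longrightarrow> G \<in> grassmann N \<Longrightarrow> (\<lambda>A. a * F A + b * G A) \<in> grassmann N"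
  by (auto simp: grassmann_def)

lemma grassmann_dop_zero: "F \<in> grassmann N \<Longrightarrow> k \<notin> {1..N} \<Longrightarrow> gderiv k F = (\<lambda>A. 0)"
  by (auto simp: grassmann_def dop_eq fun_eq_iff)

lemma partner_mem: "k \<in> {1..2 * n} \<Longrightarrow> partner k \<in> {1..2 * n}"
  by (erule pair_cases) auto

lemma sgn_of_sq: "sgn_of k * sgn_of k = 1"
  by (simp add: sgn_of_def)

lemma mop_vector_derivative:
  assumes "\<And>A. ((\<lambda>s. F s A) has_vector_derivative F' A) (at t within I)"
  shows "((\<lambda>s. mop k (F s) A) has_vector_derivative mop k F' A) (at t within I)"
  using has_vector_derivative_mult_right[OF assms, of "sg k A" "A - {k}"] by (cases "k \<in> A") (simp_all add: mop_def)

lemma dop_vector_derivative: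
  assumes "\<And>A. ((\<lambda>s. F s A) has_vector_derivative F' A) (at t within I)"
  shows "((\<lambda>s. gderiv k (F s) A) has_vector_derivative (gderiv k F' A :: complex)) (at t within I)"
  using has_vector_derivative_mult_right[OF assms, of "sg k A" "insert k A"] by (cases "k \<in> A") (simp_all add: dop_eq)

section \<open>The Berezin transform\<close>

text \<open>\<open>ke\<close> multiplies x^2 + y^2 in the exponent of the kernel. \<open>kf\<close>
  is half the coefficient of the inner product, since the latter has a factor 1/2 in its
  anti-commuting part.\<close>

definition kq :: "real \<Rightarrow> complex" where "kq \<alpha> = exp (2 * \<i> * of_real \<alpha>)"
definition ke :: "real \<Rightarrow> complex" where "ke \<alpha> = (1 + exp (2 * \<i> * of_real \<alpha>)) / (2 - 2 * exp (2 * \<i> * of_real \<alpha>))"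
definition kf :: "real \<Rightarrow> complex" where "kf \<alpha> = - 2 * exp (\<i> * of_real \<alpha>) / (2 - 2 * exp (2 * \<i> * of_real \<alpha>))"

text \<open>Everything follows from 1 - z^2 = - 2 \<i> z sin \<alpha> and 1 + z^2 = 2 z cos \<alpha>
  with z = e^(i \<alpha>). The last identity is what closes the linear system in
  \<open>gint_dop\<close>.\<close>

lemma kernel_coeffs:
  assumes S: "sin \<alpha> \<noteq> 0"
  shows "kf \<alpha> = - \<i> / (2 * of_real (sin \<alpha>))" "ke \<alpha> = - of_real (cos \<alpha>) * kf \<alpha>" "kf \<alpha> \<noteq> 0"
    "(1 - kq \<alpha>) * ke \<alpha> = (1 + kq \<alpha>) / 2"
    "ke \<alpha> * ke \<alpha> - kf \<alpha> * kf \<alpha> = 1 / 4"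
proof -
  define z where "z = exp (\<i> * complex_of_real \<alpha>)"
  define c s where "c = complex_of_real (cos \<alpha>)" "s = complex_of_real (sin \<alpha>)"
  have z: "z = c + \<i> * s" by (simp add: z_def c_s_def cis_conv_exp[symmetric] complex_eq_iff)
  have "2 * \<i> * complex_of_real \<alpha> = \<i> * of_real \<alpha> + \<i> * of_real \<alpha>" by simp
  then have q: "exp (2 * \<i> * complex_of_real \<alpha>) = z * z" unfolding z_def by (simp only: exp_add)
  have "(cos \<alpha>)\<^sup>2 + (sin \<alpha>)\<^sup>2 = 1" by simp
  then have cs: "c * c + s * s = 1" unfolding c_s_def by (simp flip: of_real_mult of_real_add add: power2_eq_square)
  have c4: "c * (c * 4) + s * (s * 4) = 4" using cs by algebra
  have s0: "s \<noteq> 0" using S by (simp add: c_s_def)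
  have z0: "z \<noteq> 0" by (simp add: z_def)
  have 1: "1 - z * z = - 2 * \<i> * s * z" using cs unfolding z by (simp add: algebra_simps) (simp add: add.commute)?
  have 2: "1 + z * z = 2 * c * z" using cs unfolding z by (simp add: algebra_simps) (simp add: add.commute)?
  have 3: "2 - 2 * (z * z) = - 4 * \<i> * s * z"
  proof -
    have "2 - 2 * (z * z) = 2 * (1 - z * z)" by simp
    then show ?thesis unfolding 1 by simp
  qed
  have d: "2 - 2 * (z * z) \<noteq> 0" unfolding 3 using s0 z0 by simp
  show f: "kf \<alpha> = - \<i> / (2 * of_real (sin \<alpha>))"
    unfolding kf_def q z_def[symmetric] c_s_def[symmetric] 3 using s0 z0 by (simp add: field_simps)
  show e: "ke \<alpha> = - of_real (cos \<alpha>) * kf \<alpha>"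
    unfolding f ke_def q c_s_def[symmetric] 2 3 using s0 z0 by (simp add: field_simps)
  show "kf \<alpha> \<noteq> 0" unfolding f using S by simp
  show "(1 - kq \<alpha>) * ke \<alpha> = (1 + kq \<alpha>) / 2"
    unfolding ke_def kq_def q using d by (simp add: field_simps)
  have "(c * c + s * s) / (s * s) = 1 / (s * s)" unfolding cs ..
  then show "ke \<alpha> * ke \<alpha> - kf \<alpha> * kf \<alpha> = 1 / 4"
    unfolding e f c_s_def[symmetric] using s0 c4 by (simp add: field_simps)
qed

text \<open>The anti-commuting part of the integral transform. The power of
  \<open>1 - kq \<alpha>\<close> is its share in the constant with exponent -M/2, the powers of
  \<pi> having cancelled.\<close>

definition gint :: "nat \<Rightarrow> real \<Rightarrow> gr \<Rightarrow> gr"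
  where "gint n \<alpha> L = (\<lambda>A. (1 - kq \<alpha>) ^ n * berezin n (qexp (tlist (ke \<alpha>) (kf \<alpha>) n) L) A)"

lemma gint_lin: "gint n \<alpha> (\<lambda>A. a * F A + b * G A) = (\<lambda>A. a * gint n \<alpha> F A + b * gint n \<alpha> G A)"
  by (simp add: gint_def qexp_lin berezin_lin algebra_simps)

lemma gint_top:
  assumes "sin \<alpha> \<noteq> 0"
  shows "gint n \<alpha> (gsing {1..2*n}) = yprod 0 (1 - kq \<alpha>) ((1 + kq \<alpha>) / 2) [1..<n+1] (gconst 1)"
proof -
  have "qexp (tlist (ke \<alpha>) (kf \<alpha>) n) (gsing {1..2*n}) = yprod (2*n) 1 (ke \<alpha>) [1..<n+1] (gsing {1..2*n})"
    unfolding tlist_def by (rule qexp_top) (auto simp: mop_gsing_mem)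
  moreover have "(\<lambda>A. (1 - kq \<alpha>) ^ length [1..<n+1] * berezin n (yprod (2*n) 1 (ke \<alpha>) [1..<n+1] (gsing {1..2*n})) A)
      = yprod 0 (1 - kq \<alpha>) ((1 - kq \<alpha>) * ke \<alpha>) [1..<n+1] (berezin n (gsing {1..2*n}))"
    by (rule berezin_yprod) auto
  ultimately show ?thesis unfolding gint_def kernel_coeffs(4)[OF assms] berezin_top by simp
qed

text \<open>Two relations are available: a Berezin integral of a derivative in an x variable is 0,
  and a derivative in a y variable acts on the exponent only. Both involve the integral of an x
  generator times the kernel; eliminating it with e^2 - f^2 = 1/4 gives the rotation.\<close>

lemma gint_dop:
  assumes S: "sin \<alpha> \<noteq> 0" and L: "L \<in> grassmann (2 * n)" and k: "k \<in> {1..2 * n}"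
  shows "gint n \<alpha> (gderiv k L) = (\<lambda>A. of_real (cos \<alpha>) * gderiv k (gint n \<alpha> L) A
    + sgn_of k * (\<i> * of_real (sin \<alpha>) / 2) * mop (partner k) (gint n \<alpha> L) A)"
proof
  fix A
  define e f where "e = ke \<alpha>" "f = kf \<alpha>"
  define Q where "Q = qexp (tlist e f n) L"
  define QD where "QD = qexp (tlist e f n) (gderiv k L)"
  note ef = kernel_coeffs[OF S, folded e_f_def]
  \<comment> \<open>\<open>L\<close> contains no y variable, so a derivative in such a variable
    kills it and sees the exponential alone.\<close>
  have z: "qexp (tlist e f n) (gderiv (2 * n + i) L) = (\<lambda>A. 0)" if "i \<ge> 1" for i
  proof -
    have "gderiv (2 * n + i) L = (\<lambda>A. 0)" using grassmann_dop_zero[OF L, of "2 * n + i"] that by simp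
    moreover have "qexp (tlist e f n) (\<lambda>A. 0 * L A + 0 * L A) = (\<lambda>A. 0)" unfolding qexp_lin by simp
    ultimately show ?thesis by simp
  qed
  have y: "gderiv i (berezin n Q) = berezin n (qder (2 * n + i) (tlist e f n) Q)" if "i \<ge> 1" for i
    using gderiv_qexp[of "2 * n + i" "tlist e f n" L] unfolding berezin_dop[symmetric] z[OF that] Q_def[symmetric] by simp
  have "gderiv k Q = (\<lambda>A. 1 * QD A + 1 * qder k (tlist e f n) Q A)"
    unfolding Q_def QD_def by (rule gderiv_qexp)
  then have x: "(\<lambda>A. 0) = (\<lambda>A. 1 * berezin n QD A + 1 * berezin n (qder k (tlist e f n) Q) A)"
    unfolding berezin_dop_zero[OF k, of Q, symmetric] berezin_lin[symmetric] by (rule arg_cong)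
  have inv: "\<i> * of_real (sin \<alpha>) / 2 * f = 1 / 4" unfolding ef(1) using S by (simp add: field_simps)
  have main: "berezin n QD A = of_real (cos \<alpha>) * gderiv k (berezin n Q) A
      + sgn_of k * (\<i> * of_real (sin \<alpha>) / 2) * mop (partner k) (berezin n Q) A"
    using k
  proof (cases rule: pair_cases)
    case (1 j)
    \<comment> \<open>\<open>X\<close> is the integral with an extra x generator, which is to be
      eliminated; \<open>D\<close> and \<open>M\<close> are the derivative and the multiplication
      outside the integral, in terms of which the answer is expressed.\<close>
    define X D M where "X = berezin n (mop (2*j) Q) A" "D = gderiv (2*j-1) (berezin n Q) A" "M = mop (2*j) (berezin n Q) A"
    have j: "2*j \<ge> 1" "2*j-1 \<ge> 1" using 1 by auto
    have 3: "D = f * X + e * M"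
      using fun_cong[OF y[OF j(2)], of A] unfolding qder_tlist_pair[OF 1(1)] berezin_lin berezin_mop[OF j(1)]
      by (simp add: X_D_M_def)
    have 4: "0 = berezin n QD A + (f * M + e * X)"
      using fun_cong[OF x, of A] unfolding 1(2) qder_tlist_pair[OF 1(1)] berezin_lin berezin_mop[OF j(1)]
      by (simp add: X_D_M_def)
    have "berezin n QD A * f = (of_real (cos \<alpha>) * D + (\<i> * of_real (sin \<alpha>) / 2) * M) * f"
    proof -
      have "berezin n QD A = - (f * M + e * X)" using 4 by (simp only: eq_neg_iff_add_eq_0)
      then have "berezin n QD A * f = - (f * M + e * X) * f" by (simp only:)
      also have "\<dots> = - e * (D - e * M) - f * f * M" unfolding 3 by (simp add: algebra_simps)
      also have "\<dots> = - e * D + (e * e - f * f) * M" by (simp add: algebra_simps)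
      also have "\<dots> = of_real (cos \<alpha>) * f * D + (\<i> * of_real (sin \<alpha>) / 2 * f) * M" unfolding ef(5) inv unfolding ef(2) by simp
      finally show ?thesis by (simp add: algebra_simps)
    qed
    then show ?thesis using ef(3) 1 by (simp add: X_D_M_def)
  next
    case (2 j)
    define X D M where "X = berezin n (mop (2*j-1) Q) A" "D = gderiv (2*j) (berezin n Q) A" "M = mop (2*j-1) (berezin n Q) A"
    have j: "2*j \<ge> 1" "2*j-1 \<ge> 1" using 2 by auto
    have l: "(\<lambda>A. - f * F A - e * G A) = (\<lambda>A. (- f) * F A + (- e) * G A)" for F G :: gr by simp
    have 3: "D = - f * X - e * M"
      using fun_cong[OF y[OF j(1)], of A] unfolding qder_tlist_pair[OF 2(1)] l berezin_lin berezin_mop[OF j(2)]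
      by (simp add: X_D_M_def)
    have 4: "0 = berezin n QD A + (- f * M - e * X)"
      using fun_cong[OF x, of A] unfolding 2(2) qder_tlist_pair[OF 2(1)] l berezin_lin berezin_mop[OF j(2)]
      by (simp add: X_D_M_def)
    have "berezin n QD A * f = (of_real (cos \<alpha>) * D - (\<i> * of_real (sin \<alpha>) / 2) * M) * f"
    proof -
      have "berezin n QD A * f = (f * M + e * X) * f" using 4 by (simp add: algebra_simps)
      also have "\<dots> = - e * (D + e * M) + f * f * M" unfolding 3 by (simp add: algebra_simps)
      also have "\<dots> = - e * D - (e * e - f * f) * M" by (simp add: algebra_simps)
      also have "\<dots> = of_real (cos \<alpha>) * f * D - (\<i> * of_real (sin \<alpha>) / 2 * f) * M" unfolding ef(5) inv unfolding ef(2) by simp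
      finally show ?thesis by (simp add: algebra_simps)
    qed
    then show ?thesis using ef(3) 2 by (simp add: X_D_M_def)
  qed
  have g: "gint n \<alpha> L = (\<lambda>A. (1 - kq \<alpha>) ^ n * berezin n Q A)"
    "gint n \<alpha> (gderiv k L) = (\<lambda>A. (1 - kq \<alpha>) ^ n * berezin n QD A)"
    by (simp_all add: gint_def Q_def QD_def e_f_def)
  show "gint n \<alpha> (gderiv k L) A = of_real (cos \<alpha>) * gderiv k (gint n \<alpha> L) A
    + sgn_of k * (\<i> * of_real (sin \<alpha>) / 2) * mop (partner k) (gint n \<alpha> L) A"
    unfolding g dop_cmult mop_cmult main by (simp add: algebra_simps)
qed

section \<open>The flow of the top monomial\<close>

definition pairop :: "nat \<Rightarrow> gr \<Rightarrow> gr"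
  where "pairop j F = (\<lambda>A. 4 * gderiv (2*j-1) (gderiv (2*j) F) A - mop (2*j-1) (mop (2*j) F) A + 2 * F A)"

lemma fermi_pairop: "fermi n F A = (\<Sum>j=1..n. pairop j F A)"
  by (simp add: fermi_def pairop_def sum.distrib sum_subtractf sum_distrib_left)

lemma pairop_lin: "pairop j (\<lambda>A. a * F A + b * G A) = (\<lambda>A. a * pairop j F A + b * pairop j G A)"
  by (simp add: pairop_def mop_lin dop_lin algebra_simps)

lemma pairop_mm:
  assumes "i \<in> {1..n}" "j \<in> {1..n}" "i \<noteq> j"
  shows "pairop i (mop (2*j-1) (mop (2*j) F)) = mop (2*j-1) (mop (2*j) (pairop i F))"
proof -
  have ne: "2*i-1 \<noteq> 2*j-1" "2*i \<noteq> 2*j" "2*i-1 \<noteq> 2*j" "2*i \<noteq> 2*j-1" using pair_eq[OF assms(1,2)] assms(3) by auto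
  have d: "gderiv (2*i-1) (gderiv (2*i) (mop k F)) = mop k (gderiv (2*i-1) (gderiv (2*i) F))" if "2*i-1 \<noteq> k" "2*i \<noteq> k" for k F
    unfolding dd_mop using that by simp
  have m: "mop (2*i-1) (mop (2*i) (mop (2*j-1) (mop (2*j) F))) = mop (2*j-1) (mop (2*j) (mop (2*i-1) (mop (2*i) F)))"
    unfolding mm_comm[of "2*i-1" "2*i"] ..
  show ?thesis unfolding pairop_def d[OF ne(1,4)] d[OF ne(3,2)] m mop_add mop_diff mop_cmult ..
qed

text \<open>On the coefficients (a, b) this is the matrix with rows (2, -4) and (-1, 2). Its
  eigenvalues are 0 and 4, with eigenvectors (2, 1) and (-2, 1).\<close>

lemma pairop_self:
  assumes j: "j \<in> {1..n}" and z: "gderiv (2*j-1) Y = (\<lambda>A. 0)" "gderiv (2*j) Y = (\<lambda>A. 0)"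
  shows "pairop j (\<lambda>A. a * Y A + b * mop (2*j-1) (mop (2*j) Y) A)
    = (\<lambda>A. (2 * a - 4 * b) * Y A + (2 * b - a) * mop (2*j-1) (mop (2*j) Y) A)"
proof -
  have ne: "(2*j-1 = 2*j) = False" "(2*j = 2*j-1) = False" using pair_eq[OF j j] by auto
  have 1: "gderiv (2*j-1) (gderiv (2*j) (mop (2*j-1) (mop (2*j) Y))) = (\<lambda>A. - Y A)"
    unfolding dd_mop ne dop_mop z by (simp add: z dop_diff dop_cmult dop_neg dop_mop mop_neg ne)
  have 2: "mop (2*j-1) (mop (2*j) (mop (2*j-1) (mop (2*j) Y))) = (\<lambda>A. 0)" by (rule mm_nilpotent)
  show ?thesis unfolding pairop_def mop_lin dop_lin 1 2 z dop_zero by (simp add: algebra_simps)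
qed

lemma dop_gconst: "gderiv k (gconst c) = (\<lambda>A. 0 :: complex)"
  by (auto simp: dop_eq gconst_def fun_eq_iff)

lemma yprod_Cons: "yprod 0 a b (j # js) F = (\<lambda>A. a * yprod 0 a b js F A + b * mop (2*j-1) (mop (2*j) (yprod 0 a b js F)) A)"
  by (simp add: yprod_def)

lemma dop_yprod:
  assumes j: "j \<in> {1..n}" "k = 2*j-1 \<or> k = 2*j"
  shows "set js \<subseteq> {1..n} - {j} \<Longrightarrow> gderiv k (yprod 0 a b js (gconst 1)) = (\<lambda>A. 0)"
proof (induction js)
  case Nil then show ?case by (simp add: yprod_def dop_gconst)
next
  case (Cons i js)
  then have i: "i \<in> {1..n}" "i \<noteq> j" and IH: "gderiv k (yprod 0 a b js (gconst 1)) = (\<lambda>A. 0)" by auto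
  have ne: "(k = 2*i-1) = False" "(k = 2*i) = False" using pair_eq[OF j(1) i(1)] pair_eq[OF i(1) j(1)] i(2) j(2) by auto
  show ?case unfolding yprod_Cons dop_lin dop_mop ne IH if_False by (simp add: IH)
qed

text \<open>Different pairs do not interact, so the product rule leaves one two-dimensional system
  for each pair. Its solution that starts at the monomial of the pair is (1, 1/2) + q (-1, 1/2): the
  first vector belongs to eigenvalue 0, the second to 4, and \<i> / 2 times 4 is the rate of q =
  e^(2 i \<alpha>).\<close>

lemma yprod_derivative:
  assumes a: "\<And>s. (a has_vector_derivative - 2 * \<i> * q s) (at s)" "\<And>s. (b has_vector_derivative \<i> * q s) (at s)"
    and ab: "\<And>s. a s = 1 - q s" "\<And>s. b s = (1 + q s) / 2"
  shows "distinct js \<Longrightarrow> set js \<subseteq> {1..n} \<Longrightarrow>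
    ((\<lambda>s. yprod 0 (a s) (b s) js (gconst 1) A) has_vector_derivative
      \<i> / 2 * (\<Sum>j\<in>set js. pairop j (yprod 0 (a t) (b t) js (gconst 1)) A)) (at t)"
proof (induction js arbitrary: A)
  case Nil then show ?case by (simp add: yprod_def)
next
  case (Cons j js)
  let ?Y = "\<lambda>s. yprod 0 (a s) (b s) js (gconst 1)"
  let ?mm = "\<lambda>F. mop (2*j-1) (mop (2*j) F)"
  define D where "D = (\<lambda>A. \<i> / 2 * (\<Sum>i\<in>set js. pairop i (?Y t) A))"
  have js: "j \<in> {1..n}" "j \<notin> set js" "distinct js" "set js \<subseteq> {1..n}" "set js \<subseteq> {1..n} - {j}" using Cons.prems by auto
  have Y: "((\<lambda>s. ?Y s A) has_vector_derivative D A) (at t)" for A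
    unfolding D_def by (rule Cons.IH[OF js(3,4)])
  have MM: "((\<lambda>s. ?mm (?Y s) A) has_vector_derivative ?mm D A) (at t)" for A
    by (intro mop_vector_derivative Y)
  have "((\<lambda>s. a s * ?Y s A + b s * ?mm (?Y s) A) has_vector_derivative
     (a t * D A + - 2 * \<i> * q t * ?Y t A) + (b t * ?mm D A + \<i> * q t * ?mm (?Y t) A)) (at t)"
    by (intro has_vector_derivative_add has_vector_derivative_mult a Y MM)
  moreover have "(a t * D A + - 2 * \<i> * q t * ?Y t A) + (b t * ?mm D A + \<i> * q t * ?mm (?Y t) A)
    = \<i> / 2 * (\<Sum>i\<in>set (j # js). pairop i (yprod 0 (a t) (b t) (j # js) (gconst 1)) A)"
  proof -
    have z: "gderiv (2*j-1) (?Y t) = (\<lambda>A. 0)" "gderiv (2*j) (?Y t) = (\<lambda>A. 0)"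
      by (rule dop_yprod[OF js(1) _ js(5)]; simp)+
    have 1: "pairop j (yprod 0 (a t) (b t) (j # js) (gconst 1)) A
      = (2 * a t - 4 * b t) * ?Y t A + (2 * b t - a t) * ?mm (?Y t) A"
      unfolding yprod_Cons pairop_self[OF js(1) z] ..
    have "pairop i (yprod 0 (a t) (b t) (j # js) (gconst 1)) A = a t * pairop i (?Y t) A + b t * ?mm (pairop i (?Y t)) A"
      if "i \<in> set js" for i
    proof -
      have i: "i \<in> {1..n}" "i \<noteq> j" using that js by auto
      show ?thesis unfolding yprod_Cons pairop_lin pairop_mm[OF i(1) js(1) i(2)] ..
    qed
    then have "(\<Sum>i\<in>set js. pairop i (yprod 0 (a t) (b t) (j # js) (gconst 1)) A)
      = a t * (\<Sum>i\<in>set js. pairop i (?Y t) A) + b t * (\<Sum>i\<in>set js. ?mm (pairop i (?Y t)) A)"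
      by (simp add: sum.distrib sum_distrib_left)
    moreover have "?mm D A = \<i> / 2 * (\<Sum>i\<in>set js. ?mm (pairop i (?Y t)) A)"
      unfolding D_def mop_cmult sum_mop ..
    ultimately have 2: "\<i> / 2 * (\<Sum>i\<in>set js. pairop i (yprod 0 (a t) (b t) (j # js) (gconst 1)) A) = a t * D A + b t * ?mm D A"
      by (simp add: D_def algebra_simps)
    have "(\<Sum>i\<in>set (j # js). pairop i (yprod 0 (a t) (b t) (j # js) (gconst 1)) A) =
       pairop j (yprod 0 (a t) (b t) (j # js) (gconst 1)) A + (\<Sum>i\<in>set js. pairop i (yprod 0 (a t) (b t) (j # js) (gconst 1)) A)"
      using js(2) by simp
    then have 3: "\<i> / 2 * (\<Sum>i\<in>set (j # js). pairop i (yprod 0 (a t) (b t) (j # js) (gconst 1)) A) =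
       \<i> / 2 * pairop j (yprod 0 (a t) (b t) (j # js) (gconst 1)) A + \<i> / 2 * (\<Sum>i\<in>set js. pairop i (yprod 0 (a t) (b t) (j # js) (gconst 1)) A)"
      by (simp only: distrib_left)
    have 4: "\<i> / 2 * ((2 * a t - 4 * b t) * x + (2 * b t - a t) * y) = - 2 * \<i> * q t * x + \<i> * q t * y" for x y
      unfolding ab by (simp add: field_simps)
    show ?thesis unfolding 3 2 1 4 by (simp only: ac_simps)
  qed
  ultimately show ?case unfolding yprod_Cons by (simp only:)
qed

lemma yprod_zero: "i \<ge> 1 \<Longrightarrow> i \<le> n + 1 \<Longrightarrow> yprod 0 0 1 [i..<n+1] (gconst 1) = gsing {2*i-1..2*n}"
proof (induction "n + 1 - i" arbitrary: i)
  case 0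
  then show ?case by (auto simp: yprod_def gsing_def gconst_def fun_eq_iff)
next
  case (Suc d)
  then have i: "i < n + 1" by simp
  have "yprod 0 0 1 [i..<n+1] (gconst 1) = mop (2*i-1) (mop (2*i) (gsing {2*Suc i-1..2*n}))"
    using Suc.hyps(1)[of "Suc i"] Suc.hyps(2) Suc.prems i unfolding upt_conv_Cons[OF i] yprod_Cons by simp
  also have "mop (2*i) (gsing {2*Suc i-1..2*n}) = gsing (insert (2*i) {2*Suc i-1..2*n})"
  proof -
    have "sg (2*i) {2*Suc i-1..2*n} = 1" by (rule sg_none) auto
    then show ?thesis by (simp add: mop_gsing)
  qed
  also have "insert (2*i) {2*Suc i-1..2*n} = {2*i..2*n}" using i by auto
  also have "mop (2*i-1) (gsing {2*i..2*n}) = gsing (insert (2*i-1) {2*i..2*n})"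
  proof -
    have "sg (2*i-1) {2*i..2*n} = 1" by (rule sg_none) auto
    moreover have "2*i-1 \<notin> {2*i..2*n}" using Suc.prems by auto
    ultimately show ?thesis by (simp add: mop_gsing)
  qed
  also have "insert (2*i-1) {2*i..2*n} = {2*i-1..2*n}" using i Suc.prems by auto
  finally show ?case .
qed

section \<open>Flows of all Grassmann elements\<close>

text \<open>The differential equation and the agreement with the Berezin transform are bundled,
  since both pass from \<open>L\<close> to linear combinations and to \<open>gderiv k L\<close>. The
  flow is defined at angle 0 as well, where the integral formula is singular.\<close>

definition gflow :: "nat \<Rightarrow> gr \<Rightarrow> (real \<Rightarrow> gr) \<Rightarrow> bool"
  where "gflow n L g \<longleftrightarrow> (\<forall>\<alpha>. g \<alpha> \<in> grassmann (2 * n)) \<and> g 0 = L \<and>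
    (\<forall>\<alpha> A. ((\<lambda>s. g s A) has_vector_derivative \<i> / 2 * fermi n (g \<alpha>) A) (at \<alpha>)) \<and>
    (\<forall>\<alpha>. sin \<alpha> \<noteq> 0 \<longrightarrow> g \<alpha> = gint n \<alpha> L)"

lemma gflow_lincomb:
  assumes "gflow n L g" "gflow n L' g'"
  shows "gflow n (\<lambda>A. a * L A + b * L' A) (\<lambda>\<alpha> A. a * g \<alpha> A + b * g' \<alpha> A)"
  unfolding gflow_def
proof (intro conjI allI impI)
  fix \<alpha> A
  have "((\<lambda>s. a * g s A + b * g' s A) has_vector_derivative a * (\<i> / 2 * fermi n (g \<alpha>) A) + b * (\<i> / 2 * fermi n (g' \<alpha>) A)) (at \<alpha>)"
    using assms unfolding gflow_def by (intro has_vector_derivative_add has_vector_derivative_mult_right) blast+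
  then show "((\<lambda>s. a * g s A + b * g' s A) has_vector_derivative \<i> / 2 * fermi n (\<lambda>A. a * g \<alpha> A + b * g' \<alpha> A) A) (at \<alpha>)"
    unfolding fermi_lin by (simp add: algebra_simps)
next
  fix \<alpha> :: real assume "sin \<alpha> \<noteq> 0"
  then have "g \<alpha> = gint n \<alpha> L" "g' \<alpha> = gint n \<alpha> L'" using assms by (auto simp: gflow_def)
  then show "(\<lambda>A. a * g \<alpha> A + b * g' \<alpha> A) = gint n \<alpha> (\<lambda>A. a * L A + b * L' A)"
    unfolding gint_lin by simp
next
  fix \<alpha> :: real
  have G: "g \<alpha> \<in> grassmann (2 * n)" "g' \<alpha> \<in> grassmann (2 * n)" "g 0 = L" "g' 0 = L'" using assms by (auto simp: gflow_def)
  show "(\<lambda>A. a * g \<alpha> A + b * g' \<alpha> A) \<in> grassmann (2 * n)" by (rule grassmann_lincomb[OF G(1,2)])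
  show "(\<lambda>A. a * g 0 A + b * g' 0 A) = (\<lambda>A. a * L A + b * L' A)" unfolding G(3,4) ..
qed

text \<open>The scalar part of \<open>gflow_dop\<close>: \<open>h\<close> is \<i> / 2, whose square
  is -1/4, \<sigma> is \<open>sgn_of k\<close>, and \<open>c\<close> and \<open>S\<close> are cosine
  and sine.\<close>

lemma flow_identity:
  fixes a b c d h x S \<sigma> :: complex
  assumes "\<sigma> * \<sigma> = 1" "4 * (h * h) = - 1"
  shows "(c * (h * a) + - S * d) + (\<sigma> * (h * S) * (h * x) + \<sigma> * (h * c) * b) = h * (c * (a + \<sigma> * b) + \<sigma> * (h * S) * (x + 4 * \<sigma> * d))"
proof -
  have "h * (c * (a + \<sigma> * b) + \<sigma> * (h * S) * (x + 4 * \<sigma> * d)) = h * c * a + h * c * \<sigma> * b + \<sigma> * h * S * h * x + (\<sigma> * \<sigma>) * (4 * (h * h)) * S * d"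
    by (simp add: algebra_simps)
  then show ?thesis unfolding assms by (simp add: algebra_simps)
qed

text \<open>The commutators with \<open>fermi\<close> rotate \<open>gderiv k\<close> into
  \<open>mop (partner k)\<close>; the operator rotated by the current angle therefore maps the flow
  of \<open>L\<close> to a solution again, and \<open>gint_dop\<close> shows that it agrees with the
  Berezin transform.\<close>

lemma gflow_dop:
  assumes g: "gflow n L g" and k: "k \<in> {1..2 * n}"
  shows "gflow n (gderiv k L) (\<lambda>\<alpha> A. of_real (cos \<alpha>) * gderiv k (g \<alpha>) A + sgn_of k * (\<i> * of_real (sin \<alpha>) / 2) * mop (partner k) (g \<alpha>) A)"
  unfolding gflow_def
proof (intro conjI allI impI)
  fix \<alpha>
  have G: "g \<alpha> \<in> grassmann (2 * n)" "g 0 = L" "L \<in> grassmann (2 * n)" using g by (auto simp: gflow_def)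
  show "(\<lambda>A. of_real (cos \<alpha>) * gderiv k (g \<alpha>) A + sgn_of k * (\<i> * of_real (sin \<alpha>) / 2) * mop (partner k) (g \<alpha>) A) \<in> grassmann (2 * n)"
    by (rule grassmann_lincomb[OF grassmann_dop[OF G(1)] grassmann_mop[OF G(1) partner_mem[OF k]]])
  show "(\<lambda>A. of_real (cos 0) * gderiv k (g 0) A + sgn_of k * (\<i> * of_real (sin 0) / 2) * mop (partner k) (g 0) A) = gderiv k L"
    by (simp add: G)
  show "(\<lambda>A. of_real (cos \<alpha>) * gderiv k (g \<alpha>) A + sgn_of k * (\<i> * of_real (sin \<alpha>) / 2) * mop (partner k) (g \<alpha>) A) = gint n \<alpha> (gderiv k L)"
    if "sin \<alpha> \<noteq> 0"
    using g that unfolding gint_dop[OF that G(3) k] by (simp add: gflow_def)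
  fix A
  define X where "X = (\<lambda>A. \<i> / 2 * fermi n (g \<alpha>) A)"
  have g': "((\<lambda>s. g s A) has_vector_derivative X A) (at \<alpha>)" for A
    using g unfolding gflow_def X_def by blast
  have re: "((\<lambda>s. complex_of_real (u s)) has_vector_derivative of_real u') (at \<alpha>)"
    if "(u has_vector_derivative u') (at \<alpha>)" for u u'
    by (rule bounded_linear.has_vector_derivative[OF bounded_linear_of_real that])
  have "(cos has_vector_derivative - sin \<alpha>) (at \<alpha>)" "(sin has_vector_derivative cos \<alpha>) (at \<alpha>)"
    by (auto intro!: derivative_eq_intros simp: has_real_derivative_iff_has_vector_derivative[symmetric])
  note cs = this[THEN re]
  have c: "((\<lambda>s. complex_of_real (cos s)) has_vector_derivative - of_real (sin \<alpha>)) (at \<alpha>)" using cs(1) by simp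
  have s: "((\<lambda>s. sgn_of k * (\<i> * complex_of_real (sin s) / 2)) has_vector_derivative sgn_of k * (\<i> * of_real (cos \<alpha>) / 2)) (at \<alpha>)"
    using has_vector_derivative_mult_right[OF cs(2), of "sgn_of k * \<i> / 2"] by (simp add: mult.assoc)
  have "((\<lambda>s. of_real (cos s) * gderiv k (g s) A + sgn_of k * (\<i> * of_real (sin s) / 2) * mop (partner k) (g s) A) has_vector_derivative
     (of_real (cos \<alpha>) * gderiv k X A + - of_real (sin \<alpha>) * gderiv k (g \<alpha>) A)
     + (sgn_of k * (\<i> * of_real (sin \<alpha>) / 2) * mop (partner k) X A + sgn_of k * (\<i> * of_real (cos \<alpha>) / 2) * mop (partner k) (g \<alpha>) A)) (at \<alpha>)"
    by (intro has_vector_derivative_add has_vector_derivative_mult c s dop_vector_derivative mop_vector_derivative g')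
  moreover have "(of_real (cos \<alpha>) * gderiv k X A + - of_real (sin \<alpha>) * gderiv k (g \<alpha>) A)
     + (sgn_of k * (\<i> * of_real (sin \<alpha>) / 2) * mop (partner k) X A + sgn_of k * (\<i> * of_real (cos \<alpha>) / 2) * mop (partner k) (g \<alpha>) A)
     = \<i> / 2 * fermi n (\<lambda>A. of_real (cos \<alpha>) * gderiv k (g \<alpha>) A + sgn_of k * (\<i> * of_real (sin \<alpha>) / 2) * mop (partner k) (g \<alpha>) A) A"
  proof -
    have h: "\<i> * of_real r / 2 = \<i> / 2 * of_real r" for r :: real by simp
    show ?thesis
      unfolding fermi_lin fermi_dop[OF k] fermi_mop_partner[OF k] X_def dop_cmult mop_cmult h
      by (rule flow_identity[OF sgn_of_sq]) simp
  qed
  ultimately show "((\<lambda>s. of_real (cos s) * gderiv k (g s) A + sgn_of k * (\<i> * of_real (sin s) / 2) * mop (partner k) (g s) A) has_vector_derivative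
     \<i> / 2 * fermi n (\<lambda>A. of_real (cos \<alpha>) * gderiv k (g \<alpha>) A + sgn_of k * (\<i> * of_real (sin \<alpha>) / 2) * mop (partner k) (g \<alpha>) A) A) (at \<alpha>)"
    by (simp only:)
qed

lemma grassmann_gconst: "gconst c \<in> grassmann N"
  by (auto simp: grassmann_def gconst_def)

lemma grassmann_yprod: "set js \<subseteq> {1..n} \<Longrightarrow> yprod 0 a b js (gconst 1) \<in> grassmann (2 * n)"
proof (induction js)
  case Nil then show ?case by (simp add: yprod_def grassmann_gconst)
next
  case (Cons j js)
  then have Y: "yprod 0 a b js (gconst 1) \<in> grassmann (2 * n)" "2*j \<in> {1..2*n}" "2*j-1 \<in> {1..2*n}" by auto
  show ?case unfolding yprod_Cons by (rule grassmann_lincomb[OF Y(1) grassmann_mop[OF grassmann_mop[OF Y(1,2)] Y(3)]])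
qed

lemma kq_derivative: "(kq has_vector_derivative 2 * \<i> * kq s) (at s)"
proof -
  have "((\<lambda>z. exp (2 * \<i> * z)) has_field_derivative 2 * \<i> * exp (2 * \<i> * of_real s)) (at (of_real s))"
    by (auto intro!: derivative_eq_intros)
  from has_vector_derivative_real_field[OF this] show ?thesis unfolding kq_def[abs_def] .
qed

lemma gflow_top: "gflow n (gsing {1..2*n}) (\<lambda>\<alpha>. yprod 0 (1 - kq \<alpha>) ((1 + kq \<alpha>) / 2) [1..<n+1] (gconst 1))"
  unfolding gflow_def
proof (intro conjI allI impI)
  fix \<alpha>
  show "yprod 0 (1 - kq \<alpha>) ((1 + kq \<alpha>) / 2) [1..<n+1] (gconst 1) \<in> grassmann (2 * n)"
    by (rule grassmann_yprod) auto
  show "yprod 0 (1 - kq 0) ((1 + kq 0) / 2) [1..<n+1] (gconst 1) = gsing {1..2*n}"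
    using yprod_zero[of 1 n] by (simp add: kq_def One_nat_def)
  show "yprod 0 (1 - kq \<alpha>) ((1 + kq \<alpha>) / 2) [1..<n+1] (gconst 1) = gint n \<alpha> (gsing {1..2*n})" if "sin \<alpha> \<noteq> 0"
    by (rule gint_top[OF that, symmetric])
  fix A
  have a: "((\<lambda>s. 1 - kq s) has_vector_derivative - 2 * \<i> * kq s) (at s)" for s
    using has_vector_derivative_diff[OF has_vector_derivative_const kq_derivative, of 1 s] by simp
  have b: "((\<lambda>s. (1 + kq s) / 2) has_vector_derivative \<i> * kq s) (at s)" for s
    using has_vector_derivative_mult_right[OF has_vector_derivative_add[OF has_vector_derivative_const kq_derivative], of "1/2" 1 s] by simp
  have "((\<lambda>s. yprod 0 (1 - kq s) ((1 + kq s) / 2) [1..<n+1] (gconst 1) A) has_vector_derivative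
      \<i> / 2 * (\<Sum>j\<in>set [1..<n+1]. pairop j (yprod 0 (1 - kq \<alpha>) ((1 + kq \<alpha>) / 2) [1..<n+1] (gconst 1)) A)) (at \<alpha>)"
    by (rule yprod_derivative[OF a b refl refl, where n=n]) auto
  moreover have "set [1..<n+1] = {1..n}" by auto
  ultimately show "((\<lambda>s. yprod 0 (1 - kq s) ((1 + kq s) / 2) [1..<n+1] (gconst 1) A) has_vector_derivative
      \<i> / 2 * fermi n (yprod 0 (1 - kq \<alpha>) ((1 + kq \<alpha>) / 2) [1..<n+1] (gconst 1)) A) (at \<alpha>)"
    unfolding fermi_pairop by (simp only:)
qed

lemma gflow_gsing: "S \<subseteq> {1..2*n} \<Longrightarrow> \<exists>g. gflow n (gsing S) g"
proof (induction "card ({1..2*n} - S)" arbitrary: S)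
  case 0
  then have "S = {1..2*n}" by auto
  then show ?case using gflow_top by blast
next
  case (Suc d)
  then have "{1..2*n} - S \<noteq> {}" by (metis card.empty nat.distinct(1))
  then obtain k where "k \<in> {1..2*n} - S" by blast
  then have k: "k \<in> {1..2*n}" "k \<notin> S" by auto
  have "card ({1..2*n} - insert k S) = d"
  proof -
    have "{1..2*n} - insert k S = ({1..2*n} - S) - {k}" by auto
    then show ?thesis using Suc.hyps(2) k by simp
  qed
  then obtain g where "gflow n (gsing (insert k S)) g"
    using Suc.hyps(1)[of "insert k S"] Suc.prems k(1) by auto
  from gflow_dop[OF this k(1)] obtain h where h: "gflow n (gderiv k (gsing (insert k S))) h" by blast
  \<comment> \<open>Scaling by \<open>sg\<close> undoes the sign of the derivative, because the sign
    squares to 1.\<close>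
  have "(\<lambda>A. sg k (insert k S) * gderiv k (gsing (insert k S)) A + 0 * gderiv k (gsing (insert k S)) A) = gsing S"
    using k(2) by (simp add: dop_gsing fun_eq_iff)
  with gflow_lincomb[OF h h, of "sg k (insert k S)" 0] show ?case by auto
qed

lemma grassmann_expand:
  assumes "F \<in> grassmann N" shows "F A = (\<Sum>S\<in>Pow {1..N}. F S * gsing S A)"
proof -
  have "(\<Sum>S\<in>Pow {1..N}. F S * gsing S A) = (\<Sum>S\<in>Pow {1..N}. if S = A then F A else 0)"
    by (rule sum.cong) (auto simp: gsing_def)
  also have "\<dots> = F A" using assms by (auto simp: grassmann_def)
  finally show ?thesis ..
qed

lemma gflow_exists:
  assumes L: "L \<in> grassmann (2 * n)" obtains g where "gflow n L g"
proof -
  have "\<exists>g. gflow n (\<lambda>A. \<Sum>S\<in>\<S>. L S * gsing S A) g" if "finite \<S>" "\<S> \<subseteq> Pow {1..2*n}" for \<S>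
    using that
  proof (induction \<S>)
    case empty
    obtain g where g: "gflow n (gsing {}) g" using gflow_gsing[of "{}" n] by blast
    have "gflow n (\<lambda>A. 0) (\<lambda>\<alpha> A. 0)" using gflow_lincomb[OF g g, of 0 0] by simp
    then show ?case unfolding sum.empty by - (rule exI[of _ "\<lambda>\<alpha> A. 0"])
  next
    case (insert S \<S>)
    then have sub: "\<S> \<subseteq> Pow {1..2*n}" "S \<subseteq> {1..2*n}" by auto
    obtain g where g: "gflow n (\<lambda>A. \<Sum>S\<in>\<S>. L S * gsing S A) g" using insert.IH[OF sub(1)] by (rule exE)
    obtain h where h: "gflow n (gsing S) h" using gflow_gsing[OF sub(2)] by (rule exE)
    have eq: "(\<lambda>A. L S * gsing S A + 1 * (\<Sum>S\<in>\<S>. L S * gsing S A)) = (\<lambda>A. \<Sum>S\<in>insert S \<S>. L S * gsing S A)"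
      using insert.hyps by simp
    have "\<exists>g. gflow n (\<lambda>A. L S * gsing S A + 1 * (\<Sum>S\<in>\<S>. L S * gsing S A)) g"
      by (rule exI, rule gflow_lincomb[OF h g])
    then show ?case unfolding eq .
  qed
  then have "\<exists>g. gflow n (\<lambda>A. \<Sum>S\<in>Pow {1..2*n}. L S * gsing S A) g" by simp
  then obtain g where g: "gflow n (\<lambda>A. \<Sum>S\<in>Pow {1..2*n}. L S * gsing S A) g" by (rule exE)
  have "(\<lambda>A. \<Sum>S\<in>Pow {1..2*n}. L S * gsing S A) = L"
    by (rule ext) (rule grassmann_expand[OF L, symmetric])
  with g show ?thesis using that by simp
qed

section \<open>Convergence of superfunctions in terms of their components\<close>

lemma pd_cong_Rm:
  assumes "\<And>x. x \<in> Rm m \<Longrightarrow> f x = g x" "j \<in> {1..m}" "x \<in> Rm m"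
  shows "pd j f x = pd j g x"
proof -
  have "(\<lambda>t. f (x(j := t))) = (\<lambda>t. g (x(j := t)))"
    by (rule ext, rule assms(1)) (use assms(2,3) in simp)
  then show ?thesis unfolding pd_def by (simp only:)
qed

lemma pds_cong_Rm:
  assumes "\<And>x. x \<in> Rm m \<Longrightarrow> f x = g x"
  shows "set js \<subseteq> {1..m} \<Longrightarrow> x \<in> Rm m \<Longrightarrow> pds js f x = pds js g x"
proof (induction js arbitrary: x)
  case (Cons j js)
  then show ?case unfolding pds_Cons by (intro pd_cong_Rm[of m]) auto
qed (simp add: assms)

text \<open>The families \<open>P\<close> and \<open>Q\<close> have to agree with Schwartz functions
  on \<open>Rm m\<close> only, because the integral transform and the generator are identified only
  there.\<close>

lemma uniform_limit_snull:
  assumes p: "\<forall>\<^sub>F i in F. p i \<in> schwartz m" and q: "q \<in> schwartz m"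
    and P: "\<forall>\<^sub>F i in F. \<forall>x\<in>Rm m. P i x = p i x" and Q: "\<And>x. x \<in> Rm m \<Longrightarrow> Q x = q x"
  shows "(\<forall>js \<beta>. set js \<subseteq> {1..m} \<longrightarrow> uniform_limit (Rm m) (\<lambda>i x. monomial m \<beta> x * pds js (P i) x)
      (\<lambda>x. monomial m \<beta> x * pds js Q x) F) \<longleftrightarrow> snull m (\<lambda>i x. p i x - q x) F"
proof -
  have key: "uniform_limit (Rm m) (\<lambda>i x. monomial m \<beta> x * pds js (P i) x) (\<lambda>x. monomial m \<beta> x * pds js Q x) F
     \<longleftrightarrow> (\<forall>e>0. \<forall>\<^sub>F i in F. sn_le m {(js, \<beta>)} (\<lambda>x. p i x - q x) e)" if js: "set js \<subseteq> {1..m}" for js \<beta>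
  proof -
    have D: "dist (monomial m \<beta> x * pds js (p i) x) (monomial m \<beta> x * pds js q x)
        = norm (monomial m \<beta> x * pds js (\<lambda>x. p i x - q x) x)" if "p i \<in> schwartz m" for i x
    proof -
      have "pds js (\<lambda>x. p i x - q x) x = pds js (p i) x - pds js q x"
        using pds_lincomb[OF that q js, of 1 "-1"] by simp
      then show ?thesis by (simp add: dist_norm right_diff_distrib)
    qed
    have "uniform_limit (Rm m) (\<lambda>i x. monomial m \<beta> x * pds js (P i) x) (\<lambda>x. monomial m \<beta> x * pds js Q x) F
      \<longleftrightarrow> uniform_limit (Rm m) (\<lambda>i x. monomial m \<beta> x * pds js (p i) x) (\<lambda>x. monomial m \<beta> x * pds js q x) F"
    proof (rule uniform_limit_cong)
      show "\<forall>\<^sub>F i in F. \<forall>x\<in>Rm m. monomial m \<beta> x * pds js (P i) x = monomial m \<beta> x * pds js (p i) x"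
        using P
      proof eventually_elim
        case (elim i)
        then have "pds js (P i) x = pds js (p i) x" if "x \<in> Rm m" for x using pds_cong_Rm[of m "P i" "p i", OF _ js that] by blast
        then show ?case by simp
      qed
      show "monomial m \<beta> x * pds js Q x = monomial m \<beta> x * pds js q x" if "x \<in> Rm m" for x
        using pds_cong_Rm[of m Q q, OF Q js that] by simp
    qed
    also have "\<dots> \<longleftrightarrow> (\<forall>e>0. \<forall>\<^sub>F i in F. sn_le m {(js, \<beta>)} (\<lambda>x. p i x - q x) e)"
      unfolding uniform_limit_iff
    proof (intro iffI allI impI)
      fix e :: real assume e: "e > 0" and "\<forall>e>0. \<forall>\<^sub>F i in F. \<forall>x\<in>Rm m. dist (monomial m \<beta> x * pds js (p i) x) (monomial m \<beta> x * pds js q x) < e"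
      then have "\<forall>\<^sub>F i in F. \<forall>x\<in>Rm m. dist (monomial m \<beta> x * pds js (p i) x) (monomial m \<beta> x * pds js q x) < e" by blast
      with p show "\<forall>\<^sub>F i in F. sn_le m {(js, \<beta>)} (\<lambda>x. p i x - q x) e"
      proof eventually_elim
        case (elim i)
        then show ?case unfolding sn_le_def by (auto simp: D less_imp_le)
      qed
    next
      fix e :: real assume e: "e > 0" and "\<forall>e>0. \<forall>\<^sub>F i in F. sn_le m {(js, \<beta>)} (\<lambda>x. p i x - q x) e"
      \<comment> \<open>Half of \<open>e\<close>, since \<open>sn_le\<close> gives a weak inequality
        whereas uniform convergence asks for a strict one.\<close>
      then have "\<forall>\<^sub>F i in F. sn_le m {(js, \<beta>)} (\<lambda>x. p i x - q x) (e / 2)" by simp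
      with p show "\<forall>\<^sub>F i in F. \<forall>x\<in>Rm m. dist (monomial m \<beta> x * pds js (p i) x) (monomial m \<beta> x * pds js q x) < e"
      proof eventually_elim
        case (elim i)
        show ?case
        proof
          fix x assume "x \<in> Rm m"
          then have "norm (monomial m \<beta> x * pds js (\<lambda>x. p i x - q x) x) \<le> e / 2"
            using elim(2) unfolding sn_le_def by simp
          then show "dist (monomial m \<beta> x * pds js (p i) x) (monomial m \<beta> x * pds js q x) < e"
            unfolding D[OF elim(1)] using e by linarith
        qed
      qed
    qed
    finally show ?thesis .
  qed
  have "\<forall>\<^sub>F i in F. (\<lambda>x. p i x - q x) \<in> schwartz m"
    using p by eventually_elim (rule schwartz_diff[OF _ q])
  then show ?thesis unfolding snull_def using key by blast
qed

section \<open>Calculus of curves of Schwartz functions\<close>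

lemma sderiv_schwartz: "sderiv m v v' t I \<Longrightarrow> s \<in> I \<Longrightarrow> v s \<in> schwartz m" "sderiv m v v' t I \<Longrightarrow> v' \<in> schwartz m"
  by (auto simp: sderiv_def)

lemma sderiv_add:
  assumes v: "sderiv m v v' t I" and w: "sderiv m w w' t I"
  shows "sderiv m (\<lambda>s x. v s x + w s x) (\<lambda>x. v' x + w' x) t I"
proof -
  have eq: "(a + b - (a' + b')) / d - (c + c') = ((a - a') / d - c) + ((b - b') / d - c')" for a b a' b' c c' d :: complex
    by (simp add: add_divide_distrib diff_divide_distrib)
  have "snull m (\<lambda>s x. (v s x + w s x - (v t x + w t x)) / of_real (s - t) - (v' x + w' x)) (at t within I)"
    unfolding eq by (rule snull_add) (use v w in \<open>simp_all only: sderiv_def\<close>)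
  moreover have "\<forall>s\<in>I. (\<lambda>x. v s x + w s x) \<in> schwartz m"
    using sderiv_schwartz(1)[OF v] sderiv_schwartz(1)[OF w] schwartz_add by blast
  moreover have "(\<lambda>x. v' x + w' x) \<in> schwartz m"
    by (rule schwartz_add[OF sderiv_schwartz(2)[OF v] sderiv_schwartz(2)[OF w]])
  ultimately show ?thesis unfolding sderiv_def by blast
qed

lemma sderiv_sum:
  "(\<And>k. k < (N::nat) \<Longrightarrow> sderiv m (v k) (v' k) t I) \<Longrightarrow> sderiv m (\<lambda>s x. \<Sum>k<N. v k s x) (\<lambda>x. \<Sum>k<N. v' k x) t I"
proof (induction N)
  case 0
  show ?case unfolding lessThan_0 sum.empty by (rule sderiv_const[OF schwartz_zero])
next
  case (Suc N)
  show ?case unfolding sum.lessThan_Suc by (rule sderiv_add[OF Suc.IH]) (simp_all add: Suc.prems)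
qed

lemma scaleR_inverse_eq: "z /\<^sub>R r = z / complex_of_real r"
  by (simp add: divide_inverse scaleR_conv_of_real mult.commute)

lemma sderiv_scalar:
  assumes v: "sderiv m v v' t I" and t: "t \<in> I" and c: "(c has_vector_derivative c') (at t within I)"
  shows "sderiv m (\<lambda>s x. c s * v s x) (\<lambda>x. c' * v t x + c t * v' x) t I"
proof -
  have eq: "(cs * a - ct * b) / d - (c' * b + ct * w) = cs * ((a - b) / d - w) + ((cs - ct) * w + ((cs - ct) / d - c') * b)"
    for cs ct a b d w :: complex
    by (simp add: diff_divide_distrib algebra_simps)
  have lim: "(c \<longlongrightarrow> c t) (at t within I)"
    using has_vector_derivative_continuous[OF c] by (simp add: continuous_within)
  have "\<forall>\<^sub>F s in at t within I. norm (c s) < norm (c t) + 1"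
    by (rule order_tendstoD(2)[OF tendsto_norm[OF lim]]) simp
  then have bd: "\<forall>\<^sub>F s in at t within I. norm (c s) \<le> norm (c t) + 1" by eventually_elim simp
  have lim2: "((\<lambda>s. (c s - c t) / of_real (s - t) - c') \<longlongrightarrow> 0) (at t within I)"
    using c[unfolded has_vector_derivative_iff_quotient scaleR_inverse_eq] by (rule LIM_zero)
  have N: "snull m (\<lambda>s x. (v s x - v t x) / of_real (s - t) - v' x) (at t within I)"
    using v unfolding sderiv_def by blast
  have "snull m (\<lambda>s x. (c s * v s x - c t * v t x) / of_real (s - t) - (c' * v t x + c t * v' x)) (at t within I)"
    unfolding eq
    by (rule snull_add[OF snull_scale[OF N bd] snull_add[OF snull_scale_zero[OF sderiv_schwartz(2)[OF v] LIM_zero[OF lim]]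
          snull_scale_zero[OF sderiv_schwartz(1)[OF v t] lim2]]])
  moreover have "\<forall>s\<in>I. (\<lambda>x. c s * v s x) \<in> schwartz m"
    using sderiv_schwartz(1)[OF v] schwartz_cmult by blast
  moreover have "(\<lambda>x. c' * v t x + c t * v' x) \<in> schwartz m"
    by (rule schwartz_lincomb[OF sderiv_schwartz(1)[OF v t] sderiv_schwartz(2)[OF v]])
  ultimately show ?thesis unfolding sderiv_def by blast
qed

lemma linear_op_sum:
  assumes lin: "\<And>a b f g. f \<in> schwartz m \<Longrightarrow> g \<in> schwartz m \<Longrightarrow> P (\<lambda>x. a * f x + b * g x) = (\<lambda>x. a * P f x + b * P g x :: complex)"
    and K: "finite K" and h: "\<And>k. k \<in> K \<Longrightarrow> h k \<in> schwartz m"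
  shows "P (\<lambda>x. \<Sum>k\<in>K. a k * h k x) = (\<lambda>x. \<Sum>k\<in>K. a k * P (h k) x)"
  using K h
proof (induction K)
  case empty
  show ?case using lin[OF schwartz_zero schwartz_zero, of 0 0] by simp
next
  case (insert k K)
  have "(\<lambda>x. \<Sum>k\<in>K. a k * h k x) \<in> schwartz m"
    by (intro schwartz_sum schwartz_cmult) (use insert.prems in auto)
  from lin[OF _ this, of "h k" "a k" 1] insert show ?case by simp
qed

lemma pd_pd_lincomb:
  assumes "f \<in> schwartz m" "g \<in> schwartz m" "j \<in> {1..m}"
  shows "pd j (pd j (\<lambda>x. a * f x + b * g x)) = (\<lambda>x. a * pd j (pd j f) x + b * pd j (pd j g) x)"
  using pds_lincomb[OF assms(1,2), of "[j, j]" a b] assms(3) by simp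

lemma hermites_lincomb:
  assumes "f \<in> schwartz m" "g \<in> schwartz m"
  shows "set js \<subseteq> {1..m} \<Longrightarrow> hermites js (\<lambda>x. a * f x + b * g x) = (\<lambda>x. a * hermites js f x + b * hermites js g x)"
proof (induction js)
  case Nil
  show ?case by (simp add: hermites_def fun_eq_iff)
next
  case (Cons j js)
  then have j: "j \<in> {1..m}" by simp
  have "hermite j (\<lambda>x. a * f x + b * g x) x = a * hermite j f x + b * hermite j g x" for x
    unfolding hermite_def pd_pd_lincomb[OF assms j] mx_def by (simp add: algebra_simps)
  then show ?case using Cons unfolding hermites_Cons by (simp add: algebra_simps)
qed

lemma fermi_sum: "finite K \<Longrightarrow> fermi n (\<lambda>A. \<Sum>k\<in>K. a k * F k A) A = (\<Sum>k\<in>K. a k * fermi n (F k) A)"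
proof (induction K rule: finite_induct)
  case empty
  show ?case using fun_cong[OF fermi_lin[of n 0 "\<lambda>A. 0" 0 "\<lambda>A. 0"], of A] by simp
next
  case (insert k K)
  have "fermi n (\<lambda>A. a k * F k A + 1 * (\<Sum>k\<in>K. a k * F k A)) A = a k * fermi n (F k) A + 1 * fermi n (\<lambda>A. \<Sum>k\<in>K. a k * F k A) A"
    unfolding fermi_lin ..
  then show ?case using insert by simp
qed

lemma fermi_matrix:
  assumes "F \<in> grassmann (2 * n)"
  shows "fermi n F A = (\<Sum>S\<in>Pow {1..2*n}. fermi n (gsing S) A * F S)"
proof -
  have "fermi n F A = fermi n (\<lambda>A. \<Sum>S\<in>Pow {1..2*n}. F S * gsing S A) A"
    by (subst grassmann_expand[OF assms, abs_def]) (rule refl)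
  also have "\<dots> = (\<Sum>S\<in>Pow {1..2*n}. F S * fermi n (gsing S) A)" by (rule fermi_sum) simp
  finally show ?thesis by (simp add: mult.commute)
qed

section \<open>The Cauchy problem for the components\<close>

text \<open>A component of the solution after a linear functional, which turns the algebra
  coefficients into the numbers \<open>b k\<close>. The commuting and anti-commuting generators act
  on different tensor factors, so the product of the two flows solves the joint problem.\<close>

definition evol :: "nat \<Rightarrow> nat list \<Rightarrow> nat \<Rightarrow> (nat \<Rightarrow> complex) \<Rightarrow> (nat \<Rightarrow> (nat \<Rightarrow> real) \<Rightarrow> complex) \<Rightarrow> (nat \<Rightarrow> real \<Rightarrow> gr) \<Rightarrow> nat set \<Rightarrow> real \<Rightarrow> (nat \<Rightarrow> real) \<Rightarrow> complex"
  where "evol m js N b h g A s x = (\<Sum>k<N. (b k * g k s A) * frfts m js s (h k) x)"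

text \<open>The generator on components. The rate \<kappa> = a \<pi> / 2 is chosen so that time 1
  corresponds to the angle \<alpha>, which turns \<i> a \<pi> / 4 into \<i> \<kappa> / 2.\<close>

definition gener :: "nat list \<Rightarrow> nat \<Rightarrow> real \<Rightarrow> (nat set \<Rightarrow> (nat \<Rightarrow> real) \<Rightarrow> complex) \<Rightarrow> nat set \<Rightarrow> (nat \<Rightarrow> real) \<Rightarrow> complex"
  where "gener js n \<kappa> v A x = \<i> * of_real \<kappa> / 2 * (hermites js (v A) x + fermi n (\<lambda>A. v A x) A)"

lemma sderiv_evol:
  assumes js: "set js \<subseteq> {1..m}" and h: "\<And>k. k < N \<Longrightarrow> h k \<in> schwartz m" and g: "\<And>k. k < N \<Longrightarrow> gflow n (L k) (g k)"
    and I: "\<And>s. s \<in> I \<Longrightarrow> \<kappa> * s \<in> angles" and t: "t \<in> I"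
  shows "sderiv m (\<lambda>s. evol m js N b h g A (\<kappa> * s)) (gener js n \<kappa> (\<lambda>A. evol m js N b h g A (\<kappa> * t)) A) t I"
proof -
  let ?B = "\<lambda>k s. frfts m js (\<kappa> * s) (h k)"
  have B: "sderiv m (?B k) (\<lambda>x. of_real \<kappa> * (\<i> / 2 * hermites js (?B k t) x)) t I" if "k < N" for k
    by (rule sderiv_reparam[OF sderiv_frfts[OF h[OF that] I[OF t] js] I t])
  have C: "((\<lambda>s. b k * g k (\<kappa> * s) A) has_vector_derivative b k * (of_real \<kappa> * (\<i> / 2 * fermi n (g k (\<kappa> * t)) A))) (at t within I)"
    if "k < N" for k
  proof -
    have "((\<lambda>s. g k s A) has_vector_derivative \<i> / 2 * fermi n (g k (\<kappa> * t)) A) (at (\<kappa> * t))"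
      using g[OF that] unfolding gflow_def by blast
    then have "((\<lambda>s. g k s A) has_vector_derivative \<i> / 2 * fermi n (g k (\<kappa> * t)) A) (at (\<kappa> * t) within (\<lambda>s. \<kappa> * s) ` I)"
      by (rule has_vector_derivative_at_within)
    moreover have "((\<lambda>s. \<kappa> * s) has_vector_derivative \<kappa>) (at t within I)"
      by (auto intro!: derivative_eq_intros simp: has_real_derivative_iff_has_vector_derivative[symmetric])
    ultimately have "((\<lambda>s. g k s A) \<circ> (\<lambda>s. \<kappa> * s) has_vector_derivative \<kappa> *\<^sub>R (\<i> / 2 * fermi n (g k (\<kappa> * t)) A)) (at t within I)"
      by (intro vector_diff_chain_within)
    then have "((\<lambda>s. g k (\<kappa> * s) A) has_vector_derivative of_real \<kappa> * (\<i> / 2 * fermi n (g k (\<kappa> * t)) A)) (at t within I)"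
      by (simp only: comp_def scaleR_conv_of_real)
    then show ?thesis by (rule has_vector_derivative_mult_right)
  qed
  have "sderiv m (\<lambda>s x. \<Sum>k<N. (b k * g k (\<kappa> * s) A) * ?B k s x)
    (\<lambda>x. \<Sum>k<N. b k * (of_real \<kappa> * (\<i> / 2 * fermi n (g k (\<kappa> * t)) A)) * ?B k t x
       + (b k * g k (\<kappa> * t) A) * (of_real \<kappa> * (\<i> / 2 * hermites js (?B k t) x))) t I"
    by (rule sderiv_sum, rule sderiv_scalar[OF B t C])
  moreover have "(\<Sum>k<N. b k * (of_real \<kappa> * (\<i> / 2 * fermi n (g k (\<kappa> * t)) A)) * ?B k t x
       + (b k * g k (\<kappa> * t) A) * (of_real \<kappa> * (\<i> / 2 * hermites js (?B k t) x)))
     = gener js n \<kappa> (\<lambda>A. evol m js N b h g A (\<kappa> * t)) A x" for x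
  proof -
    have 1: "hermites js (\<lambda>x. \<Sum>k<N. (b k * g k (\<kappa> * t) A) * ?B k t x) = (\<lambda>x. \<Sum>k<N. (b k * g k (\<kappa> * t) A) * hermites js (?B k t) x)"
      by (rule linear_op_sum[where m=m]) (use hermites_lincomb js frfts_schwartz h I t in auto)
    have "(\<lambda>A. \<Sum>k<N. b k * g k (\<kappa> * t) A * ?B k t x) = (\<lambda>A. \<Sum>k<N. (b k * ?B k t x) * g k (\<kappa> * t) A)"
      by (simp only: mult_ac)
    then have 2: "fermi n (\<lambda>A. \<Sum>k<N. b k * g k (\<kappa> * t) A * ?B k t x) A = (\<Sum>k<N. (b k * ?B k t x) * fermi n (g k (\<kappa> * t)) A)"
      by (simp only: fermi_sum finite_lessThan)
    show ?thesis unfolding gener_def evol_def 1 2 by (simp add: sum.distrib sum_distrib_left algebra_simps)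
  qed
  ultimately show ?thesis unfolding evol_def[abs_def, symmetric] by (simp only: evol_def[abs_def])
qed

text \<open>Gronwall's argument: the energy \<open>E\<close> grows at most at the rate
  \<open>M\<close>, so \<open>E t * exp (- M * t)\<close> is nonincreasing and starts at 0.\<close>

lemma linear_ode_zero:
  fixes d :: "'k \<Rightarrow> real \<Rightarrow> complex"
  assumes K: "finite K"
    and d: "\<And>k t. k \<in> K \<Longrightarrow> t \<in> {0..1} \<Longrightarrow> (d k has_vector_derivative (\<Sum>l\<in>K. \<kappa> k l * d l t)) (at t within {0..1})"
    and z: "\<And>k. k \<in> K \<Longrightarrow> d k 0 = 0"
    and t: "t \<in> {0..1}" and k: "k \<in> K"
  shows "d k t = 0"
proof -
  define C where "C = (\<Sum>k\<in>K. \<Sum>l\<in>K. norm (\<kappa> k l))"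
  \<comment> \<open>From 2 |d k| |d l| <= |d k|^2 + |d l|^2: the double sum over \<open>K\<close>
    contains the energy 2 \<open>card K\<close> times.\<close>
  define M where "M = 2 * C * card K"
  define E where "E t = (\<Sum>k\<in>K. d k t \<bullet> d k t)" for t
  define E' where "E' t = (\<Sum>k\<in>K. d k t \<bullet> (\<Sum>l\<in>K. \<kappa> k l * d l t) + (\<Sum>l\<in>K. \<kappa> k l * d l t) \<bullet> d k t)" for t
  have C: "norm (\<kappa> k l) \<le> C" if "k \<in> K" "l \<in> K" for k l
  proof -
    have "norm (\<kappa> k l) \<le> (\<Sum>l\<in>K. norm (\<kappa> k l))" by (rule member_le_sum) (use that K in auto)
    also have "\<dots> \<le> C" unfolding C_def by (rule member_le_sum) (use that K in \<open>auto intro: sum_nonneg\<close>)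
    finally show ?thesis .
  qed
  have E: "(E has_vector_derivative E' t) (at t within {0..1})" if "t \<in> {0..1}" for t
    unfolding E_def[abs_def] E'_def
    by (intro has_vector_derivative_sum bounded_bilinear.has_vector_derivative[OF bounded_bilinear_inner] d that)
  have bound: "E' t \<le> M * E t" for t
  proof -
    have "E' t \<le> (\<Sum>k\<in>K. \<Sum>l\<in>K. C * (d k t \<bullet> d k t + d l t \<bullet> d l t))"
      unfolding E'_def
    proof (rule sum_mono)
      fix k assume k: "k \<in> K"
      have "d k t \<bullet> (\<Sum>l\<in>K. \<kappa> k l * d l t) + (\<Sum>l\<in>K. \<kappa> k l * d l t) \<bullet> d k t = (\<Sum>l\<in>K. 2 * (d k t \<bullet> (\<kappa> k l * d l t)))"
        by (simp add: inner_sum_right inner_sum_left inner_commute sum.distrib[symmetric])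
      also have "\<dots> \<le> (\<Sum>l\<in>K. C * (d k t \<bullet> d k t + d l t \<bullet> d l t))"
      proof (rule sum_mono)
        fix l assume l: "l \<in> K"
        have "d k t \<bullet> (\<kappa> k l * d l t) \<le> norm (d k t) * (norm (\<kappa> k l) * norm (d l t))"
          using norm_cauchy_schwarz[of "d k t" "\<kappa> k l * d l t"] by (simp only: norm_mult)
        also have "\<dots> = norm (\<kappa> k l) * (norm (d k t) * norm (d l t))" by simp
        also have "\<dots> \<le> C * (norm (d k t) * norm (d l t))"
          by (rule mult_right_mono[OF C[OF k l]]) simp
        finally have 1: "2 * (d k t \<bullet> (\<kappa> k l * d l t)) \<le> C * (2 * norm (d k t) * norm (d l t))" by simp
        have "0 \<le> C" using order_trans[OF norm_ge_zero C[OF k l]] .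
        then have "C * (2 * norm (d k t) * norm (d l t)) \<le> C * ((norm (d k t))\<^sup>2 + (norm (d l t))\<^sup>2)"
          by (rule mult_left_mono[OF sum_squares_bound])
        with 1 show "2 * (d k t \<bullet> (\<kappa> k l * d l t)) \<le> C * (d k t \<bullet> d k t + d l t \<bullet> d l t)"
          by (simp add: power2_norm_eq_inner)
      qed
      finally show "d k t \<bullet> (\<Sum>l\<in>K. \<kappa> k l * d l t) + (\<Sum>l\<in>K. \<kappa> k l * d l t) \<bullet> d k t \<le> (\<Sum>l\<in>K. C * (d k t \<bullet> d k t + d l t \<bullet> d l t))" .
    qed
    also have "\<dots> = C * (\<Sum>k\<in>K. \<Sum>l\<in>K. d k t \<bullet> d k t + d l t \<bullet> d l t)" by (simp only: sum_distrib_left)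
    also have "(\<Sum>k\<in>K. \<Sum>l\<in>K. d k t \<bullet> d k t + d l t \<bullet> d l t) = 2 * card K * E t"
      unfolding E_def by (simp add: sum.distrib sum_distrib_left[symmetric])
    also have "C * (2 * card K * E t) = M * E t" by (simp add: M_def)
    finally show ?thesis .
  qed
  define G where "G t = E t * exp (- M * t)" for t
  have ex: "((\<lambda>t. exp (- M * t)) has_vector_derivative - M * exp (- M * t)) (at t within {0..1})" for t
    unfolding has_real_derivative_iff_has_vector_derivative[symmetric] by (auto intro!: derivative_eq_intros)
  have G: "(G has_vector_derivative (E' t - M * E t) * exp (- M * t)) (at t within {0..1})" if "t \<in> {0..1}" for t
  proof -
    have "(G has_vector_derivative E t * (- M * exp (- M * t)) + E' t * exp (- M * t)) (at t within {0..1})"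
      unfolding G_def[abs_def] by (rule has_vector_derivative_mult[OF E[OF that] ex])
    then show ?thesis by (simp add: algebra_simps)
  qed
  have "G t \<le> G 0"
  proof (rule DERIV_nonpos_imp_decreasing_open[of 0 t G])
    show "0 \<le> t" using t by simp
    show "\<exists>y. DERIV G s :> y \<and> y \<le> 0" if "0 < s" "s < t" for s
    proof (intro exI conjI)
      have "at s within {0..1} = at s" by (rule at_within_interior) (use that t in auto)
      then show "DERIV G s :> (E' s - M * E s) * exp (- M * s)"
        using G[of s] that t by (simp add: has_real_derivative_iff_has_vector_derivative)
      show "(E' s - M * E s) * exp (- M * s) \<le> 0" using bound[of s] by (simp add: mult_nonpos_nonneg)
    qed
    show "continuous_on {0..t} G"
    proof (rule continuous_on_subset[of "{0..1}"])
      show "continuous_on {0..1} G"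
        unfolding continuous_on_eq_continuous_within using has_vector_derivative_continuous[OF G] by blast
    qed (use t in auto)
  qed
  also have "G 0 = 0" by (simp add: G_def E_def z)
  finally have "E t \<le> 0" by (simp add: G_def mult_le_0_iff not_le[of _ "0::real"] not_less)
  moreover have "d k t \<bullet> d k t \<le> E t" unfolding E_def by (rule member_le_sum) (use k K in auto)
  ultimately show ?thesis using inner_ge_zero[of "d k t"] inner_eq_zero_iff[of "d k t"] by linarith
qed

text \<open>The transform at angle -\<kappa> t contributes the term with \<open>hermites\<close>
  with the opposite sign; it commutes with the transform and cancels that of \<open>gener\<close>.
  The operator \<open>fermi\<close> acts on the index \<open>A\<close> alone and passes through as a
  constant matrix.\<close>

lemma transport_derivative:
  assumes js: "set js \<subseteq> {1..m}" and ang: "\<And>t. t \<in> {0..1} \<Longrightarrow> \<kappa> * t \<in> angles"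
    and v: "\<And>A t. t \<in> {0..1} \<Longrightarrow> sderiv m (v A) (gener js n \<kappa> (\<lambda>A. v A t) A) t {0..1}"
    and gr: "\<And>t x. t \<in> {0..1} \<Longrightarrow> (\<lambda>A. v A t x) \<in> grassmann (2 * n)"
    and t: "t \<in> {0..1}" and x: "x \<in> Rm m"
  shows "((\<lambda>t. frfts m js (- \<kappa> * t) (v A t) x) has_vector_derivative
    (\<Sum>S\<in>Pow {1..2*n}. (\<i> * of_real \<kappa> / 2 * fermi n (gsing S) A) * frfts m js (- \<kappa> * t) (v S t) x)) (at t within {0..1})"
proof -
  have ang': "- \<kappa> * s \<in> angles" if "s \<in> {0..1}" for s using ang[OF that] by (auto simp: angles_def)
  let ?W = "\<lambda>s. frfts m js (- \<kappa> * s)"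
  have vS: "v S t \<in> schwartz m" for S by (rule sderiv_schwartz(1)[OF v[OF t] t])
  have W: "sderiv m (\<lambda>s. ?W s f) (\<lambda>x. of_real (- \<kappa>) * (\<i> / 2 * hermites js (?W t f) x)) t {0..1}" if "f \<in> schwartz m" for f
    by (rule sderiv_reparam[OF sderiv_frfts[OF that ang'[OF t] js] ang' t])
  have e: "equi m (?W ` {0..1})"
  proof (rule equi_subset[OF equi_frfts[OF js]])
    fix X assume "X \<in> ?W ` {0..1}"
    then obtain s where s: "X = ?W s" "s \<in> {0..1}" by (rule imageE)
    have "X \<in> frfts m js ` angles" unfolding s(1) by (rule imageI[OF ang'[OF s(2)]])
    then show "\<exists>V\<in>frfts m js ` angles. \<forall>f\<in>schwartz m. X f = V f" by (intro bexI[of _ X]) (rule ballI, rule refl)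
  qed
  have D: "sderiv m (\<lambda>s. ?W s (v A s)) (\<lambda>x. ?W t (gener js n \<kappa> (\<lambda>A. v A t) A) x + of_real (- \<kappa>) * (\<i> / 2 * hermites js (?W t (v A t)) x)) t {0..1}"
    by (rule sderiv_chain[where W="?W" and W'="\<lambda>f x. of_real (- \<kappa>) * (\<i> / 2 * hermites js (?W t f) x)", OF v[OF t] t frfts_lincomb[OF js _ _ ang'] e W])
  let ?c = "\<i> * of_real \<kappa> / 2"
  let ?s = "\<lambda>x. \<Sum>S\<in>Pow {1..2*n}. (?c * fermi n (gsing S) A) * v S t x"
  have "gener js n \<kappa> (\<lambda>A. v A t) A = (\<lambda>x. ?c * hermites js (v A t) x + 1 * ?s x)"
    unfolding gener_def fermi_matrix[OF gr[OF t]] by (simp add: distrib_left sum_distrib_left mult.assoc)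
  moreover have "?s \<in> schwartz m" by (intro schwartz_sum schwartz_cmult vS)
  ultimately have "?W t (gener js n \<kappa> (\<lambda>A. v A t) A) = (\<lambda>x. ?c * ?W t (hermites js (v A t)) x + 1 * ?W t ?s x)"
    by (simp only: frfts_lincomb[OF js hermites_schwartz[OF js vS] _ ang'[OF t]])
  moreover have "?W t ?s = (\<lambda>x. \<Sum>S\<in>Pow {1..2*n}. (?c * fermi n (gsing S) A) * ?W t (v S t) x)"
    by (rule linear_op_sum[where m=m, OF frfts_lincomb[OF js _ _ ang'[OF t]]]) (assumption, assumption, simp, rule vS)
  moreover have "?W t (hermites js (v A t)) = hermites js (?W t (v A t))"
    by (rule hermites_frfts[OF vS js ang'[OF t] js, symmetric])
  ultimately have "?W t (gener js n \<kappa> (\<lambda>A. v A t) A) x + of_real (- \<kappa>) * (\<i> / 2 * hermites js (?W t (v A t)) x)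
     = (\<Sum>S\<in>Pow {1..2*n}. (?c * fermi n (gsing S) A) * ?W t (v S t) x)"
    by simp
  with sderiv_pointwise[OF D x] show ?thesis by (simp only:)
qed

lemma transport_unique:
  assumes js: "set js \<subseteq> {1..m}" and ang: "\<And>t. t \<in> {0..1} \<Longrightarrow> \<kappa> * t \<in> angles"
    and v: "\<And>A t. t \<in> {0..1} \<Longrightarrow> sderiv m (v A) (gener js n \<kappa> (\<lambda>A. v A t) A) t {0..1}"
    and gv: "\<And>t x. t \<in> {0..1} \<Longrightarrow> (\<lambda>A. v A t x) \<in> grassmann (2 * n)"
    and w: "\<And>A t. t \<in> {0..1} \<Longrightarrow> sderiv m (w A) (gener js n \<kappa> (\<lambda>A. w A t) A) t {0..1}"
    and gw: "\<And>t x. t \<in> {0..1} \<Longrightarrow> (\<lambda>A. w A t x) \<in> grassmann (2 * n)"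
    and init: "\<And>A. v A 0 = w A 0" and t: "t \<in> {0..1}"
  shows "v A t = w A t"
proof (cases "A \<subseteq> {1..2*n}")
  case False
  then have "v A t x = 0 \<and> w A t x = 0" for x using gv[OF t, of x] gw[OF t, of x] by (simp add: grassmann_def)
  then show ?thesis by (simp add: fun_eq_iff)
next
  case A: True
  let ?W = "\<lambda>t. frfts m js (- \<kappa> * t)"
  have ang': "- \<kappa> * t \<in> angles" using ang[OF t] by (auto simp: angles_def)
  have S: "v A t \<in> schwartz m" "w A t \<in> schwartz m" using sderiv_schwartz(1)[OF v[OF t] t] sderiv_schwartz(1)[OF w[OF t] t] by blast+
  have "?W t (v A t) x = ?W t (w A t) x" for x
  proof (cases "x \<in> Rm m")
    case x: True
    define d where "d S t = ?W t (v S t) x - ?W t (w S t) x" for S t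
    have "d A t = 0"
    proof (rule linear_ode_zero[of "Pow {1..2*n}" d "\<lambda>A S. \<i> * of_real \<kappa> / 2 * fermi n (gsing S) A"])
      fix A t assume t: "t \<in> {0..1::real}"
      have "(d A has_vector_derivative
         (\<Sum>S\<in>Pow {1..2*n}. (\<i> * of_real \<kappa> / 2 * fermi n (gsing S) A) * ?W t (v S t) x) -
         (\<Sum>S\<in>Pow {1..2*n}. (\<i> * of_real \<kappa> / 2 * fermi n (gsing S) A) * ?W t (w S t) x)) (at t within {0..1})"
        unfolding d_def[abs_def]
        by (rule has_vector_derivative_diff[OF transport_derivative[OF js ang v gv t x] transport_derivative[OF js ang w gw t x]])
      then show "(d A has_vector_derivative (\<Sum>S\<in>Pow {1..2*n}. \<i> * of_real \<kappa> / 2 * fermi n (gsing S) A * d S t)) (at t within {0..1})"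
        by (simp only: d_def right_diff_distrib sum_subtractf)
    next
      show "d S 0 = 0" for S unfolding d_def init by (rule diff_self)
      show "finite (Pow {1..2*n})" "A \<in> Pow {1..2*n}" using A by simp_all
      show "t \<in> {0..1}" by (rule t)
    qed
    then show ?thesis by (simp add: d_def)
  next
    case False
    show ?thesis using schwartz_outside[OF frfts_schwartz[OF js S(1) ang'] False] schwartz_outside[OF frfts_schwartz[OF js S(2) ang'] False] by simp
  qed
  then have eq: "?W t (v A t) = ?W t (w A t)" by (rule ext)
  have n: "- \<kappa> * t = - (\<kappa> * t)" by simp
  have "frfts m js (\<kappa> * t) (frfts m js (- (\<kappa> * t)) (v A t)) = frfts m js (\<kappa> * t) (frfts m js (- (\<kappa> * t)) (w A t))"
    unfolding eq[unfolded n] ..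
  then show ?thesis unfolding frfts_inverse[OF js S(1) ang[OF t]] frfts_inverse[OF js S(2) ang[OF t]] .
qed

section \<open>Linear functionals of the Clifford--Weyl algebra\<close>

lemma
  assumes "cw_functional \<phi>"
  shows functional_cscale: "\<phi> (cscale c x) = c * \<phi> x"
    and functional_zero: "\<phi> 0 = 0" and functional_diff: "\<phi> (x - y) = \<phi> x - \<phi> y" and functional_minus: "\<phi> (- x) = - \<phi> x"
    and functional_sum: "\<phi> (\<Sum>k\<in>K. F k) = (\<Sum>k\<in>K. \<phi> (F k))"
proof -
  interpret Vector_Spaces.linear cscale "(*)" \<phi> using assms unfolding cw_functional_def .
  show "\<phi> (cscale c x) = c * \<phi> x" by (rule scale)
  show "\<phi> 0 = 0" by (rule zero)
  show "\<phi> (x - y) = \<phi> x - \<phi> y" by (rule diff)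
  show "\<phi> (- x) = - \<phi> x" by (rule neg)
  show "\<phi> (\<Sum>k\<in>K. F k) = (\<Sum>k\<in>K. \<phi> (F k))" by (rule sum)
qed

text \<open>A nonzero difference is an independent vector, so the functional with value 1 on it
  extends linearly to the whole algebra.\<close>

lemma functionals_separate:
  fixes x y :: "('m::len0, 'n::len0) cw"
  assumes "\<And>\<phi>. cw_functional \<phi> \<Longrightarrow> \<phi> x = \<phi> y"
  shows "x = y"
proof (rule ccontr)
  assume ne: "x \<noteq> y"
  interpret v1: vector_space "cscale :: complex \<Rightarrow> ('m, 'n) cw \<Rightarrow> _" by (rule vector_space_cw)
  interpret v2: vector_space "(*) :: complex \<Rightarrow> complex \<Rightarrow> _" by unfold_locales (simp_all add: algebra_simps)
  interpret vector_space_pair "cscale :: complex \<Rightarrow> ('m, 'n) cw \<Rightarrow> _" "(*) :: complex \<Rightarrow> complex \<Rightarrow> _" ..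
  have "v1.independent {x - y}" using ne by (simp add: v1.dependent_single)
  from linear_independent_extend[OF this, of "\<lambda>_. 1"]
  obtain \<phi> where \<phi>: "Vector_Spaces.linear cscale (*) \<phi>" "\<phi> (x - y) = 1" by auto
  then have f: "cw_functional \<phi>" by (simp add: cw_functional_def)
  show False using functional_diff[OF f, of x y] assms[OF f] \<phi>(2) by simp
qed

lemma functional_sign: "cw_functional \<phi> \<Longrightarrow> \<phi> ((- 1) ^ k * x) = (- 1) ^ k * \<phi> x"
  by (induction k) (simp_all add: functional_minus)

lemma cscale_one_mult: "cscale c 1 * x = cscale c x"
  by transfer (simp add: cw_rel_def cw_ideal.zero)

lemma functional_gderiv:
  "cw_functional \<phi> \<Longrightarrow> \<phi> (gderiv j F A) = gderiv j (\<lambda>A. \<phi> (F A)) A"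
  by (simp add: gderiv_def functional_sign functional_zero)

lemma functional_fold_gderiv:
  "cw_functional \<phi> \<Longrightarrow> \<phi> (fold gderiv xs F A) = fold gderiv xs (\<lambda>A. \<phi> (F A)) A"
proof (induction xs arbitrary: F)
  case (Cons x xs)
  have "(\<lambda>A. \<phi> (gderiv x F A)) = gderiv x (\<lambda>A. \<phi> (F A))"
    using Cons.prems by (simp add: functional_gderiv fun_eq_iff)
  then show ?case using Cons by simp
qed simp

lemma functional_gmult:
  assumes "cw_functional \<phi>" shows "\<phi> (gmult (gembed P) F A) = gmult P (\<lambda>A. \<phi> (F A)) A"
  unfolding gmult_def functional_sum[OF assms]
proof (rule sum.cong[OF refl])
  fix B
  let ?s = "(- 1) ^ card {(i, j). i \<in> B \<and> j \<in> A - B \<and> j < i}"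
  have "?s * gembed P B * F (A - B) = ?s * cscale (P B) (F (A - B))"
    by (simp only: gembed_def mult.assoc cscale_one_mult)
  then show "\<phi> (?s * gembed P B * F (A - B)) = ?s * P B * \<phi> (F (A - B))"
    by (simp only: functional_sign[OF assms] functional_cscale[OF assms] mult.assoc)
qed

lemma functional_comb:
  "cw_functional \<phi> \<Longrightarrow> \<phi> (\<Sum>k\<in>K. cscale (a k) (c k)) = (\<Sum>k\<in>K. a k * \<phi> (c k))"
  by (simp add: functional_sum functional_cscale)

text \<open>The representation of \<open>F\<close> is assumed on \<open>Rm\<close> only, so the
  result applies again to \<open>cw_pd j F\<close>, which is itself known only there. Separation of
  points makes the weak derivative unique.\<close>

lemma cw_pd_comb:
  fixes F :: "('m::len0, 'n::len0) superfun"
  assumes h: "\<And>k. k < (N::nat) \<Longrightarrow> h k \<in> schwartz LENGTH('m)"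
    and F: "\<And>x A. x \<in> Rm LENGTH('m) \<Longrightarrow> F x A = (\<Sum>k<N. cscale (h k x * l k A) (c k))"
    and j: "j \<in> {1..LENGTH('m)}" and x: "x \<in> Rm LENGTH('m)"
  shows "cw_pd j F x A = (\<Sum>k<N. cscale (pd j (h k) x * l k A) (c k))"
  unfolding cw_pd_def
proof (rule the_equality)
  let ?D = "\<Sum>k<N. cscale (pd j (h k) x * l k A) (c k)"
  have D: "((\<lambda>t. \<phi> (F (x(j := t)) A)) has_vector_derivative \<phi> ?D) (at (x j))" if \<phi>: "cw_functional \<phi>" for \<phi>
  proof -
    have Fx: "\<phi> (F (x(j := t)) A) = (\<Sum>k<N. h k (x(j := t)) * (l k A * \<phi> (c k)))" for t
    proof -
      have "x(j := t) \<in> Rm LENGTH('m)" using j x by simp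
      then show ?thesis by (simp only: F functional_comb[OF \<phi>] mult.assoc)
    qed
    have D': "\<phi> ?D = (\<Sum>k<N. pd j (h k) x * (l k A * \<phi> (c k)))"
      by (simp only: functional_comb[OF \<phi>] mult.assoc)
    have hd: "((\<lambda>t. h k (x(j := t))) has_vector_derivative pd j (h k) x) (at (x j))" if "k < N" for k
      using schwartz_deriv[OF h[OF that] j x, of "x j"] by simp
    show ?thesis unfolding Fx D'
      by (intro has_vector_derivative_sum has_vector_derivative_mult_left hd) simp
  qed
  then show "\<forall>\<phi>. cw_functional \<phi> \<longrightarrow> ((\<lambda>t. \<phi> (F (x(j := t)) A)) has_vector_derivative \<phi> ?D) (at (x j))" by blast
  fix d assume d: "\<forall>\<phi>. cw_functional \<phi> \<longrightarrow> ((\<lambda>t. \<phi> (F (x(j := t)) A)) has_vector_derivative \<phi> d) (at (x j))"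
  show "d = ?D"
    by (rule functionals_separate) (use d D vector_derivative_unique_at in blast)
qed

lemma gmult_gvar_gvar:
  fixes G :: gr
  assumes A: "finite A" shows "gmult (gmult (gvar i) (gvar j)) G A = mop i (mop j G) A"
proof -
  have "gmult (gmult (gvar i) (gvar j)) G A = gmult (mop i (gvar j)) G A"
    unfolding gmult_def[of _ G] by (rule sum.cong) (use A in \<open>auto simp: gmult_gvar dest: finite_subset\<close>)
  also have "\<dots> = mop i (gmult (gvar j) G) A" by (simp only: gmult_mop)
  also have "\<dots> = mop i (mop j G) A" using A by (simp add: mop_def[of i] gmult_gvar)
  finally show ?thesis .
qed

text \<open>The shift \<open>s\<close> is 0 for the x generators and \<open>2 * n\<close> for the y
  generators.\<close>

lemma gmult_super_square:
  fixes G :: gr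
  assumes A: "finite A"
  shows "gmult (super_square m n x (\<lambda>j. gvar (s + j))) G A
    = (\<Sum>j=1..n. mop (s + (2*j-1)) (mop (s + 2*j) G) A) - of_real (\<Sum>j=1..m. (x j)\<^sup>2) * G A"
proof -
  have "super_square m n x (\<lambda>j. gvar (s + j))
    = (\<lambda>A. 1 * (\<Sum>j=1..n. gmult (gvar (s + (2*j-1))) (gvar (s + 2*j)) A) + (-1) * gconst (of_real (\<Sum>j=1..m. (x j)\<^sup>2)) A)"
    by (simp add: super_square_def fun_eq_iff)
  then show ?thesis
    by (simp only: gmult_add gmult_sum gmult_gconst[OF A] gmult_gvar_gvar[OF A]) simp
qed

lemma fermi_infinite:
  assumes "F \<in> grassmann (2 * n)" "infinite A"
  shows "mop i (mop j F) A = 0" "gderiv i (gderiv j F) A = (0::complex)" "F A = 0"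
proof -
  have "F B = 0" if "infinite B" for B using assms(1) that by (auto simp: grassmann_def dest: finite_subset)
  with assms(2) show "mop i (mop j F) A = 0" "gderiv i (gderiv j F) A = (0::complex)" "F A = 0"
    by (simp_all add: mop_def dop_eq)
qed

lemma sum_list_upt: "(\<Sum>j\<leftarrow>[1..<n+1]. f j) = (\<Sum>j=1..n. f j)"
proof -
  have "set [1..<n+1] = {1..n}" by auto
  then show ?thesis by (simp only: sum_list_distinct_conv_sum_set[OF distinct_upt])
qed

text \<open>The super-dimension is distributed: its m completes the Hermite operators, its -2n the
  operator \<open>fermi\<close>. The variables x enter as x_j^2 with a plus sign, because x^2
  contains their squares negatively.\<close>

lemma frac_generator_functional:
  fixes F :: "('m::len0, 'n::len0) superfun"
  assumes h: "\<And>k. k < (N::nat) \<Longrightarrow> h k \<in> schwartz LENGTH('m)" and l: "\<And>k. k < N \<Longrightarrow> l k \<in> grassmann (2 * LENGTH('n))"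
    and F: "F = (\<lambda>x A. \<Sum>k<N. cscale (h k x * l k A) (c k))"
    and x: "x \<in> Rm LENGTH('m)" and \<phi>: "cw_functional \<phi>" and js: "js = [1..<LENGTH('m)+1]"
  shows "\<phi> (frac_generator a F x A) = \<i> * of_real (a * pi / 2) / 2 *
    (hermites js (\<lambda>x. \<phi> (F x A)) x + fermi LENGTH('n) (\<lambda>A. \<phi> (F x A)) A)"
proof -
  let ?m = "LENGTH('m)" and ?n = "LENGTH('n)"
  define G where "G = (\<lambda>A. \<phi> (F x A))"
  define f where "f = (\<lambda>x. \<phi> (F x A))"
  have G: "G \<in> grassmann (2 * ?n)"
  proof -
    have "G B = 0" if "\<not> B \<subseteq> {1..2 * ?n}" for B
      using l that unfolding G_def F functional_comb[OF \<phi>] by (intro sum.neutral) (simp add: grassmann_def)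
    then show ?thesis by (simp add: grassmann_def)
  qed
  have pp: "\<phi> (cw_pd j (cw_pd j F) x A) = pd j (pd j f) x" if j: "j \<in> {1..?m}" for j
  proof -
    have 1: "cw_pd j F y B = (\<Sum>k<N. cscale (pd j (h k) y * l k B) (c k))" if "y \<in> Rm ?m" for y B
      by (rule cw_pd_comb[OF h _ j that]) (simp_all add: F)
    have 2: "cw_pd j (cw_pd j F) x A = (\<Sum>k<N. cscale (pd j (pd j (h k)) x * l k A) (c k))"
      by (rule cw_pd_comb[OF pd_schwartz[OF h j] 1 j x])
    have f: "f = (\<lambda>x. \<Sum>k\<in>{..<N}. (l k A * \<phi> (c k)) * h k x)"
      unfolding f_def F functional_comb[OF \<phi>] by (simp only: mult_ac)
    have "pd j (pd j f) = (\<lambda>x. \<Sum>k\<in>{..<N}. (l k A * \<phi> (c k)) * pd j (pd j (h k)) x)"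
      unfolding f by (rule linear_op_sum[where m="?m" and P="\<lambda>f. pd j (pd j f)"]) (use h j pd_pd_lincomb in auto)
    then show ?thesis unfolding 2 functional_comb[OF \<phi>] by (simp only: mult_ac)
  qed
  have L: "\<phi> (super_laplace F x A) = 4 * (\<Sum>j=1..?n. gderiv (2*j-1) (gderiv (2*j) G) A) - (\<Sum>j=1..?m. pd j (pd j f) x)"
  proof -
    have "(\<lambda>A. \<phi> (gderiv (2*j) (F x) A)) = gderiv (2*j) G" for j
      unfolding functional_gderiv[OF \<phi>] G_def ..
    then show ?thesis
      by (simp add: super_laplace_def functional_diff[OF \<phi>] functional_cscale[OF \<phi>] functional_sum[OF \<phi>] functional_gderiv[OF \<phi>] pp)
  qed
  have X: "gmult (super_square ?m ?n x xf) G A = (\<Sum>j=1..?n. mop (2*j-1) (mop (2*j) G) A) - of_real (\<Sum>j=1..?m. (x j)\<^sup>2) * G A"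
  proof (cases "finite A")
    case True
    then show ?thesis using gmult_super_square[OF True, of ?m ?n x 0 G] by (simp add: xf_def[abs_def])
  next
    case False
    then show ?thesis using fermi_infinite[OF G False] by (simp add: gmult_infinite)
  qed
  have H: "hermites js f x = of_real (\<Sum>j=1..?m. (x j)\<^sup>2) * G A - (\<Sum>j=1..?m. pd j (pd j f) x) - of_nat ?m * G A"
  proof -
    have "hermites js f x = (\<Sum>j=1..?m. hermite j f x)"
      unfolding hermites_def js by (rule sum_list_upt)
    moreover have "f x = G A" by (simp add: f_def G_def)
    ultimately show ?thesis
      by (simp add: hermite_def mx_def sum.distrib sum_subtractf sum_distrib_right power2_eq_square mult.assoc)
  qed
  have M: "of_int (super_dim TYPE('m) TYPE('n)) = (of_nat ?m - 2 * of_nat ?n :: complex)" by (simp add: super_dim_def)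
  have "\<phi> (frac_generator a F x A) = (\<i> * of_real (a * pi / 4)) *
     (\<phi> (super_laplace F x A) - gmult (super_square ?m ?n x xf) G A - of_int (super_dim TYPE('m) TYPE('n)) * G A)"
    by (simp add: frac_generator_def functional_cscale[OF \<phi>] functional_diff[OF \<phi>] functional_gmult[OF \<phi>] G_def)
  also have "\<dots> = \<i> * of_real (a * pi / 2) / 2 * (hermites js f x + fermi ?n G A)"
    unfolding L X M H fermi_def by (simp add: field_simps)
  finally show ?thesis unfolding f_def G_def .
qed

section \<open>The integral transform of the components\<close>

lemma qop_tlist: "qop (tlist e f n) F A = (\<Sum>j=1..n. qop (tpair e f n j) F A)"
proof -
  have app: "qop (xs @ ys) F A = qop xs F A + qop ys F A" for xs ys
    by (induction xs) (auto simp: algebra_simps)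
  have "qop (concat (map (tpair e f n) js)) F A = (\<Sum>j\<leftarrow>js. qop (tpair e f n j) F A)" for js
    by (induction js) (simp_all add: app)
  then show ?thesis unfolding tlist_def sum_list_upt[symmetric] .
qed

text \<open>The exponent is a scalar plus the quadratic element \<open>tlist\<close>. The inner
  product has coefficient \<open>2 * kf \<alpha>\<close>; its factor 1/2 on the anti-commuting part
  leaves \<open>kf \<alpha>\<close>, and its sign on the commuting part gives
  \<open>- 2 * kf \<alpha>\<close>.\<close>

lemma gmult_kernel_exponent:
  assumes A: "finite A"
  shows "gmult (\<lambda>A. (- 4 * exp (\<i> * of_real \<alpha>) * super_inner m n x y A
      + (1 + exp (2 * \<i> * of_real \<alpha>)) * (super_square m n x xf A + super_square m n y (yf n) A))
    / (2 - 2 * exp (2 * \<i> * of_real \<alpha>))) F A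
   = pquad (- 2 * kf \<alpha> * of_real (\<Sum>i=1..m. x i * y i) - ke \<alpha> * of_real ((\<Sum>i=1..m. (x i)\<^sup>2) + (\<Sum>i=1..m. (y i)\<^sup>2)))
       (tlist (ke \<alpha>) (kf \<alpha>) n) F A"
proof -
  let ?e = "ke \<alpha>" and ?f = "kf \<alpha>"
  have P: "(\<lambda>A. (- 4 * exp (\<i> * of_real \<alpha>) * super_inner m n x y A
      + (1 + exp (2 * \<i> * of_real \<alpha>)) * (super_square m n x xf A + super_square m n y (yf n) A))
    / (2 - 2 * exp (2 * \<i> * of_real \<alpha>)))
    = (\<lambda>A. (2 * ?f) * super_inner m n x y A + ?e * (\<lambda>A. 1 * super_square m n x xf A + 1 * super_square m n y (yf n) A) A)"
  proof -
    have "(- 4 * z * I + q * (X + Y)) / d = (2 * (- 2 * z / d)) * I + q / d * (1 * X + 1 * Y)" for z I q X Y d :: complex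
      by (simp add: add_divide_distrib diff_divide_distrib)
    then show ?thesis unfolding ke_def kf_def by (simp only:)
  qed
  have I: "super_inner m n x y = (\<lambda>A. (-1) * gconst (of_real (\<Sum>i=1..m. x i * y i)) A
     + (1/2) * (\<Sum>j=1..n. 1 * gmult (gvar (2*j-1)) (gvar (2*n+2*j)) A + (-1) * gmult (gvar (2*j)) (gvar (2*n+(2*j-1))) A))"
    by (simp add: super_inner_def fun_eq_iff xf_def yf_def)
  have X: "gmult (super_square m n x xf) F A = (\<Sum>j=1..n. mop (2*j-1) (mop (2*j) F) A) - of_real (\<Sum>j=1..m. (x j)\<^sup>2) * F A"
    using gmult_super_square[OF A, of m n x 0 F] by (simp add: xf_def[abs_def])
  have Y: "gmult (super_square m n y (yf n)) F A = (\<Sum>j=1..n. mop (2*n+(2*j-1)) (mop (2*n+2*j) F) A) - of_real (\<Sum>j=1..m. (y j)\<^sup>2) * F A"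
    using gmult_super_square[OF A, of m n y "2*n" F] by (simp add: yf_def[abs_def])
  have Q: "qop (tlist ?e ?f n) F A = ?f * (\<Sum>j=1..n. mop (2*j-1) (mop (2*n+2*j) F) A - mop (2*j) (mop (2*n+(2*j-1)) F) A)
    + ?e * ((\<Sum>j=1..n. mop (2*j-1) (mop (2*j) F) A) + (\<Sum>j=1..n. mop (2*n+(2*j-1)) (mop (2*n+2*j) F) A))"
    unfolding qop_tlist tpair_def by (simp add: sum.distrib sum_subtractf sum_negf sum_distrib_left right_diff_distrib distrib_left)
  show ?thesis
    unfolding P unfolding gmult_add unfolding X Y I unfolding gmult_add gmult_sum gmult_gconst[OF A] gmult_gvar_gvar[OF A] pquad_def Q
    by (simp add: algebra_simps)
qed

lemma exp_kernel_exponent: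
  fixes m :: nat
  assumes "sin \<alpha> \<noteq> 0"
  shows "exp (- 2 * kf \<alpha> * of_real (\<Sum>i=1..m. x i * y i) - ke \<alpha> * of_real ((\<Sum>i=1..m. (x i)\<^sup>2) + (\<Sum>i=1..m. (y i)\<^sup>2)))
    = (\<Prod>i\<in>{1..m}. frft_kernel \<alpha> (y i) (x i))"
proof -
  have "- 2 * kf \<alpha> * of_real (\<Sum>i=1..m. x i * y i) - ke \<alpha> * of_real ((\<Sum>i=1..m. (x i)\<^sup>2) + (\<Sum>i=1..m. (y i)\<^sup>2))
    = (\<Sum>i=1..m. \<i> * of_real (x i * y i / sin \<alpha> - cos \<alpha> / sin \<alpha> * (((x i)\<^sup>2 + (y i)\<^sup>2) / 2)))"
    unfolding kernel_coeffs(2)[OF assms] kernel_coeffs(1)[OF assms] sum_distrib_left of_real_sum of_real_add sum.distrib[symmetric] sum_subtractf[symmetric]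
    by (rule sum.cong) (use assms in \<open>simp_all add: field_simps\<close>)
  then show ?thesis unfolding frft_kernel_def cis_conv_exp by (simp only:) (rule exp_sum, simp)
qed

lemma qexp_infinite: "(\<And>A. infinite A \<Longrightarrow> F A = 0) \<Longrightarrow> infinite A \<Longrightarrow> qexp ts F A = 0"
proof (induction ts arbitrary: F A)
  case (Cons t ts)
  obtain a i j where t: "t = (a, i, j)" by (cases t)
  show ?case unfolding t qexp.simps by (rule Cons.IH[OF _ Cons.prems(2)]) (simp add: mop_def Cons.prems(1))
qed simp

lemma gmult_frac_kernel:
  assumes "F \<in> grassmann N" "sin \<alpha> \<noteq> 0"
  shows "gmult (frac_kernel m n \<alpha> x y) F = (\<lambda>A. (\<Prod>i\<in>{1..m}. frft_kernel \<alpha> (y i) (x i)) * qexp (tlist (ke \<alpha>) (kf \<alpha>) n) F A)"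
proof
  fix A
  have z: "F B = 0" if "infinite B" for B using assms(1) that by (auto simp: grassmann_def dest: finite_subset)
  show "gmult (frac_kernel m n \<alpha> x y) F A = (\<Prod>i\<in>{1..m}. frft_kernel \<alpha> (y i) (x i)) * qexp (tlist (ke \<alpha>) (kf \<alpha>) n) F A"
  proof (cases "finite A")
    case True
    show ?thesis unfolding frac_kernel_def exp_kernel_exponent[OF assms(2), symmetric]
      by (rule gmult_gexp[OF gmult_kernel_exponent True])
  next
    case False
    then show ?thesis using qexp_infinite[of F A, OF z False] by (simp add: gmult_infinite)
  qed
qed

text \<open>All powers are exponentials of multiples of the same principal logarithm, so splitting
  the exponent -M/2 = m (-1/2) + n is exact and no branch has to be compared.\<close>

lemma frac_const_powr:
  assumes "sin \<alpha> \<noteq> 0"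
  shows "(of_real pi * (1 - exp (2 * \<i> * of_real \<alpha>))) powr (- of_int (super_dim TYPE('m::len0) TYPE('n::len0)) / 2)
    = frft_const \<alpha> ^ LENGTH('m) * (of_real pi * (1 - kq \<alpha>)) ^ LENGTH('n)"
proof -
  let ?P = "complex_of_real pi * (1 - exp (2 * \<i> * of_real \<alpha>))"
  have P: "?P \<noteq> 0" using assms unfolding one_minus_exp by simp
  have 0: "- of_int (super_dim TYPE('m) TYPE('n)) / 2 * z = of_nat LENGTH('m) * (- 1 / 2 * z) + of_nat LENGTH('n) * z" for z :: complex
    by (simp add: super_dim_def diff_divide_distrib left_diff_distrib)
  have 1: "?P powr (- of_int (super_dim TYPE('m) TYPE('n)) / 2) = exp (of_nat LENGTH('m) * (- 1 / 2 * Ln ?P) + of_nat LENGTH('n) * Ln ?P)"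
    unfolding powr_def if_not_P[OF P] 0 ..
  have 2: "frft_const \<alpha> ^ LENGTH('m) = exp (of_nat LENGTH('m) * (- 1 / 2 * Ln ?P))"
    unfolding frft_const_def powr_def if_not_P[OF P] exp_of_nat_mult ..
  have 3: "?P ^ LENGTH('n) = exp (of_nat LENGTH('n) * Ln ?P)"
    unfolding exp_of_nat_mult exp_Ln[OF P] ..
  show ?thesis unfolding kq_def 3 unfolding 1 2 exp_add ..
qed

lemma gint_sum: "finite K \<Longrightarrow> gint n \<alpha> (\<lambda>A. \<Sum>k\<in>K. a k * L k A) = (\<lambda>A. \<Sum>k\<in>K. a k * gint n \<alpha> (L k) A)"
proof (induction K rule: finite_induct)
  case empty
  show ?case using gint_lin[of n \<alpha> 0 "\<lambda>A. 0" 0 "\<lambda>A. 0"] by simp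
next
  case (insert k K)
  have "gint n \<alpha> (\<lambda>A. a k * L k A + 1 * (\<Sum>k\<in>K. a k * L k A)) = (\<lambda>A. a k * gint n \<alpha> (L k) A + 1 * (\<Sum>k\<in>K. a k * gint n \<alpha> (L k) A))"
    unfolding gint_lin insert.IH ..
  then show ?case by (simp only: sum.insert[OF insert.hyps] mult_1_left)
qed

lemma sin_angle: "\<alpha> \<in> angles \<Longrightarrow> \<alpha> \<noteq> 0 \<Longrightarrow> sin \<alpha> \<noteq> 0"
proof (rule sin_nonzero)
  assume "\<alpha> \<in> angles"
  then show "\<bar>\<alpha>\<bar> < pi" using anglesD[of \<alpha>] pi_gt_zero by linarith
qed

text \<open>After a linear functional the integrand is a finite sum of a scalar function of x times
  a Grassmann element that is constant in x; the Lebesgue integral and the Berezin integral then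
  factorise.\<close>

lemma frac_integral_transform_comb:
  fixes F :: "('m::len0, 'n::len0) superfun"
  assumes h: "\<And>k. k < (N::nat) \<Longrightarrow> h k \<in> schwartz LENGTH('m)" and l: "\<And>k. k < N \<Longrightarrow> l k \<in> grassmann (2 * LENGTH('n))"
    and F: "F = (\<lambda>x A. \<Sum>k<N. cscale (h k x * l k A) (c k))"
    and y: "y \<in> Rm LENGTH('m)" and a: "\<alpha> \<in> angles" "\<alpha> \<noteq> 0" and js: "js = [1..<LENGTH('m)+1]"
  shows "frac_integral_transform \<alpha> F y A = (\<Sum>k<N. cscale (frfts LENGTH('m) js \<alpha> (h k) y * gint LENGTH('n) \<alpha> (l k) A) (c k))"
proof -
  let ?m = "LENGTH('m)" and ?n = "LENGTH('n)"
  let ?T = "tlist (ke \<alpha>) (kf \<alpha>) ?n" and ?C = "frft_const \<alpha> ^ ?m" and ?P = "(of_real pi * (1 - kq \<alpha>)) ^ ?n"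
  let ?A = "(\<lambda>j. 2 * ?n + j) ` A"
  have S: "sin \<alpha> \<noteq> 0" by (rule sin_angle[OF a])
  have q0: "1 - kq \<alpha> \<noteq> 0"
    unfolding kq_def one_minus_exp using S by simp
  then have P0: "?P \<noteq> 0" "1 - kq \<alpha> \<noteq> 0" by simp_all
  have "of_real pi * (1 - exp (2 * \<i> * of_real \<alpha>)) \<noteq> (0 :: complex)" using q0 unfolding kq_def by simp
  then have C0: "?C \<noteq> 0" unfolding frft_const_def powr_def by (simp only: if_False power_not_zero exp_not_eq_zero not_False_eq_True)
  \<comment> \<open>The value of the bare integral. \<open>frfts\<close> includes the constant
    \<open>?C\<close> and \<open>gint\<close> the power of \<open>1 - kq \<alpha>\<close>, while the
    Berezin integral brings \<pi>^(-n); dividing by \<open>?C\<close> and \<open>?P\<close> takes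
    this into account.\<close>
  let ?V = "\<Sum>k<N. cscale (frfts ?m js \<alpha> (h k) y / ?C * gint ?n \<alpha> (l k) A / ?P) (c k)"
  let ?g = "\<lambda>x. gmult (gembed (frac_kernel ?m ?n \<alpha> x y)) (F x)"
  have val: "has_bochner_integral (lebesgue_Rm ?m) (\<lambda>x. \<phi> (berezin_x (?g x) ?A)) (\<phi> ?V)" if \<phi>: "cw_functional \<phi>" for \<phi>
  proof -
    let ?K = "\<lambda>x. \<Prod>i\<in>{1..?m}. frft_kernel \<alpha> (y i) (x i)"
    have J: "\<phi> (berezin_x (?g x) ?A) = (\<Sum>k<N. (gint ?n \<alpha> (l k) A / ?P * \<phi> (c k)) * (?K x * h k x))" for x
    proof -
      define G where "G = (\<lambda>A. \<Sum>k\<in>{..<N}. (h k x * \<phi> (c k)) * l k A)"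
      have G: "(\<lambda>A. \<phi> (F x A)) = G" unfolding F functional_comb[OF \<phi>] G_def by (simp only: mult_ac)
      have gr: "G \<in> grassmann (2 * ?n)"
      proof -
        have "G B = 0" if "\<not> B \<subseteq> {1..2 * ?n}" for B
          using l that unfolding G_def by (intro sum.neutral) (simp add: grassmann_def)
        then show ?thesis by (simp add: grassmann_def)
      qed
      have 1: "\<phi> (berezin_x (?g x) ?A) = of_real (1 / pi ^ ?n) * berezin ?n (\<lambda>A. \<phi> (?g x A)) A"
        unfolding berezin_x_def functional_cscale[OF \<phi>] functional_fold_gderiv[OF \<phi>] berezin_def ..
      have 2: "(\<lambda>A. \<phi> (?g x A)) = (\<lambda>A. ?K x * qexp ?T G A + 0 * G A)"
        unfolding functional_gmult[OF \<phi>] G gmult_frac_kernel[OF gr S] by simp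
      have 3: "berezin ?n (\<lambda>A. ?K x * qexp ?T G A + 0 * G A) A = ?K x * berezin ?n (qexp ?T G) A"
        unfolding berezin_lin by simp
      have 4: "berezin ?n (qexp ?T G) A = gint ?n \<alpha> G A / (1 - kq \<alpha>) ^ ?n"
        using P0(2) by (simp add: gint_def)
      have 5: "gint ?n \<alpha> G A = (\<Sum>k<N. (h k x * \<phi> (c k)) * gint ?n \<alpha> (l k) A)"
        unfolding G_def gint_sum[OF finite_lessThan] ..
      have "of_real (1 / pi ^ ?n) * (K * ((\<Sum>k<N. (u k * v k) * w k) / Q)) = (\<Sum>k<N. (w k / (of_real pi ^ ?n * Q) * v k) * (K * u k))"
        for K Q :: complex and u v w
        unfolding sum_divide_distrib sum_distrib_left by (rule sum.cong[OF refl]) (simp add: field_simps)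
      then show ?thesis unfolding 1 2 3 4 5 power_mult_distrib .
    qed
    have I: "has_bochner_integral (lebesgue_Rm ?m) (\<lambda>x. ?K x * h k x) (frfts ?m js \<alpha> (h k) y / ?C)" if k: "k < N" for k
    proof -
      have set_js: "set js = {1..?m}" "distinct js" "length js = ?m" unfolding js by auto
      then have sub: "set js \<subseteq> {1..?m}" by simp
      have ov: "(\<lambda>i. if i \<in> {1..?m} then x i else y i) = x" if "x \<in> space (lebesgue_Rm ?m)" for x
        using that y by (auto simp: lebesgue_Rm_def space_PiM PiE_iff extensional_def fun_eq_iff)
      have int: "integrable (lebesgue_Rm ?m) (\<lambda>x. ?K x * h k (\<lambda>i. if i \<in> {1..?m} then x i else y i))"
        unfolding lebesgue_Rm_def by (rule kernel_integrable[OF h[OF k] order_refl y])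
      have "integrable (lebesgue_Rm ?m) (\<lambda>x. ?K x * h k (\<lambda>i. if i \<in> {1..?m} then x i else y i))
        = integrable (lebesgue_Rm ?m) (\<lambda>x. ?K x * h k x)"
        by (rule Bochner_Integration.integrable_cong[OF refl]) (simp only: ov)
      then have 1: "integrable (lebesgue_Rm ?m) (\<lambda>x. ?K x * h k x)" using int by (rule iffD1)
      have 2: "frfts ?m js \<alpha> (h k) y = ?C * (LINT x|lebesgue_Rm ?m. ?K x * h k (\<lambda>i. if i \<in> {1..?m} then x i else y i))"
        unfolding lebesgue_Rm_def by (rule frfts_integral[OF y a h[OF k] set_js(2) sub, unfolded set_js(1,3)])
      have 3: "(LINT x|lebesgue_Rm ?m. ?K x * h k (\<lambda>i. if i \<in> {1..?m} then x i else y i)) = (LINT x|lebesgue_Rm ?m. ?K x * h k x)"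
        by (rule Bochner_Integration.integral_cong[OF refl]) (simp only: ov)
      have "(LINT x|lebesgue_Rm ?m. ?K x * h k x) = frfts ?m js \<alpha> (h k) y / ?C"
        unfolding 2 3 using C0 by (rule nonzero_mult_div_cancel_left[symmetric])
      then show ?thesis unfolding has_bochner_integral_iff using 1 by (rule conjI[rotated])
    qed
    have "has_bochner_integral (lebesgue_Rm ?m) (\<lambda>x. \<Sum>k<N. (gint ?n \<alpha> (l k) A / ?P * \<phi> (c k)) * (?K x * h k x))
       (\<Sum>k<N. (gint ?n \<alpha> (l k) A / ?P * \<phi> (c k)) * (frfts ?m js \<alpha> (h k) y / ?C))"
      by (intro has_bochner_integral_sum has_bochner_integral_mult_right I) simp
    moreover have "(\<Sum>k<N. (gint ?n \<alpha> (l k) A / ?P * \<phi> (c k)) * (frfts ?m js \<alpha> (h k) y / ?C)) = \<phi> ?V"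
      unfolding functional_comb[OF \<phi>] by (rule sum.cong[OF refl]) (simp add: mult_ac)
    ultimately show ?thesis unfolding J by (simp only:)
  qed
  have "super_integral_x ?g ?A = ?V"
    unfolding super_integral_x_def cw_integral_def
  proof (rule the_equality)
    show "\<forall>\<phi>. cw_functional \<phi> \<longrightarrow> has_bochner_integral (lebesgue_Rm ?m) (\<lambda>x. \<phi> (berezin_x (?g x) ?A)) (\<phi> ?V)" using val by blast
    fix d :: "('m, 'n) cw"
    assume d: "\<forall>\<phi>. cw_functional \<phi> \<longrightarrow> has_bochner_integral (lebesgue_Rm ?m) (\<lambda>x. \<phi> (berezin_x (?g x) ?A)) (\<phi> d)"
    show "d = ?V"
    proof (rule functionals_separate)
      fix \<psi> :: "('m, 'n) cw \<Rightarrow> complex" assume \<psi>: "cw_functional \<psi>"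
      show "\<psi> d = \<psi> ?V" by (rule has_bochner_integral_eq[OF d[rule_format, OF \<psi>] val[OF \<psi>]])
    qed
  qed
  then have T: "frac_integral_transform \<alpha> F y A = cscale (?C * ?P) ?V"
    unfolding frac_integral_transform_def frac_const_powr[OF S] by (simp only:)
  show ?thesis
  proof (rule functionals_separate)
    fix \<phi> :: "('m, 'n) cw \<Rightarrow> complex" assume \<phi>: "cw_functional \<phi>"
    show "\<phi> (frac_integral_transform \<alpha> F y A) = \<phi> (\<Sum>k<N. cscale (frfts ?m js \<alpha> (h k) y * gint ?n \<alpha> (l k) A) (c k))"
      unfolding T functional_cscale[OF \<phi>] functional_comb[OF \<phi>] sum_distrib_left
    proof (rule sum.cong[OF refl])
      fix k
      have "C * P * (u / C * v / P * w) = u * v * w" if "C \<noteq> 0" "P \<noteq> 0" for C P u v w :: complex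
        using that by simp
      from this[OF C0 P0(1)] show "?C * ?P * (frfts ?m js \<alpha> (h k) y / ?C * gint ?n \<alpha> (l k) A / ?P * \<phi> (c k))
        = frfts ?m js \<alpha> (h k) y * gint ?n \<alpha> (l k) A * \<phi> (c k)" .
    qed
  qed
qed

section \<open>Existence and uniqueness for the Cauchy problem\<close>

lemma super_schwartzE:
  assumes "F \<in> super_schwartz"
  obtains N h L c where "\<forall>k<(N::nat). h k \<in> schwartz LENGTH('m)" "\<forall>k<N. L k \<in> grassmann (2 * LENGTH('n))"
    "(F :: ('m::len0, 'n::len0) superfun) = (\<lambda>x A. \<Sum>k<N. cscale (h k x * L k A) (c k))"
  using assms unfolding super_schwartz_def by blast

lemma component_schwartz:
  fixes F :: "('m::len0, 'n::len0) superfun"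
  assumes F: "F \<in> super_schwartz" and \<phi>: "cw_functional \<phi>"
  shows "(\<lambda>x. \<phi> (F x A)) \<in> schwartz LENGTH('m)"
proof -
  obtain N h L c where rep: "\<forall>k<(N::nat). h k \<in> schwartz LENGTH('m)" "\<forall>k<N. L k \<in> grassmann (2 * LENGTH('n))"
    "F = (\<lambda>x A. \<Sum>k<N. cscale (h k x * L k A) (c k))" using F by (rule super_schwartzE)
  note R = rep(1)[rule_format] rep(2)[rule_format] rep(3)
  have "(\<lambda>x. \<phi> (F x A)) = (\<lambda>x. \<Sum>k\<in>{..<N}. (L k A * \<phi> (c k)) * h k x)"
    unfolding R(3) functional_comb[OF \<phi>] by (simp only: mult_ac)
  moreover have "(\<lambda>x. \<Sum>k\<in>{..<N}. (L k A * \<phi> (c k)) * h k x) \<in> schwartz LENGTH('m)"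
    by (rule schwartz_sum, rule schwartz_cmult) (simp add: R(1))
  ultimately show ?thesis by (simp only:)
qed

lemma component_grassmann:
  fixes F :: "('m::len0, 'n::len0) superfun"
  assumes F: "F \<in> super_schwartz" and \<phi>: "cw_functional \<phi>"
  shows "(\<lambda>A. \<phi> (F x A)) \<in> grassmann (2 * LENGTH('n))"
proof -
  obtain N h L c where rep: "\<forall>k<(N::nat). h k \<in> schwartz LENGTH('m)" "\<forall>k<N. L k \<in> grassmann (2 * LENGTH('n))"
    "F = (\<lambda>x A. \<Sum>k<N. cscale (h k x * L k A) (c k))" using F by (rule super_schwartzE)
  note R = rep(1)[rule_format] rep(2)[rule_format] rep(3)
  have "\<phi> (F x A) = 0" if "\<not> A \<subseteq> {1..2 * LENGTH('n)}" for A
    using R(2) that unfolding R(3) functional_comb[OF \<phi>] by (intro sum.neutral) (simp add: grassmann_def)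
  then show ?thesis by (simp add: grassmann_def)
qed

lemma component_generator:
  fixes F :: "('m::len0, 'n::len0) superfun"
  assumes F: "F \<in> super_schwartz" and \<phi>: "cw_functional \<phi>" and x: "x \<in> Rm LENGTH('m)"
  shows "\<phi> (frac_generator a F x A) = gener [1..<LENGTH('m)+1] LENGTH('n) (a * pi / 2) (\<lambda>A x. \<phi> (F x A)) A x"
proof -
  obtain N h L c where rep: "\<forall>k<(N::nat). h k \<in> schwartz LENGTH('m)" "\<forall>k<N. L k \<in> grassmann (2 * LENGTH('n))"
    "F = (\<lambda>x A. \<Sum>k<N. cscale (h k x * L k A) (c k))" using F by (rule super_schwartzE)
  note R = rep(1)[rule_format] rep(2)[rule_format] rep(3)
  show ?thesis unfolding gener_def by (rule frac_generator_functional[OF R x \<phi> refl])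
qed

lemma gener_schwartz:
  assumes "set js \<subseteq> {1..m}" "\<And>A. v A \<in> schwartz m" "\<And>x. (\<lambda>A. v A x) \<in> grassmann (2 * n)"
  shows "gener js n \<kappa> v A \<in> schwartz m"
proof -
  have "gener js n \<kappa> v A = (\<lambda>x. \<i> * of_real \<kappa> / 2 * (hermites js (v A) x + (\<Sum>S\<in>Pow {1..2*n}. fermi n (gsing S) A * v S x)))"
    unfolding gener_def fermi_matrix[OF assms(3)] ..
  moreover have "(\<lambda>x. \<Sum>S\<in>Pow {1..2*n}. fermi n (gsing S) A * v S x) \<in> schwartz m"
    by (rule schwartz_sum, rule schwartz_cmult, rule assms(2))
  ultimately show ?thesis
    by (simp only: schwartz_cmult schwartz_add hermites_schwartz[OF assms(1) assms(2)])
qed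

text \<open>Translates the Cauchy problem in the function space into one for each component and each
  functional, in both directions: one for existence, the other for uniqueness.\<close>

lemma super_tendsto_iff_sderiv:
  fixes u :: "real \<Rightarrow> ('m::len0, 'n::len0) superfun"
  assumes u: "\<And>s. s \<in> {0..1} \<Longrightarrow> u s \<in> super_schwartz" and t: "t \<in> {0..1}"
  shows "super_tendsto (\<lambda>s x A. cscale (of_real (1 / (s - t))) (u s x A - u t x A)) (frac_generator a (u t)) (at t within {0..1})
    \<longleftrightarrow> (\<forall>A \<phi>. cw_functional \<phi> \<longrightarrow> sderiv LENGTH('m) (\<lambda>s x. \<phi> (u s x A))
      (gener [1..<LENGTH('m)+1] LENGTH('n) (a * pi / 2) (\<lambda>A x. \<phi> (u t x A)) A) t {0..1})"
proof -
  let ?m = "LENGTH('m)" and ?F = "at t within {0..1}"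
  have key: "(\<forall>js \<beta>. set js \<subseteq> {1..?m} \<longrightarrow> uniform_limit (Rm ?m)
      (\<lambda>s x. monomial ?m \<beta> x * pds js (\<lambda>x. \<phi> (cscale (of_real (1 / (s - t))) (u s x A - u t x A))) x)
      (\<lambda>x. monomial ?m \<beta> x * pds js (\<lambda>x. \<phi> (frac_generator a (u t) x A)) x) ?F)
    \<longleftrightarrow> sderiv ?m (\<lambda>s x. \<phi> (u s x A)) (gener [1..<?m+1] LENGTH('n) (a * pi / 2) (\<lambda>A x. \<phi> (u t x A)) A) t {0..1}"
    if \<phi>: "cw_functional \<phi>" for A \<phi>
  proof -
    define v where "v = (\<lambda>s x. \<phi> (u s x A))"
    define G where "G = gener [1..<?m+1] LENGTH('n) (a * pi / 2) (\<lambda>A x. \<phi> (u t x A)) A"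
    have S: "v s \<in> schwartz ?m" if "s \<in> {0..1}" for s
      unfolding v_def by (rule component_schwartz[OF u[OF that] \<phi>])
    have GS: "G \<in> schwartz ?m"
      unfolding G_def by (rule gener_schwartz[OF _ component_schwartz[OF u[OF t] \<phi>] component_grassmann[OF u[OF t] \<phi>]]) auto
    have P: "\<phi> (cscale (of_real (1 / (s - t))) (u s x A - u t x A)) = (v s x - v t x) / of_real (s - t)" for s x
    proof -
      have "of_real (1 / r) * z = z / complex_of_real r" for r z by simp
      then show ?thesis unfolding functional_cscale[OF \<phi>] functional_diff[OF \<phi>] v_def .
    qed
    have Q: "\<phi> (frac_generator a (u t) x A) = G x" if "x \<in> Rm ?m" for x
      unfolding G_def by (rule component_generator[OF u[OF t] \<phi> that])
    have quot: "(\<lambda>x. (v s x - v t x) / of_real r) \<in> schwartz ?m" if "s \<in> {0..1}" for s r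
    proof -
      have "(\<lambda>x. (v s x - v t x) / of_real r) = (\<lambda>x. (1 / of_real r) * v s x + (- 1 / of_real r) * v t x)"
        by (simp add: diff_divide_distrib)
      then show ?thesis using schwartz_lincomb[OF S[OF that] S[OF t]] by (simp only:)
    qed
    have "\<forall>\<^sub>F s in ?F. (\<lambda>x. (v s x - v t x) / of_real (s - t)) \<in> schwartz ?m"
      using eventually_at_within_mem[of "{0..1}" t] by (rule eventually_mono) (rule quot, blast)
    from uniform_limit_snull[OF this GS, of "\<lambda>s x. (v s x - v t x) / of_real (s - t)", OF _ Q]
    have "(\<forall>js \<beta>. set js \<subseteq> {1..?m} \<longrightarrow> uniform_limit (Rm ?m)
      (\<lambda>s x. monomial ?m \<beta> x * pds js (\<lambda>x. (v s x - v t x) / of_real (s - t)) x)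
      (\<lambda>x. monomial ?m \<beta> x * pds js (\<lambda>x. \<phi> (frac_generator a (u t) x A)) x) ?F)
      \<longleftrightarrow> snull ?m (\<lambda>s x. (v s x - v t x) / of_real (s - t) - G x) ?F"
      by simp
    moreover have "sderiv ?m v G t {0..1} \<longleftrightarrow> snull ?m (\<lambda>s x. (v s x - v t x) / of_real (s - t) - G x) ?F"
      unfolding sderiv_def using S GS by blast
    ultimately show ?thesis unfolding P unfolding v_def[symmetric] G_def[symmetric] by (simp only:)
  qed
  have "super_tendsto (\<lambda>s x A. cscale (of_real (1 / (s - t))) (u s x A - u t x A)) (frac_generator a (u t)) ?F
    \<longleftrightarrow> (\<forall>A \<phi>. cw_functional \<phi> \<longrightarrow> (\<forall>js \<beta>. set js \<subseteq> {1..?m} \<longrightarrow> uniform_limit (Rm ?m)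
      (\<lambda>s x. monomial ?m \<beta> x * pds js (\<lambda>x. \<phi> (cscale (of_real (1 / (s - t))) (u s x A - u t x A))) x)
      (\<lambda>x. monomial ?m \<beta> x * pds js (\<lambda>x. \<phi> (frac_generator a (u t) x A)) x) ?F))"
    unfolding super_tendsto_def by blast
  then show ?thesis using key by (simp cong: imp_cong)
qed

lemma angle_mem:
  assumes "a \<in> {-1..1}" "t \<in> {0..1}" shows "a * pi / 2 * t \<in> angles"
proof -
  have "\<bar>a * t\<bar> \<le> 1" unfolding abs_mult by (rule mult_le_one) (use assms in auto)
  then have "\<bar>a * t\<bar> * (pi / 2) \<le> 1 * (pi / 2)" by (rule mult_right_mono) simp
  moreover have "a * pi / 2 * t = (a * t) * (pi / 2)" by simp
  ultimately have "\<bar>a * pi / 2 * t\<bar> \<le> pi / 2" by (simp add: abs_mult)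
  then show ?thesis unfolding angles_def by (simp add: abs_le_iff)
qed

definition super_evol :: "nat \<Rightarrow> (nat \<Rightarrow> (nat \<Rightarrow> real) \<Rightarrow> complex) \<Rightarrow> (nat \<Rightarrow> real \<Rightarrow> gr) \<Rightarrow> (nat \<Rightarrow> ('m::len0, 'n::len0) cw) \<Rightarrow>
    real \<Rightarrow> ('m, 'n) superfun"
  where "super_evol N h g c s = (\<lambda>x A. \<Sum>k<N. cscale (frfts LENGTH('m) [1..<LENGTH('m)+1] s (h k) x * g k s A) (c k))"

lemma super_evol_functional:
  fixes c :: "nat \<Rightarrow> ('m::len0, 'n::len0) cw"
  assumes "cw_functional \<phi>"
  shows "(\<lambda>x. \<phi> (super_evol N h g c s x A)) = evol LENGTH('m) [1..<LENGTH('m)+1] N (\<lambda>k. \<phi> (c k)) h g A s"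
  unfolding super_evol_def functional_comb[OF assms] evol_def by (simp only: mult_ac)

lemma coords_subset: "set [1..<m+1] \<subseteq> {1..m}"
  by auto

lemma super_evol_schwartz:
  fixes c :: "nat \<Rightarrow> ('m::len0, 'n::len0) cw"
  assumes "\<And>k. k < N \<Longrightarrow> h k \<in> schwartz LENGTH('m)" "\<And>k. k < N \<Longrightarrow> gflow LENGTH('n) (L k) (g k)" "s \<in> angles"
  shows "super_evol N h g c s \<in> super_schwartz"
proof -
  have W: "\<forall>k<N. frfts LENGTH('m) [1..<LENGTH('m)+1] s (h k) \<in> schwartz LENGTH('m) \<and> g k s \<in> grassmann (2 * LENGTH('n))"
    using frfts_schwartz[OF coords_subset assms(1) assms(3)] assms(2) by (auto simp: gflow_def)
  show ?thesis unfolding super_schwartz_def super_evol_def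
    by (rule CollectI, rule exI[of _ N], rule exI[of _ "\<lambda>k. frfts LENGTH('m) [1..<LENGTH('m)+1] s (h k)"],
        rule exI[of _ "\<lambda>k. g k s"], rule exI[of _ c], rule conjI[OF W refl])
qed

lemma super_evol_0:
  fixes c :: "nat \<Rightarrow> ('m::len0, 'n::len0) cw"
  assumes "\<And>k. k < N \<Longrightarrow> h k \<in> schwartz LENGTH('m)" "\<And>k. k < N \<Longrightarrow> gflow LENGTH('n) (L k) (g k)"
  shows "super_evol N h g c 0 = (\<lambda>x A. \<Sum>k<N. cscale (h k x * L k A) (c k))"
  unfolding super_evol_def
  by (intro ext sum.cong refl) (use assms in \<open>simp add: frfts_0 gflow_def\<close>)

lemma super_evol_solution:
  fixes f :: "('m::len0, 'n::len0) superfun"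
  assumes a: "a \<in> {-1..1}" and h: "\<And>k. k < N \<Longrightarrow> h k \<in> schwartz LENGTH('m)" and g: "\<And>k. k < N \<Longrightarrow> gflow LENGTH('n) (L k) (g k)"
    and f: "f = (\<lambda>x A. \<Sum>k<N. cscale (h k x * L k A) (c k))"
  shows "super_cauchy_solution (frac_generator a) f (\<lambda>t. super_evol N h g c (a * pi / 2 * t))"
proof -
  let ?u = "\<lambda>t. super_evol N h g c (a * pi / 2 * t) :: ('m, 'n) superfun"
  have S: "?u t \<in> super_schwartz" if "t \<in> {0..1}" for t
    by (rule super_evol_schwartz[OF h g angle_mem[OF a that]])
  have "super_tendsto (\<lambda>s x A. cscale (of_real (1 / (s - t))) (?u s x A - ?u t x A)) (frac_generator a (?u t)) (at t within {0..1})"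
    if t: "t \<in> {0..1}" for t
  proof (rule super_tendsto_iff_sderiv[of ?u, THEN iffD2])
    show "?u s \<in> super_schwartz" if "s \<in> {0..1}" for s by (rule S[OF that])
    show "t \<in> {0..1}" by (rule t)
    have "sderiv LENGTH('m) (\<lambda>s x. \<phi> (?u s x A)) (gener [1..<LENGTH('m)+1] LENGTH('n) (a * pi / 2) (\<lambda>A x. \<phi> (?u t x A)) A) t {0..1}"
      if \<phi>: "cw_functional \<phi>" for A \<phi>
      unfolding super_evol_functional[OF \<phi>]
      by (rule sderiv_evol[OF coords_subset h g angle_mem[OF a] t])
    then show "\<forall>A \<phi>. cw_functional \<phi> \<longrightarrow> sderiv LENGTH('m) (\<lambda>s x. \<phi> (?u s x A)) (gener [1..<LENGTH('m)+1] LENGTH('n) (a * pi / 2) (\<lambda>A x. \<phi> (?u t x A)) A) t {0..1}"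
      by blast
  qed
  moreover have "?u 0 = f" using super_evol_0[OF h g] unfolding f by simp
  ultimately show ?thesis unfolding super_cauchy_solution_def using S by blast
qed

lemma super_cauchy_unique:
  fixes u w :: "real \<Rightarrow> ('m::len0, 'n::len0) superfun"
  assumes a: "a \<in> {-1..1}" and u: "super_cauchy_solution (frac_generator a) f u" and w: "super_cauchy_solution (frac_generator a) f w"
    and t: "t \<in> {0..1}"
  shows "u t = w t"
proof (intro ext functionals_separate)
  fix x A and \<phi> :: "('m, 'n) cw \<Rightarrow> complex" assume \<phi>: "cw_functional \<phi>"
  have uS: "u s \<in> super_schwartz" "w s \<in> super_schwartz" if "s \<in> {0..1}" for s
    using u w that unfolding super_cauchy_solution_def by blast+
  have du: "sderiv LENGTH('m) (\<lambda>s x. \<phi> (z s x A)) (gener [1..<LENGTH('m)+1] LENGTH('n) (a * pi / 2) (\<lambda>A x. \<phi> (z s x A)) A) s {0..1}"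
    if z: "super_cauchy_solution (frac_generator a) f z" and s: "s \<in> {0..1}" for z :: "real \<Rightarrow> ('m, 'n) superfun" and s A
  proof -
    have zS: "z s \<in> super_schwartz" if "s \<in> {0..1}" for s using z that unfolding super_cauchy_solution_def by blast
    have "super_tendsto (\<lambda>r x A. cscale (of_real (1 / (r - s))) (z r x A - z s x A)) (frac_generator a (z s)) (at s within {0..1})"
      using z s unfolding super_cauchy_solution_def by blast
    then have "\<forall>A \<phi>. cw_functional \<phi> \<longrightarrow> sderiv LENGTH('m) (\<lambda>s x. \<phi> (z s x A))
        (gener [1..<LENGTH('m)+1] LENGTH('n) (a * pi / 2) (\<lambda>A x. \<phi> (z s x A)) A) s {0..1}"
      by (rule super_tendsto_iff_sderiv[of z s a, THEN iffD1, rotated 2]) (rule zS, assumption, rule s)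
    then show ?thesis using \<phi> by blast
  qed
  have init: "(\<lambda>x. \<phi> (u 0 x A)) = (\<lambda>x. \<phi> (w 0 x A))" for A
    using u w unfolding super_cauchy_solution_def by simp
  have "(\<lambda>x. \<phi> (u t x A)) = (\<lambda>x. \<phi> (w t x A))"
    by (rule transport_unique[where v="\<lambda>A t x. \<phi> (u t x A)" and w="\<lambda>A t x. \<phi> (w t x A)",
          OF coords_subset angle_mem[OF a] du[OF u] component_grassmann[OF uS(1) \<phi>] du[OF w] component_grassmann[OF uS(2) \<phi>] init t])
  then show "\<phi> (u t x A) = \<phi> (w t x A)" by (rule fun_cong)
qed

lemma frac_fourier_eq:
  fixes f :: "('m::len0, 'n::len0) superfun"
  assumes a: "a \<in> {-1..1}" and h: "\<And>k. k < N \<Longrightarrow> h k \<in> schwartz LENGTH('m)" and g: "\<And>k. k < N \<Longrightarrow> gflow LENGTH('n) (L k) (g k)"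
    and f: "f = (\<lambda>x A. \<Sum>k<N. cscale (h k x * L k A) (c k))"
  shows "frac_fourier a f = super_evol N h g c (a * pi / 2)"
proof -
  note sol = super_evol_solution[OF a h g f]
  have "frac_fourier a f = super_evol N h g c (a * pi / 2 * 1)"
    unfolding frac_fourier_def op_exp_def
  proof (rule the_equality)
    show "\<exists>u. super_cauchy_solution (frac_generator a) f u \<and> u 1 = super_evol N h g c (a * pi / 2 * 1)"
      by (rule exI[of _ "\<lambda>t. super_evol N h g c (a * pi / 2 * t)"]) (rule conjI[OF sol refl])
    fix G assume "\<exists>u. super_cauchy_solution (frac_generator a) f u \<and> u 1 = G"
    then obtain u where u: "super_cauchy_solution (frac_generator a) f u" "u 1 = G" by blast
    show "G = super_evol N h g c (a * pi / 2 * 1)"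
      using super_cauchy_unique[OF a u(1) sol, of 1] u(2) by simp
  qed
  then show ?thesis by simp
qed

lemma frac_integral_transform_eq:
  fixes f :: "('m::len0, 'n::len0) superfun"
  assumes h: "\<And>k. k < N \<Longrightarrow> h k \<in> schwartz LENGTH('m)" and L: "\<And>k. k < N \<Longrightarrow> L k \<in> grassmann (2 * LENGTH('n))"
    and g: "\<And>k. k < N \<Longrightarrow> gflow LENGTH('n) (L k) (g k)"
    and f: "f = (\<lambda>x A. \<Sum>k<N. cscale (h k x * L k A) (c k))"
    and y: "y \<in> Rm LENGTH('m)" and \<alpha>: "\<alpha> \<in> angles" "\<alpha> \<noteq> 0"
  shows "frac_integral_transform \<alpha> f y = super_evol N h g c \<alpha> y"
proof
  fix A
  have "sin \<alpha> \<noteq> 0" by (rule sin_angle[OF \<alpha>])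
  then have G: "gint LENGTH('n) \<alpha> (L k) = g k \<alpha>" if "k < N" for k using g[OF that] unfolding gflow_def by simp
  have "frac_integral_transform \<alpha> f y A
    = (\<Sum>k<N. cscale (frfts LENGTH('m) [1..<LENGTH('m)+1] \<alpha> (h k) y * gint LENGTH('n) \<alpha> (L k) A) (c k))"
    by (rule frac_integral_transform_comb[OF h L f y \<alpha> refl])
  also have "\<dots> = super_evol N h g c \<alpha> y A"
    unfolding super_evol_def by (rule sum.cong[OF refl]) (simp add: G)
  finally show "frac_integral_transform \<alpha> f y A = super_evol N h g c \<alpha> y A" .
qed

theorem theorem12:
  fixes a \<alpha> :: real and f :: "('m::len0, 'n::len0) superfun"
  assumes "a \<in> {-1..1}" and "\<alpha> = a * pi / 2" and "f \<in> super_schwartz"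
  shows "(a \<noteq> 0 \<longrightarrow>
           (\<forall>y\<in>Rm LENGTH('m). frac_fourier a f y = frac_integral_transform \<alpha> f y)) \<and>
         (a = 0 \<longrightarrow>
           super_tendsto (\<lambda>\<beta>. frac_integral_transform \<beta> f) (frac_fourier a f) (at \<alpha>))"
proof -
  obtain N h L c where rep: "\<forall>k<(N::nat). h k \<in> schwartz LENGTH('m)" "\<forall>k<N. L k \<in> grassmann (2 * LENGTH('n))"
    "f = (\<lambda>x A. \<Sum>k<N. cscale (h k x * L k A) (c k))" using assms(3) by (rule super_schwartzE)
  note R = rep(1)[rule_format] rep(2)[rule_format] rep(3)
  have "\<forall>k. \<exists>g. k < N \<longrightarrow> gflow LENGTH('n) (L k) g" using R(2) gflow_exists by meson
  then obtain g where "\<forall>k. k < N \<longrightarrow> gflow LENGTH('n) (L k) (g k)" by (rule choice[THEN exE])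
  then have g: "\<And>k. k < N \<Longrightarrow> gflow LENGTH('n) (L k) (g k)" by blast
  have ft: "frac_fourier a f = super_evol N h g c \<alpha>"
    unfolding assms(2) by (rule frac_fourier_eq[OF assms(1) R(1) g R(3)])
  have ang: "\<alpha> \<in> angles" unfolding assms(2) using angle_mem[OF assms(1), of 1] by simp
  show ?thesis
  proof (intro conjI impI ballI)
    fix y assume "a \<noteq> 0" and y: "y \<in> Rm LENGTH('m)"
    then have "\<alpha> \<noteq> 0" unfolding assms(2) by simp
    have "frac_integral_transform \<alpha> f y = super_evol N h g c \<alpha> y"
      by (rule frac_integral_transform_eq[OF R(1,2) g R(3) y ang \<open>\<alpha> \<noteq> 0\<close>])
    then show "frac_fourier a f y = frac_integral_transform \<alpha> f y" unfolding ft by (rule sym)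
  next
    \<comment> \<open>Kernel and constant are singular at angle 0. At nearby nonzero angles the
      integral transform is the evolution, which is differentiable at 0 in the Schwartz topology and
      hence continuous.\<close>
    assume "a = 0"
    then have \<alpha>: "\<alpha> = 0" using assms(2) by simp
    let ?m = "LENGTH('m)"
    have within: "at 0 within angles = at (0::real)"
      by (rule at_within_interior) (simp add: angles_def interior_atLeastAtMost_real)
    have mem: "\<forall>\<^sub>F \<beta> in at (0::real). \<beta> \<in> angles \<and> \<beta> \<noteq> 0"
      using eventually_at_within_mem[of angles 0] unfolding within .
    show "super_tendsto (\<lambda>\<beta>. frac_integral_transform \<beta> f) (frac_fourier a f) (at \<alpha>)"
      unfolding super_tendsto_def \<alpha> ft
    proof (intro allI impI)
      fix js \<beta> A and \<phi> :: "('m, 'n) cw \<Rightarrow> complex"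
      assume js: "set js \<subseteq> {1..?m}" and \<phi>: "cw_functional \<phi>"
      let ?v = "evol ?m [1..<?m+1] N (\<lambda>k. \<phi> (c k)) h g A"
      \<comment> \<open>The rate 1 makes time and angle coincide, so differentiability is obtained
        on all of \<open>angles\<close>, in which 0 is an interior point.\<close>
      have D: "sderiv ?m (\<lambda>s. ?v (1 * s)) (gener [1..<?m+1] LENGTH('n) 1 (\<lambda>A. evol ?m [1..<?m+1] N (\<lambda>k. \<phi> (c k)) h g A (1 * 0)) A) 0 angles"
        by (rule sderiv_evol[OF coords_subset R(1) g]) (simp_all add: angles_def)
      have 0: "(0::real) \<in> angles" by (simp add: angles_def)
      have N: "snull ?m (\<lambda>s x. ?v s x - ?v 0 x) (at 0)"
        using sderiv_snull[OF D 0] unfolding mult_1_left within .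
      have vS: "?v s \<in> schwartz ?m" if "s \<in> angles" for s
        using sderiv_schwartz(1)[OF D that] unfolding mult_1_left .
      have ev: "\<forall>\<^sub>F s in at 0. ?v s \<in> schwartz ?m"
        using mem by (rule eventually_mono) (rule vS, blast)
      have P: "\<forall>\<^sub>F s in at 0. \<forall>x\<in>Rm ?m. \<phi> (frac_integral_transform s f x A) = ?v s x"
        using mem
      proof (rule eventually_mono, intro ballI)
        fix s x assume s: "s \<in> angles \<and> s \<noteq> 0" and x: "x \<in> Rm ?m"
        have "frac_integral_transform s f x = super_evol N h g c s x"
          by (rule frac_integral_transform_eq[OF R(1,2) g R(3) x]) (use s in auto)
        then show "\<phi> (frac_integral_transform s f x A) = ?v s x"
          using fun_cong[OF super_evol_functional[OF \<phi>, of N h g c s A], of x] by simp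
      qed
      have Q: "\<phi> (super_evol N h g c 0 x A) = ?v 0 x" for x
        using fun_cong[OF super_evol_functional[OF \<phi>, of N h g c 0 A], of x] .
      show "uniform_limit (Rm ?m) (\<lambda>s x. monomial ?m \<beta> x * pds js (\<lambda>x. \<phi> (frac_integral_transform s f x A)) x)
        (\<lambda>x. monomial ?m \<beta> x * pds js (\<lambda>x. \<phi> (super_evol N h g c 0 x A)) x) (at 0)"
        using iffD2[OF uniform_limit_snull[OF ev vS[OF 0] P Q] N] js by blast
    qed
  qed
qed

end
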